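(* Let $A$ be a quadri-biserial algebra. Let $I$ be a biserial injective module in $\mathrm{mod}\,A$ with $I/\mathrm{soc}\,I=(M_1/\mathrm{soc}\,I)\oplus(M_2/\mathrm{soc}\,I)$, where $M_1,M_2$ are submodules of $I$ containing $\mathrm{soc}\,I$, $M_1/\mathrm{soc}\,I$ is simple, and $M_2/\mathrm{soc}\,I$ is uniserial of length two such that $P_{\mathrm{soc}(M_2/\mathrm{soc}\,I)}$ is uniserial. Then there are two almost split sequences in $\mathrm{mod}\,A$ of the following forms: (1) $0\to M_1\to \mathrm{soc}^2I\to \mathrm{soc}(M_2/\mathrm{soc}\,I)\to 0$; (2) $0\to \mathrm{soc}\,I\to M_1\oplus \mathrm{rad}\,M_2\to \mathrm{soc}^2I\to 0$.
   Context: $A$ is an artin algebra with Jacobson radical $J$; $\mathrm{mod}\,A$ is the category of finitely generated left $A$-modules; $A^\circ$ is the opposite algebra, and $\mathrm{mod}\,A^\circ$ is identified with the category of finitely generated right $A$-modules. $\mathrm{top}\,X=X/\mathrm{rad}\,X$; $\mathrm{soc}^2X$ is the submodule of $X$ containing $\mathrm{soc}\,X$ with $\mathrm{soc}^2X/\mathrm{soc}\,X=\mathrm{soc}(X/\mathrm{soc}\,X)$. $P_X$ and $I_X$ denote a projective cover and an injective envelope of $X$ (in the category $\mathrm{mod}\,A$ or $\mathrm{mod}\,A^\circ$ in which $X$ lies). A module is uniserial if any two of its submodules are comparable under inclusion. An indecomposable module $X$ is biserial if it has two non-comparable uniserial submodules $X_1,X_2$ such that (i) $X_1+X_2$ is $X$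 or the largest proper submodule of $X$, and (ii) $X_1\cap X_2$ is zero or the smallest nonzero submodule of $X$. An artin algebra $A$ is biserial if every indecomposable non-uniserial projective module in $\mathrm{mod}\,A$ or $\mathrm{mod}\,A^\circ$ is biserial. A biserial artin algebra $A$ is quadri-biserial if every indecomposable projective module $Q$ in $\mathrm{mod}\,A$ and in $\mathrm{mod}\,A^\circ$ satisfies: (a) the length of $Q$ is at most four; (b) if $\mathrm{top}(\mathrm{rad}\,Q)=S_1\oplus S_2$ with $S_1,S_2$ simple, then $I_{S_1}$ or $I_{S_2}$ is uniserial; (c) if $\mathrm{rad}\,Q=T\oplus U$ with $T$ simple and $U$ uniserial of length two, then $I_T$ and $I_{\mathrm{soc}\,U}$ are uniserial. *)

theory Defs
  imports "HOL-Algebra.Module" "HOL-Algebra.Ideal"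
begin

section \<open>Left modules over a not necessarily commutative ring\<close>

text \<open>
  The locale \<^locale>\<open>module\<close> of the library asks for a commutative ring of scalars, but the record
  \<^type>\<open>module\<close> and the predicate \<^const>\<open>submodule\<close> do not, and are used here. The fields for
  multiplication and unit that the record inherits from rings carry no meaning for a module.
\<close>

locale left_module = R?: ring R + M?: abelian_group M
  for R :: "('a, 'r) ring_scheme" (structure) and M :: "('a, 'm) module" (structure) +
  assumes smult_closed:
      "\<lbrakk>a \<in> carrier R; x \<in> carrier M\<rbrakk> \<Longrightarrow> a \<odot>\<^bsub>M\<^esub> x \<in> carrier M"
    and smult_l_distr:
      "\<lbrakk>a \<in> carrier R; b \<in> carrier R; x \<in> carrier M\<rbrakk>
        \<Longrightarrow> (a \<oplus> b) \<odot>\<^bsub>M\<^esub> x = a \<odot>\<^bsub>M\<^esub> x \<oplus>\<^bsub>M\<^esub> b \<odot>\<^bsub>M\<^esub> x"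
    and smult_r_distr:
      "\<lbrakk>a \<in> carrier R; x \<in> carrier M; y \<in> carrier M\<rbrakk>
        \<Longrightarrow> a \<odot>\<^bsub>M\<^esub> (x \<oplus>\<^bsub>M\<^esub> y) = a \<odot>\<^bsub>M\<^esub> x \<oplus>\<^bsub>M\<^esub> a \<odot>\<^bsub>M\<^esub> y"
    and smult_assoc:
      "\<lbrakk>a \<in> carrier R; b \<in> carrier R; x \<in> carrier M\<rbrakk>
        \<Longrightarrow> (a \<otimes> b) \<odot>\<^bsub>M\<^esub> x = a \<odot>\<^bsub>M\<^esub> (b \<odot>\<^bsub>M\<^esub> x)"
    and smult_one:
      "x \<in> carrier M \<Longrightarrow> \<one> \<odot>\<^bsub>M\<^esub> x = x"

definition fg_module :: "('a, 'r) ring_scheme \<Rightarrow> ('a, 'm) module \<Rightarrow> bool" where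
  "fg_module A M \<longleftrightarrow> left_module A M \<and>
     (\<exists>S. finite S \<and> S \<subseteq> carrier M \<and>
        (\<forall>x \<in> carrier M. \<exists>c \<in> S \<rightarrow> carrier A. x = (\<Oplus>\<^bsub>M\<^esub>s\<in>S. c s \<odot>\<^bsub>M\<^esub> s)))"

definition module_hom ::
  "('a, 'r) ring_scheme \<Rightarrow> ('a, 'm) module \<Rightarrow> ('a, 'n) module \<Rightarrow> ('m \<Rightarrow> 'n) set" where
  "module_hom A M N = {f \<in> carrier M \<rightarrow> carrier N.
     (\<forall>x \<in> carrier M. \<forall>y \<in> carrier M. f (x \<oplus>\<^bsub>M\<^esub> y) = f x \<oplus>\<^bsub>N\<^esub> f y) \<and>
     (\<forall>a \<in> carrier A. \<forall>x \<in> carrier M. f (a \<odot>\<^bsub>M\<^esub> x) = a \<odot>\<^bsub>N\<^esub> f x)}"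

abbreviation restr :: "('a, 'm) module \<Rightarrow> 'm set \<Rightarrow> ('a, 'm) module" where
  "restr M N \<equiv> M\<lparr>carrier := N\<rparr>"

definition quot_module :: "('a, 'm) module \<Rightarrow> 'm set \<Rightarrow> ('a, 'm set) module" where
  "quot_module M N =
     \<lparr>carrier = a_rcosets\<^bsub>M\<^esub> N, mult = undefined, one = undefined, zero = N, add = set_add M,
      smult = (\<lambda>a X. (\<Union>x\<in>X. N +>\<^bsub>M\<^esub> (a \<odot>\<^bsub>M\<^esub> x)))\<rparr>"

definition dsum :: "('a, 'm) module \<Rightarrow> ('a, 'n) module \<Rightarrow> ('a, 'm \<times> 'n) module" where
  "dsum M N =
     \<lparr>carrier = carrier M \<times> carrier N, mult = undefined, one = undefined,
      zero = (\<zero>\<^bsub>M\<^esub>, \<zero>\<^bsub>N\<^esub>),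
      add = (\<lambda>(x, y) (x', y'). (x \<oplus>\<^bsub>M\<^esub> x', y \<oplus>\<^bsub>N\<^esub> y')),
      smult = (\<lambda>a (x, y). (a \<odot>\<^bsub>M\<^esub> x, a \<odot>\<^bsub>N\<^esub> y))\<rparr>"

definition internal_dsum ::
  "('a, 'r) ring_scheme \<Rightarrow> ('a, 'm) module \<Rightarrow> 'm set \<Rightarrow> 'm set \<Rightarrow> bool" where
  "internal_dsum A M U V \<longleftrightarrow> submodule U A M \<and> submodule V A M \<and>
     U <+>\<^bsub>M\<^esub> V = carrier M \<and> U \<inter> V = {\<zero>\<^bsub>M\<^esub>}"

definition indecomposable_module :: "('a, 'r) ring_scheme \<Rightarrow> ('a, 'm) module \<Rightarrow> bool" where
  "indecomposable_module A M \<longleftrightarrow> left_module A M \<and> carrier M \<noteq> {\<zero>\<^bsub>M\<^esub>} \<and>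
     (\<forall>U V. internal_dsum A M U V \<longrightarrow> U = {\<zero>\<^bsub>M\<^esub>} \<or> V = {\<zero>\<^bsub>M\<^esub>})"

definition simple_module :: "('a, 'r) ring_scheme \<Rightarrow> ('a, 'm) module \<Rightarrow> bool" where
  "simple_module A M \<longleftrightarrow> left_module A M \<and> carrier M \<noteq> {\<zero>\<^bsub>M\<^esub>} \<and>
     (\<forall>N. submodule N A M \<longrightarrow> N = {\<zero>\<^bsub>M\<^esub>} \<or> N = carrier M)"

definition uniserial_module :: "('a, 'r) ring_scheme \<Rightarrow> ('a, 'm) module \<Rightarrow> bool" where
  "uniserial_module A M \<longleftrightarrow> left_module A M \<and>
     (\<forall>U V. submodule U A M \<and> submodule V A M \<longrightarrow> U \<subseteq> V \<or> V \<subseteq> U)"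

definition has_length :: "('a, 'r) ring_scheme \<Rightarrow> ('a, 'm) module \<Rightarrow> nat \<Rightarrow> bool" where
  "has_length A M n \<longleftrightarrow> left_module A M \<and>
     (\<exists>C :: nat \<Rightarrow> 'm set. C 0 = {\<zero>\<^bsub>M\<^esub>} \<and> C n = carrier M \<and>
        (\<forall>i \<le> n. submodule (C i) A M) \<and>
        (\<forall>i < n. C i \<subseteq> C (Suc i) \<and>
           simple_module A (quot_module (restr M (C (Suc i))) (C i))))"

definition maximal_submodule ::
  "'m set \<Rightarrow> ('a, 'r) ring_scheme \<Rightarrow> ('a, 'm) module \<Rightarrow> bool" where
  "maximal_submodule N A M \<longleftrightarrow> submodule N A M \<and> N \<noteq> carrier M \<and>
     (\<forall>L. submodule L A M \<and> N \<subseteq> L \<longrightarrow> L = N \<or> L = carrier M)"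

definition rad_module :: "('a, 'r) ring_scheme \<Rightarrow> ('a, 'm) module \<Rightarrow> 'm set" where
  "rad_module A M = carrier M \<inter> \<Inter>{N. maximal_submodule N A M}"

definition top_module :: "('a, 'r) ring_scheme \<Rightarrow> ('a, 'm) module \<Rightarrow> ('a, 'm set) module" where
  "top_module A M = quot_module M (rad_module A M)"

text \<open>The sum of the simple submodules, as the smallest submodule containing all of them.\<close>

definition soc_module :: "('a, 'r) ring_scheme \<Rightarrow> ('a, 'm) module \<Rightarrow> 'm set" where
  "soc_module A M = \<Inter>{N. submodule N A M \<and>
     (\<forall>S. submodule S A M \<and> simple_module A (restr M S) \<longrightarrow> S \<subseteq> N)}"

text \<open>The union of the cosets that make up the socle of the quotient by the socle, that is, its
  preimage under the projection.\<close>

definition soc2_module :: "('a, 'r) ring_scheme \<Rightarrow> ('a, 'm) module \<Rightarrow> 'm set" where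
  "soc2_module A M = \<Union>(soc_module A (quot_module M (soc_module A M)))"


section \<open>The category of finitely generated modules\<close>

text \<open>
  A definition cannot quantify over all types. A finitely generated left module over a ring with
  elements in \<open>'a\<close> has, however, an isomorphic copy with carrier in the type \<open>(nat \<Rightarrow> 'a) set\<close>
  (lemma \<open>fg_module_copy\<close> below: send an element to the set of its coordinate sequences with
  respect to a finite generating set). Quantifiers over the objects of the module category
  therefore range over modules with carrier in this type, while the modules whose properties are
  defined may live in an arbitrary type.
\<close>

type_synonym 'a cat_module = "('a, (nat \<Rightarrow> 'a) set) module"

lemma fg_module_transport:
  fixes A :: "('a, 'r) ring_scheme" and M :: "('a, 'm) module" and j :: "'m \<Rightarrow> 'n"
  assumes fg: "fg_module A M" and inj: "inj_on j (carrier M)"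
  shows "\<exists>N :: ('a, 'n) module.
    fg_module A N \<and> j \<in> module_hom A M N \<and> bij_betw j (carrier M) (carrier N)"
proof -
  interpret left_module A M
    using fg by (simp add: fg_module_def)
  define v where "v = the_inv_into (carrier M) j"
  have v [simp]: "v (j x) = x" if "x \<in> carrier M" for x
    using the_inv_into_f_f[OF inj that] by (simp add: v_def)
  define N :: "('a, 'n) module" where "N = \<lparr>carrier = j ` carrier M, mult = undefined,
    one = undefined, zero = j \<zero>\<^bsub>M\<^esub>, add = (\<lambda>x y. j (v x \<oplus>\<^bsub>M\<^esub> v y)),
    smult = (\<lambda>a x. j (a \<odot>\<^bsub>M\<^esub> v x))\<rparr>"
  have N [simp]: "carrier N = j ` carrier M" "zero N = j \<zero>\<^bsub>M\<^esub>"
    "add N = (\<lambda>x y. j (v x \<oplus>\<^bsub>M\<^esub> v y))" "smult N = (\<lambda>a x. j (a \<odot>\<^bsub>M\<^esub> v x))"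
    by (simp_all add: N_def)
  have grp: "abelian_group N"
  proof (rule abelian_groupI)
    fix x assume "x \<in> carrier N"
    then obtain m where m: "m \<in> carrier M" "x = j m" by auto
    then show "\<exists>y\<in>carrier N. y \<oplus>\<^bsub>N\<^esub> x = \<zero>\<^bsub>N\<^esub>"
      by (intro bexI[of _ "j (\<ominus>\<^bsub>M\<^esub> m)"]) (auto simp: M.l_neg)
  qed (auto simp: M.a_ac)
  interpret N: abelian_group N by (fact grp)
  have lm: "left_module A N"
    by unfold_locales
      (auto simp: smult_closed smult_l_distr smult_r_distr smult_assoc smult_one)
  obtain S where S: "finite S" "S \<subseteq> carrier M"
    and gen: "\<And>x. x \<in> carrier M \<Longrightarrow> \<exists>c \<in> S \<rightarrow> carrier A. x = (\<Oplus>\<^bsub>M\<^esub>s\<in>S. c s \<odot>\<^bsub>M\<^esub> s)"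
    using fg by (auto simp: fg_module_def)
  have sum: "j (\<Oplus>\<^bsub>M\<^esub>s\<in>T. f s) = (\<Oplus>\<^bsub>N\<^esub>t\<in>j ` T. j (f (v t)))"
    if "finite T" "T \<subseteq> carrier M" "f \<in> T \<rightarrow> carrier M" for T f
    using that
  proof (induction T rule: finite_induct)
    case (insert t T)
    then have "j t \<notin> j ` T"
      using inj by (auto simp: inj_on_def)
    moreover have "(\<lambda>t. j (f (v t))) \<in> j ` T \<rightarrow> carrier N"
      using insert.prems by (auto simp: Pi_iff subset_iff)
    moreover have "(\<Oplus>\<^bsub>M\<^esub>s\<in>T. f s) \<in> carrier M"
      using insert.prems by (intro M.finsum_closed) auto
    ultimately show ?case
      using insert by (simp add: M.finsum_insert N.finsum_insert Pi_iff flip: insert.IH)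
  qed simp
  have "\<exists>c \<in> j ` S \<rightarrow> carrier A. y = (\<Oplus>\<^bsub>N\<^esub>t\<in>j ` S. c t \<odot>\<^bsub>N\<^esub> t)" if y: "y \<in> carrier N" for y
  proof -
    obtain x where x: "x \<in> carrier M" "y = j x" using y by auto
    obtain c where c: "c \<in> S \<rightarrow> carrier A" "x = (\<Oplus>\<^bsub>M\<^esub>s\<in>S. c s \<odot>\<^bsub>M\<^esub> s)"
      using gen[OF x(1)] by auto
    have "y = (\<Oplus>\<^bsub>N\<^esub>t\<in>j ` S. j (c (v t) \<odot>\<^bsub>M\<^esub> v t))"
      unfolding x(2) c(2) using S c(1) by (intro sum) (auto simp: Pi_iff subset_iff smult_closed)
    moreover have "(\<lambda>t. c (v t)) \<in> j ` S \<rightarrow> carrier A"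
      using S c(1) by (auto simp: Pi_iff subset_iff)
    ultimately show ?thesis
      by (intro bexI[of _ "\<lambda>t. c (v t)"]) simp_all
  qed
  then have "fg_module A N"
    unfolding fg_module_def using lm S by (intro conjI exI[of _ "j ` S"]) auto
  moreover have "j \<in> module_hom A M N"
    by (auto simp: module_hom_def)
  moreover have "bij_betw j (carrier M) (carrier N)"
    using inj by (simp add: bij_betw_def)
  ultimately show ?thesis by blast
qed

lemma fg_module_copy:
  fixes A :: "('a, 'r) ring_scheme" and M :: "('a, 'm) module"
  assumes "fg_module A M"
  shows "\<exists>(N :: 'a cat_module) f.
    fg_module A N \<and> f \<in> module_hom A M N \<and> bij_betw f (carrier M) (carrier N)"
proof -
  interpret left_module A M
    using assms by (simp add: fg_module_def)
  obtain S where S: "finite S" "S \<subseteq> carrier M"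
    and gen: "\<And>x. x \<in> carrier M \<Longrightarrow> \<exists>c \<in> S \<rightarrow> carrier A. x = (\<Oplus>\<^bsub>M\<^esub>s\<in>S. c s \<odot>\<^bsub>M\<^esub> s)"
    using assms by (auto simp: fg_module_def)
  obtain e :: "nat \<Rightarrow> 'm" where e: "bij_betw e {0..<card S} S"
    using ex_bij_betw_nat_finite[OF S(1)] by blast
  define j :: "'m \<Rightarrow> (nat \<Rightarrow> 'a) set" where
    "j x = {d. \<exists>c \<in> S \<rightarrow> carrier A. x = (\<Oplus>\<^bsub>M\<^esub>s\<in>S. c s \<odot>\<^bsub>M\<^esub> s) \<and> (\<forall>i < card S. d i = c (e i))}"
    for x
  have "inj_on j (carrier M)"
  proof (rule inj_onI)
    fix x y assume xy: "x \<in> carrier M" "y \<in> carrier M" "j x = j y"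
    obtain c where c: "c \<in> S \<rightarrow> carrier A" "x = (\<Oplus>\<^bsub>M\<^esub>s\<in>S. c s \<odot>\<^bsub>M\<^esub> s)"
      using gen[OF xy(1)] by auto
    then have "(\<lambda>i. c (e i)) \<in> j y"
      unfolding xy(3)[symmetric] by (auto simp: j_def)
    then obtain c' where c': "c' \<in> S \<rightarrow> carrier A" "y = (\<Oplus>\<^bsub>M\<^esub>s\<in>S. c' s \<odot>\<^bsub>M\<^esub> s)"
      and eq: "\<And>i. i < card S \<Longrightarrow> c (e i) = c' (e i)"
      by (auto simp: j_def)
    have "c s = c' s" if s: "s \<in> S" for s
    proof -
      have "s \<in> e ` {0..<card S}"
        using s e by (simp add: bij_betw_imp_surj_on)
      then obtain i where "i < card S" "s = e i" by auto
      then show ?thesis using eq by simp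
    qed
    then show "x = y"
      unfolding c(2) c'(2) using S c'(1)
      by (intro M.finsum_cong') (auto simp: Pi_iff subset_iff smult_closed)
  qed
  from fg_module_transport[OF assms this] show ?thesis by blast
qed

definition injective_module :: "('a, 'r) ring_scheme \<Rightarrow> ('a, 'm) module \<Rightarrow> bool" where
  "injective_module A I \<longleftrightarrow> fg_module A I \<and>
     (\<forall>(X :: 'a cat_module) (Y :: 'a cat_module) i g.
        fg_module A X \<and> fg_module A Y \<and>
        i \<in> module_hom A X Y \<and> inj_on i (carrier X) \<and> g \<in> module_hom A X I
        \<longrightarrow> (\<exists>h \<in> module_hom A Y I. \<forall>x \<in> carrier X. h (i x) = g x))"

definition projective_module :: "('a, 'r) ring_scheme \<Rightarrow> ('a, 'm) module \<Rightarrow> bool" where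
  "projective_module A P \<longleftrightarrow> fg_module A P \<and>
     (\<forall>(X :: 'a cat_module) (Y :: 'a cat_module) p g.
        fg_module A X \<and> fg_module A Y \<and>
        p \<in> module_hom A X Y \<and> p ` carrier X = carrier Y \<and> g \<in> module_hom A P Y
        \<longrightarrow> (\<exists>h \<in> module_hom A P X. \<forall>x \<in> carrier P. p (h x) = g x))"

definition injective_envelope ::
  "('a, 'r) ring_scheme \<Rightarrow> ('a, 'm) module \<Rightarrow> ('a, 'n) module \<Rightarrow> ('m \<Rightarrow> 'n) \<Rightarrow> bool" where
  "injective_envelope A X E i \<longleftrightarrow> fg_module A X \<and> injective_module A E \<and>
     i \<in> module_hom A X E \<and> inj_on i (carrier X) \<and>
     (\<forall>N. submodule N A E \<and> N \<inter> i ` carrier X = {\<zero>\<^bsub>E\<^esub>} \<longrightarrow> N = {\<zero>\<^bsub>E\<^esub>})"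

definition projective_cover ::
  "('a, 'r) ring_scheme \<Rightarrow> ('a, 'm) module \<Rightarrow> ('a, 'n) module \<Rightarrow> ('n \<Rightarrow> 'm) \<Rightarrow> bool" where
  "projective_cover A X P p \<longleftrightarrow> fg_module A X \<and> projective_module A P \<and>
     p \<in> module_hom A P X \<and> p ` carrier P = carrier X \<and>
     (\<forall>N. submodule N A P \<and> N <+>\<^bsub>P\<^esub> a_kernel P X p = carrier P \<longrightarrow> N = carrier P)"

definition injective_envelope_uniserial ::
  "('a, 'r) ring_scheme \<Rightarrow> ('a, 'm) module \<Rightarrow> bool" where
  "injective_envelope_uniserial A X \<longleftrightarrow>
     (\<exists>(E :: 'a cat_module) i. injective_envelope A X E i \<and> uniserial_module A E)"

definition projective_cover_uniserial ::
  "('a, 'r) ring_scheme \<Rightarrow> ('a, 'm) module \<Rightarrow> bool" where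
  "projective_cover_uniserial A X \<longleftrightarrow>
     (\<exists>(P :: 'a cat_module) p. projective_cover A X P p \<and> uniserial_module A P)"


section \<open>Almost split sequences\<close>

definition split_mono ::
  "('a, 'r) ring_scheme \<Rightarrow> ('a, 'm) module \<Rightarrow> ('a, 'n) module \<Rightarrow> ('m \<Rightarrow> 'n) \<Rightarrow> bool" where
  "split_mono A X Y f \<longleftrightarrow> f \<in> module_hom A X Y \<and>
     (\<exists>r \<in> module_hom A Y X. \<forall>x \<in> carrier X. r (f x) = x)"

definition split_epi ::
  "('a, 'r) ring_scheme \<Rightarrow> ('a, 'm) module \<Rightarrow> ('a, 'n) module \<Rightarrow> ('m \<Rightarrow> 'n) \<Rightarrow> bool" where
  "split_epi A Y Z g \<longleftrightarrow> g \<in> module_hom A Y Z \<and>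
     (\<exists>s \<in> module_hom A Z Y. \<forall>z \<in> carrier Z. g (s z) = z)"

definition left_almost_split ::
  "('a, 'r) ring_scheme \<Rightarrow> ('a, 'm) module \<Rightarrow> ('a, 'n) module \<Rightarrow> ('m \<Rightarrow> 'n) \<Rightarrow> bool" where
  "left_almost_split A X Y f \<longleftrightarrow> f \<in> module_hom A X Y \<and> \<not> split_mono A X Y f \<and>
     (\<forall>(W :: 'a cat_module) h.
        fg_module A W \<and> h \<in> module_hom A X W \<and> \<not> split_mono A X W h
        \<longrightarrow> (\<exists>k \<in> module_hom A Y W. \<forall>x \<in> carrier X. k (f x) = h x))"

definition right_almost_split ::
  "('a, 'r) ring_scheme \<Rightarrow> ('a, 'm) module \<Rightarrow> ('a, 'n) module \<Rightarrow> ('m \<Rightarrow> 'n) \<Rightarrow> bool" where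
  "right_almost_split A Y Z g \<longleftrightarrow> g \<in> module_hom A Y Z \<and> \<not> split_epi A Y Z g \<and>
     (\<forall>(W :: 'a cat_module) h.
        fg_module A W \<and> h \<in> module_hom A W Z \<and> \<not> split_epi A W Z h
        \<longrightarrow> (\<exists>k \<in> module_hom A W Y. \<forall>w \<in> carrier W. g (k w) = h w))"

definition short_exact ::
  "('a, 'r) ring_scheme \<Rightarrow> ('a, 'l) module \<Rightarrow> ('a, 'm) module \<Rightarrow> ('a, 'n) module
    \<Rightarrow> ('l \<Rightarrow> 'm) \<Rightarrow> ('m \<Rightarrow> 'n) \<Rightarrow> bool" where
  "short_exact A X Y Z f g \<longleftrightarrow> f \<in> module_hom A X Y \<and> g \<in> module_hom A Y Z \<and>
     inj_on f (carrier X) \<and> f ` carrier X = a_kernel Y Z g \<and> g ` carrier Y = carrier Z"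

definition almost_split_sequence ::
  "('a, 'r) ring_scheme \<Rightarrow> ('a, 'l) module \<Rightarrow> ('a, 'm) module \<Rightarrow> ('a, 'n) module
    \<Rightarrow> ('l \<Rightarrow> 'm) \<Rightarrow> ('m \<Rightarrow> 'n) \<Rightarrow> bool" where
  "almost_split_sequence A X Y Z f g \<longleftrightarrow>
     fg_module A X \<and> fg_module A Y \<and> fg_module A Z \<and> short_exact A X Y Z f g \<and>
     left_almost_split A X Y f \<and> right_almost_split A Y Z g"


section \<open>Artin algebras and quadri-biserial algebras\<close>

definition artinian_cring :: "('k, 's) ring_scheme \<Rightarrow> bool" where
  "artinian_cring k \<longleftrightarrow> cring k \<and>
     (\<forall>J :: nat \<Rightarrow> 'k set. (\<forall>n. ideal (J n) k \<and> J (Suc n) \<subseteq> J n)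
        \<longrightarrow> (\<exists>n. \<forall>m \<ge> n. J m = J n))"

text \<open>The ring \<open>A\<close> as a module over \<open>k\<close> by means of a structure map from \<open>k\<close> to \<open>A\<close>.\<close>

definition scalar_module ::
  "('a, 'r) ring_scheme \<Rightarrow> ('k \<Rightarrow> 'a) \<Rightarrow> ('k, 'a) module" where
  "scalar_module A \<phi> =
     \<lparr>carrier = carrier A, mult = undefined, one = undefined, zero = \<zero>\<^bsub>A\<^esub>, add = add A,
      smult = (\<lambda>c x. \<phi> c \<otimes>\<^bsub>A\<^esub> x)\<rparr>"

definition artin_algebra ::
  "('k, 's) ring_scheme \<Rightarrow> ('a, 'r) ring_scheme \<Rightarrow> ('k \<Rightarrow> 'a) \<Rightarrow> bool" where
  "artin_algebra k A \<phi> \<longleftrightarrow> artinian_cring k \<and> ring A \<and> \<phi> \<in> ring_hom k A \<and>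
     (\<forall>c \<in> carrier k. \<forall>x \<in> carrier A. \<phi> c \<otimes>\<^bsub>A\<^esub> x = x \<otimes>\<^bsub>A\<^esub> \<phi> c) \<and>
     fg_module k (scalar_module A \<phi>)"

text \<open>Right modules are left modules over the opposite ring.\<close>

definition opposite_ring :: "('a, 'r) ring_scheme \<Rightarrow> ('a, 'r) ring_scheme" where
  "opposite_ring A = A\<lparr>mult := (\<lambda>x y. y \<otimes>\<^bsub>A\<^esub> x)\<rparr>"

definition biserial_module :: "('a, 'r) ring_scheme \<Rightarrow> ('a, 'm) module \<Rightarrow> bool" where
  "biserial_module A X \<longleftrightarrow> indecomposable_module A X \<and>
     (\<exists>X\<^sub>1 X\<^sub>2. submodule X\<^sub>1 A X \<and> submodule X\<^sub>2 A X \<and>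
        uniserial_module A (restr X X\<^sub>1) \<and> uniserial_module A (restr X X\<^sub>2) \<and>
        \<not> X\<^sub>1 \<subseteq> X\<^sub>2 \<and> \<not> X\<^sub>2 \<subseteq> X\<^sub>1 \<and>
        (X\<^sub>1 <+>\<^bsub>X\<^esub> X\<^sub>2 = carrier X \<or>
         (X\<^sub>1 <+>\<^bsub>X\<^esub> X\<^sub>2 \<noteq> carrier X \<and>
          (\<forall>N. submodule N A X \<and> N \<noteq> carrier X \<longrightarrow> N \<subseteq> X\<^sub>1 <+>\<^bsub>X\<^esub> X\<^sub>2))) \<and>
        (X\<^sub>1 \<inter> X\<^sub>2 = {\<zero>\<^bsub>X\<^esub>} \<or>
         (X\<^sub>1 \<inter> X\<^sub>2 \<noteq> {\<zero>\<^bsub>X\<^esub>} \<and>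
          (\<forall>N. submodule N A X \<and> N \<noteq> {\<zero>\<^bsub>X\<^esub>} \<longrightarrow> X\<^sub>1 \<inter> X\<^sub>2 \<subseteq> N))))"

definition biserial_algebra ::
  "('k, 's) ring_scheme \<Rightarrow> ('a, 'r) ring_scheme \<Rightarrow> ('k \<Rightarrow> 'a) \<Rightarrow> bool" where
  "biserial_algebra k A \<phi> \<longleftrightarrow> artin_algebra k A \<phi> \<and>
     (\<forall>B \<in> {A, opposite_ring A}. \<forall>Q :: 'a cat_module.
        projective_module B Q \<and> indecomposable_module B Q \<and> \<not> uniserial_module B Q
        \<longrightarrow> biserial_module B Q)"

definition quadri_biserial_algebra ::
  "('k, 's) ring_scheme \<Rightarrow> ('a, 'r) ring_scheme \<Rightarrow> ('k \<Rightarrow> 'a) \<Rightarrow> bool" where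
  "quadri_biserial_algebra k A \<phi> \<longleftrightarrow> biserial_algebra k A \<phi> \<and>
     (\<forall>B \<in> {A, opposite_ring A}. \<forall>Q :: 'a cat_module.
        projective_module B Q \<and> indecomposable_module B Q \<longrightarrow>
        (let R = restr Q (rad_module B Q); T = top_module B R in
         (\<exists>n \<le> 4. has_length B Q n) \<and>
         (\<forall>S\<^sub>1 S\<^sub>2. internal_dsum B T S\<^sub>1 S\<^sub>2 \<and>
            simple_module B (restr T S\<^sub>1) \<and> simple_module B (restr T S\<^sub>2) \<longrightarrow>
            injective_envelope_uniserial B (restr T S\<^sub>1) \<or>
            injective_envelope_uniserial B (restr T S\<^sub>2)) \<and>
         (\<forall>V U. internal_dsum B R V U \<and> simple_module B (restr Q V) \<and>
            uniserial_module B (restr Q U) \<and> has_length B (restr Q U) 2 \<longrightarrow>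
            injective_envelope_uniserial B (restr Q V) \<and>
            injective_envelope_uniserial B
              (restr Q (soc_module B (restr Q U))))))"

end

theory Submission
  imports Defs
begin

text \<open>
  Write \<open>\<sigma>\<close> for the socle of \<open>I\<close> and \<open>R\<close> for \<open>rad M\<^sub>2\<close>. There are primitive idempotents \<open>e0\<close>, \<open>e1\<close>, \<open>e2\<close>
  and generators \<open>s = e0 s\<close>, \<open>t = e1 t\<close>, \<open>w = e2 w\<close> of \<open>\<sigma>\<close>, \<open>M\<^sub>1\<close>, \<open>R\<close> such that \<open>s = q t = p w\<close>, where
  \<open>q \<in> e0 J e1\<close> and \<open>p \<in> e0 J e2\<close>. The right module \<open>e0 A\<close> has length four and radical \<open>q A + p A\<close>.
  Condition (c) for \<open>e0 A\<close> and condition (b) for \<open>A\<close> force \<open>A e1\<close> to be uniserial, as \<open>A e2\<close> is by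
  hypothesis. This gives explicit projective presentations of \<open>M\<^sub>1\<close>, \<open>R\<close> and \<open>M\<^sub>1 + R = soc\<^sup>2 I\<close>: the
  relations between \<open>t\<close> and \<open>w\<close> are generated by \<open>q t = p w\<close>.

  Let \<open>h\<close> be a map from \<open>M\<^sub>1\<close> (or \<open>\<sigma>\<close>) to \<open>W\<close> and put \<open>s' = h s\<close>. If the equation \<open>s' = p x\<close>
  (or \<open>s' = q x + p y\<close>) is solvable in \<open>W\<close>, then \<open>h\<close> extends along the first map of the sequence.
  Otherwise the injectivity of \<open>I\<close> yields a map \<open>W \<rightarrow> I\<close> that sends \<open>s'\<close> to \<open>s\<close> and gives a retraction
  of \<open>h\<close>. So the first map of each sequence is left almost split. It follows formally that the second
  one is right almost split, because every endomorphism of the cokernel is bijective or has square zero.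
\<close>

section \<open>Left modules\<close>

text \<open>The two sides of the algebra are linked by \<open>faithful\<close>: an element of
  \<open>e0 A\<close> that annihilates \<open>I\<close> is zero. So relations in the right ideal
  \<open>e0 A\<close> can be read off from the submodules of \<open>I\<close>. They give
  \<open>q J = 0\<close>, hence \<open>q A\<close> is simple, and strict inclusions
  \<open>0 < pgA < pA < qA + pA < e0 A\<close>, where \<open>g\<close> carries a generator of
  \<open>M2\<close> to \<open>w\<close>. By the length bound four this is a composition series, so
  that \<open>p A\<close> has length two and condition (c) applies. The same count is used once more
  for the right ideal \<open>f A\<close> in \<open>separate\<close>. The uniserial injective right
  module obtained from (c) contains the simple module \<open>q A\<close>. A second generator of the
  radical of \<open>A e1\<close> would lead to two incomparable cyclic submodules of it. The role of
  (b) is to place that second generator at an idempotent inequivalent to \<open>e0\<close>: the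
  socle of \<open>I\<close> does not embed into a uniserial injective module, because
  \<open>I\<close> would embed too. The conditions on the algebra concern modules over one fixed
  type, so they are applied to copies of \<open>A e\<close> and \<open>e A\<close>. Idempotents with
  local corner ring stand in for a decomposition of the unit; Fitting's lemma, fed by the length
  bound, provides them.\<close>

context left_module
begin

lemma zero_smult [simp]: "x \<in> carrier M \<Longrightarrow> \<zero> \<odot>\<^bsub>M\<^esub> x = \<zero>\<^bsub>M\<^esub>"
  using smult_l_distr[of \<zero> \<zero> x] smult_closed[of \<zero> x] M.add.l_cancel_one'[of "\<zero> \<odot>\<^bsub>M\<^esub> x" "\<zero> \<odot>\<^bsub>M\<^esub> x"]
  by simp

lemma smult_zero [simp]: "a \<in> carrier R \<Longrightarrow> a \<odot>\<^bsub>M\<^esub> \<zero>\<^bsub>M\<^esub> = \<zero>\<^bsub>M\<^esub>"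
  using smult_r_distr[of a "\<zero>\<^bsub>M\<^esub>" "\<zero>\<^bsub>M\<^esub>"] smult_closed[of a "\<zero>\<^bsub>M\<^esub>"]
    M.add.l_cancel_one'[of "a \<odot>\<^bsub>M\<^esub> \<zero>\<^bsub>M\<^esub>" "a \<odot>\<^bsub>M\<^esub> \<zero>\<^bsub>M\<^esub>"]
  by simp

lemma minus_smult: "a \<in> carrier R \<Longrightarrow> x \<in> carrier M \<Longrightarrow> (\<ominus> a) \<odot>\<^bsub>M\<^esub> x = \<ominus>\<^bsub>M\<^esub> (a \<odot>\<^bsub>M\<^esub> x)"
  using smult_l_distr[of "\<ominus> a" a x] smult_closed
  by (intro M.minus_equality[symmetric]) (auto simp: R.l_neg)

lemma smult_minus: "a \<in> carrier R \<Longrightarrow> x \<in> carrier M \<Longrightarrow> a \<odot>\<^bsub>M\<^esub> (\<ominus>\<^bsub>M\<^esub> x) = \<ominus>\<^bsub>M\<^esub> (a \<odot>\<^bsub>M\<^esub> x)"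
  using smult_r_distr[of a "\<ominus>\<^bsub>M\<^esub> x" x] smult_closed
  by (intro M.minus_equality[symmetric]) (auto simp: M.l_neg)

lemma smult_diff_l: "a \<in> carrier R \<Longrightarrow> b \<in> carrier R \<Longrightarrow> x \<in> carrier M \<Longrightarrow>
   (a \<ominus> b) \<odot>\<^bsub>M\<^esub> x = a \<odot>\<^bsub>M\<^esub> x \<ominus>\<^bsub>M\<^esub> b \<odot>\<^bsub>M\<^esub> x"
  by (simp add: R.minus_eq M.minus_eq smult_l_distr minus_smult)

lemma smult_diff_r: "a \<in> carrier R \<Longrightarrow> x \<in> carrier M \<Longrightarrow> y \<in> carrier M \<Longrightarrow>
   a \<odot>\<^bsub>M\<^esub> (x \<ominus>\<^bsub>M\<^esub> y) = a \<odot>\<^bsub>M\<^esub> x \<ominus>\<^bsub>M\<^esub> a \<odot>\<^bsub>M\<^esub> y"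
  by (simp add: M.minus_eq smult_r_distr smult_minus)

lemma diff_eq_zero: "x \<in> carrier M \<Longrightarrow> y \<in> carrier M \<Longrightarrow> x \<ominus>\<^bsub>M\<^esub> y = \<zero>\<^bsub>M\<^esub> \<longleftrightarrow> x = y"
  using M.add.inv_solve_right'[of "\<zero>\<^bsub>M\<^esub>" x y] by (auto simp: M.minus_eq)

lemma diff_eq: "x \<in> carrier M \<Longrightarrow> y \<in> carrier M \<Longrightarrow> z \<in> carrier M \<Longrightarrow>
    x \<ominus>\<^bsub>M\<^esub> y = z \<longleftrightarrow> x = z \<oplus>\<^bsub>M\<^esub> y"
  using M.add.inv_solve_right'[of z x y] by (auto simp: M.minus_eq)

lemma submoduleI:
  assumes "N \<subseteq> carrier M" "\<zero>\<^bsub>M\<^esub> \<in> N" "\<And>x y. x \<in> N \<Longrightarrow> y \<in> N \<Longrightarrow> x \<oplus>\<^bsub>M\<^esub> y \<in> N"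
    and smult: "\<And>a x. a \<in> carrier R \<Longrightarrow> x \<in> N \<Longrightarrow> a \<odot>\<^bsub>M\<^esub> x \<in> N"
  shows "submodule N R M"
proof -
  have "\<ominus>\<^bsub>M\<^esub> x \<in> N" if "x \<in> N" for x
    using smult[of "\<ominus> \<one>" x] assms(1) that by (auto simp: minus_smult smult_one subset_iff)
  with assms show ?thesis
    unfolding submodule_def submodule_axioms_def
    by (auto intro!: M.add.subgroupI)
qed

lemma submoduleD:
  assumes "submodule N R M"
  shows submodule_carrier: "\<And>x. x \<in> N \<Longrightarrow> x \<in> carrier M" and submodule_subset: "N \<subseteq> carrier M"
    and submodule_zero: "\<zero>\<^bsub>M\<^esub> \<in> N"
    and submodule_add: "\<And>x y. x \<in> N \<Longrightarrow> y \<in> N \<Longrightarrow> x \<oplus>\<^bsub>M\<^esub> y \<in> N"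
    and submodule_neg: "\<And>x. x \<in> N \<Longrightarrow> \<ominus>\<^bsub>M\<^esub> x \<in> N"
    and submodule_diff: "\<And>x y. x \<in> N \<Longrightarrow> y \<in> N \<Longrightarrow> x \<ominus>\<^bsub>M\<^esub> y \<in> N"
    and submodule_smult: "\<And>a x. a \<in> carrier R \<Longrightarrow> x \<in> N \<Longrightarrow> a \<odot>\<^bsub>M\<^esub> x \<in> N"
proof -
  interpret N: submodule N R M by fact
  show *: "\<And>x. x \<in> N \<Longrightarrow> x \<in> carrier M" and "N \<subseteq> carrier M"
    "\<zero>\<^bsub>M\<^esub> \<in> N" "\<And>x y. x \<in> N \<Longrightarrow> y \<in> N \<Longrightarrow> x \<oplus>\<^bsub>M\<^esub> y \<in> N"
    "\<And>a x. a \<in> carrier R \<Longrightarrow> x \<in> N \<Longrightarrow> a \<odot>\<^bsub>M\<^esub> x \<in> N"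
    using N.subset N.one_closed N.m_closed N.smult_closed by auto
  show **: "\<ominus>\<^bsub>M\<^esub> x \<in> N" if "x \<in> N" for x
    using N.m_inv_closed[OF that] by (simp add: a_inv_def)
  show "\<And>x y. x \<in> N \<Longrightarrow> y \<in> N \<Longrightarrow> x \<ominus>\<^bsub>M\<^esub> y \<in> N"
    using ** N.m_closed by (auto simp: M.minus_eq)
qed

lemma submodule_add_cancel:
  assumes "submodule N R M" "x \<in> carrier M" "y \<in> N" "x \<oplus>\<^bsub>M\<^esub> y \<in> N"
  shows "x \<in> N"
proof -
  have "x = (x \<oplus>\<^bsub>M\<^esub> y) \<ominus>\<^bsub>M\<^esub> y"
    using assms submodule_carrier[OF assms(1)] by (simp add: M.minus_eq M.a_assoc M.r_neg)
  with assms submodule_diff[OF assms(1)] show ?thesis by metis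
qed

lemma submodule_diff_cancel:
  assumes "submodule N R M" "x \<in> carrier M" "y \<in> N" "x \<ominus>\<^bsub>M\<^esub> y \<in> N"
  shows "x \<in> N"
  using submodule_add_cancel[OF assms(1,2) submodule_neg[OF assms(1,3)]] assms(4)
  by (simp add: M.minus_eq)

lemma submodule_zero_set: "submodule {\<zero>\<^bsub>M\<^esub>} R M"
  by (rule submoduleI) auto

lemma submodule_UNIV: "submodule (carrier M) R M"
  by (rule submoduleI) (auto intro: smult_closed)

lemma submodule_Int: "submodule U R M \<Longrightarrow> submodule V R M \<Longrightarrow> submodule (U \<inter> V) R M"
  by (rule submoduleI) (auto dest: submoduleD)

lemma set_add_iff: "x \<in> U <+>\<^bsub>M\<^esub> V \<longleftrightarrow> (\<exists>u\<in>U. \<exists>v\<in>V. x = u \<oplus>\<^bsub>M\<^esub> v)"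
  by (auto simp: set_add_def')

lemma submodule_set_add:
  assumes U: "submodule U R M" and V: "submodule V R M"
  shows "submodule (U <+>\<^bsub>M\<^esub> V) R M"
proof (rule submoduleI)
  note c [simp] = submodule_carrier[OF U] submodule_carrier[OF V]
  show "U <+>\<^bsub>M\<^esub> V \<subseteq> carrier M" by (auto simp: set_add_iff)
  show "\<zero>\<^bsub>M\<^esub> \<in> U <+>\<^bsub>M\<^esub> V"
    using submodule_zero[OF U] submodule_zero[OF V] by (force simp: set_add_iff)
  fix x y assume "x \<in> U <+>\<^bsub>M\<^esub> V" "y \<in> U <+>\<^bsub>M\<^esub> V"
  then obtain u v u' v' where *: "u \<in> U" "v \<in> V" "u' \<in> U" "v' \<in> V" "x = u \<oplus>\<^bsub>M\<^esub> v" "y = u' \<oplus>\<^bsub>M\<^esub> v'"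
    by (auto simp: set_add_iff)
  have "x \<oplus>\<^bsub>M\<^esub> y = (u \<oplus>\<^bsub>M\<^esub> u') \<oplus>\<^bsub>M\<^esub> (v \<oplus>\<^bsub>M\<^esub> v')" using * by (simp add: M.a_ac)
  then show "x \<oplus>\<^bsub>M\<^esub> y \<in> U <+>\<^bsub>M\<^esub> V"
    using * submodule_add[OF U] submodule_add[OF V] unfolding set_add_iff by blast
next
  fix a x assume a: "a \<in> carrier R" and "x \<in> U <+>\<^bsub>M\<^esub> V"
  then obtain u v where *: "u \<in> U" "v \<in> V" "x = u \<oplus>\<^bsub>M\<^esub> v" by (auto simp: set_add_iff)
  then have "a \<odot>\<^bsub>M\<^esub> x = a \<odot>\<^bsub>M\<^esub> u \<oplus>\<^bsub>M\<^esub> a \<odot>\<^bsub>M\<^esub> v"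
    using a submodule_carrier[OF U] submodule_carrier[OF V] by (simp add: smult_r_distr)
  then show "a \<odot>\<^bsub>M\<^esub> x \<in> U <+>\<^bsub>M\<^esub> V"
    using * a submodule_smult[OF U] submodule_smult[OF V] unfolding set_add_iff by blast
qed

lemma set_add_upper:
  assumes U: "submodule U R M" and V: "submodule V R M"
  shows "U \<subseteq> U <+>\<^bsub>M\<^esub> V" "V \<subseteq> U <+>\<^bsub>M\<^esub> V"
proof -
  show "U \<subseteq> U <+>\<^bsub>M\<^esub> V"
  proof
    fix x assume "x \<in> U"
    then have "x = x \<oplus>\<^bsub>M\<^esub> \<zero>\<^bsub>M\<^esub>" using submodule_carrier[OF U] by simp
    then show "x \<in> U <+>\<^bsub>M\<^esub> V" using \<open>x \<in> U\<close> submodule_zero[OF V] unfolding set_add_iff by blast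
  qed
  show "V \<subseteq> U <+>\<^bsub>M\<^esub> V"
  proof
    fix x assume "x \<in> V"
    then have "x = \<zero>\<^bsub>M\<^esub> \<oplus>\<^bsub>M\<^esub> x" using submodule_carrier[OF V] by simp
    then show "x \<in> U <+>\<^bsub>M\<^esub> V" using \<open>x \<in> V\<close> submodule_zero[OF U] unfolding set_add_iff by blast
  qed
qed

lemma set_add_least:
  assumes "submodule W R M" "U \<subseteq> W" "V \<subseteq> W"
  shows "U <+>\<^bsub>M\<^esub> V \<subseteq> W"
  using assms submodule_add[OF assms(1)] by (auto simp: set_add_iff subset_iff)

text \<open>Dedekind's law, from solving \<open>x = u + v\<close> for \<open>v\<close>. It does the
  work of quotient modules in the lattice arguments below, such as \<open>above_M1\<close>.\<close>

lemma modular_law: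
  assumes U: "submodule U R M" and V: "submodule V R M" and W: "submodule W R M" and "U \<subseteq> W"
  shows "(U <+>\<^bsub>M\<^esub> V) \<inter> W = U <+>\<^bsub>M\<^esub> (V \<inter> W)"
proof
  show "(U <+>\<^bsub>M\<^esub> V) \<inter> W \<subseteq> U <+>\<^bsub>M\<^esub> (V \<inter> W)"
  proof
    fix x assume x: "x \<in> (U <+>\<^bsub>M\<^esub> V) \<inter> W"
    then obtain u v where *: "u \<in> U" "v \<in> V" "x = u \<oplus>\<^bsub>M\<^esub> v" by (auto simp: set_add_iff)
    then have "v \<oplus>\<^bsub>M\<^esub> u \<in> W"
      using x submodule_carrier[OF U] submodule_carrier[OF V] by (simp add: M.a_comm)
    then have "v \<in> W" using * \<open>U \<subseteq> W\<close> submodule_add_cancel[OF W] submodule_carrier[OF V] by blast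
    then show "x \<in> U <+>\<^bsub>M\<^esub> (V \<inter> W)" using * by (auto simp: set_add_iff)
  qed
  show "U <+>\<^bsub>M\<^esub> (V \<inter> W) \<subseteq> (U <+>\<^bsub>M\<^esub> V) \<inter> W"
  proof
    fix x assume "x \<in> U <+>\<^bsub>M\<^esub> (V \<inter> W)"
    then obtain u v where "u \<in> U" "v \<in> V" "v \<in> W" "x = u \<oplus>\<^bsub>M\<^esub> v" by (auto simp: set_add_iff)
    then show "x \<in> (U <+>\<^bsub>M\<^esub> V) \<inter> W"
      using \<open>U \<subseteq> W\<close> submodule_add[OF W, of u v] by (auto simp: set_add_iff)
  qed
qed

lemma set_add_comm: "U \<subseteq> carrier M \<Longrightarrow> V \<subseteq> carrier M \<Longrightarrow> U <+>\<^bsub>M\<^esub> V = V <+>\<^bsub>M\<^esub> U"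
  using M.a_comm by (fastforce simp: set_add_def' subset_iff)

lemma left_module_restr:
  assumes N: "submodule N R M"
  shows "left_module R (restr M N)"
proof -
  interpret N: abelian_group "restr M N"
  proof (rule abelian_groupI)
    fix x assume "x \<in> carrier (restr M N)"
    then show "\<exists>y\<in>carrier (restr M N). y \<oplus>\<^bsub>restr M N\<^esub> x = \<zero>\<^bsub>restr M N\<^esub>"
      using submoduleD[OF N] by (auto intro!: bexI[of _ "\<ominus>\<^bsub>M\<^esub> x"] simp: M.l_neg)
  qed (use submoduleD[OF N] in \<open>auto simp: M.a_ac\<close>)
  show ?thesis
    by unfold_locales
      (use submoduleD[OF N] in \<open>auto simp: smult_closed smult_l_distr smult_r_distr smult_assoc
        smult_one\<close>)
qed

lemma submodule_restr:
  assumes N: "submodule N R M"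
  shows "submodule U R (restr M N) \<longleftrightarrow> submodule U R M \<and> U \<subseteq> N"
proof -
  interpret N: left_module R "restr M N" by (rule left_module_restr[OF N])
  show ?thesis
  proof
    assume U: "submodule U R (restr M N)"
    show "submodule U R M \<and> U \<subseteq> N"
      using N.submoduleD[OF U] submodule_carrier[OF N] by (auto intro!: submoduleI)
  next
    assume U: "submodule U R M \<and> U \<subseteq> N"
    then show "submodule U R (restr M N)"
      using submoduleD[of U] by (intro N.submoduleI) auto
  qed
qed

text \<open>\<open>L\<close> is any left ideal; the instances below are the whole ring, the radical
  and the left annihilator of an element.\<close>

lemma submodule_smult_image:
  assumes "x \<in> carrier M" "L \<subseteq> carrier R" "\<zero> \<in> L" "\<And>a b. a \<in> L \<Longrightarrow> b \<in> L \<Longrightarrow> a \<oplus> b \<in> L"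
    "\<And>a b. a \<in> carrier R \<Longrightarrow> b \<in> L \<Longrightarrow> a \<otimes> b \<in> L"
  shows "submodule {a \<odot>\<^bsub>M\<^esub> x | a. a \<in> L} R M"
proof (rule submoduleI)
  show "\<zero>\<^bsub>M\<^esub> \<in> {a \<odot>\<^bsub>M\<^esub> x | a. a \<in> L}"
    using assms(1,3) zero_smult[of x] by force
  fix y z assume "y \<in> {a \<odot>\<^bsub>M\<^esub> x | a. a \<in> L}" "z \<in> {a \<odot>\<^bsub>M\<^esub> x | a. a \<in> L}"
  then obtain a b where "a \<in> L" "b \<in> L" "y = a \<odot>\<^bsub>M\<^esub> x" "z = b \<odot>\<^bsub>M\<^esub> x" by auto
  then show "y \<oplus>\<^bsub>M\<^esub> z \<in> {a \<odot>\<^bsub>M\<^esub> x | a. a \<in> L}"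
    using assms(1,2,4) smult_l_distr[of a b x] by (intro CollectI exI[of _
      "a \<oplus> b"]) (auto simp: subset_iff)
next
  fix c y assume c: "c \<in> carrier R" and "y \<in> {a \<odot>\<^bsub>M\<^esub> x | a. a \<in> L}"
  then obtain a where "a \<in> L" "y = a \<odot>\<^bsub>M\<^esub> x" by auto
  then show "c \<odot>\<^bsub>M\<^esub> y \<in> {a \<odot>\<^bsub>M\<^esub> x | a. a \<in> L}"
    using assms(1,2,5) smult_assoc[of c a x] c by (intro CollectI exI[of _
      "c \<otimes> a"]) (auto simp: subset_iff)
qed (use assms in \<open>auto intro: smult_closed\<close>)

definition cyc :: "'m \<Rightarrow> 'm set" where
  "cyc x = {a \<odot>\<^bsub>M\<^esub> x | a. a \<in> carrier R}"

lemma cycI: "a \<in> carrier R \<Longrightarrow> a \<odot>\<^bsub>M\<^esub> x \<in> cyc x"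
  by (auto simp: cyc_def)

lemma cyc_self: "x \<in> carrier M \<Longrightarrow> x \<in> cyc x"
  using cycI[of \<one> x] by (simp add: smult_one)

lemma submodule_cyc: "x \<in> carrier M \<Longrightarrow> submodule (cyc x) R M"
  using submodule_smult_image[of x "carrier R"] by (simp add: cyc_def)

lemma cyc_least: "submodule N R M \<Longrightarrow> x \<in> N \<Longrightarrow> cyc x \<subseteq> N"
  by (auto simp: cyc_def dest: submoduleD)

end

locale left_module_hom = M: left_module A M + N: left_module A N
  for A (structure) and M and N + fixes f assumes hom: "f \<in> module_hom A M N"
begin

lemma hom_closed: "x \<in> carrier M \<Longrightarrow> f x \<in> carrier N"
  and hom_add: "x \<in> carrier M \<Longrightarrow> y \<in> carrier M \<Longrightarrow> f (x \<oplus>\<^bsub>M\<^esub> y) = f x \<oplus>\<^bsub>N\<^esub> f y"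
  and hom_smult: "a \<in> carrier A \<Longrightarrow> x \<in> carrier M \<Longrightarrow> f (a \<odot>\<^bsub>M\<^esub> x) = a \<odot>\<^bsub>N\<^esub> f x"
  using hom by (auto simp: module_hom_def)

lemma hom_zero: "f \<zero>\<^bsub>M\<^esub> = \<zero>\<^bsub>N\<^esub>"
  using hom_smult[of \<zero> "\<zero>\<^bsub>M\<^esub>"] hom_closed[of "\<zero>\<^bsub>M\<^esub>"] by simp

lemma hom_neg: "x \<in> carrier M \<Longrightarrow> f (\<ominus>\<^bsub>M\<^esub> x) = \<ominus>\<^bsub>N\<^esub> f x"
  using hom_add[of "\<ominus>\<^bsub>M\<^esub> x" x] hom_closed hom_zero
  by (intro N.M.minus_equality[symmetric]) (auto simp: M.M.l_neg)

lemma hom_diff: "x \<in> carrier M \<Longrightarrow> y \<in> carrier M \<Longrightarrow> f (x \<ominus>\<^bsub>M\<^esub> y) = f x \<ominus>\<^bsub>N\<^esub> f y"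
  by (simp add: M.M.minus_eq N.M.minus_eq hom_add hom_neg)

lemma submodule_image:
  assumes U: "submodule U A M"
  shows "submodule (f ` U) A N"
proof (rule N.submoduleI)
  show "\<zero>\<^bsub>N\<^esub> \<in> f ` U" using M.submodule_zero[OF U] hom_zero by (metis imageI)
  fix x y assume "x \<in> f ` U" "y \<in> f ` U"
  then obtain u v where "u \<in> U" "v \<in> U" "x = f u" "y = f v" by auto
  then show "x \<oplus>\<^bsub>N\<^esub> y \<in> f ` U"
    using hom_add M.submodule_add[OF U] M.submodule_carrier[OF U] by (metis imageI)
next
  fix a x assume a: "a \<in> carrier A" and "x \<in> f ` U"
  then obtain u where u: "u \<in> U" "x = f u" by auto
  show "a \<odot>\<^bsub>N\<^esub> x \<in> f ` U"
    using hom_smult[OF a M.submodule_carrier[OF U u(1)]] M.submodule_smult[OF U a u(1)] u(2)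
    by (metis imageI)
qed (use M.submodule_carrier[OF U] hom_closed in auto)

lemma submodule_preimage:
  assumes V: "submodule V A N"
  shows "submodule {x \<in> carrier M. f x \<in> V} A M"
  using N.submoduleD[OF V]
  by (intro M.submoduleI) (auto simp: hom_zero hom_add hom_smult M.smult_closed)

lemma submodule_kernel: "submodule {x \<in> carrier M. f x = \<zero>\<^bsub>N\<^esub>} A M"
  using submodule_preimage[OF N.submodule_zero_set] by simp

lemma inj_onI_kernel:
  assumes "\<And>x. x \<in> carrier M \<Longrightarrow> f x = \<zero>\<^bsub>N\<^esub> \<Longrightarrow> x = \<zero>\<^bsub>M\<^esub>"
  shows "inj_on f (carrier M)"
proof (rule inj_onI)
  fix x y assume xy: "x \<in> carrier M" "y \<in> carrier M" "f x = f y"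
  then have "f (x \<ominus>\<^bsub>M\<^esub> y) = \<zero>\<^bsub>N\<^esub>" by (simp add: hom_diff hom_closed N.diff_eq_zero)
  with xy assms[of "x \<ominus>\<^bsub>M\<^esub> y"] show "x = y" by (simp add: M.diff_eq_zero)
qed

lemma image_set_add:
  assumes "U \<subseteq> carrier M" "V \<subseteq> carrier M"
  shows "f ` (U <+>\<^bsub>M\<^esub> V) = f ` U <+>\<^bsub>N\<^esub> f ` V"
proof
  show "f ` (U <+>\<^bsub>M\<^esub> V) \<subseteq> f ` U <+>\<^bsub>N\<^esub> f ` V"
  proof
    fix z assume "z \<in> f ` (U <+>\<^bsub>M\<^esub> V)"
    then obtain u v where *: "u \<in> U" "v \<in> V" "z = f (u \<oplus>\<^bsub>M\<^esub> v)" by (auto simp: set_add_def')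
    then have "z = f u \<oplus>\<^bsub>N\<^esub> f v" using assms by (auto simp: hom_add subset_iff)
    with * show "z \<in> f ` U <+>\<^bsub>N\<^esub> f ` V" unfolding set_add_def' by blast
  qed
  show "f ` U <+>\<^bsub>N\<^esub> f ` V \<subseteq> f ` (U <+>\<^bsub>M\<^esub> V)"
  proof
    fix z assume "z \<in> f ` U <+>\<^bsub>N\<^esub> f ` V"
    then obtain u v where *: "u \<in> U" "v \<in> V" "z = f u \<oplus>\<^bsub>N\<^esub> f v" by (auto simp: set_add_def')
    then have "z = f (u \<oplus>\<^bsub>M\<^esub> v)" using assms by (auto simp: hom_add subset_iff)
    with * show "z \<in> f ` (U <+>\<^bsub>M\<^esub> V)" unfolding set_add_def' by blast
  qed
qed

lemma inverse_hom:
  assumes "bij_betw f (carrier M) (carrier N)"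
  shows "the_inv_into (carrier M) f \<in> module_hom A N M"
proof -
  let ?g = "the_inv_into (carrier M) f"
  have inj: "inj_on f (carrier M)" and im: "f ` carrier M = carrier N"
    using assms by (auto simp: bij_betw_def)
  have g: "?g y \<in> carrier M" "f (?g y) = y" if "y \<in> carrier N" for y
    using the_inv_into_into[OF inj, of y "carrier M"] f_the_inv_into_f[OF inj, of y] that im by auto
  have eq: "?g y = x" if "x \<in> carrier M" "f x = y" for x y
    using the_inv_into_f_f[OF inj] that by blast
  show ?thesis
    unfolding module_hom_def using g
    by (auto intro!: eq simp: hom_add hom_smult M.smult_closed)
qed

end

lemma left_module_homI:
  "left_module A M \<Longrightarrow> left_module A N \<Longrightarrow> f \<in> module_hom A M N \<Longrightarrow> left_module_hom A M N f"
  by (simp add: left_module_hom_def left_module_hom_axioms_def)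

lemma module_homI:
  assumes "\<And>x. x \<in> carrier M \<Longrightarrow> f x \<in> carrier N"
    "\<And>x y. x \<in> carrier M \<Longrightarrow> y \<in> carrier M \<Longrightarrow> f (x \<oplus>\<^bsub>M\<^esub> y) = f x \<oplus>\<^bsub>N\<^esub> f y"
    "\<And>a x. a \<in> carrier A \<Longrightarrow> x \<in> carrier M \<Longrightarrow> f (a \<odot>\<^bsub>M\<^esub> x) = a \<odot>\<^bsub>N\<^esub> f x"
  shows "f \<in> module_hom A M N"
  using assms by (auto simp: module_hom_def)

lemma module_hom_compose:
  "f \<in> module_hom A M N \<Longrightarrow> g \<in> module_hom A N P \<Longrightarrow> (\<lambda>x. g (f x)) \<in> module_hom A M P"
  by (auto simp: module_hom_def Pi_iff)

lemma module_hom_restr: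
  "f \<in> module_hom A M N \<Longrightarrow> U \<subseteq> carrier M \<Longrightarrow> f ` U \<subseteq> V \<Longrightarrow> f \<in> module_hom A (restr M U) (restr N V)"
  by (auto simp: module_hom_def Pi_iff subset_iff image_subset_iff)

lemma module_hom_restr_dom:
  "f \<in> module_hom A M N \<Longrightarrow> U \<subseteq> carrier M \<Longrightarrow> f \<in> module_hom A (restr M U) N"
  by (auto simp: module_hom_def Pi_iff subset_iff image_subset_iff)

lemma module_hom_id: "(\<lambda>x. x) \<in> module_hom A M M"
  by (auto simp: module_hom_def)

text \<open>\<open>M\<close> is the quotient of \<open>A\<close> by the annihilator of
  \<open>t\<close>, so a map is well defined as soon as this annihilator kills \<open>t'\<close>.
  The coefficient of an element with respect to \<open>t\<close> is picked by \<open>SOME\<close>;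
  two choices differ by an element that annihilates \<open>t\<close>.\<close>

lemma cyclic_hom:
  assumes M: "left_module A M" and W: "left_module A W"
    and t: "t \<in> carrier M" "\<And>x. x \<in> carrier M \<Longrightarrow> \<exists>a\<in>carrier A. x = a \<odot>\<^bsub>M\<^esub> t"
    and t': "t' \<in> carrier W" "\<And>a. a \<in> carrier A \<Longrightarrow> a \<odot>\<^bsub>M\<^esub> t = \<zero>\<^bsub>M\<^esub> \<Longrightarrow> a \<odot>\<^bsub>W\<^esub> t' = \<zero>\<^bsub>W\<^esub>"
  shows "\<exists>f\<in>module_hom A M W. f t = t'"
proof -
  interpret M: left_module A M by fact
  interpret W: left_module A W by fact
  define f where "f x = (SOME a. a \<in> carrier A \<and> x = a \<odot>\<^bsub>M\<^esub> t) \<odot>\<^bsub>W\<^esub> t'" for x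
  have f: "f x = a \<odot>\<^bsub>W\<^esub> t'" if a: "a \<in> carrier A" "x = a \<odot>\<^bsub>M\<^esub> t" for a x
  proof -
    define b where "b = (SOME a. a \<in> carrier A \<and> x = a \<odot>\<^bsub>M\<^esub> t)"
    have b: "b \<in> carrier A" "x = b \<odot>\<^bsub>M\<^esub> t"
      using someI[of "\<lambda>a. a \<in> carrier A \<and> x = a \<odot>\<^bsub>M\<^esub> t" a] a by (auto simp: b_def)
    have "(b \<ominus>\<^bsub>A\<^esub> a) \<odot>\<^bsub>M\<^esub> t = \<zero>\<^bsub>M\<^esub>"
      using a b t(1) by (metis M.smult_diff_l M.diff_eq_zero M.smult_closed)
    then have "(b \<ominus>\<^bsub>A\<^esub> a) \<odot>\<^bsub>W\<^esub> t' = \<zero>\<^bsub>W\<^esub>" using a b by (intro t'(2)) auto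
    then show ?thesis
      using a b t'(1) W.smult_diff_l[of b a t'] W.smult_closed W.diff_eq_zero
        unfolding f_def b_def[symmetric]
      by auto
  qed
  have "f \<in> module_hom A M W"
  proof (rule module_homI)
    fix x assume "x \<in> carrier M"
    then obtain a where a: "a \<in> carrier A" "x = a \<odot>\<^bsub>M\<^esub> t" using t(2) by blast
    then show "f x \<in> carrier W" using f[OF a] t'(1) W.smult_closed by auto
    {
      fix y assume "y \<in> carrier M"
      then obtain b where b: "b \<in> carrier A" "y = b \<odot>\<^bsub>M\<^esub> t" using t(2) by blast
      show "f (x \<oplus>\<^bsub>M\<^esub> y) = f x \<oplus>\<^bsub>W\<^esub> f y"
        using f[OF a] f[OF b] f[of "a \<oplus>\<^bsub>A\<^esub> b" "x \<oplus>\<^bsub>M\<^esub> y"] a b t(1) t'(1)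
        by (simp add: M.smult_l_distr W.smult_l_distr)
    }
    fix c assume c: "c \<in> carrier A"
    show "f (c \<odot>\<^bsub>M\<^esub> x) = c \<odot>\<^bsub>W\<^esub> f x"
      using f[OF a] f[of "c \<otimes>\<^bsub>A\<^esub> a" "c \<odot>\<^bsub>M\<^esub> x"] a c t(1) t'(1)
      by (simp add: M.smult_assoc W.smult_assoc)
  qed
  moreover have "f t = t'"
    using f[of "\<one>\<^bsub>A\<^esub>" t] t(1) t'(1) by (simp add: M.smult_one W.smult_one)
  ultimately show ?thesis by blast
qed

section \<open>Cosets and quotient modules\<close>

context left_module
begin

lemma coset_iff:
  assumes "submodule N R M" "x \<in> carrier M"
  shows "y \<in> N +>\<^bsub>M\<^esub> x \<longleftrightarrow> y \<in> carrier M \<and> y \<ominus>\<^bsub>M\<^esub> x \<in> N"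
proof
  assume "y \<in> N +>\<^bsub>M\<^esub> x"
  then obtain n where n: "n \<in> N" "y = n \<oplus>\<^bsub>M\<^esub> x" by (auto simp: a_r_coset_def')
  then have nc: "n \<in> carrier M" using submodule_carrier[OF assms(1)] by blast
  have "y \<in> carrier M" using n nc assms(2) by simp
  moreover have "y \<ominus>\<^bsub>M\<^esub> x = n"
    using diff_eq[of y x n] n nc assms(2) by simp
  ultimately show "y \<in> carrier M \<and> y \<ominus>\<^bsub>M\<^esub> x \<in> N" using n by simp
next
  assume y: "y \<in> carrier M \<and> y \<ominus>\<^bsub>M\<^esub> x \<in> N"
  then have "y = (y \<ominus>\<^bsub>M\<^esub> x) \<oplus>\<^bsub>M\<^esub> x"
    using assms(2) diff_eq[of y x "y \<ominus>\<^bsub>M\<^esub> x"] by simp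
  with y show "y \<in> N +>\<^bsub>M\<^esub> x" unfolding a_r_coset_def' by blast
qed

lemma coset_eq_iff:
  assumes N: "submodule N R M" and x: "x \<in> carrier M" and y: "y \<in> carrier M"
  shows "N +>\<^bsub>M\<^esub> x = N +>\<^bsub>M\<^esub> y \<longleftrightarrow> x \<ominus>\<^bsub>M\<^esub> y \<in> N"
proof
  assume "N +>\<^bsub>M\<^esub> x = N +>\<^bsub>M\<^esub> y"
  then have "x \<in> N +>\<^bsub>M\<^esub> y"
    using coset_iff[OF N x, of x] x submodule_zero[OF N] diff_eq_zero[of x x] by simp
  then show "x \<ominus>\<^bsub>M\<^esub> y \<in> N" using coset_iff[OF N y] by blast
next
  assume d: "x \<ominus>\<^bsub>M\<^esub> y \<in> N"
  have "z \<ominus>\<^bsub>M\<^esub> x \<in> N \<longleftrightarrow> z \<ominus>\<^bsub>M\<^esub> y \<in> N" if z: "z \<in> carrier M" for z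
  proof -
    have "z \<ominus>\<^bsub>M\<^esub> y = (z \<ominus>\<^bsub>M\<^esub> x) \<oplus>\<^bsub>M\<^esub> (x \<ominus>\<^bsub>M\<^esub> y)"
      using x y z by (simp add: M.minus_eq M.a_assoc M.r_neg1)
    then show ?thesis
      using submodule_add[OF N, of "z \<ominus>\<^bsub>M\<^esub> x" "x \<ominus>\<^bsub>M\<^esub> y"]
        submodule_add_cancel[OF N, of "z \<ominus>\<^bsub>M\<^esub> x" "x \<ominus>\<^bsub>M\<^esub> y"] d x y z by auto
  qed
  then show "N +>\<^bsub>M\<^esub> x = N +>\<^bsub>M\<^esub> y" using coset_iff[OF N] x y by blast
qed

lemma coset_add:
  assumes N: "submodule N R M" and x: "x \<in> carrier M" and y: "y \<in> carrier M"
  shows "(N +>\<^bsub>M\<^esub> x) <+>\<^bsub>M\<^esub> (N +>\<^bsub>M\<^esub> y) = N +>\<^bsub>M\<^esub> (x \<oplus>\<^bsub>M\<^esub> y)"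
proof -
  note c = submodule_carrier[OF N]
  show ?thesis
  proof
    show "(N +>\<^bsub>M\<^esub> x) <+>\<^bsub>M\<^esub> (N +>\<^bsub>M\<^esub> y) \<subseteq> N +>\<^bsub>M\<^esub> (x \<oplus>\<^bsub>M\<^esub> y)"
    proof
      fix z assume "z \<in> (N +>\<^bsub>M\<^esub> x) <+>\<^bsub>M\<^esub> (N +>\<^bsub>M\<^esub> y)"
      then obtain n m where *: "n \<in> N" "m \<in> N" "z = (n \<oplus>\<^bsub>M\<^esub> x) \<oplus>\<^bsub>M\<^esub> (m \<oplus>\<^bsub>M\<^esub> y)"
        by (auto simp: a_r_coset_def' set_add_def')
      then have "z = (n \<oplus>\<^bsub>M\<^esub> m) \<oplus>\<^bsub>M\<^esub> (x \<oplus>\<^bsub>M\<^esub> y)"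
        using c x y by (simp add: M.a_ac)
      with * submodule_add[OF N] show "z \<in> N +>\<^bsub>M\<^esub> (x \<oplus>\<^bsub>M\<^esub> y)"
        unfolding a_r_coset_def' by blast
    qed
    show "N +>\<^bsub>M\<^esub> (x \<oplus>\<^bsub>M\<^esub> y) \<subseteq> (N +>\<^bsub>M\<^esub> x) <+>\<^bsub>M\<^esub> (N +>\<^bsub>M\<^esub> y)"
    proof
      fix z assume "z \<in> N +>\<^bsub>M\<^esub> (x \<oplus>\<^bsub>M\<^esub> y)"
      then obtain n where *: "n \<in> N" "z = n \<oplus>\<^bsub>M\<^esub> (x \<oplus>\<^bsub>M\<^esub> y)"
        by (auto simp: a_r_coset_def')
      then have "z = (n \<oplus>\<^bsub>M\<^esub> x) \<oplus>\<^bsub>M\<^esub> (\<zero>\<^bsub>M\<^esub> \<oplus>\<^bsub>M\<^esub> y)"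
        using c x y by (simp add: M.a_ac)
      with * submodule_zero[OF N] show "z \<in> (N +>\<^bsub>M\<^esub> x) <+>\<^bsub>M\<^esub> (N +>\<^bsub>M\<^esub> y)"
        unfolding a_r_coset_def' set_add_def' by blast
    qed
  qed
qed

lemma coset_smult:
  assumes N: "submodule N R M" and x: "x \<in> carrier M" and a: "a \<in> carrier R"
  shows "(\<Union>z\<in>N +>\<^bsub>M\<^esub> x. N +>\<^bsub>M\<^esub> (a \<odot>\<^bsub>M\<^esub> z)) = N +>\<^bsub>M\<^esub> (a \<odot>\<^bsub>M\<^esub> x)"
proof -
  have "N +>\<^bsub>M\<^esub> (a \<odot>\<^bsub>M\<^esub> z) = N +>\<^bsub>M\<^esub> (a \<odot>\<^bsub>M\<^esub> x)" if "z \<in> N +>\<^bsub>M\<^esub> x" for z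
    using that a x coset_iff[OF N x, of z] submodule_smult[OF N a, of "z \<ominus>\<^bsub>M\<^esub> x"]
    by (simp add: coset_eq_iff[OF N] smult_closed smult_diff_r)
  moreover have "x \<in> N +>\<^bsub>M\<^esub> x"
    using coset_iff[OF N x, of x] x submodule_zero[OF N] diff_eq_zero[of x x] by simp
  ultimately show ?thesis by blast
qed

lemma carrier_quot: "carrier (quot_module M N) = (\<lambda>x. N +>\<^bsub>M\<^esub> x) ` carrier M"
  by (auto simp: quot_module_def A_RCOSETS_def')

lemma diff_zero_right: "x \<in> carrier M \<Longrightarrow> x \<ominus>\<^bsub>M\<^esub> \<zero>\<^bsub>M\<^esub> = x"
  using diff_eq[of x "\<zero>\<^bsub>M\<^esub>" x] by simp

lemma coset_zero: "submodule N R M \<Longrightarrow> x \<in> carrier M \<Longrightarrow> N +>\<^bsub>M\<^esub> x = N \<longleftrightarrow> x \<in> N"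
  using coset_eq_iff[of N x "\<zero>\<^bsub>M\<^esub>"] coset_iff[of N "\<zero>\<^bsub>M\<^esub>"] submodule_carrier[of N]
  by (auto simp: diff_zero_right)

lemma quot_module_simps:
  assumes N: "submodule N R M"
  shows "zero (quot_module M N) = N"
    and "x \<in> carrier M \<Longrightarrow> y \<in> carrier M \<Longrightarrow>
      (N +>\<^bsub>M\<^esub> x) \<oplus>\<^bsub>quot_module M N\<^esub> (N +>\<^bsub>M\<^esub> y) = N +>\<^bsub>M\<^esub> (x \<oplus>\<^bsub>M\<^esub> y)"
    and "a \<in> carrier R \<Longrightarrow> x \<in> carrier M \<Longrightarrow>
      a \<odot>\<^bsub>quot_module M N\<^esub> (N +>\<^bsub>M\<^esub> x) = N +>\<^bsub>M\<^esub> (a \<odot>\<^bsub>M\<^esub> x)"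
  using coset_add[OF N] coset_smult[OF N] by (auto simp: quot_module_def)

lemma left_module_quot:
  assumes N: "submodule N R M"
  shows "left_module R (quot_module M N)"
proof -
  note [simp] = quot_module_simps[OF N] carrier_quot
  have z: "N = N +>\<^bsub>M\<^esub> \<zero>\<^bsub>M\<^esub>" using coset_zero[OF N, of "\<zero>\<^bsub>M\<^esub>"] submodule_zero[OF N] by simp
  interpret Q: abelian_group "quot_module M N"
  proof (rule abelian_groupI)
    show "\<zero>\<^bsub>quot_module M N\<^esub> \<in> carrier (quot_module M N)" using z by auto
    fix X assume "X \<in> carrier (quot_module M N)"
    then obtain x where x: "x \<in> carrier M" "X = N +>\<^bsub>M\<^esub> x" by auto
    have "(N +>\<^bsub>M\<^esub> \<zero>\<^bsub>M\<^esub>) \<oplus>\<^bsub>quot_module M N\<^esub> X = X" using x by (simp del: carrier_quot)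
    then show "\<zero>\<^bsub>quot_module M N\<^esub> \<oplus>\<^bsub>quot_module M N\<^esub> X = X"
      using z by simp
    show "\<exists>Y\<in>carrier (quot_module M N). Y \<oplus>\<^bsub>quot_module M N\<^esub> X = \<zero>\<^bsub>quot_module M N\<^esub>"
      using x z by (intro bexI[of _ "N +>\<^bsub>M\<^esub> (\<ominus>\<^bsub>M\<^esub> x)"]) (auto simp: M.l_neg)
  qed (auto simp: M.a_ac)
  show ?thesis
    by unfold_locales
      (auto simp: smult_closed smult_l_distr smult_r_distr smult_assoc smult_one)
qed

lemma quot_hom:
  assumes N: "submodule N R M"
  shows "(\<lambda>x. N +>\<^bsub>M\<^esub> x) \<in> module_hom R M (quot_module M N)"
  by (rule module_homI) (auto simp: quot_module_simps[OF N] carrier_quot)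

end

text \<open>This is simplicity of \<open>V / Z\<close> expressed inside one module, so that
  composition series can be handled without changing the type of the elements.\<close>

definition adjacent :: "('a, 'r) ring_scheme \<Rightarrow> ('a, 'm) module \<Rightarrow> 'm set \<Rightarrow> 'm set \<Rightarrow> bool" where
  "adjacent A M Z V \<longleftrightarrow> submodule Z A M \<and> submodule V A M \<and> Z \<subset> V \<and>
     (\<forall>U. submodule U A M \<and> Z \<subseteq> U \<and> U \<subseteq> V \<longrightarrow> U = Z \<or> U = V)"

text \<open>The correspondence theorem: submodules of the image match the submodules above the
  kernel.\<close>

lemma (in left_module_hom) simple_iff_adjacent:
  assumes surj: "f ` carrier M = carrier N"
  shows "simple_module A N \<longleftrightarrow> adjacent A M {x \<in> carrier M. f x = \<zero>\<^bsub>N\<^esub>} (carrier M)"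
    (is "_ \<longleftrightarrow> adjacent A M ?K _")
proof
  assume s: "simple_module A N"
  then have "\<not> (\<forall>x\<in>carrier M. f x = \<zero>\<^bsub>N\<^esub>)"
    using surj N.submodule_zero[OF N.submodule_UNIV] by (auto simp: simple_module_def)
  moreover have "U = ?K \<or> U = carrier M" if U: "submodule U A M" "?K \<subseteq> U" for U
  proof -
    consider "f ` U = {\<zero>\<^bsub>N\<^esub>}" | "f ` U = carrier N"
      using s submodule_image[OF U(1)] by (auto simp: simple_module_def)
    then show ?thesis
    proof cases
      case 1
      then have "U \<subseteq> ?K" using M.submodule_carrier[OF U(1)] by auto
      with U(2) show ?thesis by auto
    next
      case 2
      have "x \<in> U" if x: "x \<in> carrier M" for x
      proof -
        have "f x \<in> f ` U" using x 2 hom_closed by blast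
        then obtain u where u: "u \<in> U" "f x = f u" by auto
        note uc = M.submodule_carrier[OF U(1) u(1)]
        have "x \<ominus>\<^bsub>M\<^esub> u \<in> ?K"
          using x u uc by (simp add: hom_diff N.diff_eq_zero hom_closed)
        then show ?thesis using U M.submodule_diff_cancel[OF U(1) x u(1)] by blast
      qed
      then show ?thesis using M.submodule_carrier[OF U(1)] by blast
    qed
  qed
  ultimately show "adjacent A M ?K (carrier M)"
    using submodule_kernel M.submodule_UNIV by (auto simp: adjacent_def)
next
  assume a: "adjacent A M ?K (carrier M)"
  then obtain x where x: "x \<in> carrier M" "f x \<noteq> \<zero>\<^bsub>N\<^esub>" by (auto simp: adjacent_def)
  have "V = {\<zero>\<^bsub>N\<^esub>} \<or> V = carrier N" if V: "submodule V A N" for V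
  proof -
    let ?U = "{x \<in> carrier M. f x \<in> V}"
    have "submodule ?U A M" "?K \<subseteq> ?U" "?U \<subseteq> carrier M"
      using submodule_preimage[OF V] N.submodule_zero[OF V] by auto
    then consider "?U = ?K" | "?U = carrier M" using a by (auto simp: adjacent_def)
    then show ?thesis
    proof cases
      case 1
      have "y = \<zero>\<^bsub>N\<^esub>" if y: "y \<in> V" for y
      proof -
        obtain x where "x \<in> carrier M" "y = f x"
          using N.submodule_carrier[OF V y] surj by auto
        then show ?thesis using y 1 by blast
      qed
      then show ?thesis using N.submodule_zero[OF V] by blast
    next
      case 2
      then have "f ` carrier M \<subseteq> V" by blast
      then have "carrier N \<subseteq> V" using surj by simp
      then show ?thesis using N.submodule_carrier[OF V] by auto
    qed
  qed
  then show "simple_module A N"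
    using x hom_closed[of x] N.left_module_axioms by (auto simp: simple_module_def)
qed

context left_module
begin

lemma quot_left_module_hom: "submodule N R M \<Longrightarrow> left_module_hom R M (quot_module M N) (\<lambda>x. N +>\<^bsub>M\<^esub> x)"
  by (intro left_module_homI left_module_axioms left_module_quot quot_hom)

lemma simple_quot_iff:
  assumes Z: "submodule Z R M"
  shows "simple_module R (quot_module M Z) \<longleftrightarrow> adjacent R M Z (carrier M)"
proof -
  interpret q: left_module_hom R M "quot_module M Z" "\<lambda>x. Z +>\<^bsub>M\<^esub> x" by (rule quot_left_module_hom[OF Z])
  have "{x \<in> carrier M. Z +>\<^bsub>M\<^esub> x = \<zero>\<^bsub>quot_module M Z\<^esub>} = Z"
    using coset_zero[OF Z] submodule_carrier[OF Z] by (auto simp: quot_module_simps[OF Z])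
  with q.simple_iff_adjacent show ?thesis by (simp add: carrier_quot)
qed

lemma adjacent_restr:
  assumes W: "submodule W R M" "V \<subseteq> W"
  shows "adjacent R (restr M W) Z V \<longleftrightarrow> adjacent R M Z V"
proof -
  have "U \<subseteq> W" if "U \<subseteq> V" for U using that W(2) by blast
  moreover have "Z \<subseteq> W" if "Z \<subset> V" using that W(2) by blast
  ultimately show ?thesis
    unfolding adjacent_def submodule_restr[OF W(1)] using W(2) by metis
qed

text \<open>Turns the steps of a composition series in \<open>has_length\<close> into adjacent
  pairs.\<close>

lemma simple_quot_restr_iff:
  assumes Z: "submodule Z R M" and V: "submodule V R M" and "Z \<subseteq> V"
  shows "simple_module R (quot_module (restr M V) Z) \<longleftrightarrow> adjacent R M Z V"
proof -
  interpret V: left_module R "restr M V" by (rule left_module_restr[OF V])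
  show ?thesis
    using V.simple_quot_iff[of Z] adjacent_restr[OF V order.refl, of Z] assms
    by (simp add: submodule_restr[OF V])
qed

lemma simple_iff: "simple_module R M \<longleftrightarrow> adjacent R M {\<zero>\<^bsub>M\<^esub>} (carrier M)"
  using submodule_zero_set submodule_UNIV left_module_axioms
  by (auto simp: simple_module_def adjacent_def dest: submodule_zero submodule_subset)

lemma simple_restr_iff: "submodule V R M \<Longrightarrow> simple_module R (restr M V) \<longleftrightarrow> adjacent R M {\<zero>\<^bsub>M\<^esub>} V"
  using left_module.simple_iff[OF left_module_restr[of V]] adjacent_restr[of V V "{\<zero>\<^bsub>M\<^esub>}"] by simp

end

text \<open>A strictly monotone rank function with values in \<open>{0..n}\<close> bounds every
  strict chain of submodules. Unlike a composition series it can be pulled back along injective maps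
  at once.\<close>

definition height_le :: "('a, 'r) ring_scheme \<Rightarrow> ('a, 'm) module \<Rightarrow> nat \<Rightarrow> bool" where
  "height_le A M n \<longleftrightarrow> (\<exists>l :: 'm set \<Rightarrow> nat. (\<forall>U. submodule U A M \<longrightarrow> l U \<le> n) \<and>
     (\<forall>U V. submodule U A M \<and> submodule V A M \<and> U \<subset> V \<longrightarrow> l U < l V))"

text \<open>Count the steps of a composition series that are visible in a given submodule.\<close>

lemma has_length_height:
  assumes "has_length A M n"
  shows "height_le A M n"
proof -
  interpret left_module A M using assms by (simp add: has_length_def)
  obtain C where C0: "C 0 = {\<zero>\<^bsub>M\<^esub>}" and Cn: "C n = carrier M" and C: "\<And>i. i \<le> n \<Longrightarrow> submodule (C i) A M"
    and "\<And>i. i < n \<Longrightarrow> C i \<subseteq> C (Suc i) \<and> simple_module A (quot_module (restr M (C (Suc i))) (C i))"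
    using assms by (auto simp: has_length_def)
  then have adj: "adjacent A M (C i) (C (Suc i))" if "i < n" for i
    using simple_quot_restr_iff[of "C i" "C (Suc i)"] that by auto
  define I where "I U = {i. i < n \<and> \<not> U \<inter> C (Suc i) \<subseteq> C i}" for U
  have fin: "finite (I U)" for U by (simp add: I_def)
  have "card (I U) \<le> n" for U
    using card_mono[of "{..<n}" "I U"] by (auto simp: I_def)
  moreover have "card (I U) < card (I V)" if U: "submodule U A M" and V: "submodule V A M"
    and UV: "U \<subset> V" for U V
  proof (rule ccontr)
    assume "\<not> card (I U) < card (I V)"
    moreover have "I U \<subseteq> I V" using UV by (auto simp: I_def)
    ultimately have eq: "I U = I V" using card_seteq[OF fin[of V], of "I U"] by simp
    \<comment> \<open>If \<open>V\<close> shows no more steps than \<open>U\<close>, every element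
      of \<open>V\<close> is reduced into \<open>U\<close> by descending the series.\<close>
    have "V \<inter> C i \<subseteq> U" if "i \<le> n" for i
      using that
    proof (induction i)
      case 0
      then show ?case using submodule_zero[OF U] by (auto simp: C0)
    next
      case (Suc i)
      show ?case
      proof
        fix x assume x: "x \<in> V \<inter> C (Suc i)"
        show "x \<in> U"
        proof (cases "x \<in> C i")
          case True
          with x Suc show ?thesis by auto
        next
          case False
          then have "i \<in> I U" using x Suc unfolding eq by (auto simp: I_def)
          then obtain z where z: "z \<in> U" "z \<in> C (Suc i)" "z \<notin> C i" by (auto simp: I_def)
          \<comment> \<open>By simplicity the element \<open>z\<close> of \<open>U\<close> fills the
            whole step, so \<open>x\<close> can be corrected by some \<open>u\<close> in
            \<open>U\<close> to lie in \<open>C i\<close>.\<close>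
          let ?W = "C i <+>\<^bsub>M\<^esub> (U \<inter> C (Suc i))"
          have s: "submodule (C i) A M" "submodule (C (Suc i)) A M" "submodule (U \<inter> C (Suc i)) A M"
            using C[of i] C[of "Suc i"] Suc U by (auto intro: submodule_Int)
          have "C i \<subseteq> C (Suc i)" using adj[of i] Suc by (auto simp: adjacent_def)
          then have "?W \<subseteq> C (Suc i)" "C i \<subseteq> ?W" "U \<inter> C (Suc i) \<subseteq> ?W"
            using set_add_least[OF s(2), of "C i"] set_add_upper[OF s(1,3)] by auto
          then have "?W = C (Suc i)"
            using adj[of i] Suc.prems submodule_set_add[OF s(1,3)] z unfolding adjacent_def
            by (metis IntI Suc_le_lessD subsetD)
          then obtain c u where cu: "c \<in> C i" "u \<in> U" "x = c \<oplus>\<^bsub>M\<^esub> u"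
            using x set_add_iff[of x "C i" "U \<inter> C (Suc i)"] by blast
          then have cc: "c \<in> carrier M" using submodule_carrier[OF s(1)] by blast
          have "c \<in> V"
            using cu x UV submodule_add_cancel[OF V cc, of u] by auto
          then show ?thesis using cu Suc submodule_add[OF U, of c u] by auto
        qed
      qed
    qed
    from this[of n] have "V \<subseteq> U" using submodule_carrier[OF V] by (auto simp: Cn)
    with UV show False by auto
  qed
  ultimately show ?thesis
    unfolding height_le_def by (intro exI[of _ "\<lambda>U. card (I U)"]) auto
qed

text \<open>Rank a submodule by the rank of its image; injectivity keeps strict inclusions
  strict.\<close>

lemma (in left_module_hom) height_le_inj:
  assumes inj: "inj_on f (carrier M)" and "height_le A N n"
  shows "height_le A M n"
proof -
  obtain l where l: "\<And>U. submodule U A N \<Longrightarrow> l U \<le> n"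
    "\<And>U V. submodule U A N \<Longrightarrow> submodule V A N \<Longrightarrow> U \<subset> V \<Longrightarrow> l U < l V"
    using assms(2) unfolding height_le_def by metis
  have "l (f ` U) < l (f ` V)" if "submodule U A M" "submodule V A M" "U \<subset> V" for U V
  proof (rule l(2)[OF submodule_image submodule_image])
    show "f ` U \<subset> f ` V"
      using that inj_on_image_eq_iff[OF inj, of U V] M.submodule_subset by auto
  qed (use that in auto)
  then show ?thesis
    unfolding height_le_def using l(1) submodule_image by (intro exI[of _ "\<lambda>U. l (f ` U)"]) auto
qed

text \<open>Among the proper submodules of \<open>V\<close> above \<open>U\<close>, one of largest
  rank has nothing between itself and \<open>V\<close>.\<close>

lemma height_le_adjacent:
  assumes h: "height_le A M n" and U: "submodule U A M" and V: "submodule V A M" and UV: "U \<subset> V"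
  shows "\<exists>Z. U \<subseteq> Z \<and> adjacent A M Z V"
proof -
  obtain l where l: "\<And>U. submodule U A M \<Longrightarrow> l U \<le> n"
    "\<And>U V. submodule U A M \<Longrightarrow> submodule V A M \<Longrightarrow> U \<subset> V \<Longrightarrow> l U < l V"
    using h unfolding height_le_def by metis
  let ?P = "\<lambda>Z. submodule Z A M \<and> U \<subseteq> Z \<and> Z \<subset> V"
  have "\<exists>Z. ?P Z \<and> (\<forall>Y. ?P Y \<longrightarrow> l Y \<le> l Z)"
    using U UV l(1) by (intro ex_has_greatest_nat[of ?P U l "Suc n"]) (auto simp: less_Suc_eq_le)
  then obtain Z where Z: "?P Z" "\<And>Y. ?P Y \<Longrightarrow> l Y \<le> l Z" by blast
  then have "adjacent A M Z V"
    using V l(2)[of Z] unfolding adjacent_def by (metis leD order.trans psubsetI)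
  with Z(1) show ?thesis by blast
qed

lemma height_leE:
  assumes "height_le A M n"
  obtains l where "\<And>U. submodule U A M \<Longrightarrow> l U \<le> n"
    "\<And>U V. submodule U A M \<Longrightarrow> submodule V A M \<Longrightarrow> U \<subset> V \<Longrightarrow> l U < l V"
  using assms unfolding height_le_def by metis

text \<open>Five strictly increasing ranks in \<open>{0..4}\<close> are consecutive, which leaves no
  room for a submodule in between. This is how the length bound turns the explicit chains of right
  ideals below into composition series.\<close>

lemma height_le_4_chain:
  fixes M :: "('a, 'b) module"
  assumes "height_le A M 4" "submodule X0 A M" "submodule X1 A M" "submodule X2 A M"
    "submodule X3 A M" "submodule X4 A M" "X0 \<subset> X1" "X1 \<subset> X2" "X2 \<subset> X3" "X3 \<subset> X4"
  shows "adjacent A M X0 X1" "adjacent A M X1 X2" "adjacent A M X2 X3" "adjacent A M X3 X4"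
proof -
  obtain l :: "'b set \<Rightarrow> nat" where l: "\<And>U. submodule U A M \<Longrightarrow> l U \<le> 4"
    and m: "\<And>U V. submodule U A M \<Longrightarrow> submodule V A M \<Longrightarrow> U \<subset> V \<Longrightarrow> l U < l V"
    by (rule height_leE[OF assms(1)]) (rule that)
  have *: "l X0 < l X1" "l X1 < l X2" "l X2 < l X3" "l X3 < l X4" "l X4 \<le> 4"
    using m[OF assms(2,3,7)] m[OF assms(3,4,8)] m[OF assms(4,5,9)] m[OF assms(5,6,10)] l[OF assms(6)]
    by simp_all
  have "adjacent A M U V" if "submodule U A M" "submodule V A M" "U \<subset> V" "l V \<le> Suc (l U)" for U V
    unfolding adjacent_def
  proof (intro conjI allI impI)
    fix Y assume Y: "submodule Y A M \<and> U \<subseteq> Y \<and> Y \<subseteq> V"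
    show "Y = U \<or> Y = V"
    proof (rule ccontr)
      assume "\<not> ?thesis"
      then have "U \<subset> Y" "Y \<subset> V" using Y by auto
      then show False using m[of U Y] m[of Y V] Y that by simp
    qed
  qed (use that in auto)
  then show "adjacent A M X0 X1" "adjacent A M X1 X2" "adjacent A M X2 X3" "adjacent A M X3 X4"
    using * assms by simp_all
qed

text \<open>A descending chain stops where its rank is least, an ascending one where its rank is
  greatest.\<close>

lemma (in left_module) height_le_chain_stable:
  assumes h: "height_le R M n" and C: "\<And>i. submodule (C i) R M"
  shows "(\<And>i. C (Suc i) \<subseteq> C i) \<Longrightarrow> \<exists>n. \<forall>m\<ge>n. C m = C n"
    and "(\<And>i. C i \<subseteq> C (Suc i)) \<Longrightarrow> \<exists>n. \<forall>m\<ge>n. C m = C n"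
proof -
  obtain l where l: "\<And>U. submodule U R M \<Longrightarrow> l U \<le> n"
    and m: "\<And>U V. submodule U R M \<Longrightarrow> submodule V R M \<Longrightarrow> U \<subset> V \<Longrightarrow> l U < l V"
    using h unfolding height_le_def by metis
  {
    assume "\<And>i. C (Suc i) \<subseteq> C i"
    then have anti: "C j \<subseteq> C i" if "i \<le> j" for i j using that lift_Suc_antimono_le[of C i j] by simp
    obtain k where "\<And>j. l (C k) \<le> l (C j)" using ex_has_least_nat[of "\<lambda>_. True" 0 "\<lambda>j. l (C j)"] by auto
    then have "\<forall>j\<ge>k. C j = C k" using anti m[OF C C] by (metis leD psubsetI)
    then show "\<exists>n. \<forall>m\<ge>n. C m = C n" by blast
  }
  {
    assume "\<And>i. C i \<subseteq> C (Suc i)"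
    then have mono: "C i \<subseteq> C j" if "i \<le> j" for i j using that lift_Suc_mono_le[of C i j] by simp
    obtain k where "\<And>j. l (C j) \<le> l (C k)"
      using ex_has_greatest_nat[of "\<lambda>_. True" 0 "\<lambda>j. l (C j)" "Suc n"] l[OF C]
        by (auto simp: less_Suc_eq_le)
    then have "\<forall>j\<ge>k. C j = C k" using mono m[OF C C] by (metis leD psubsetI)
    then show "\<exists>n. \<forall>m\<ge>n. C m = C n" by blast
  }
qed

section \<open>Finitely generated modules\<close>

text \<open>The linear combinations of \<open>S\<close> form the smallest submodule containing
  \<open>S\<close>. Stated through submodules, finite generation passes along homomorphisms by
  images and preimages alone.\<close>

lemma (in left_module) fg_iff:
  "fg_module R M \<longleftrightarrow>
     (\<exists>S. finite S \<and> S \<subseteq> carrier M \<and> (\<forall>N. submodule N R M \<and> S \<subseteq> N \<longrightarrow> N = carrier M))"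
proof
  assume "fg_module R M"
  then obtain S where S: "finite S" "S \<subseteq> carrier M"
    and gen: "\<And>x. x \<in> carrier M \<Longrightarrow> \<exists>c \<in> S \<rightarrow> carrier R. x = (\<Oplus>\<^bsub>M\<^esub>s\<in>S. c s \<odot>\<^bsub>M\<^esub> s)"
    by (auto simp: fg_module_def)
  have sum_in: "(\<Oplus>\<^bsub>M\<^esub>s\<in>T. c s \<odot>\<^bsub>M\<^esub> s) \<in> N"
    if N: "submodule N R M" and T: "finite T" "T \<subseteq> N" "c \<in> T \<rightarrow> carrier R" for N T c
    using T
  proof (induction T)
    case empty
    then show ?case using submodule_zero[OF N] by simp
  next
    case (insert t T)
    have "(\<lambda>s. c s \<odot>\<^bsub>M\<^esub> s) \<in> insert t T \<rightarrow> carrier M"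
      using insert submodule_carrier[OF N] by (auto intro!: smult_closed)
    with insert show ?case
      by (auto intro!: submodule_add[OF N] submodule_smult[OF N])
  qed
  have "carrier M \<subseteq> N" if "submodule N R M" "S \<subseteq> N" for N
  proof
    fix x assume "x \<in> carrier M"
    from gen[OF this] obtain c where "c \<in> S \<rightarrow> carrier R" "x = (\<Oplus>\<^bsub>M\<^esub>s\<in>S. c s \<odot>\<^bsub>M\<^esub> s)" by blast
    with sum_in[OF that(1) S(1) that(2)] show "x \<in> N" by simp
  qed
  then have "\<forall>N. submodule N R M \<and> S \<subseteq> N \<longrightarrow> N = carrier M"
    using submodule_subset by blast
  with S show "\<exists>S. finite S \<and> S \<subseteq> carrier M \<and> (\<forall>N. submodule N R M \<and> S \<subseteq> N \<longrightarrow> N = carrier M)" by blast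
next
  assume "\<exists>S. finite S \<and> S \<subseteq> carrier M \<and> (\<forall>N. submodule N R M \<and> S \<subseteq> N \<longrightarrow> N = carrier M)"
  then obtain S where S: "finite S" "S \<subseteq> carrier M" and gen: "\<And>N. submodule N R M \<Longrightarrow> S \<subseteq> N \<Longrightarrow> N = carrier M"
    by metis
  let ?s = "\<lambda>c. \<Oplus>\<^bsub>M\<^esub>s\<in>S. c s \<odot>\<^bsub>M\<^esub> s"
  let ?N = "{?s c | c. c \<in> S \<rightarrow> carrier R}"
  have cl: "(\<lambda>s. c s \<odot>\<^bsub>M\<^esub> s) \<in> S \<rightarrow> carrier M" if "c \<in> S \<rightarrow> carrier R" for c
    using that S(2) by (auto intro!: smult_closed)
  have "submodule ?N R M"
  proof (rule submoduleI)
    show "?N \<subseteq> carrier M" using cl by (auto intro!: M.finsum_closed)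
    have "?s (\<lambda>_. \<zero>) = (\<Oplus>\<^bsub>M\<^esub>s\<in>S. \<zero>\<^bsub>M\<^esub>)"
      using S(2) by (intro M.finsum_cong') auto
    then have "\<zero>\<^bsub>M\<^esub> = ?s (\<lambda>_. \<zero>)" by simp
    moreover have "(\<lambda>_. \<zero>) \<in> S \<rightarrow> carrier R" by auto
    ultimately show "\<zero>\<^bsub>M\<^esub> \<in> ?N" by (intro CollectI exI[of _ "\<lambda>_. \<zero>"] conjI)
    fix x y assume "x \<in> ?N" "y \<in> ?N"
    then obtain c d where cd: "c \<in> S \<rightarrow> carrier R" "d \<in> S \<rightarrow> carrier R" "x = ?s c" "y = ?s d" by blast
    then have "x \<oplus>\<^bsub>M\<^esub> y = (\<Oplus>\<^bsub>M\<^esub>s\<in>S. c s \<odot>\<^bsub>M\<^esub> s \<oplus>\<^bsub>M\<^esub> d s \<odot>\<^bsub>M\<^esub> s)"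
      using cl by (simp add: M.finsum_addf)
    also have "\<dots> = ?s (\<lambda>s. c s \<oplus> d s)"
      using cd S(2) by (intro M.finsum_cong') (auto simp: Pi_iff subset_iff smult_l_distr intro!:
        smult_closed)
    finally have "x \<oplus>\<^bsub>M\<^esub> y = ?s (\<lambda>s. c s \<oplus> d s)" .
    moreover have "(\<lambda>s. c s \<oplus> d s) \<in> S \<rightarrow> carrier R" using cd by auto
    ultimately show "x \<oplus>\<^bsub>M\<^esub> y \<in> ?N" by (intro CollectI exI[of _ "\<lambda>s. c s \<oplus> d s"] conjI)
  next
    fix a x assume a: "a \<in> carrier R" and "x \<in> ?N"
    then obtain c where c: "c \<in> S \<rightarrow> carrier R" "x = ?s c" by blast
    have "a \<odot>\<^bsub>M\<^esub> (\<Oplus>\<^bsub>M\<^esub>s\<in>T. c s \<odot>\<^bsub>M\<^esub> s) = (\<Oplus>\<^bsub>M\<^esub>s\<in>T. (a \<otimes> c s) \<odot>\<^bsub>M\<^esub> s)" if "finite T" "T \<subseteq> S" for T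
      using that
    proof (induction T)
      case empty
      then show ?case using a by simp
    next
      case (insert t T)
      have 1: "(\<lambda>s. c s \<odot>\<^bsub>M\<^esub> s) \<in> T \<rightarrow> carrier M" "(\<lambda>s. (a \<otimes> c s) \<odot>\<^bsub>M\<^esub> s) \<in> T \<rightarrow> carrier M"
        "t \<in> carrier M" "c t \<in> carrier R"
        using c(1) a insert.prems S(2) by (auto simp: Pi_iff subset_iff intro!: smult_closed)
      then have "(\<Oplus>\<^bsub>M\<^esub>s\<in>T. c s \<odot>\<^bsub>M\<^esub> s) \<in> carrier M" by (intro M.finsum_closed)
      then show ?case using insert 1 a by (simp add: smult_r_distr smult_assoc smult_closed)
    qed
    from this[OF S(1) order.refl] have "a \<odot>\<^bsub>M\<^esub> x = ?s (\<lambda>s. a \<otimes> c s)" using c by simp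
    moreover have "(\<lambda>s. a \<otimes> c s) \<in> S \<rightarrow> carrier R" using a c by auto
    ultimately show "a \<odot>\<^bsub>M\<^esub> x \<in> ?N" by (intro CollectI exI[of _ "\<lambda>s. a \<otimes> c s"] conjI)
  qed
  moreover have "S \<subseteq> ?N"
  proof
    fix t assume t: "t \<in> S"
    let ?c = "\<lambda>s. if s = t then \<one> else \<zero>"
    have "?s ?c = (\<Oplus>\<^bsub>M\<^esub>s\<in>S. if t = s then s else \<zero>\<^bsub>M\<^esub>)"
      using S(2) by (intro M.finsum_cong') (auto simp: smult_one subset_iff)
    also have "\<dots> = t" using t S M.finsum_singleton[of t S "\<lambda>s. s"] by (auto simp: subset_iff)
    finally have "t = ?s ?c" by simp
    moreover have "?c \<in> S \<rightarrow> carrier R" by auto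
    ultimately show "t \<in> ?N" by (intro CollectI exI[of _ ?c] conjI)
  qed
  ultimately have "?N = carrier M" by (rule gen)
  then have "\<exists>c \<in> S \<rightarrow> carrier R. x = ?s c" if "x \<in> carrier M" for x
    using that by blast
  then show "fg_module R M" unfolding fg_module_def using S left_module_axioms by blast
qed

lemma fg_module_left_module: "fg_module A M \<Longrightarrow> left_module A M"
  by (simp add: fg_module_def)

lemma (in left_module_hom) fg_module_image:
  assumes fg: "fg_module A M" and surj: "f ` carrier M = carrier N"
  shows "fg_module A N"
proof -
  obtain S where S: "finite S" "S \<subseteq> carrier M" "\<And>N. submodule N A M \<Longrightarrow> S \<subseteq> N \<Longrightarrow> N = carrier M"
    using fg M.fg_iff by auto
  have "U = carrier N" if U: "submodule U A N" "f ` S \<subseteq> U" for U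
  proof -
    have "{x \<in> carrier M. f x \<in> U} = carrier M"
      using U S(2) by (intro S(3) submodule_preimage) auto
    then have "f ` carrier M \<subseteq> U" by blast
    then show ?thesis using surj N.submodule_subset[OF U(1)] by simp
  qed
  then show ?thesis
    unfolding N.fg_iff using S(1,2) hom_closed by (intro exI[of _ "f ` S"] conjI allI impI) auto
qed

text \<open>Lift generators of the image; what remains of an element lies in the kernel, which is
  covered by \<open>S\<close>. It is applied to the first projection of a pullback.\<close>

lemma (in left_module_hom) fg_module_extension:
  assumes fg: "fg_module A N" and surj: "f ` carrier M = carrier N"
    and S: "finite S" "S \<subseteq> carrier M"
    and ker: "\<And>U. submodule U A M \<Longrightarrow> S \<subseteq> U \<Longrightarrow> {x \<in> carrier M. f x = \<zero>\<^bsub>N\<^esub>} \<subseteq> U"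
  shows "fg_module A M"
proof -
  obtain T where T: "finite T" "T \<subseteq> carrier N" "\<And>U. submodule U A N \<Longrightarrow> T \<subseteq> U \<Longrightarrow> U = carrier N"
    using fg N.fg_iff by auto
  obtain T' where T': "finite T'" "T' \<subseteq> carrier M" "f ` T' = T"
    using finite_subset_image[OF T(1), of f "carrier M"] T(2) surj by auto
  have "U = carrier M" if U: "submodule U A M" "S \<union> T' \<subseteq> U" for U
  proof -
    have fU: "f ` U = carrier N"
      using U T' by (intro T(3) submodule_image) auto
    have "x \<in> U" if x: "x \<in> carrier M" for x
    proof -
      obtain u where u: "u \<in> U" "f x = f u" using x fU hom_closed by blast
      note uc = M.submodule_carrier[OF U(1) u(1)]
      have "x \<ominus>\<^bsub>M\<^esub> u \<in> U"
        using ker[OF U(1)] U(2) x uc u(2) N.diff_eq_zero[of "f u" "f u"]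
          by (auto simp: hom_diff hom_closed)
      then show ?thesis using M.submodule_diff_cancel[OF U(1) x u(1)] by blast
    qed
    then show ?thesis using M.submodule_carrier[OF U(1)] by blast
  qed
  then show ?thesis
    unfolding M.fg_iff using S T' by (intro exI[of _ "S \<union> T'"]) auto
qed

lemma (in left_module) fg_module_cyclic:
  assumes "x \<in> carrier M" "\<And>y. y \<in> carrier M \<Longrightarrow> \<exists>a\<in>carrier R. y = a \<odot>\<^bsub>M\<^esub> x"
  shows "fg_module R M"
proof -
  have "carrier M \<subseteq> N" if "submodule N R M" "x \<in> N" for N
    using assms(2) submodule_smult[OF that(1) _ that(2)] by blast
  then show ?thesis
    unfolding fg_iff using assms(1) submodule_subset
    by (intro exI[of _ "{x}"] conjI allI impI subset_antisym) auto
qed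

text \<open>Two preimages under \<open>p\<close> differ by an element of its kernel, which
  \<open>f\<close> kills.\<close>

lemma (in left_module_hom) factor_hom:
  assumes Q: "left_module A Q" and p: "p \<in> module_hom A M Q" "p ` carrier M = carrier Q"
    and ker: "\<And>x. x \<in> carrier M \<Longrightarrow> p x = \<zero>\<^bsub>Q\<^esub> \<Longrightarrow> f x = \<zero>\<^bsub>N\<^esub>"
  shows "\<exists>k \<in> module_hom A Q N. \<forall>x\<in>carrier M. k (p x) = f x"
proof -
  interpret p: left_module_hom A M Q p
    by (intro left_module_homI M.left_module_axioms Q p)
  define k where "k y = f (SOME x. x \<in> carrier M \<and> p x = y)" for y
  have k: "k (p x) = f x" if x: "x \<in> carrier M" for x
  proof -
    define z where "z = (SOME z. z \<in> carrier M \<and> p z = p x)"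
    have z: "z \<in> carrier M" "p z = p x"
      using someI[of "\<lambda>z. z \<in> carrier M \<and> p z = p x" x] x by (auto simp: z_def)
    have "f (z \<ominus>\<^bsub>M\<^esub> x) = \<zero>\<^bsub>N\<^esub>"
      using x z p.N.diff_eq_zero[of "p x" "p x"] by (intro ker) (auto simp: p.hom_diff p.hom_closed)
    then show ?thesis
      using x z by (simp add: k_def z_def[symmetric] hom_diff N.diff_eq_zero hom_closed)
  qed
  have "k \<in> module_hom A Q N"
  proof (rule module_homI)
    fix y assume "y \<in> carrier Q"
    then obtain x where x: "x \<in> carrier M" "y = p x" using p(2) by auto
    then show "k y \<in> carrier N" using k hom_closed by simp
    show "k (a \<odot>\<^bsub>Q\<^esub> y) = a \<odot>\<^bsub>N\<^esub> k y" if a: "a \<in> carrier A" for a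
      using k[of x] k[of "a \<odot>\<^bsub>M\<^esub> x"] a x by (simp add: p.hom_smult hom_smult M.smult_closed)
    fix z assume "z \<in> carrier Q"
    then obtain w where w: "w \<in> carrier M" "z = p w" using p(2) by auto
    show "k (y \<oplus>\<^bsub>Q\<^esub> z) = k y \<oplus>\<^bsub>N\<^esub> k z"
      using k[of x] k[of w] k[of "x \<oplus>\<^bsub>M\<^esub> w"] x w by (simp add: p.hom_add hom_add)
  qed
  with k show ?thesis by blast
qed

text \<open>The coset of \<open>y\<close> generates a cyclic submodule of \<open>Y / K\<close>,
  which maps to \<open>I\<close> by sending the generator to \<open>x\<close>, and injectivity
  extends this map. As injectivity is tested on modules of type \<open>cat_module\<close>, the
  quotient is first replaced by a copy of that type. All later uses of injectivity have this
  form.\<close>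

lemma injective_extend:
  fixes A :: "('a, 'r) ring_scheme" and I :: "('a, 'i) module" and Y :: "('a, 'y) module"
  assumes I: "injective_module A I" and Y: "fg_module A Y" and K: "submodule K A Y"
    and y: "y \<in> carrier Y" and x: "x \<in> carrier I"
    and ann: "\<And>a. a \<in> carrier A \<Longrightarrow> a \<odot>\<^bsub>Y\<^esub> y \<in> K \<Longrightarrow> a \<odot>\<^bsub>I\<^esub> x = \<zero>\<^bsub>I\<^esub>"
  shows "\<exists>g\<in>module_hom A Y I. (\<forall>z\<in>K. g z = \<zero>\<^bsub>I\<^esub>) \<and> g y = x"
proof -
  interpret I: left_module A I using I by (simp add: injective_module_def fg_module_def)
  interpret Y: left_module A Y using Y by (simp add: fg_module_def)
  interpret q: left_module_hom A Y "quot_module Y K" "\<lambda>x. K +>\<^bsub>Y\<^esub> x"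
    by (rule Y.quot_left_module_hom[OF K])
  have "fg_module A (quot_module Y K)"
    by (rule q.fg_module_image[OF Y]) (simp add: Y.carrier_quot)
  then obtain N :: "'a cat_module" and f where N: "fg_module A N"
    and f: "f \<in> module_hom A (quot_module Y K) N" "bij_betw f (carrier (quot_module Y K)) (carrier N)"
    using fg_module_copy by blast
  interpret N: left_module A N using N by (simp add: fg_module_def)
  interpret f: left_module_hom A "quot_module Y K" N f
    by (intro left_module_homI f q.N.left_module_axioms N.left_module_axioms)
  define \<pi> where "\<pi> z = f (K +>\<^bsub>Y\<^esub> z)" for z
  have \<pi>: "\<pi> \<in> module_hom A Y N"
    unfolding \<pi>_def by (rule module_hom_compose[OF q.hom f(1)])
  interpret \<pi>: left_module_hom A Y N \<pi>
    by (intro left_module_homI \<pi> Y.left_module_axioms N.left_module_axioms)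
  have \<pi>0: "\<pi> z = \<zero>\<^bsub>N\<^esub> \<longleftrightarrow> z \<in> K" if z: "z \<in> carrier Y" for z
  proof -
    have "inj_on f (carrier (quot_module Y K))" using f(2) by (simp add: bij_betw_def)
    then have "f (K +>\<^bsub>Y\<^esub> z) = f \<zero>\<^bsub>quot_module Y K\<^esub> \<longleftrightarrow> K +>\<^bsub>Y\<^esub> z = \<zero>\<^bsub>quot_module Y K\<^esub>"
      using q.hom_closed[OF z] q.N.submodule_zero[OF q.N.submodule_UNIV] by (auto dest: inj_onD)
    then show ?thesis
      using Y.coset_zero[OF K z] by (simp add: \<pi>_def f.hom_zero[unfolded Y.quot_module_simps[OF K]]
        Y.quot_module_simps[OF K])
  qed
  have yN: "\<pi> y \<in> carrier N" using y by (rule \<pi>.hom_closed)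
  define C where "C = N.cyc (\<pi> y)"
  have C: "submodule C A N" "\<pi> y \<in> C" unfolding C_def using yN by (auto intro: N.submodule_cyc N.cyc_self)
  interpret C: left_module A "restr N C" by (rule N.left_module_restr[OF C(1)])
  have gen: "\<exists>a\<in>carrier A. z = a \<odot>\<^bsub>restr N C\<^esub> \<pi> y" if "z \<in> carrier (restr N C)" for z
    using that by (auto simp: C_def N.cyc_def)
  have "\<exists>h\<in>module_hom A (restr N C) I. h (\<pi> y) = x"
  proof (rule cyclic_hom[OF C.left_module_axioms I.left_module_axioms _ gen x])
    fix a assume a: "a \<in> carrier A" "a \<odot>\<^bsub>restr N C\<^esub> \<pi> y = \<zero>\<^bsub>restr N C\<^esub>"
    then have "\<pi> (a \<odot>\<^bsub>Y\<^esub> y) = \<zero>\<^bsub>N\<^esub>" using y by (simp add: \<pi>.hom_smult)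
    then show "a \<odot>\<^bsub>I\<^esub> x = \<zero>\<^bsub>I\<^esub>" using a y \<pi>0[of "a \<odot>\<^bsub>Y\<^esub> y"] ann by (simp add: Y.smult_closed)
  qed (use C in auto)
  then obtain h where h: "h \<in> module_hom A (restr N C) I" "h (\<pi> y) = x" by blast
  have "fg_module A (restr N C)"
    using C(2) gen by (intro C.fg_module_cyclic) auto
  moreover have "(\<lambda>x. x) \<in> module_hom A (restr N C) N"
    using C(1) by (intro module_hom_restr_dom module_hom_id N.submodule_subset)
  moreover have "inj_on (\<lambda>x. x) (carrier (restr N C))" by simp
  ultimately have "\<exists>h' \<in> module_hom A N I. \<forall>x\<in>carrier (restr N C). h' x = h x"
    using I N h(1) unfolding injective_module_def by blast
  then obtain h' where h': "h' \<in> module_hom A N I" "h' (\<pi> y) = x" using h(2) C(2) by auto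
  interpret h': left_module_hom A N I h'
    by (intro left_module_homI h' N.left_module_axioms I.left_module_axioms)
  show ?thesis
  proof (intro bexI[of _ "\<lambda>z. h' (\<pi> z)"] conjI ballI)
    fix z assume z: "z \<in> K"
    then have "\<pi> z = \<zero>\<^bsub>N\<^esub>" using \<pi>0 Y.submodule_carrier[OF K] by blast
    then show "h' (\<pi> z) = \<zero>\<^bsub>I\<^esub>" using h'.hom_zero by simp
  qed (use h' module_hom_compose[OF \<pi> h'(1)] in auto)
qed

section \<open>Almost split sequences\<close>

lemma dsum_simps [simp]:
  "carrier (dsum M N) = carrier M \<times> carrier N" "\<zero>\<^bsub>dsum M N\<^esub> = (\<zero>\<^bsub>M\<^esub>, \<zero>\<^bsub>N\<^esub>)"
  "p \<oplus>\<^bsub>dsum M N\<^esub> q = (fst p \<oplus>\<^bsub>M\<^esub> fst q, snd p \<oplus>\<^bsub>N\<^esub> snd q)"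
  "a \<odot>\<^bsub>dsum M N\<^esub> p = (a \<odot>\<^bsub>M\<^esub> fst p, a \<odot>\<^bsub>N\<^esub> snd p)"
  by (auto simp: dsum_def split: prod.splits)

lemma left_module_dsum:
  assumes "left_module A M" "left_module A N"
  shows "left_module A (dsum M N)"
proof -
  interpret M: left_module A M by fact
  interpret N: left_module A N by fact
  interpret D: abelian_group "dsum M N"
  proof (rule abelian_groupI)
    fix x assume "x \<in> carrier (dsum M N)"
    then show "\<exists>y\<in>carrier (dsum M N). y \<oplus>\<^bsub>dsum M N\<^esub> x = \<zero>\<^bsub>dsum M N\<^esub>"
      by (intro bexI[of _ "(\<ominus>\<^bsub>M\<^esub> fst x, \<ominus>\<^bsub>N\<^esub> snd x)"]) (auto simp: M.M.l_neg N.M.l_neg)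
  qed (auto simp: M.M.a_ac N.M.a_ac)
  show ?thesis
    by unfold_locales
      (auto simp: M.smult_closed M.smult_l_distr M.smult_r_distr M.smult_assoc M.smult_one
        N.smult_closed N.smult_l_distr N.smult_r_distr N.smult_assoc N.smult_one)
qed

lemma dsum_homs:
  "fst \<in> module_hom A (dsum M N) M" "snd \<in> module_hom A (dsum M N) N"
  by (auto intro!: module_homI)

lemma module_hom_diff:
  assumes "left_module A N" "f \<in> module_hom A M N" "g \<in> module_hom A M N"
  shows "(\<lambda>x. f x \<ominus>\<^bsub>N\<^esub> g x) \<in> module_hom A M N"
proof -
  interpret N: left_module A N by fact
  show ?thesis
    using assms(2,3)
    by (auto intro!: module_homI simp: module_hom_def Pi_iff N.smult_r_distr N.smult_minus
      N.smult_closed N.M.minus_eq N.M.minus_add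
        N.M.a_ac)
qed

lemma module_hom_add:
  assumes "left_module A N" "f \<in> module_hom A M N" "g \<in> module_hom A M N"
  shows "(\<lambda>x. f x \<oplus>\<^bsub>N\<^esub> g x) \<in> module_hom A M N"
proof -
  interpret N: left_module A N by fact
  show ?thesis
    using assms(2,3)
    by (auto intro!: module_homI simp: module_hom_def Pi_iff N.smult_r_distr N.M.a_ac)
qed

lemma module_hom_zero:
  assumes "left_module A N"
  shows "(\<lambda>x. \<zero>\<^bsub>N\<^esub>) \<in> module_hom A M N"
proof -
  interpret N: left_module A N by fact
  show ?thesis by (auto intro!: module_homI)
qed

text \<open>The generators of the image are tested against submodules of the larger module
  \<open>N\<close>, the form in which \<open>fg_module_extension\<close> asks for generators of a
  kernel.\<close>

lemma (in left_module_hom) fg_module_image_generators: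
  assumes fg: "fg_module A M"
  shows "\<exists>S. finite S \<and> S \<subseteq> f ` carrier M \<and> (\<forall>U. submodule U A N \<and> S \<subseteq> U \<longrightarrow> f ` carrier M \<subseteq> U)"
proof -
  obtain S where S: "finite S" "S \<subseteq> carrier M" "\<And>U. submodule U A M \<Longrightarrow> S \<subseteq> U \<Longrightarrow> U = carrier M"
    using fg M.fg_iff by auto
  have "f ` carrier M \<subseteq> U" if U: "submodule U A N" "f ` S \<subseteq> U" for U
  proof -
    have "{x \<in> carrier M. f x \<in> U} = carrier M"
      using U S(2) by (intro S(3) submodule_preimage) auto
    then show ?thesis by blast
  qed
  then show ?thesis using S(1,2) by (intro exI[of _ "f ` S"]) auto
qed

text \<open>Composing \<theta> with the inverse of \<open>f\<close> on its image gives a retraction.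
  It is applied to \<open>1 - s g\<close> for a section \<open>s\<close> of \<open>g\<close> and to
  the square of an endomorphism.\<close>

lemma split_mono_if_retracts:
  assumes X: "left_module A X" and Y: "left_module A Y"
    and f: "f \<in> module_hom A X Y" "inj_on f (carrier X)"
    and \<theta>: "\<theta> \<in> module_hom A Y Y" "\<And>y. y \<in> carrier Y \<Longrightarrow> \<theta> y \<in> f ` carrier X"
      "\<And>x. x \<in> carrier X \<Longrightarrow> \<theta> (f x) = f x"
  shows "split_mono A X Y f"
proof -
  interpret f: left_module_hom A X Y f by (intro left_module_homI X Y f)
  let ?F = "restr Y (f ` carrier X)"
  have F: "submodule (f ` carrier X) A Y" by (rule f.submodule_image[OF f.M.submodule_UNIV])
  interpret F: left_module_hom A X ?F f
    using f(1) f.N.left_module_restr[OF F]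
    by (intro left_module_homI X) (auto simp: module_hom_def)
  let ?g = "the_inv_into (carrier X) f"
  have g: "?g \<in> module_hom A ?F X"
    using f(2) by (intro F.inverse_hom) (auto simp: bij_betw_def)
  have "\<theta> \<in> module_hom A Y ?F"
    using \<theta>(1,2) by (auto simp: module_hom_def Pi_iff)
  from module_hom_compose[OF this g] show ?thesis
    using f \<theta>(3) unfolding split_mono_def
    by (intro conjI bexI[of _ "\<lambda>y. ?g (\<theta> y)"]) (auto simp: the_inv_into_f_f)
qed

text \<open>For a section \<open>s\<close> of \<open>g\<close>, the map \<open>y - s (g y)\<close>
  projects onto the kernel of \<open>g\<close>, which is the image of \<open>f\<close>.\<close>

lemma short_exact_split:
  assumes X: "left_module A X" and Y: "left_module A Y" and Z: "left_module A Z"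
    and se: "short_exact A X Y Z f g" and split: "split_epi A Y Z g"
  shows "split_mono A X Y f"
proof -
  interpret g: left_module_hom A Y Z g
    using se by (intro left_module_homI Y Z) (simp add: short_exact_def)
  obtain s where s: "s \<in> module_hom A Z Y" "\<And>z. z \<in> carrier Z \<Longrightarrow> g (s z) = z"
    using split by (auto simp: split_epi_def)
  have ker: "f ` carrier X = {y \<in> carrier Y. g y = \<zero>\<^bsub>Z\<^esub>}"
    and f: "f \<in> module_hom A X Y" "inj_on f (carrier X)"
    using se by (auto simp: short_exact_def a_kernel_def')
  interpret s: left_module_hom A Z Y s by (intro left_module_homI Y Z s)
  interpret f: left_module_hom A X Y f by (intro left_module_homI X Y f)
  let ?\<theta> = "\<lambda>y. y \<ominus>\<^bsub>Y\<^esub> s (g y)"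
  show ?thesis
  proof (rule split_mono_if_retracts[OF X Y f])
    show "?\<theta> \<in> module_hom A Y Y"
      by (intro module_hom_diff Y module_hom_id module_hom_compose[OF g.hom s(1)])
    show "?\<theta> y \<in> f ` carrier X" if "y \<in> carrier Y" for y
      unfolding ker using that s(2)
      by (auto simp: g.hom_diff g.hom_closed s.hom_closed g.N.diff_eq_zero)
    show "?\<theta> (f x) = f x" if "x \<in> carrier X" for x
    proof -
      have "f x \<in> carrier Y" "g (f x) = \<zero>\<^bsub>Z\<^esub>" using that ker by auto
      then show ?thesis by (simp add: s.hom_zero g.M.diff_zero_right)
    qed
  qed
qed

text \<open>
  Pull the sequence back along a map that is not a split epimorphism. If the pullback splits, the map
  lifts; otherwise the left almost split map extends to the pullback, which induces an endomorphism
  of \<open>Z\<close>.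
\<close>

lemma right_almost_split_from_left:
  fixes A :: "('a, 'r) ring_scheme" and X :: "('a, 'x) module" and Y :: "('a, 'y) module"
    and Z :: "('a, 'z) module"
  assumes X: "fg_module A X" and Y: "fg_module A Y" and Z: "left_module A Z"
    and se: "short_exact A X Y Z f g" and las: "left_almost_split A X Y f"
    and endo: "\<And>\<phi>. \<phi> \<in> module_hom A Z Z \<Longrightarrow>
      bij_betw \<phi> (carrier Z) (carrier Z) \<or> (\<forall>z\<in>carrier Z. \<phi> (\<phi> z) = \<zero>\<^bsub>Z\<^esub>)"
  shows "right_almost_split A Y Z g"
  unfolding right_almost_split_def
proof (intro conjI allI impI)
  note Xm = fg_module_left_module[OF X] and Ym = fg_module_left_module[OF Y]
  show g: "g \<in> module_hom A Y Z" using se by (simp add: short_exact_def)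
  have nsf: "\<not> split_mono A X Y f" using las by (simp add: left_almost_split_def)
  then show "\<not> split_epi A Y Z g" using short_exact_split[OF Xm Ym Z se] by blast
  have ker: "f ` carrier X = {y \<in> carrier Y. g y = \<zero>\<^bsub>Z\<^esub>}"
    and f: "f \<in> module_hom A X Y" "inj_on f (carrier X)"
    and gs: "g ` carrier Y = carrier Z"
    using se by (auto simp: short_exact_def a_kernel_def')
  interpret g: left_module_hom A Y Z g by (intro left_module_homI Ym Z g)
  interpret f: left_module_hom A X Y f by (intro left_module_homI Xm Ym f)
  fix W :: "'a cat_module" and h
  assume "fg_module A W \<and> h \<in> module_hom A W Z \<and> \<not> split_epi A W Z h"
  then have W: "fg_module A W" and h: "h \<in> module_hom A W Z" and nsh: "\<not> split_epi A W Z h" by auto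
  note Wm = fg_module_left_module[OF W]
  interpret h: left_module_hom A W Z h by (intro left_module_homI Wm Z h)
  interpret D: left_module A "dsum W Y" by (intro left_module_dsum Wm Ym)
  define E where "E = {(w, y). w \<in> carrier W \<and> y \<in> carrier Y \<and> h w = g y}"
  have E: "submodule E A (dsum W Y)"
    by (rule D.submoduleI)
      (auto simp: E_def h.hom_zero g.hom_zero h.hom_add g.hom_add h.hom_smult g.hom_smult
        h.M.smult_closed g.M.smult_closed)
  let ?E = "restr (dsum W Y) E"
  have Em: "left_module A ?E" by (rule D.left_module_restr[OF E])
  have fstE: "fst \<in> module_hom A ?E W" and sndE: "snd \<in> module_hom A ?E Y"
    using D.submodule_subset[OF E] by (auto intro!: module_hom_restr_dom dsum_homs)
  interpret fstE: left_module_hom A ?E W fst by (intro left_module_homI Em Wm fstE)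
  interpret sndE: left_module_hom A ?E Y snd by (intro left_module_homI Em Ym sndE)
  have fst_surj: "\<exists>y. (w, y) \<in> E" if "w \<in> carrier W" for w
  proof -
    have "h w \<in> g ` carrier Y" using gs h.hom_closed[OF that] by simp
    then show ?thesis using that by (auto simp: E_def)
  qed
  then have fst_im: "fst ` carrier ?E = carrier W" by (force simp: E_def)
  define f' where "f' x = (\<zero>\<^bsub>W\<^esub>, f x)" for x
  have gf: "g (f x) = \<zero>\<^bsub>Z\<^esub>" "f x \<in> carrier Y" if "x \<in> carrier X" for x using that ker by auto
  have f': "f' \<in> module_hom A X ?E"
    by (rule module_homI)
      (auto simp: f'_def E_def gf h.hom_zero f.hom_add f.hom_smult)
  interpret f': left_module_hom A X ?E f' by (intro left_module_homI Xm Em f')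
  have f'_im: "{p \<in> carrier ?E. fst p = \<zero>\<^bsub>W\<^esub>} \<subseteq> f' ` carrier X"
  proof
    fix p assume "p \<in> {p \<in> carrier ?E. fst p = \<zero>\<^bsub>W\<^esub>}"
    then obtain y where "p = (\<zero>\<^bsub>W\<^esub>, y)" "y \<in> carrier Y" "g y = \<zero>\<^bsub>Z\<^esub>"
      by (cases p) (auto simp: E_def h.hom_zero)
    then have "p = (\<zero>\<^bsub>W\<^esub>, y)" "y \<in> f ` carrier X" using ker by simp_all
    then show "p \<in> f' ` carrier X" by (auto simp: f'_def)
  qed
  obtain S where S: "finite S" "S \<subseteq> f' ` carrier X"
    "\<forall>U. submodule U A ?E \<and> S \<subseteq> U \<longrightarrow> f' ` carrier X \<subseteq> U"
    using f'.fg_module_image_generators[OF X] by metis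
  have "fg_module A ?E"
  proof (rule fstE.fg_module_extension[OF W fst_im S(1)])
    show "S \<subseteq> carrier ?E"
      using S(2) fstE.M.submodule_subset[OF f'.submodule_image[OF f.M.submodule_UNIV]]
      by (rule subset_trans)
    fix U assume "submodule U A ?E" "S \<subseteq> U"
    then have "f' ` carrier X \<subseteq> U" using S(3) by simp
    with f'_im show "{p \<in> carrier ?E. fst p = \<zero>\<^bsub>W\<^esub>} \<subseteq> U" by (rule subset_trans)
  qed
  \<comment> \<open>The left almost split property is tested on modules of type
    \<open>cat_module\<close>, so the pullback enters through its copy \<open>N\<close>.\<close>
  then obtain N :: "'a cat_module" and j where N: "fg_module A N"
    and j: "j \<in> module_hom A ?E N" "bij_betw j (carrier ?E) (carrier N)"
    using fg_module_copy by blast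
  note Nm = fg_module_left_module[OF N]
  interpret j: left_module_hom A ?E N j by (intro left_module_homI Em Nm j)
  define i where "i = the_inv_into (carrier ?E) j"
  have i: "i \<in> module_hom A N ?E" unfolding i_def by (rule j.inverse_hom[OF j(2)])
  interpret i: left_module_hom A N ?E i by (intro left_module_homI Em Nm i)
  have ij: "i (j p) = p" if "p \<in> carrier ?E" for p
    using j(2) that by (simp add: i_def bij_betw_def the_inv_into_f_f)
  have jf': "(\<lambda>x. j (f' x)) \<in> module_hom A X N" by (rule module_hom_compose[OF f' j(1)])
  show "\<exists>k\<in>module_hom A W Y. \<forall>w\<in>carrier W. g (k w) = h w"
  proof (cases "split_mono A X N (\<lambda>x. j (f' x))")
    case True
    then obtain r where r: "r \<in> module_hom A N X" "\<And>x. x \<in> carrier X \<Longrightarrow> r (j (f' x)) = x"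
      by (auto simp: split_mono_def)
    \<comment> \<open>Subtracting the retraction kills the copy of \<open>X\<close> in the pullback,
      so the second projection, corrected in this way, descends to \<open>W\<close>.\<close>
    let ?\<theta> = "\<lambda>p. snd p \<ominus>\<^bsub>Y\<^esub> f (r (j p))"
    have jr: "(\<lambda>p. r (j p)) \<in> module_hom A ?E X" by (rule module_hom_compose[OF j(1) r(1)])
    interpret jr: left_module_hom A ?E X "\<lambda>p. r (j p)" by (intro left_module_homI Em Xm jr)
    have \<theta>: "?\<theta> \<in> module_hom A ?E Y"
      by (rule module_hom_diff[OF Ym sndE module_hom_compose[OF jr f(1)]])
    interpret \<theta>: left_module_hom A ?E Y ?\<theta> by (intro left_module_homI Em Ym \<theta>)
    have "?\<theta> p = \<zero>\<^bsub>Y\<^esub>" if p: "p \<in> carrier ?E" "fst p = \<zero>\<^bsub>W\<^esub>" for p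
    proof -
      obtain x where x: "x \<in> carrier X" "p = f' x" using f'_im p by blast
      then show ?thesis using r(2)[OF x(1)] gf(2)[OF x(1)] by (simp add: f'_def g.M.diff_eq_zero)
    qed
    from \<theta>.factor_hom[OF Wm fstE fst_im this]
    obtain k where k: "k \<in> module_hom A W Y" "\<And>p. p \<in> carrier ?E \<Longrightarrow> k (fst p) = ?\<theta> p" by blast
    have "g (k w) = h w" if w: "w \<in> carrier W" for w
    proof -
      obtain y where y: "(w, y) \<in> E" using fst_surj[OF w] by blast
      have rx: "r (j (w, y)) \<in> carrier X" using jr.hom_closed[of "(w, y)"] y by simp
      have "k w = y \<ominus>\<^bsub>Y\<^esub> f (r (j (w, y)))" using k(2)[of "(w, y)"] y by simp
      then have "g (k w) = g y \<ominus>\<^bsub>Z\<^esub> \<zero>\<^bsub>Z\<^esub>"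
        using y gf[OF rx] by (simp add: g.hom_diff E_def)
      then show ?thesis using y by (simp add: E_def g.N.diff_zero_right g.hom_closed)
    qed
    with k(1) show ?thesis by blast
  next
    case False
    then obtain k where k: "k \<in> module_hom A Y N" "\<And>x. x \<in> carrier X \<Longrightarrow> k (f x) = j (f' x)"
      using las N jf' unfolding left_almost_split_def by blast
    have ik: "(\<lambda>y. i (k y)) \<in> module_hom A Y ?E" by (rule module_hom_compose[OF k(1) i])
    interpret ik: left_module_hom A Y ?E "\<lambda>y. i (k y)" by (intro left_module_homI Em Ym ik)
    \<comment> \<open>The two coordinates of the extension to the pullback: \<open>?u\<close> fixes
      each \<open>f x\<close> and \<open>?a\<close> kills it, so \<open>?a\<close> induces
      \<open>b\<close> from \<open>Z\<close> to \<open>W\<close> with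
      \<open>h (b (g y)) = g (?u y)\<close>.\<close>
    let ?u = "\<lambda>y. snd (i (k y))" and ?a = "\<lambda>y. fst (i (k y))"
    have u: "?u \<in> module_hom A Y Y" by (rule module_hom_compose[OF ik sndE])
    have a: "?a \<in> module_hom A Y W" by (rule module_hom_compose[OF ik fstE])
    interpret u: left_module_hom A Y Y ?u by (intro left_module_homI Ym u)
    interpret a: left_module_hom A Y W ?a by (intro left_module_homI Ym Wm a)
    have ikf: "i (k (f x)) = f' x" if "x \<in> carrier X" for x
      using k(2)[OF that] ij[OF f'.hom_closed[OF that]] by simp
    have "?a y = \<zero>\<^bsub>W\<^esub>" if "y \<in> carrier Y" "g y = \<zero>\<^bsub>Z\<^esub>" for y
    proof -
      have "y \<in> f ` carrier X" using that ker by simp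
      then show ?thesis using ikf by (auto simp: f'_def)
    qed
    from a.factor_hom[OF Z g gs this]
    obtain b where b: "b \<in> module_hom A Z W" "\<And>y. y \<in> carrier Y \<Longrightarrow> b (g y) = ?a y" by blast
    let ?\<phi> = "\<lambda>z. h (b z)"
    have \<phi>: "?\<phi> \<in> module_hom A Z Z" by (rule module_hom_compose[OF b(1) h])
    interpret \<phi>: left_module_hom A Z Z ?\<phi> by (intro left_module_homI Z \<phi>)
    have \<phi>g: "?\<phi> (g y) = g (?u y)" if y: "y \<in> carrier Y" for y
      using ik.hom_closed[OF y] b(2)[OF y] by (auto simp: E_def)
    from endo[OF \<phi>] show ?thesis
    proof
      assume bij: "bij_betw ?\<phi> (carrier Z) (carrier Z)"
      let ?c = "the_inv_into (carrier Z) ?\<phi>"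
      have "(\<lambda>z. b (?c z)) \<in> module_hom A Z W"
        by (rule module_hom_compose[OF \<phi>.inverse_hom[OF bij] b(1)])
      moreover have "h (b (?c z)) = z" if "z \<in> carrier Z" for z
        using f_the_inv_into_f[of ?\<phi> "carrier Z" z] bij that by (auto simp: bij_betw_def)
      ultimately have "split_epi A W Z h"
        unfolding split_epi_def using h by (intro conjI bexI[of _ "\<lambda>z. b (?c z)"]) auto
      with nsh show ?thesis by blast
    next
      assume nil: "\<forall>z\<in>carrier Z. ?\<phi> (?\<phi> z) = \<zero>\<^bsub>Z\<^esub>"
      \<comment> \<open>Here \<open>g\<close> kills the image of the square of \<open>?u\<close>,
        which therefore projects \<open>Y\<close> onto the image of \<open>f\<close>.\<close>
      have "split_mono A X Y f"
      proof (rule split_mono_if_retracts[OF Xm Ym f])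
        show "(\<lambda>y. ?u (?u y)) \<in> module_hom A Y Y" by (rule module_hom_compose[OF u u])
        show "?u (?u y) \<in> f ` carrier X" if y: "y \<in> carrier Y" for y
        proof -
          have "g (?u (?u y)) = ?\<phi> (?\<phi> (g y))"
            using \<phi>g[OF y] \<phi>g[OF u.hom_closed[OF y]] by simp
          then show ?thesis
            unfolding ker using nil g.hom_closed[OF y] u.hom_closed[OF u.hom_closed[OF y]] by simp
        qed
        show "?u (?u (f x)) = f x" if "x \<in> carrier X" for x
          using ikf[OF that] by (simp add: f'_def)
      qed
      with nsf show ?thesis by blast
    qed
  qed
qed

section \<open>Descending chains of left ideals\<close>

text \<open>Relative to a submodule \<open>N\<close>, so that a finite generating set can be added
  one element at a time.\<close>

definition dcc_below :: "('a, 'r) ring_scheme \<Rightarrow> ('a, 'm) module \<Rightarrow> 'm set \<Rightarrow> bool" where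
  "dcc_below A M N \<longleftrightarrow> (\<forall>C :: nat \<Rightarrow> 'm set.
     (\<forall>n. submodule (C n) A M \<and> C (Suc n) \<subseteq> C n \<and> C n \<subseteq> N) \<longrightarrow> (\<exists>n. \<forall>m\<ge>n. C m = C n))"

text \<open>For a chain below \<open>N + R s\<close>, the coefficients of \<open>s\<close> that
  occur modulo \<open>N\<close> form a descending chain of ideals of the commutative ring, and the
  intersections with \<open>N\<close> descend as well. Once both are constant, so is the
  chain.\<close>

lemma (in left_module) dcc_below_add_cyc:
  assumes k: "artinian_cring R" and N: "submodule N R M" "dcc_below R M N" and s: "s \<in> carrier M"
  shows "dcc_below R M (N <+>\<^bsub>M\<^esub> cyc s)"
  unfolding dcc_below_def
proof (intro allI impI)
  interpret R: cring R using k by (simp add: artinian_cring_def)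
  note Nc = submodule_carrier[OF N(1)]
  fix C :: "nat \<Rightarrow> 'm set" assume *: "\<forall>n. submodule (C n) R M \<and> C (Suc n) \<subseteq> C n \<and> C n \<subseteq> N <+>\<^bsub>M\<^esub> cyc s"
  then have C: "submodule (C n) R M" "C (Suc n) \<subseteq> C n" "C n \<subseteq> N <+>\<^bsub>M\<^esub> cyc s" for n by auto
  have anti: "C m \<subseteq> C n" if "n \<le> m" for n m using lift_Suc_antimono_le[of C n m] C(2) that by blast
  define J where "J n = {c \<in> carrier R. \<exists>y\<in>N. c \<odot>\<^bsub>M\<^esub> s \<oplus>\<^bsub>M\<^esub> y \<in> C n}" for n
  have "ideal (J n) R" for n
  proof (rule idealI)
    show "ring R" by (rule R.ring_axioms)
    have zero: "\<zero> \<in> J n"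
      using submodule_zero[OF N(1)] submodule_zero[OF C(1)] s
        by (auto simp: J_def intro!: bexI[of _ "\<zero>\<^bsub>M\<^esub>"])
    have add: "c \<oplus> d \<in> J n" if cJ: "c \<in> J n" and dJ: "d \<in> J n" for c d
    proof -
      obtain x y where xy: "x \<in> N" "y \<in> N" "c \<odot>\<^bsub>M\<^esub> s \<oplus>\<^bsub>M\<^esub> x \<in> C n" "d \<odot>\<^bsub>M\<^esub> s \<oplus>\<^bsub>M\<^esub> y \<in> C n"
        and cd: "c \<in> carrier R" "d \<in> carrier R"
        using cJ dJ by (auto simp: J_def)
      have "(c \<oplus> d) \<odot>\<^bsub>M\<^esub> s \<oplus>\<^bsub>M\<^esub> (x \<oplus>\<^bsub>M\<^esub> y) = (c \<odot>\<^bsub>M\<^esub> s \<oplus>\<^bsub>M\<^esub> x) \<oplus>\<^bsub>M\<^esub> (d \<odot>\<^bsub>M\<^esub> s \<oplus>\<^bsub>M\<^esub> y)"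
        using cd Nc[OF xy(1)] Nc[OF xy(2)] s by (simp add: smult_l_distr smult_closed M.a_ac)
      then show ?thesis
        using cd submodule_add[OF N(1) xy(1,2)] submodule_add[OF C(1) xy(3,4)]
        by (auto simp: J_def intro!: bexI[of _ "x \<oplus>\<^bsub>M\<^esub> y"])
    qed
    have mult: "a \<otimes> c \<in> J n" if a: "a \<in> carrier R" and cJ: "c \<in> J n" for a c
    proof -
      obtain x where x: "x \<in> N" "c \<odot>\<^bsub>M\<^esub> s \<oplus>\<^bsub>M\<^esub> x \<in> C n" and c: "c \<in> carrier R"
        using cJ by (auto simp: J_def)
      have "(a \<otimes> c) \<odot>\<^bsub>M\<^esub> s \<oplus>\<^bsub>M\<^esub> a \<odot>\<^bsub>M\<^esub> x = a \<odot>\<^bsub>M\<^esub> (c \<odot>\<^bsub>M\<^esub> s \<oplus>\<^bsub>M\<^esub> x)"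
        using a c Nc[OF x(1)] s by (simp add: smult_r_distr smult_closed smult_assoc)
      then show ?thesis
        using a c submodule_smult[OF N(1) a x(1)] submodule_smult[OF C(1) a x(2)]
        by (auto simp: J_def intro!: bexI[of _ "a \<odot>\<^bsub>M\<^esub> x"])
    qed
    have sub: "J n \<subseteq> carrier R" by (auto simp: J_def)
    have neg: "\<ominus> c \<in> J n" if "c \<in> J n" for c
      using mult[OF _ that, of "\<ominus> \<one>"] that sub by (auto simp: R.l_minus)
    show "subgroup (J n) (add_monoid R)"
      using sub zero add neg by (intro R.add.subgroupI) auto
    show "a \<otimes> x \<in> J n" "x \<otimes> a \<in> J n" if "a \<in> J n" "x \<in> carrier R" for a x
      using mult[OF that(2,1)] sub that R.m_comm[of a x] by auto
  qed
  moreover have "J (Suc n) \<subseteq> J n" for n using C(2) by (auto simp: J_def)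
  ultimately obtain n1 where n1: "\<And>m. m \<ge> n1 \<Longrightarrow> J m = J n1"
    using k unfolding artinian_cring_def by meson
  have "submodule (C n \<inter> N) R M \<and> C (Suc n) \<inter> N \<subseteq> C n \<inter> N \<and> C n \<inter> N \<subseteq> N" for n
    using C N(1) submodule_Int[of "C n" N] by blast
  with spec[OF N(2)[unfolded dcc_below_def], of "\<lambda>n. C n \<inter> N"]
  have "\<exists>n. \<forall>m\<ge>n. C m \<inter> N = C n \<inter> N" by simp
  then obtain n2 where n2: "\<And>m. m \<ge> n2 \<Longrightarrow> C m \<inter> N = C n2 \<inter> N" by blast
  define n where "n = max n1 n2"
  have "C n \<subseteq> C m" if m: "m \<ge> n" for m
  proof
    fix x assume x: "x \<in> C n"
    then obtain y c where yc: "y \<in> N" "c \<in> carrier R" "x = y \<oplus>\<^bsub>M\<^esub> c \<odot>\<^bsub>M\<^esub> s"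
      using C(3)[of n] by (auto simp: set_add_iff cyc_def subset_iff)
    have cl: "y \<in> carrier M" "c \<odot>\<^bsub>M\<^esub> s \<in> carrier M" using Nc yc s by (auto intro: smult_closed)
    have "c \<in> J n" using x yc cl by (auto simp: J_def M.a_comm intro!: bexI[of _ y])
    also have "J n = J m" using n1[of n] n1[of m] m by (simp add: n_def)
    finally obtain y' where y': "y' \<in> N" "c \<odot>\<^bsub>M\<^esub> s \<oplus>\<^bsub>M\<^esub> y' \<in> C m" by (auto simp: J_def)
    let ?z = "c \<odot>\<^bsub>M\<^esub> s \<oplus>\<^bsub>M\<^esub> y'"
    have zc: "?z \<in> carrier M" using cl Nc[OF y'(1)] by simp
    \<comment> \<open>Elements with the same coefficient of \<open>s\<close> differ by an element of
      \<open>N\<close>.\<close>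
    have "x \<ominus>\<^bsub>M\<^esub> ?z = y \<ominus>\<^bsub>M\<^esub> y'"
      using cl Nc[OF y'(1)] unfolding yc(3) by (simp add: M.minus_eq M.minus_add M.a_ac M.r_neg2
        M.r_neg1 M.r_neg)
    moreover have "?z \<in> C n" using y'(2) anti[OF m] by blast
    ultimately have "x \<ominus>\<^bsub>M\<^esub> ?z \<in> C n \<inter> N"
      using submodule_diff[OF C(1) x, of ?z] submodule_diff[OF N(1) yc(1) y'(1)] by (metis IntI)
    also have "C n \<inter> N = C m \<inter> N" using n2[of n] n2[of m] m by (simp add: n_def)
    finally show "x \<in> C m"
      using submodule_diff_cancel[OF C(1) submodule_carrier[OF C(1) x] y'(2)] by blast
  qed
  then show "\<exists>n. \<forall>m\<ge>n. C m = C n" using anti by (intro exI[of _ n]) blast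
qed

lemma (in left_module) dcc_below_fg:
  assumes k: "artinian_cring R" and fg: "fg_module R M"
  shows "dcc_below R M (carrier M)"
proof -
  obtain S where S: "finite S" "S \<subseteq> carrier M" and gen: "\<And>N. submodule N R M \<Longrightarrow> S \<subseteq> N \<Longrightarrow> N = carrier M"
    using fg unfolding fg_iff by metis
  have "\<exists>N. submodule N R M \<and> S \<subseteq> N \<and> dcc_below R M N"
    using S
  proof (induction S)
    case empty
    have "C m = C n" if "\<forall>n. submodule (C n) R M \<and> C (Suc n) \<subseteq> C n \<and> C n \<subseteq> {\<zero>\<^bsub>M\<^esub>}" for C ::
      "nat \<Rightarrow> 'm set" and m n
    proof -
      have "C i = {\<zero>\<^bsub>M\<^esub>}" for i using that submodule_zero[of "C i"] by blast
      then show ?thesis by simp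
    qed
    then have "dcc_below R M {\<zero>\<^bsub>M\<^esub>}" unfolding dcc_below_def by metis
    then show ?case using submodule_zero_set by blast
  next
    case (insert s S)
    then obtain N where N: "submodule N R M" "S \<subseteq> N" "dcc_below R M N" by auto
    have s: "s \<in> carrier M" using insert by simp
    let ?N = "N <+>\<^bsub>M\<^esub> cyc s"
    have "insert s S \<subseteq> ?N"
      using set_add_upper[OF N(1) submodule_cyc[OF s]] cyc_self[OF s] N(2) by auto
    then show ?case
      using submodule_set_add[OF N(1) submodule_cyc[OF s]] dcc_below_add_cyc[OF k N(1,3) s] by blast
  qed
  then show ?thesis using gen by blast
qed

section \<open>The regular module and its left ideals\<close>

abbreviation reg :: "('a, 'r) ring_scheme \<Rightarrow> ('a, 'a) module" where
  "reg A \<equiv> scalar_module A (\<lambda>x. x)"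

lemma scalar_module_simps [simp]:
  "carrier (scalar_module A \<phi>) = carrier A" "\<zero>\<^bsub>scalar_module A \<phi>\<^esub> = \<zero>\<^bsub>A\<^esub>"
  "add (scalar_module A \<phi>) = add A" "c \<odot>\<^bsub>scalar_module A \<phi>\<^esub> x = \<phi> c \<otimes>\<^bsub>A\<^esub> x"
  by (simp_all add: scalar_module_def)

lemma (in ring) left_module_reg: "left_module R (reg R)"
proof -
  interpret G: abelian_group "reg R"
  proof (rule abelian_groupI)
    fix x assume "x \<in> carrier (reg R)"
    then show "\<exists>y\<in>carrier (reg R). y \<oplus>\<^bsub>reg R\<^esub> x = \<zero>\<^bsub>reg R\<^esub>"
      by (intro bexI[of _ "\<ominus> x"]) (auto simp: l_neg)
  qed (auto simp: a_ac)
  show ?thesis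
    by unfold_locales (auto simp: l_distr r_distr m_assoc)
qed

text \<open>Left ideals are \<open>k\<close>-submodules of the finitely generated
  \<open>k\<close>-module \<open>A\<close>.\<close>

lemma artin_algebra_dcc:
  fixes A :: "('b, 'r) ring_scheme"
  assumes "artin_algebra k A \<phi>"
  shows "dcc_below A (reg A) (carrier A)"
proof -
  interpret A: ring A using assms by (simp add: artin_algebra_def)
  interpret reg: left_module A "reg A" by (rule A.left_module_reg)
  have fg: "fg_module k (scalar_module A \<phi>)" and k: "artinian_cring k" and \<phi>: "\<phi> \<in> ring_hom k A"
    using assms by (auto simp: artin_algebra_def)
  interpret S: left_module k "scalar_module A \<phi>" by (rule fg_module_left_module[OF fg])
  have "submodule L k (scalar_module A \<phi>)" if L: "submodule L A (reg A)" for L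
    using reg.submoduleD[OF L] \<phi> by (intro S.submoduleI) (auto simp: ring_hom_def Pi_iff)
  then have "\<exists>n. \<forall>m\<ge>n. C m = C n"
    if "\<forall>n. submodule (C n) A (reg A) \<and> C (Suc n) \<subseteq> C n \<and> C n \<subseteq> carrier A" for C :: "nat \<Rightarrow> 'b set"
    using S.dcc_below_fg[OF k fg] that unfolding dcc_below_def scalar_module_simps by simp
  then show ?thesis unfolding dcc_below_def by simp
qed

lemma dcc_below_minimal:
  assumes "dcc_below A M N" and x: "P x"
    and F: "\<And>x. P x \<Longrightarrow> submodule (F x) A M \<and> F x \<subseteq> N"
  shows "\<exists>x. P x \<and> (\<forall>y. P y \<longrightarrow> \<not> F y \<subset> F x)"
proof (rule ccontr)
  assume "\<not> ?thesis"
  then have *: "\<And>x. P x \<Longrightarrow> \<exists>y. P y \<and> F y \<subset> F x" by blast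
  obtain s where "\<forall>n. P (s n) \<and> F (s (Suc n)) \<subset> F (s n)"
    using dependent_nat_choice[of "\<lambda>_. P" "\<lambda>_ x y. F y \<subset> F x", OF _ *] x by auto
  then have s: "P (s n)" "F (s (Suc n)) \<subset> F (s n)" for n by simp_all
  have "\<forall>n. submodule (F (s n)) A M \<and> F (s (Suc n)) \<subseteq> F (s n) \<and> F (s n) \<subseteq> N"
    using F[OF s(1)] s(2) by (simp add: psubset_imp_subset)
  with spec[OF assms(1)[unfolded dcc_below_def], of "\<lambda>n. F (s n)"]
  have "\<exists>n. \<forall>m\<ge>n. F (s m) = F (s n)" by simp
  then obtain n where n: "\<forall>m\<ge>n. F (s m) = F (s n)" ..
  have "F (s (Suc n)) = F (s n)" by (rule n[rule_format]) simp
  then show False using s(2)[of n] by simp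
qed

section \<open>Primitive idempotents and the radical\<close>

text \<open>For \<open>u\<close> in \<open>eAe\<close> this is invertibility in that corner ring,
  whose unit element is \<open>e\<close>; the equations on \<open>v\<close> place the inverse in
  \<open>eAe\<close> too.\<close>

definition unit_in :: "('a, 'r) ring_scheme \<Rightarrow> 'a \<Rightarrow> 'a \<Rightarrow> bool" where
  "unit_in A e u \<longleftrightarrow>
     (\<exists>v\<in>carrier A. e \<otimes>\<^bsub>A\<^esub> v = v \<and> v \<otimes>\<^bsub>A\<^esub> e = v \<and> u \<otimes>\<^bsub>A\<^esub> v = e \<and> v \<otimes>\<^bsub>A\<^esub> u = e)"

text \<open>These are the idempotents \<open>e\<close> for which \<open>eAe\<close> is a local ring.\<close>

definition primitive :: "('a, 'r) ring_scheme \<Rightarrow> 'a \<Rightarrow> bool" where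
  "primitive A e \<longleftrightarrow> e \<in> carrier A \<and> e \<otimes>\<^bsub>A\<^esub> e = e \<and> e \<noteq> \<zero>\<^bsub>A\<^esub> \<and>
     (\<forall>u\<in>carrier A. e \<otimes>\<^bsub>A\<^esub> u = u \<and> u \<otimes>\<^bsub>A\<^esub> e = u \<longrightarrow> unit_in A e u \<or> unit_in A e (e \<ominus>\<^bsub>A\<^esub> u))"

text \<open>A description of the Jacobson radical of an artinian ring that is visibly left-right symmetric.\<close>

definition jac :: "('a, 'r) ring_scheme \<Rightarrow> 'a set" where
  "jac A = {a \<in> carrier A. \<forall>e x y. primitive A e \<and> x \<in> carrier A \<and> y \<in> carrier A \<longrightarrow>
     e \<otimes>\<^bsub>A\<^esub> x \<otimes>\<^bsub>A\<^esub> a \<otimes>\<^bsub>A\<^esub> y \<otimes>\<^bsub>A\<^esub> e \<noteq> e}"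

lemma opposite_ring_simps [simp]:
  "carrier (opposite_ring A) = carrier A" "\<zero>\<^bsub>opposite_ring A\<^esub> = \<zero>\<^bsub>A\<^esub>" "\<one>\<^bsub>opposite_ring A\<^esub> = \<one>\<^bsub>A\<^esub>"
  "add (opposite_ring A) = add A" "x \<otimes>\<^bsub>opposite_ring A\<^esub> y = y \<otimes>\<^bsub>A\<^esub> x"
  by (simp_all add: opposite_ring_def)

lemma opposite_ring_a_minus [simp]: "x \<ominus>\<^bsub>opposite_ring A\<^esub> y = x \<ominus>\<^bsub>A\<^esub> y"
  by (simp add: a_minus_def a_inv_def m_inv_def)

lemma (in ring) ring_opposite: "ring (opposite_ring R)"
proof (rule ringI)
  show "abelian_group (opposite_ring R)"
  proof (rule abelian_groupI)
    fix x assume "x \<in> carrier (opposite_ring R)"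
    then show "\<exists>y\<in>carrier (opposite_ring R). y \<oplus>\<^bsub>opposite_ring R\<^esub> x = \<zero>\<^bsub>opposite_ring R\<^esub>"
      by (intro bexI[of _ "\<ominus> x"]) (auto simp: l_neg)
  qed (auto simp: a_ac)
  show "monoid (opposite_ring R)"
    by (rule monoidI) (auto simp: m_assoc)
qed (auto simp: l_distr r_distr)

lemma unit_in_opposite [simp]: "unit_in (opposite_ring A) e u \<longleftrightarrow> unit_in A e u"
  by (auto simp: unit_in_def)

lemma primitive_opposite [simp]: "primitive (opposite_ring A) e \<longleftrightarrow> primitive A e"
  by (auto simp: primitive_def)

lemma (in ring) primitive_closed: "primitive R e \<Longrightarrow> e \<in> carrier R"
  by (simp add: primitive_def)

lemma (in ring) primitive_idem: "primitive R e \<Longrightarrow> e \<otimes> e = e"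
  by (simp add: primitive_def)

lemma (in ring) jac_opposite: "jac (opposite_ring R) = jac R"
proof -
  have "e \<otimes> (y \<otimes> (a \<otimes> (x \<otimes> e))) = e \<otimes> y \<otimes> a \<otimes> x \<otimes> e"
    if "e \<in> carrier R" "x \<in> carrier R" "y \<in> carrier R" "a \<in> carrier R" for e a x y
    using that by (simp add: m_assoc)
  then show ?thesis
    unfolding jac_def by (auto simp: primitive_closed)
qed

lemma scalar_module_a_minus [simp]: "x \<ominus>\<^bsub>scalar_module A \<phi>\<^esub> y = x \<ominus>\<^bsub>A\<^esub> y"
  by (simp add: a_minus_def a_inv_def m_inv_def)

section \<open>The radical as a two-sided ideal\<close>

context ring
begin

lemma add_diff_cancel_l: "x \<in> carrier R \<Longrightarrow> y \<in> carrier R \<Longrightarrow> (x \<oplus> y) \<ominus> x = y"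
  by (simp add: minus_eq a_comm[of x y] a_assoc r_neg)

lemma right_minus_eq: "x \<in> carrier R \<Longrightarrow> y \<in> carrier R \<Longrightarrow> x \<ominus> y = \<zero> \<longleftrightarrow> x = y"
  using left_module.diff_eq_zero[OF left_module_reg, of x y] by simp

lemma jacD: "a \<in> jac R \<Longrightarrow> primitive R e \<Longrightarrow> x \<in> carrier R \<Longrightarrow> y \<in> carrier R \<Longrightarrow>
    e \<otimes> x \<otimes> a \<otimes> y \<otimes> e \<noteq> e"
  by (simp add: jac_def)

lemma jac_closed: "a \<in> jac R \<Longrightarrow> a \<in> carrier R"
  by (simp add: jac_def)

lemma jac_lmult:
  assumes "a \<in> jac R" "b \<in> carrier R" shows "b \<otimes> a \<in> jac R"
proof -
  have "e \<otimes> x \<otimes> (b \<otimes> a) \<otimes> y \<otimes> e = e \<otimes> (x \<otimes> b) \<otimes> a \<otimes> y \<otimes> e"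
    if "primitive R e" "x \<in> carrier R" "y \<in> carrier R" for e x y
    using that assms by (simp add: m_assoc primitive_closed jac_closed)
  then show ?thesis using assms by (auto simp: jac_def)
qed

lemma jac_rmult:
  assumes "a \<in> jac R" "b \<in> carrier R" shows "a \<otimes> b \<in> jac R"
proof -
  have "e \<otimes> x \<otimes> (a \<otimes> b) \<otimes> y \<otimes> e = e \<otimes> x \<otimes> a \<otimes> (b \<otimes> y) \<otimes> e"
    if "primitive R e" "x \<in> carrier R" "y \<in> carrier R" for e x y
    using that assms by (simp add: m_assoc primitive_closed jac_closed)
  then show ?thesis using assms by (auto simp: jac_def)
qed

lemma jac_zero: "\<zero> \<in> jac R"
  by (auto simp: jac_def primitive_def)

text \<open>If \<open>e x (a + b) y e = e\<close>, two elements of the local ring \<open>eAe\<close>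
  add up to its unit, so one of them is invertible there; this contradicts membership of
  \<open>a\<close> or of \<open>b\<close> in the radical.\<close>

lemma jac_add:
  assumes a: "a \<in> jac R" and b: "b \<in> jac R" shows "a \<oplus> b \<in> jac R"
proof -
  note c = jac_closed[OF a] jac_closed[OF b]
  have "e \<otimes> x \<otimes> (a \<oplus> b) \<otimes> y \<otimes> e \<noteq> e" if e: "primitive R e"
    and xy: "x \<in> carrier R" "y \<in> carrier R" for e x y
  proof
    note ec = primitive_closed[OF e] and ee = primitive_idem[OF e]
    let ?f = "\<lambda>a. e \<otimes> x \<otimes> a \<otimes> y \<otimes> e"
    assume "?f (a \<oplus> b) = e"
    moreover have "?f (a \<oplus> b) = ?f a \<oplus> ?f b" using ec xy c by (simp add: l_distr r_distr)
    ultimately have sum: "?f a \<oplus> ?f b = e" by simp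
    have fb: "e \<ominus> ?f a = ?f b"
      using ec xy c by (subst sum[symmetric], intro add_diff_cancel_l) simp_all
    have corner: "?f a \<in> carrier R" "e \<otimes> ?f a = ?f a" "?f a \<otimes> e = ?f a"
      using ec ee xy c by (simp_all add: m_assoc[symmetric]) (simp_all add: m_assoc)
    have no: "\<not> unit_in R e (?f d)" if d: "d \<in> jac R" for d
    proof
      assume "unit_in R e (?f d)"
      then obtain v where v: "v \<in> carrier R" "v \<otimes> e = v" "?f d \<otimes> v = e" by (auto simp: unit_in_def)
      have "e \<otimes> x \<otimes> d \<otimes> (y \<otimes> e \<otimes> v) \<otimes> e = ?f d \<otimes> v"
        using v ec ee xy jac_closed[OF d] by (simp add: m_assoc)
      then show False using d e xy v ec unfolding jac_def by auto
    qed
    from e corner have "unit_in R e (?f a) \<or> unit_in R e (e \<ominus> ?f a)" by (simp add: primitive_def)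
    then show False using no[OF a] no[OF b] by (simp add: fb)
  qed
  then show ?thesis using c by (auto simp: jac_def)
qed

lemma jac_neg: "a \<in> jac R \<Longrightarrow> \<ominus> a \<in> jac R"
  using jac_lmult[of a "\<ominus> \<one>"] jac_closed[of a] by (simp add: l_minus)

lemma jac_diff: "a \<in> jac R \<Longrightarrow> b \<in> jac R \<Longrightarrow> a \<ominus> b \<in> jac R"
  using jac_add[of a "\<ominus> b"] jac_neg[of b] by (simp add: minus_eq)

lemma primitive_not_jac: "primitive R e \<Longrightarrow> e \<notin> jac R"
proof
  assume e: "primitive R e" and "e \<in> jac R"
  from jacD[OF this(2) e one_closed one_closed] show False
    using primitive_closed[OF e] primitive_idem[OF e] by simp
qed

text \<open>If \<open>g\<close> is invertible in \<open>eAe\<close>, it can be cancelled in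
  \<open>g g = g e\<close>; otherwise \<open>e - g\<close> is invertible, and
  \<open>(e - g) g = 0\<close>.\<close>

lemma idempotent_corner:
  assumes e: "primitive R e" and g: "g \<in> carrier R" "e \<otimes> g = g" "g \<otimes> e = g" "g \<otimes> g = g"
  shows "g = e \<or> g = \<zero>"
proof -
  note ec = primitive_closed[OF e]
  consider "unit_in R e g" | "unit_in R e (e \<ominus> g)" using e g by (auto simp: primitive_def)
  then show ?thesis
  proof cases
    case 1
    then obtain v where v: "v \<in> carrier R" "g \<otimes> v = e" by (auto simp: unit_in_def)
    then have "g = e" using g by (metis m_assoc)
    then show ?thesis ..
  next
    case 2
    then obtain v where v: "v \<in> carrier R" "v \<otimes> (e \<ominus> g) = e" by (auto simp: unit_in_def)
    have "(e \<ominus> g) \<otimes> g = \<zero>" using g ec by (simp add: minus_eq l_distr l_minus r_neg)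
    then have "v \<otimes> (e \<ominus> g) \<otimes> g = \<zero>" using v(1) g ec by (simp add: m_assoc)
    then show ?thesis using g v by simp
  qed
qed

text \<open>Lying outside the radical gives \<open>f = p q\<close> with \<open>p\<close> in
  \<open>fAe\<close> a left multiple of \<open>a\<close> and \<open>q\<close> in \<open>eAf\<close>.
  Then \<open>q p\<close> is a nonzero idempotent of the local ring \<open>eAe\<close>, hence equal
  to \<open>e\<close>. Elements outside the radical are cancelled in this way throughout.\<close>

lemma not_jac_left:
  assumes e: "primitive R e" and a: "a \<in> carrier R" "a \<otimes> e = a" "a \<notin> jac R"
  shows "\<exists>b\<in>carrier R. b \<otimes> a = e"
proof -
  note ec = primitive_closed[OF e] and ee = primitive_idem[OF e]
  obtain f x y where f: "primitive R f" and xy: "x \<in> carrier R" "y \<in> carrier R"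
    and eq: "f \<otimes> x \<otimes> a \<otimes> y \<otimes> f = f"
    using a unfolding jac_def by auto
  note fc = primitive_closed[OF f] and ff = primitive_idem[OF f]
  define p where "p = f \<otimes> x \<otimes> a"
  define q where "q = e \<otimes> y \<otimes> f"
  have c: "p \<in> carrier R" "q \<in> carrier R" using ec fc xy a by (auto simp: p_def q_def)
  have pq: "p \<otimes> q = f"
  proof -
    have "p \<otimes> q = f \<otimes> x \<otimes> (a \<otimes> e) \<otimes> y \<otimes> f"
      using ec fc xy a(1) by (simp add: p_def q_def m_assoc)
    then show ?thesis using a eq by simp
  qed
  have qf: "q \<otimes> f = q" and fp: "f \<otimes> p = p" and pe: "p \<otimes> e = p" and eq': "e \<otimes> q = q"
    using ec fc xy a ff ee by (simp_all add: p_def q_def m_assoc) (simp_all add: m_assoc[symmetric])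
  have "(q \<otimes> p) \<otimes> (q \<otimes> p) = q \<otimes> (p \<otimes> q) \<otimes> p" using c by (simp add: m_assoc)
  then have "(q \<otimes> p) \<otimes> (q \<otimes> p) = q \<otimes> p" using qf c pq by simp
  then have "q \<otimes> p = e \<or> q \<otimes> p = \<zero>"
    using c ec pe eq' by (intro idempotent_corner[OF e]) (simp_all add: m_assoc, simp add:
      m_assoc[symmetric])
  moreover have "q \<otimes> p \<noteq> \<zero>"
  proof
    assume "q \<otimes> p = \<zero>"
    then have "p \<otimes> (q \<otimes> p) \<otimes> q = \<zero>" using c by simp
    moreover have "p \<otimes> (q \<otimes> p) \<otimes> q = (p \<otimes> q) \<otimes> (p \<otimes> q)" using c by (simp add: m_assoc)
    ultimately have "f = \<zero>" using pq ff by simp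
    then show False using f by (simp add: primitive_def)
  qed
  ultimately have "q \<otimes> (f \<otimes> x) \<otimes> a = e" using c fc xy a by (simp add: p_def m_assoc)
  then show ?thesis using c fc xy by (intro bexI[of _ "q \<otimes> (f \<otimes> x)"]) auto
qed

lemma not_jac_right:
  assumes e: "primitive R e" and a: "a \<in> carrier R" "e \<otimes> a = a" "a \<notin> jac R"
  shows "\<exists>b\<in>carrier R. a \<otimes> b = e"
proof -
  interpret op: ring "opposite_ring R" by (rule ring_opposite)
  show ?thesis using op.not_jac_left[of e a] assms by (simp add: jac_opposite)
qed

text \<open>For an idempotent \<open>e\<close> this is the left ideal \<open>Ae\<close>, described
  by an equation that is easy to check.\<close>

definition pid :: "'a \<Rightarrow> 'a set" where
  "pid e = {a \<in> carrier R. a \<otimes> e = a}"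

end

abbreviation pmod :: "('a, 'r) ring_scheme \<Rightarrow> 'a \<Rightarrow> ('a, 'a) module" where
  "pmod A e \<equiv> restr (reg A) (ring.pid A e)"

section \<open>The projective modules \<open>Ae\<close>\<close>

context ring
begin

lemma submodule_pid: "e \<in> carrier R \<Longrightarrow> submodule (pid e) R (reg R)"
  by (intro left_module.submoduleI[OF left_module_reg]) (auto simp: pid_def l_distr m_assoc)

lemma left_module_pmod: "e \<in> carrier R \<Longrightarrow> left_module R (pmod R e)"
  by (rule left_module.left_module_restr[OF left_module_reg submodule_pid])

lemma submodule_pmod: "e \<in> carrier R \<Longrightarrow>
    submodule U R (pmod R e) \<longleftrightarrow> submodule U R (reg R) \<and> U \<subseteq> pid e"
  by (rule left_module.submodule_restr[OF left_module_reg submodule_pid])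

lemma pid_self: "e \<in> carrier R \<Longrightarrow> e \<otimes> e = e \<Longrightarrow> e \<in> pid e"
  by (simp add: pid_def)

lemma fg_module_pmod:
  assumes "e \<in> carrier R" "e \<otimes> e = e"
  shows "fg_module R (pmod R e)"
proof -
  interpret P: left_module R "pmod R e" by (rule left_module_pmod[OF assms(1)])
  show ?thesis
  proof (rule P.fg_module_cyclic[of e])
    fix y assume "y \<in> carrier (pmod R e)"
    then show "\<exists>a\<in>carrier R. y = a \<odot>\<^bsub>pmod R e\<^esub> e" by (intro bexI[of _ y]) (auto simp: pid_def)
  qed (use assms in \<open>simp add: pid_def\<close>)
qed

lemma fg_module_reg: "fg_module R (reg R)"
  by (intro left_module.fg_module_cyclic[OF left_module_reg, of \<one>]) auto

text \<open>As \<open>y = y e\<close> for \<open>y\<close> in \<open>Ae\<close>, letting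
  \<open>y\<close> act on a preimage of \<open>g e\<close> lifts \<open>g\<close>.\<close>

lemma projective_module_pmod:
  assumes e: "e \<in> carrier R" "e \<otimes> e = e"
  shows "projective_module R (pmod R e)"
  unfolding projective_module_def
proof (intro conjI allI impI fg_module_pmod[OF e])
  fix X Y :: "'a cat_module" and p g
  assume *: "fg_module R X \<and> fg_module R Y \<and> p \<in> module_hom R X Y \<and> p ` carrier X = carrier Y \<and>
    g \<in> module_hom R (pmod R e) Y"
  interpret X: left_module R X using * by (simp add: fg_module_def)
  interpret p: left_module_hom R X Y p using * by (intro left_module_homI) (auto simp: fg_module_def)
  interpret g: left_module_hom R "pmod R e" Y g using * left_module_pmod[OF e(1)]
    by (intro left_module_homI) (auto simp: fg_module_def)
  have "g e \<in> p ` carrier X" using * g.hom_closed[of e] pid_self[OF e] by simp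
  then obtain x where x: "x \<in> carrier X" "g e = p x" by blast
  show "\<exists>h\<in>module_hom R (pmod R e) X. \<forall>y\<in>carrier (pmod R e). p (h y) = g y"
  proof (intro bexI[of _ "\<lambda>a. a \<odot>\<^bsub>X\<^esub> x"] ballI)
    show "(\<lambda>a. a \<odot>\<^bsub>X\<^esub> x) \<in> module_hom R (pmod R e) X"
      using x by (intro module_homI) (auto simp: pid_def X.smult_closed X.smult_l_distr X.smult_assoc)
    fix y assume y: "y \<in> carrier (pmod R e)"
    then have "y = y \<otimes> e" "y \<in> carrier R" by (auto simp: pid_def)
    then show "p (y \<odot>\<^bsub>X\<^esub> x) = g y"
      using x p.hom_smult[of y x] g.hom_smult[of y e] pid_self[OF e] by simp
  qed
qed

lemma jac_pid_submodule: "e \<in> carrier R \<Longrightarrow> submodule (pid e \<inter> jac R) R (reg R)"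
  by (intro left_module.submoduleI[OF left_module_reg])
    (auto simp: pid_def l_distr m_assoc jac_zero jac_add jac_lmult)

text \<open>An element of \<open>Ae\<close> outside the radical has \<open>e\<close> as a left
  multiple and so generates \<open>Ae\<close>.\<close>

lemma pmod_local:
  assumes e: "primitive R e" and U: "submodule U R (reg R)" "U \<subseteq> pid e" "U \<noteq> pid e"
  shows "U \<subseteq> jac R"
proof (rule ccontr)
  note ec = primitive_closed[OF e]
  interpret M: left_module R "reg R" by (rule left_module_reg)
  assume "\<not> U \<subseteq> jac R"
  then obtain a where a: "a \<in> U" "a \<notin> jac R" by blast
  then have "\<exists>b\<in>carrier R. b \<otimes> a = e" using U(2) by (intro not_jac_left[OF e]) (auto simp: pid_def)
  then have "e \<in> U" using M.submodule_smult[OF U(1) _ a(1)] by auto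
  then have "x \<otimes> e \<in> U" if "x \<in> carrier R" for x using M.submodule_smult[OF U(1) that] by simp
  then have "pid e \<subseteq> U" unfolding pid_def by (metis (mono_tags, lifting) mem_Collect_eq subsetI)
  with U show False by blast
qed

text \<open>Write \<open>e = u + v\<close> along the decomposition. Then
  \<open>u - u u = u v\<close> lies in both summands and vanishes, and likewise for
  \<open>v\<close>, so \<open>u\<close> and \<open>v\<close> are orthogonal idempotents of
  \<open>eAe\<close>.\<close>

lemma corner_decomposition:
  assumes e: "e \<in> carrier R" "e \<otimes> e = e" and d: "internal_dsum R (pmod R e) U V"
  obtains u v where "u \<in> U" "v \<in> V" "u \<in> carrier R" "v \<in> carrier R" "e = u \<oplus> v"
    "u \<otimes> u = u" "v \<otimes> v = v" "u \<otimes> e = u" "v \<otimes> e = v" "e \<otimes> u = u" "e \<otimes> v = v"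
proof -
  interpret M: left_module R "reg R" by (rule left_module_reg)
  interpret P: left_module R "pmod R e" by (rule left_module_pmod[OF e(1)])
  have U: "submodule U R (reg R)" "U \<subseteq> pid e" and V: "submodule V R (reg R)" "V \<subseteq> pid e"
    and sum: "U <+>\<^bsub>pmod R e\<^esub> V = pid e" and int: "U \<inter> V = {\<zero>}"
    using d submodule_pmod[OF e(1)] by (auto simp: internal_dsum_def)
  obtain u v where uv: "u \<in> U" "v \<in> V" "e = u \<oplus> v"
    using sum pid_self[OF e] P.set_add_iff[of e U V] by auto
  have c: "u \<in> carrier R" "v \<in> carrier R" "u \<otimes> e = u" "v \<otimes> e = v"
    using uv U V by (auto simp: pid_def)
  have "u = u \<otimes> u \<oplus> u \<otimes> v" "v = v \<otimes> v \<oplus> v \<otimes> u"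
    using c uv(3) r_distr[of u v u] r_distr[of u v v] by (simp_all add: a_comm)
  then have "u \<ominus> u \<otimes> u = u \<otimes> v" "v \<ominus> v \<otimes> v = v \<otimes> u"
    using add_diff_cancel_l[of "u \<otimes> u" "u \<otimes> v"] add_diff_cancel_l[of "v \<otimes> v" "v \<otimes> u"] c by simp_all
  moreover have "u \<otimes> v \<in> V" "v \<otimes> u \<in> U" "u \<ominus> u \<otimes> u \<in> U" "v \<ominus> v \<otimes> v \<in> V"
    using M.submodule_smult[OF U(1) _ uv(1)] M.submodule_smult[OF V(1) _ uv(2)] c
      M.submodule_diff[OF U(1) uv(1)] M.submodule_diff[OF V(1) uv(2)]
    by auto
  ultimately have z: "u \<otimes> v = \<zero>" "v \<otimes> u = \<zero>" using int by auto
  have "u \<otimes> u = u" using c uv(3) z r_distr[of u v u] by simp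
  moreover have "v \<otimes> v = v" using c uv(3) z r_distr[of u v v] by simp
  moreover have "e \<otimes> u = u" "e \<otimes> v = v" using c uv(3) z calculation l_distr[of u v] by simp_all
  ultimately show ?thesis using that uv c by blast
qed

lemma indecomposable_pmod:
  assumes e: "primitive R e"
  shows "indecomposable_module R (pmod R e)"
  unfolding indecomposable_module_def
proof (intro conjI allI impI)
  note ec = primitive_closed[OF e] and ee = primitive_idem[OF e]
  interpret M: left_module R "reg R" by (rule left_module_reg)
  show "left_module R (pmod R e)" by (rule left_module_pmod[OF ec])
  show "carrier (pmod R e) \<noteq> {\<zero>\<^bsub>pmod R e\<^esub>}" using pid_self[OF ec ee] e by (auto simp: primitive_def)
  fix U V assume d: "internal_dsum R (pmod R e) U V"
  have U: "submodule U R (reg R)" "U \<subseteq> pid e" and V: "submodule V R (reg R)" "V \<subseteq> pid e"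
    and int: "U \<inter> V = {\<zero>}"
    using d submodule_pmod[OF ec] by (auto simp: internal_dsum_def)
  have full: "pid e \<subseteq> W" if "submodule W R (reg R)" "e \<in> W" for W
  proof
    fix x assume x: "x \<in> pid e"
    then have "x \<otimes> e \<in> W" using M.submodule_smult[OF that(1) _ that(2), of x] by (simp add: pid_def)
    with x show "x \<in> W" by (simp add: pid_def)
  qed
  obtain u v where uv: "u \<in> U" "v \<in> V" "u \<in> carrier R" "v \<in> carrier R" "e = u \<oplus> v"
    "u \<otimes> u = u" "u \<otimes> e = u" "e \<otimes> u = u"
    by (rule corner_decomposition[OF ec ee d]) blast
  from idempotent_corner[OF e uv(3,8,7,6)] consider "u = e" | "u = \<zero>" by blast
  then show "U = {\<zero>\<^bsub>pmod R e\<^esub>} \<or> V = {\<zero>\<^bsub>pmod R e\<^esub>}"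
  proof cases
    case 1
    then have "V = {\<zero>}" using full[OF U(1)] uv(1) V(2) int by blast
    then show ?thesis by simp
  next
    case 2
    then have "v = e" using uv by simp
    then have "U = {\<zero>}" using full[OF V(1)] uv(2) U(2) int by blast
    then show ?thesis by simp
  qed
qed

text \<open>The left ideals generated by the powers of \<open>u\<close> become constant, which gives
  \<open>u^m = b u^(m+1)\<close>. Cancelling the powers makes \<open>b\<close> a left inverse, and
  cancelling \<open>u\<close> once more shows that it is a right inverse after being cut down to
  \<open>e b e\<close>.\<close>

lemma unit_in_if_cancel:
  assumes e: "e \<in> carrier R" "e \<otimes> e = e" and h: "height_le R (pmod R e) n"
    and u: "u \<in> carrier R" "e \<otimes> u = u" "u \<otimes> e = u"
    and inj: "\<And>a. a \<in> pid e \<Longrightarrow> a \<otimes> u = \<zero> \<Longrightarrow> a = \<zero>"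
  shows "unit_in R e u"
proof -
  interpret M: left_module R "reg R" by (rule left_module_reg)
  interpret P: left_module R "pmod R e" by (rule left_module_pmod[OF e(1)])
  \<comment> \<open>Powers in the corner ring: the factor \<open>e\<close> turns the zeroth power
    into the unit of \<open>eAe\<close>.\<close>
  define w where "w m = e \<otimes> u [^] (m::nat)" for m
  have w: "w m \<in> carrier R" "w m \<otimes> e = w m" "e \<otimes> w m = w m" "w (Suc m) = u \<otimes> w m" for m
  proof -
    show 1: "w m \<in> carrier R" for m using e u by (simp add: w_def)
    show 2: "e \<otimes> w m = w m" for m using e u by (simp add: w_def m_assoc[symmetric])
    have "u \<otimes> u [^] m = u [^] m \<otimes> u" using u(1) nat_pow_comm[of u 1 m] by simp
    then have "w (Suc m) = e \<otimes> (u \<otimes> u [^] m)" by (simp add: w_def)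
    then have "w (Suc m) = (e \<otimes> u) \<otimes> u [^] m"
      using m_assoc[of e u "u [^] m"] e u by simp
    moreover have "u \<otimes> w m = (u \<otimes> e) \<otimes> u [^] m"
      using m_assoc[of u e "u [^] m"] e u by (simp add: w_def)
    ultimately show "w (Suc m) = u \<otimes> w m" using u by simp
    show "w m \<otimes> e = w m"
      using e u by (induction m) (simp_all add: w_def m_assoc)
  qed
  define C where "C m = {a \<otimes> w m | a. a \<in> carrier R}" for m
  have C: "submodule (C m) R (pmod R e)" for m
    unfolding submodule_pmod[OF e(1)] C_def
    using M.submodule_smult_image[of "w m" "carrier R"] w[of m] e by (auto simp: pid_def m_assoc)
  have "C (Suc m) \<subseteq> C m" for m
  proof
    fix x assume "x \<in> C (Suc m)"
    then obtain a where "a \<in> carrier R" "x = (a \<otimes> u) \<otimes> w m"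
      using w u by (auto simp: m_assoc C_def)
    then show "x \<in> C m" using u(1) unfolding C_def by blast
  qed
  from P.height_le_chain_stable(1)[OF h, of C, OF C this] obtain m where m: "\<And>k. k \<ge> m \<Longrightarrow> C k = C m"
    by blast
  have "e \<otimes> w m \<in> C (Suc m)" unfolding m[OF le_SucI[OF order.refl]] using e by (auto simp: C_def)
  then obtain b where b: "b \<in> carrier R" "w m = b \<otimes> (u \<otimes> w m)"
    using w(3)[of m] w(4)[of m] by (auto simp: C_def)
  have injw: "a = \<zero>" if "a \<in> pid e" "a \<otimes> w k = \<zero>" for a k
    using that
  proof (induction k arbitrary: a)
    case 0
    then show ?case using e by (simp add: w_def pid_def)
  next
    case (Suc k)
    have "a \<otimes> u \<in> pid e" "a \<otimes> u \<otimes> w k = \<zero>"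
      using Suc.prems u w(1,4)[of k] e(1) m_assoc[of a u e] m_assoc[of a u "w k"] by (auto simp: pid_def)
    then have "a \<otimes> u = \<zero>" by (rule Suc.IH)
    then show ?case using Suc.prems inj by blast
  qed
  have "e \<ominus> b \<otimes> u = \<zero>"
  proof (rule injw)
    show "e \<ominus> b \<otimes> u \<in> pid e"
      using e b u by (simp add: pid_def minus_eq l_distr l_minus m_assoc)
    show "(e \<ominus> b \<otimes> u) \<otimes> w m = \<zero>"
      using e b u w[of m] by (simp add: minus_eq l_distr l_minus m_assoc r_neg)
  qed
  then have bu: "b \<otimes> u = e" using e b u right_minus_eq[of e "b \<otimes> u"] by simp
  let ?v = "e \<otimes> b \<otimes> e"
  have v: "?v \<in> carrier R" "e \<otimes> ?v = ?v" "?v \<otimes> e = ?v"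
    using e b by (simp_all add: m_assoc[symmetric]) (simp add: m_assoc)
  have vu: "?v \<otimes> u = e" using e b u bu by (simp add: m_assoc)
  have "u \<otimes> ?v \<ominus> e = \<zero>"
  proof (rule inj)
    show "u \<otimes> ?v \<ominus> e \<in> pid e"
      using e b u by (simp add: pid_def minus_eq l_distr l_minus m_assoc)
    have "u \<otimes> ?v \<otimes> u = u" using vu u v(1) by (simp add: m_assoc)
    then show "(u \<otimes> ?v \<ominus> e) \<otimes> u = \<zero>"
      using e u v(1) by (simp add: minus_eq l_distr l_minus r_neg)
  qed
  then have "u \<otimes> ?v = e" using e u v(1) right_minus_eq[of "u \<otimes> ?v" e] by simp
  with vu v show ?thesis unfolding unit_in_def by blast
qed

text \<open>Fitting's lemma for right multiplication by an element of \<open>eAe\<close>.\<close>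

lemma primitive_if_indecomposable:
  assumes e: "e \<in> carrier R" "e \<otimes> e = e" and ind: "indecomposable_module R (pmod R e)"
    and h: "height_le R (pmod R e) n"
  shows "primitive R e"
  unfolding primitive_def
proof (intro conjI ballI impI e)
  interpret M: left_module R "reg R" by (rule left_module_reg)
  interpret P: left_module R "pmod R e" by (rule left_module_pmod[OF e(1)])
  show "e \<noteq> \<zero>"
  proof
    assume "e = \<zero>"
    then have "pid e = {\<zero>}" by (auto simp: pid_def)
    then show False using ind by (simp add: indecomposable_module_def)
  qed
  fix u assume u: "u \<in> carrier R" and "e \<otimes> u = u \<and> u \<otimes> e = u"
  then have eu: "e \<otimes> u = u" and ue: "u \<otimes> e = u" by auto
  define w where "w m = e \<otimes> u [^] (m::nat)" for m
  have w: "w m \<in> carrier R" "w m \<otimes> e = w m" "e \<otimes> w m = w m" "w (Suc m) = u \<otimes> w m" "w (Suc m) = w m \<otimes> u"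
    for m
  proof -
    show 1: "w m \<in> carrier R" for m using e u by (simp add: w_def)
    show 2: "e \<otimes> w m = w m" for m using e u by (simp add: w_def m_assoc[symmetric])
    have "u \<otimes> u [^] m = u [^] m \<otimes> u" using u(1) nat_pow_comm[of u 1 m] by simp
    then have "w (Suc m) = e \<otimes> (u \<otimes> u [^] m)" by (simp add: w_def)
    then have "w (Suc m) = (e \<otimes> u) \<otimes> u [^] m"
      using m_assoc[of e u "u [^] m"] e u by simp
    moreover have "u \<otimes> w m = (u \<otimes> e) \<otimes> u [^] m"
      using m_assoc[of u e "u [^] m"] e u by (simp add: w_def)
    ultimately show "w (Suc m) = u \<otimes> w m" using eu ue by simp
    show "w (Suc m) = w m \<otimes> u" using e u by (simp add: w_def m_assoc)
    show "w m \<otimes> e = w m"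
      using e u ue by (induction m) (simp_all add: w_def m_assoc)
  qed
  have ww: "w (m + k) = w m \<otimes> w k" for m k
  proof (induction m)
    case 0
    then show ?case using w(3)[of k] e u by (simp add: w_def)
  next
    case (Suc m)
    then show ?case using w u by (simp add: m_assoc)
  qed
  \<comment> \<open>\<open>C m\<close> and \<open>K m\<close> are image and kernel of right
    multiplication by the \<open>m\<close>-th power of \<open>u\<close> on
    \<open>Ae\<close>.\<close>
  define C where "C m = {a \<otimes> w m | a. a \<in> carrier R}" for m
  define K where "K m = {a \<in> pid e. a \<otimes> w m = \<zero>}" for m
  have C: "submodule (C m) R (pmod R e)" for m
    unfolding submodule_pmod[OF e(1)] C_def
    using M.submodule_smult_image[of "w m" "carrier R"] w[of m] e by (auto simp: pid_def m_assoc)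
  have K: "submodule (K m) R (pmod R e)" for m
    unfolding submodule_pmod[OF e(1)] K_def using w[of m] e
    by (intro conjI M.submoduleI) (auto simp: pid_def l_distr m_assoc)
  have "C (Suc m) \<subseteq> C m" for m
  proof
    fix x assume "x \<in> C (Suc m)"
    then obtain a where "a \<in> carrier R" "x = (a \<otimes> u) \<otimes> w m"
      using w u by (auto simp: m_assoc C_def)
    then show "x \<in> C m" using u(1) unfolding C_def by blast
  qed
  from P.height_le_chain_stable(1)[OF h, of C, OF C this] obtain n1 where n1: "\<And>m. m \<ge> n1 \<Longrightarrow> C m = C n1"
    by blast
  have Kmono: "K m \<subseteq> K (Suc m)" for m
    using m_assoc[of _ "w m" u, symmetric] w(1)[of m] w(5)[of m] u by (auto simp: K_def pid_def)
  from P.height_le_chain_stable(2)[OF h, of K, OF K this] obtain n2 where n2: "\<And>m. m \<ge> n2 \<Longrightarrow> K m = K n2"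
    by blast
  \<comment> \<open>Past both points of stabilisation; the successor makes \<open>N\<close>
    positive, so that \<open>K 1\<close> is contained in \<open>K N\<close>.\<close>
  define N where "N = Suc (max n1 n2)"
  have CN: "C (N + N) = C N" using n1[of N] n1[of "N + N"] by (simp add: N_def)
  have KN: "K (N + N) = K N" using n2[of N] n2[of "N + N"] by (simp add: N_def)
  have "internal_dsum R (pmod R e) (C N) (K N)"
    unfolding internal_dsum_def
  proof (intro conjI C K)
    show "C N <+>\<^bsub>pmod R e\<^esub> K N = carrier (pmod R e)"
    proof
      show "C N <+>\<^bsub>pmod R e\<^esub> K N \<subseteq> carrier (pmod R e)"
        by (rule P.submodule_subset[OF P.submodule_set_add[OF C K]])
      show "carrier (pmod R e) \<subseteq> C N <+>\<^bsub>pmod R e\<^esub> K N"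
      proof
        fix a assume "a \<in> carrier (pmod R e)"
        then have a: "a \<in> carrier R" "a \<otimes> e = a" by (auto simp: pid_def)
        have "a \<otimes> w N \<in> C (N + N)" unfolding CN using a by (auto simp: C_def)
        then obtain b where b: "b \<in> carrier R" "a \<otimes> w N = b \<otimes> (w N \<otimes> w N)" by (auto simp: C_def ww)
        let ?z = "a \<ominus> b \<otimes> w N"
        have "?z \<in> K N"
          using a b w[of N] e by (simp add: K_def pid_def minus_eq l_distr l_minus m_assoc r_neg)
        moreover have "b \<otimes> w N \<in> C N" using b by (auto simp: C_def)
        moreover have "a = b \<otimes> w N \<oplus> ?z"
          using a b w(1)[of N] by (simp add: minus_eq a_ac r_neg1) (simp add: a_lcomm[of a] r_neg)
        ultimately show "a \<in> C N <+>\<^bsub>pmod R e\<^esub> K N" unfolding P.set_add_iff by auto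
      qed
    qed
    show "C N \<inter> K N = {\<zero>\<^bsub>pmod R e\<^esub>}"
    proof
      show "C N \<inter> K N \<subseteq> {\<zero>\<^bsub>pmod R e\<^esub>}"
      proof
        fix x assume "x \<in> C N \<inter> K N"
        then obtain b where b: "b \<in> carrier R" "x = b \<otimes> w N" "b \<otimes> w N \<otimes> w N = \<zero>"
          by (auto simp: C_def K_def)
        then have "b \<otimes> e \<in> K (N + N)"
          using e w[of N] w(3)[of "N + N"] by (simp add: K_def pid_def m_assoc ww)
        then have "b \<otimes> e \<otimes> w N = \<zero>" unfolding KN by (simp add: K_def)
        then show "x \<in> {\<zero>\<^bsub>pmod R e\<^esub>}" using b w[of N] e by (simp add: m_assoc)
      qed
      show "{\<zero>\<^bsub>pmod R e\<^esub>} \<subseteq> C N \<inter> K N"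
        using P.submodule_zero[OF C[of N]] P.submodule_zero[OF K[of N]] by auto
    qed
  qed
  then consider "C N = {\<zero>}" | "K N = {\<zero>}" using ind by (auto simp: indecomposable_module_def)
  then show "unit_in R e u \<or> unit_in R e (e \<ominus> u)"
  proof cases
    case 1
    \<comment> \<open>Zero image: \<open>u\<close> is nilpotent, and \<open>a = a u\<close> implies
      \<open>a = a u^N = 0\<close>, so \<open>e - u\<close> can be cancelled.\<close>
    have "e \<otimes> w N \<in> C N" using e by (auto simp: C_def)
    then have wN: "w N = \<zero>" using 1 w by simp
    have "unit_in R e (e \<ominus> u)"
    proof (rule unit_in_if_cancel[OF e h])
      fix a assume a: "a \<in> pid e" and "a \<otimes> (e \<ominus> u) = \<zero>"
      then have ac: "a \<in> carrier R" "a \<otimes> e = a" and "a \<ominus> a \<otimes> u = \<zero>"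
        using e u by (auto simp: pid_def minus_eq r_distr r_minus)
      then have au: "a = a \<otimes> u" using u right_minus_eq[of a "a \<otimes> u"] by simp
      have "a = a \<otimes> w m" for m
      proof (induction m)
        case 0
        then show ?case using ac e by (simp add: w_def)
      next
        case (Suc m)
        have "a \<otimes> w (Suc m) = (a \<otimes> u) \<otimes> w m" using w(1,4)[of m] ac u by (simp add: m_assoc)
        then show ?case using Suc au by simp
      qed
      from this[of N] show "a = \<zero>" using wN ac by simp
    qed (use e u eu ue in \<open>simp_all add: minus_eq l_distr r_distr l_minus r_minus\<close>)
    then show ?thesis by blast
  next
    case 2
    \<comment> \<open>The kernel is zero at the \<open>N\<close>-th power, hence already at the
      first, so \<open>u\<close> can be cancelled.\<close>
    have "K (Suc 0) \<subseteq> K N" using lift_Suc_mono_le[of K "Suc 0" N, OF Kmono] by (simp add: N_def)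
    then have "unit_in R e u"
      using 2 e u eu w(4)[of 0]
      by (intro unit_in_if_cancel[OF e h u eu ue]) (auto simp: K_def w_def)
    then show ?thesis by blast
  qed
qed

end

text \<open>A stand-in for a decomposition of the unit into orthogonal primitive idempotents:
  applied to the left ideal of elements that send \<open>x\<close> into \<open>N\<close>, it yields
  a primitive \<open>e\<close> with \<open>e x\<close> outside \<open>N\<close>.\<close>

locale enough_primitives = ring R for R (structure) +
  assumes ex_primitive: "submodule L R (reg R) \<Longrightarrow> \<one> \<notin> L \<Longrightarrow> \<exists>e. primitive R e \<and> e \<notin> L"

text \<open>Take an idempotent \<open>e\<close> outside \<open>L\<close> with \<open>Ae\<close>
  minimal. If \<open>e = u + v\<close> along a decomposition of \<open>Ae\<close>, one of
  \<open>u\<close>, \<open>v\<close> lies outside \<open>L\<close>, and minimality makes the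
  corresponding summand all of \<open>Ae\<close>. So \<open>Ae\<close> is indecomposable, and
  Fitting's lemma applies.\<close>

lemma enough_primitives_if_dcc:
  fixes A :: "('a, 'r) ring_scheme"
  assumes A: "ring A" and dcc: "dcc_below A (reg A) (carrier A)"
    and h: "\<And>e. e \<in> carrier A \<Longrightarrow> e \<otimes>\<^bsub>A\<^esub> e = e \<Longrightarrow> indecomposable_module A (pmod A e) \<Longrightarrow>
      height_le A (pmod A e) n"
  shows "enough_primitives A"
proof -
  interpret ring A by (fact A)
  interpret M: left_module A "reg A" by (rule left_module_reg)
  show ?thesis
  proof
    fix L assume L: "submodule L A (reg A)" and one: "\<one>\<^bsub>A\<^esub> \<notin> L"
    let ?P = "\<lambda>e. e \<in> carrier A \<and> e \<otimes>\<^bsub>A\<^esub> e = e \<and> e \<notin> L"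
    have "\<exists>e. ?P e \<and> (\<forall>f. ?P f \<longrightarrow> \<not> pid f \<subset> pid e)"
      by (rule dcc_below_minimal[OF dcc, of ?P "\<one>\<^bsub>A\<^esub>"]) (use one submodule_pid in \<open>auto simp: pid_def\<close>)
    then obtain e where e: "e \<in> carrier A" "e \<otimes>\<^bsub>A\<^esub> e = e" "e \<notin> L"
      and min: "\<And>f. f \<in> carrier A \<Longrightarrow> f \<otimes>\<^bsub>A\<^esub> f = f \<Longrightarrow> f \<notin> L \<Longrightarrow> \<not> pid f \<subset> pid e" by blast
    have full: "U = pid e"
      if u: "u \<in> U" "u \<in> carrier A" "u \<otimes>\<^bsub>A\<^esub> u = u" "u \<otimes>\<^bsub>A\<^esub> e = u" "u \<notin> L"
        and U: "submodule U A (reg A)" "U \<subseteq> pid e"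
      for u U
    proof -
      have "pid u \<subseteq> U"
      proof
        fix x assume "x \<in> pid u"
        then have "x \<in> carrier A" "x = x \<otimes>\<^bsub>A\<^esub> u" by (auto simp: pid_def)
        then show "x \<in> U" using M.submodule_smult[OF U(1) _ u(1), of x] by simp
      qed
      moreover have "\<not> pid u \<subset> pid e" using min u by blast
      ultimately show ?thesis using U(2) by blast
    qed
    have "indecomposable_module A (pmod A e)"
      unfolding indecomposable_module_def
    proof (intro conjI allI impI)
      show "left_module A (pmod A e)" by (rule left_module_pmod[OF e(1)])
      show "carrier (pmod A e) \<noteq> {\<zero>\<^bsub>pmod A e\<^esub>}"
        using pid_self[OF e(1,2)] e(3) M.submodule_zero[OF L] by auto
      fix U V assume d: "internal_dsum A (pmod A e) U V"
      have U: "submodule U A (reg A)" "U \<subseteq> pid e" and V: "submodule V A (reg A)" "V \<subseteq> pid e"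
        and int: "U \<inter> V = {\<zero>\<^bsub>A\<^esub>}"
        using d submodule_pmod[OF e(1)] by (auto simp: internal_dsum_def)
      obtain u v where uv: "u \<in> U" "v \<in> V" "u \<in> carrier A" "v \<in> carrier A" "e = u \<oplus>\<^bsub>A\<^esub> v"
        "u \<otimes>\<^bsub>A\<^esub> u = u" "v \<otimes>\<^bsub>A\<^esub> v = v" "u \<otimes>\<^bsub>A\<^esub> e = u" "v \<otimes>\<^bsub>A\<^esub> e = v"
        by (rule corner_decomposition[OF e(1,2) d]) blast
      have "u \<notin> L \<or> v \<notin> L" using e(3) uv(5) M.submodule_add[OF L, of u v] by auto
      then show "U = {\<zero>\<^bsub>pmod A e\<^esub>} \<or> V = {\<zero>\<^bsub>pmod A e\<^esub>}"
      proof
        assume "u \<notin> L"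
        then have "U = pid e" using uv by (intro full[OF _ _ _ _ _ U]) auto
        then show ?thesis using int V(2) by auto
      next
        assume "v \<notin> L"
        then have "V = pid e" using uv by (intro full[OF _ _ _ _ _ V]) auto
        then show ?thesis using int U(2) by auto
      qed
    qed
    then have "primitive A e" using primitive_if_indecomposable[OF e(1,2) _ h[OF e(1,2)]] by blast
    with e(3) show "\<exists>e. primitive A e \<and> e \<notin> L" by blast
  qed
qed

section \<open>Nakayama's lemma and the action of the radical on simple factors\<close>

context left_module
begin

text \<open>\<open>eje\<close> cannot be invertible in the local ring \<open>eAe\<close>, hence
  \<open>e - eje\<close> is; multiplying \<open>x - jx\<close> by \<open>e\<close> gives
  \<open>(e - eje) x\<close>, and the inverse recovers \<open>x\<close>.\<close>

lemma nakayama: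
  assumes e: "primitive R e" and N: "submodule N R M" and j: "j \<in> jac R"
    and x: "x \<in> carrier M" "e \<odot>\<^bsub>M\<^esub> x = x" "x \<ominus>\<^bsub>M\<^esub> j \<odot>\<^bsub>M\<^esub> x \<in> N"
  shows "x \<in> N"
proof -
  note ec = R.primitive_closed[OF e] and ee = R.primitive_idem[OF e] and jc = R.jac_closed[OF j]
  let ?u = "e \<otimes> j \<otimes> e"
  have u: "?u \<in> carrier R" "e \<otimes> ?u = ?u" "?u \<otimes> e = ?u"
    using ec ee jc by (simp_all add: R.m_assoc[symmetric]) (simp add: R.m_assoc)
  have "\<not> unit_in R e ?u"
  proof
    assume "unit_in R e ?u"
    then obtain v where v: "v \<in> carrier R" "v \<otimes> e = v" "?u \<otimes> v = e" by (auto simp: unit_in_def)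
    have "e \<otimes> \<one> \<otimes> j \<otimes> (e \<otimes> v) \<otimes> e = ?u \<otimes> v" using v ec ee jc by (simp add: R.m_assoc)
    moreover have "e \<otimes> v \<in> carrier R" using v ec by simp
    ultimately show False using R.jacD[OF j e R.one_closed, of "e \<otimes> v"] v(3) by simp
  qed
  then have "unit_in R e (e \<ominus> ?u)" using e u by (auto simp: primitive_def)
  then obtain v where v: "v \<in> carrier R" "v \<otimes> (e \<ominus> ?u) = e" by (auto simp: unit_in_def)
  have "(e \<ominus> ?u) \<odot>\<^bsub>M\<^esub> x = e \<odot>\<^bsub>M\<^esub> (x \<ominus>\<^bsub>M\<^esub> j \<odot>\<^bsub>M\<^esub> x)"
    using ec jc x u by (simp add: smult_diff_l smult_diff_r smult_assoc smult_closed)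
  then have "(e \<ominus> ?u) \<odot>\<^bsub>M\<^esub> x \<in> N" using submodule_smult[OF N ec x(3)] by simp
  then have "v \<odot>\<^bsub>M\<^esub> ((e \<ominus> ?u) \<odot>\<^bsub>M\<^esub> x) \<in> N" by (rule submodule_smult[OF N v(1)])
  then show ?thesis using v ec u x by (simp add: smult_assoc[symmetric])
qed

end

locale ep_module = left_module + enough_primitives
begin

lemma ex_primitive_smult:
  assumes N: "submodule N R M" and x: "x \<in> carrier M" "x \<notin> N"
  shows "\<exists>e. primitive R e \<and> e \<odot>\<^bsub>M\<^esub> x \<notin> N"
proof -
  let ?L = "{a \<in> carrier R. a \<odot>\<^bsub>M\<^esub> x \<in> N}"
  have "submodule ?L R (reg R)"
    by (intro left_module.submoduleI[OF R.left_module_reg])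
      (use x submoduleD[OF N] in \<open>auto simp: smult_l_distr smult_assoc\<close>)
  moreover have "\<one> \<notin> ?L" using x by (simp add: smult_one)
  ultimately show ?thesis using ex_primitive[of ?L] R.primitive_closed by blast
qed

text \<open>If some \<open>y = e a v\<close> were outside \<open>Z\<close>, then
  \<open>v = z + b y\<close> because \<open>V / Z\<close> is simple. So \<open>y\<close> equals
  \<open>e a b y\<close> modulo \<open>Z\<close>, and Nakayama's lemma puts \<open>y\<close> into
  \<open>Z\<close>.\<close>

lemma jac_adjacent:
  assumes adj: "adjacent R M Z V" and a: "a \<in> jac R" and v: "v \<in> V"
  shows "a \<odot>\<^bsub>M\<^esub> v \<in> Z"
proof (rule ccontr)
  assume av: "a \<odot>\<^bsub>M\<^esub> v \<notin> Z"
  have Z: "submodule Z R M" and V: "submodule V R M" and ZV: "Z \<subseteq> V"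
    and mid: "\<And>U. submodule U R M \<Longrightarrow> Z \<subseteq> U \<Longrightarrow> U \<subseteq> V \<Longrightarrow> U = Z \<or> U = V"
    using adj by (auto simp: adjacent_def)
  note ac = R.jac_closed[OF a] and vc = submodule_carrier[OF V v]
  obtain e where e: "primitive R e" and y: "e \<odot>\<^bsub>M\<^esub> (a \<odot>\<^bsub>M\<^esub> v) \<notin> Z"
    using ex_primitive_smult[OF Z smult_closed[OF ac vc] av] by blast
  note ec = R.primitive_closed[OF e] and ee = R.primitive_idem[OF e]
  define y where "y = e \<odot>\<^bsub>M\<^esub> (a \<odot>\<^bsub>M\<^esub> v)"
  have yc: "y \<in> carrier M" using ec ac vc by (simp add: y_def smult_closed)
  have yV: "y \<in> V" using ec ac v by (simp add: y_def submodule_smult[OF V])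
  have ey: "e \<odot>\<^bsub>M\<^esub> y = y" using ec ee ac vc by (simp add: y_def smult_assoc[symmetric] smult_closed
    R.m_assoc[symmetric])
  let ?U = "Z <+>\<^bsub>M\<^esub> cyc y"
  have U: "submodule ?U R M" "Z \<subseteq> ?U" "y \<in> ?U"
    using submodule_set_add[OF Z submodule_cyc[OF yc]] set_add_upper[OF Z submodule_cyc[OF yc]]
      cyc_self[OF yc] by auto
  moreover have "?U \<subseteq> V" by (intro set_add_least[OF V ZV] cyc_least[OF V yV])
  ultimately have "?U = V" using mid[of ?U] y by (auto simp: y_def)
  then obtain z b where zb: "z \<in> Z" "b \<in> carrier R" "v = z \<oplus>\<^bsub>M\<^esub> b \<odot>\<^bsub>M\<^esub> y"
    using v set_add_iff[of v Z "cyc y"] by (auto simp: cyc_def)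
  note zc = submodule_carrier[OF Z zb(1)]
  let ?j = "e \<otimes> (a \<otimes> b)"
  have "e \<odot>\<^bsub>M\<^esub> (a \<odot>\<^bsub>M\<^esub> v) = e \<odot>\<^bsub>M\<^esub> (a \<odot>\<^bsub>M\<^esub> z) \<oplus>\<^bsub>M\<^esub> ?j \<odot>\<^bsub>M\<^esub> y"
    by (subst zb(3)) (use ec ac zb(2) zc yc in \<open>simp add: smult_r_distr smult_assoc smult_closed\<close>)
  then have "y = e \<odot>\<^bsub>M\<^esub> (a \<odot>\<^bsub>M\<^esub> z) \<oplus>\<^bsub>M\<^esub> ?j \<odot>\<^bsub>M\<^esub> y" unfolding y_def[symmetric] .
  then have "y \<ominus>\<^bsub>M\<^esub> ?j \<odot>\<^bsub>M\<^esub> y = e \<odot>\<^bsub>M\<^esub> (a \<odot>\<^bsub>M\<^esub> z)"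
    using diff_eq[of y "?j \<odot>\<^bsub>M\<^esub> y" "e \<odot>\<^bsub>M\<^esub> (a \<odot>\<^bsub>M\<^esub> z)"] ec ac zb(2) zc yc by (simp add: smult_closed)
  then have "y \<ominus>\<^bsub>M\<^esub> ?j \<odot>\<^bsub>M\<^esub> y \<in> Z" using submodule_smult[OF Z] ec ac zb(1) by simp
  then have "y \<in> Z"
    using nakayama[OF e Z _ yc ey] R.jac_lmult[OF R.jac_rmult[OF a zb(2)] ec] by blast
  with y show False by (simp add: y_def)
qed

end

section \<open>Indecomposable projective modules over quadri-biserial algebras\<close>

lemma (in left_module_hom) image_preimage:
  assumes "f ` carrier M = carrier N" "submodule W A N"
  shows "f ` {x \<in> carrier M. f x \<in> W} = W"
proof
  show "W \<subseteq> f ` {x \<in> carrier M. f x \<in> W}"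
  proof
    fix w assume w: "w \<in> W"
    then have "w \<in> f ` carrier M" using N.submodule_carrier[OF assms(2)] assms(1) by simp
    with w show "w \<in> f ` {x \<in> carrier M. f x \<in> W}" by blast
  qed
qed blast

section \<open>Transport of module properties along isomorphisms\<close>

locale left_module_iso = left_module_hom +
  assumes bij: "bij_betw f (carrier M) (carrier N)"
begin

lemma inj: "inj_on f (carrier M)" and surj: "f ` carrier M = carrier N"
  using bij by (auto simp: bij_betw_def)

lemma submodule_eq_image:
  assumes "submodule W A N"
  shows "\<exists>U. submodule U A M \<and> W = f ` U"
  using submodule_preimage[OF assms] image_preimage[OF surj assms] by metis

lemma image_mono_iff: "U \<subseteq> carrier M \<Longrightarrow> V \<subseteq> carrier M \<Longrightarrow> f ` U \<subseteq> f ` V \<longleftrightarrow> U \<subseteq> V"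
  using inj_onD[OF inj] by (blast intro: image_mono)

lemma image_eq_iff: "U \<subseteq> carrier M \<Longrightarrow> V \<subseteq> carrier M \<Longrightarrow> f ` U = f ` V \<longleftrightarrow> U = V"
  using inj_on_image_eq_iff[OF inj] by blast

lemma image_zero: "f ` {\<zero>\<^bsub>M\<^esub>} = {\<zero>\<^bsub>N\<^esub>}"
  by (simp add: hom_zero)

lemma adjacent_image:
  assumes a: "adjacent A M Z V"
  shows "adjacent A N (f ` Z) (f ` V)"
proof -
  have Z: "submodule Z A M" and V: "submodule V A M" and ZV: "Z \<subset> V"
    and mid: "\<And>U. submodule U A M \<Longrightarrow> Z \<subseteq> U \<Longrightarrow> U \<subseteq> V \<Longrightarrow> U = Z \<or> U = V"
    using a by (auto simp: adjacent_def)
  note s = M.submodule_subset[OF Z] M.submodule_subset[OF V]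
  show ?thesis
    unfolding adjacent_def
  proof (intro conjI allI impI submodule_image Z V)
    show "f ` Z \<subset> f ` V" using ZV image_mono_iff[OF s] image_eq_iff[OF s] by (simp add: psubset_eq)
    fix W assume W: "submodule W A N \<and> f ` Z \<subseteq> W \<and> W \<subseteq> f ` V"
    then obtain U where U: "submodule U A M" "W = f ` U" using submodule_eq_image[of W] by blast
    have "Z \<subseteq> U" "U \<subseteq> V"
      using W U(2) image_mono_iff[OF s(1) M.submodule_subset[OF U(1)]]
        image_mono_iff[OF M.submodule_subset[OF U(1)] s(2)] by auto
    then show "W = f ` Z \<or> W = f ` V" using mid[OF U(1)] U(2) by blast
  qed
qed

lemma indecomposable_image:
  assumes "indecomposable_module A M"
  shows "indecomposable_module A N"
  unfolding indecomposable_module_def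
proof (intro conjI allI impI N.left_module_axioms)
  show "carrier N \<noteq> {\<zero>\<^bsub>N\<^esub>}"
  proof
    assume "carrier N = {\<zero>\<^bsub>N\<^esub>}"
    then have "f ` carrier M = f ` {\<zero>\<^bsub>M\<^esub>}" by (simp add: surj hom_zero)
    then have "carrier M = {\<zero>\<^bsub>M\<^esub>}"
      by (subst (asm) image_eq_iff) (use M.submodule_subset[OF M.submodule_zero_set] in auto)
    then show False using assms by (simp add: indecomposable_module_def)
  qed
  fix W1 W2 assume d: "internal_dsum A N W1 W2"
  then obtain U V where U: "submodule U A M" "W1 = f ` U" and V: "submodule V A M" "W2 = f ` V"
    using submodule_eq_image unfolding internal_dsum_def by metis
  note s = M.submodule_subset[OF U(1)] M.submodule_subset[OF V(1)]
  have "f ` (U <+>\<^bsub>M\<^esub> V) = f ` carrier M"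
    using d U V image_set_add[OF s] by (simp add: internal_dsum_def surj)
  then have "U <+>\<^bsub>M\<^esub> V = carrier M"
    using image_eq_iff[of "U <+>\<^bsub>M\<^esub> V" "carrier M"] M.submodule_subset[OF M.submodule_set_add[OF U(1)
      V(1)]] by simp
  moreover have "f ` (U \<inter> V) = f ` {\<zero>\<^bsub>M\<^esub>}"
    using d U V inj_on_image_Int[OF inj s] by (simp add: internal_dsum_def hom_zero)
  then have "U \<inter> V = {\<zero>\<^bsub>M\<^esub>}"
    using image_eq_iff[of "U \<inter> V" "{\<zero>\<^bsub>M\<^esub>}"] s by auto
  ultimately have "internal_dsum A M U V" using U V by (simp add: internal_dsum_def)
  then have "U = {\<zero>\<^bsub>M\<^esub>} \<or> V = {\<zero>\<^bsub>M\<^esub>}" using assms by (simp add: indecomposable_module_def)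
  then show "W1 = {\<zero>\<^bsub>N\<^esub>} \<or> W2 = {\<zero>\<^bsub>N\<^esub>}" using U V image_zero by blast
qed

lemma projective_image:
  assumes M: "projective_module A M" and N: "fg_module A N"
  shows "projective_module A N"
  unfolding projective_module_def
proof (intro conjI allI impI N)
  fix X Y :: "'a cat_module" and p g
  assume *: "fg_module A X \<and> fg_module A Y \<and> p \<in> module_hom A X Y \<and> p ` carrier X = carrier Y \<and>
    g \<in> module_hom A N Y"
  then have "(\<lambda>x. g (f x)) \<in> module_hom A M Y" using module_hom_compose[OF hom] by blast
  with conjunct2[OF M[unfolded projective_module_def], rule_format, of X Y p "\<lambda>x. g (f x)"] *
  have "\<exists>h \<in> module_hom A M X. \<forall>x \<in> carrier M. p (h x) = g (f x)" by simp
  then obtain h where h: "h \<in> module_hom A M X" "\<And>x. x \<in> carrier M \<Longrightarrow> p (h x) = g (f x)" by blast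
  let ?i = "the_inv_into (carrier M) f"
  have i: "?i y \<in> carrier M" "f (?i y) = y" if "y \<in> carrier N" for y
    using the_inv_into_into[OF inj, of y "carrier M"] f_the_inv_into_f[OF inj, of y] that surj by auto
  show "\<exists>h\<in>module_hom A N X. \<forall>x\<in>carrier N. p (h x) = g x"
    using h i by (intro bexI[of _ "\<lambda>y. h (?i y)"] module_hom_compose[OF inverse_hom[OF bij]]) auto
qed

end

lemma (in left_module_hom) uniserial_image:
  assumes surj: "f ` carrier M = carrier N" and u: "uniserial_module A M"
  shows "uniserial_module A N"
  unfolding uniserial_module_def
proof (intro conjI allI impI N.left_module_axioms)
  fix U V assume UV: "submodule U A N \<and> submodule V A N"
  let ?U = "{x \<in> carrier M. f x \<in> U}" and ?V = "{x \<in> carrier M. f x \<in> V}"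
  have "?U \<subseteq> ?V \<or> ?V \<subseteq> ?U"
    using u UV submodule_preimage unfolding uniserial_module_def by simp
  then have "f ` ?U \<subseteq> f ` ?V \<or> f ` ?V \<subseteq> f ` ?U" by (elim disjE) (simp_all add: image_mono)
  then show "U \<subseteq> V \<or> V \<subseteq> U"
    unfolding image_preimage[OF surj conjunct1[OF UV]] image_preimage[OF surj conjunct2[OF UV]] .
qed

lemma has_lengthI2:
  assumes M: "left_module A M" and a: "adjacent A M {\<zero>\<^bsub>M\<^esub>} Z" "adjacent A M Z U"
  shows "has_length A (restr M U) 2"
proof -
  interpret left_module A M by fact
  have Z: "submodule Z A M" and U: "submodule U A M" and ZU: "Z \<subset> U"
    using a by (auto simp: adjacent_def)
  interpret U: left_module A "restr M U" by (rule left_module_restr[OF U])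
  let ?C = "\<lambda>i::nat. if i = 0 then {\<zero>\<^bsub>M\<^esub>} else if i = 1 then Z else U"
  have "simple_module A (quot_module (restr M (?C (Suc i))) (?C i)) \<and> ?C i \<subseteq> ?C (Suc i)" if "i < 2" for i
  proof -
    consider "i = 0" | "i = 1" using \<open>i < 2\<close> by linarith
    then show ?thesis
      using simple_quot_restr_iff[OF submodule_zero_set Z] simple_quot_restr_iff[OF Z U] a ZU
        submodule_zero[OF Z] by cases auto
  qed
  moreover have "submodule (?C i) A (restr M U)" for i
    using submodule_zero_set Z U ZU submodule_zero[OF U] by (auto simp: submodule_restr[OF U])
  ultimately show ?thesis
    unfolding has_length_def using U.left_module_axioms
    by (intro conjI exI[of _ ?C]) auto
qed

lemma (in left_module) uniserialD:
  assumes "uniserial_module R (restr M L)" "submodule L R M" "submodule U R M" "U \<subseteq> L" "submodule V R M"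
    "V \<subseteq> L"
  shows "U \<subseteq> V \<or> V \<subseteq> U"
  using assms unfolding uniserial_module_def by (simp add: submodule_restr)

lemma (in left_module) uniserial_restrI:
  assumes L: "submodule L R M"
    and "\<And>U V. submodule U R M \<Longrightarrow> U \<subseteq> L \<Longrightarrow> submodule V R M \<Longrightarrow> V \<subseteq> L \<Longrightarrow> U \<subseteq> V \<or> V \<subseteq> U"
  shows "uniserial_module R (restr M L)"
  using assms(2) left_module_restr[OF L] unfolding uniserial_module_def
    by (auto simp: submodule_restr[OF L])

lemma (in left_module) rad_module_largest:
  assumes D: "submodule D R M" "D \<noteq> carrier M"
    and largest: "\<And>U. submodule U R M \<Longrightarrow> U \<noteq> carrier M \<Longrightarrow> U \<subseteq> D"
  shows "rad_module R M = D"
proof -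
  have "maximal_submodule N R M \<longleftrightarrow> N = D" for N
    using D largest unfolding maximal_submodule_def by (metis subset_antisym)
  then have "{N. maximal_submodule N R M} = {D}" by auto
  then show ?thesis using submodule_subset[OF D(1)] by (auto simp: rad_module_def)
qed

text \<open>
  The radical of \<open>D\<close> is the sum of the largest proper submodules of \<open>L1\<close> and \<open>L2\<close>.
\<close>

lemma (in left_module) top_of_biserial_radical:
  assumes h: "height_le R M n" and D: "submodule D R M"
    and L1: "submodule L1 R M" "uniserial_module R (restr M L1)"
    and L2: "submodule L2 R M" "uniserial_module R (restr M L2)"
    and sum: "L1 <+>\<^bsub>M\<^esub> L2 = D" and inc: "\<not> L1 \<subseteq> L2" "\<not> L2 \<subseteq> L1"
  defines "\<rho> \<equiv> rad_module R (restr M D)"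
  defines "S1 \<equiv> (\<lambda>x. \<rho> +>\<^bsub>M\<^esub> x) ` L1" and "S2 \<equiv> (\<lambda>x. \<rho> +>\<^bsub>M\<^esub> x) ` L2"
  shows "submodule \<rho> R M" "\<exists>N1 N2. adjacent R M N1 D \<and> adjacent R M N2 D \<and> \<rho> = N1 \<inter> N2"
    "internal_dsum R (top_module R (restr M D)) S1 S2"
    "simple_module R (restr (top_module R (restr M D)) S1)"
    "simple_module R (restr (top_module R (restr M D)) S2)"
    "\<not> L1 \<subseteq> \<rho>" "\<not> L2 \<subseteq> \<rho>"
proof -
  have zero_sub: "{\<zero>\<^bsub>M\<^esub>} \<subset> L" if "submodule L R M" "\<not> L \<subseteq> L'" "submodule L' R M" for L L'
    using submodule_zero[OF that(1)] submodule_zero[OF that(3)] that(2) by blast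
  \<comment> \<open>\<open>K1\<close> and \<open>K2\<close> are the largest proper submodules:
    uniseriality puts every proper submodule of \<open>L1\<close> or \<open>L2\<close> below
    them.\<close>
  obtain K1 where K1: "adjacent R M K1 L1"
    using height_le_adjacent[OF h submodule_zero_set L1(1) zero_sub[OF L1(1) inc(1) L2(1)]] by blast
  obtain K2 where K2: "adjacent R M K2 L2"
    using height_le_adjacent[OF h submodule_zero_set L2(1) zero_sub[OF L2(1) inc(2) L1(1)]] by blast
  have below: "U \<subseteq> K" if K: "adjacent R M K L" and L: "submodule L R M" "uniserial_module R (restr M L)"
    and U: "submodule U R M" "U \<subset> L" for U K L
  proof -
    have "submodule K R M" "K \<subset> L" using K by (auto simp: adjacent_def)
    then have "U \<subseteq> K \<or> K \<subseteq> U" using uniserialD[OF L(2,1) U(1)] U(2) by blast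
    then show ?thesis using K U by (auto simp: adjacent_def)
  qed
  have K1s: "submodule K1 R M" "K1 \<subset> L1" and K2s: "submodule K2 R M" "K2 \<subset> L2"
    using K1 K2 by (auto simp: adjacent_def)
  have int1: "L1 \<inter> L2 \<subseteq> K1"
    using inc by (intro below[OF K1 L1]) (auto intro: submodule_Int L1 L2)
  have int2: "L1 \<inter> L2 \<subseteq> K2"
    using inc by (intro below[OF K2 L2]) (auto intro: submodule_Int L1 L2)
  \<comment> \<open>\<open>N1\<close> and \<open>N2\<close> are two maximal submodules of
    \<open>D\<close> whose intersection \<open>Q\<close> will be its radical.\<close>
  define N1 where "N1 = K1 <+>\<^bsub>M\<^esub> L2"
  define N2 where "N2 = L1 <+>\<^bsub>M\<^esub> K2"
  define Q where "Q = K1 <+>\<^bsub>M\<^esub> K2"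
  have N1s: "submodule N1 R M" and N2s: "submodule N2 R M" and Qs: "submodule Q R M"
    unfolding N1_def N2_def Q_def by (intro submodule_set_add K1s K2s L1 L2)+
  note u1 = set_add_upper[OF K1s(1) L2(1), folded N1_def]
  note u2 = set_add_upper[OF L1(1) K2s(1), folded N2_def]
  note uQ = set_add_upper[OF K1s(1) K2s(1), folded Q_def]
  note uD = set_add_upper[OF L1(1) L2(1), unfolded sum]
  have N1D: "N1 \<subseteq> D" unfolding N1_def using K1s uD by (intro set_add_least[OF D]) auto
  have N2D: "N2 \<subseteq> D" unfolding N2_def using K2s uD by (intro set_add_least[OF D]) auto
  have QN: "Q \<subseteq> N1" "Q \<subseteq> N2"
    unfolding Q_def using u1 u2 K1s(2) K2s(2) by (intro set_add_least N1s N2s; blast)+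
  have L1N1: "L1 \<inter> N1 = K1"
  proof -
    have "N1 \<inter> L1 = K1 <+>\<^bsub>M\<^esub> (L2 \<inter> L1)"
      unfolding N1_def using K1s by (intro modular_law L2 L1) auto
    also have "\<dots> \<subseteq> K1" using int1 by (intro set_add_least[OF K1s(1)]) auto
    finally show ?thesis using K1s u1 by blast
  qed
  have comm: "N2 = K2 <+>\<^bsub>M\<^esub> L1"
    unfolding N2_def by (intro set_add_comm submodule_subset L1 K2s)
  have L2N2: "L2 \<inter> N2 = K2"
  proof -
    have "N2 \<inter> L2 = K2 <+>\<^bsub>M\<^esub> (L1 \<inter> L2)"
      unfolding comm using K2s by (intro modular_law L2 L1) auto
    also have "\<dots> \<subseteq> K2" using int2 by (intro set_add_least[OF K2s(1)]) auto
    finally show ?thesis using K2s u2 by blast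
  qed
  have NN: "N1 \<inter> N2 = Q"
  proof -
    have "N1 \<inter> N2 = K1 <+>\<^bsub>M\<^esub> (L2 \<inter> N2)"
      unfolding N1_def using K1s u2 by (intro modular_law L2 N2s) auto
    then show ?thesis by (simp add: L2N2 Q_def)
  qed
  have adj1: "adjacent R M N1 D"
    unfolding adjacent_def
  proof (intro conjI allI impI N1s D)
    show "N1 \<subset> D" using N1D L1N1 K1s uD by blast
    fix U assume U: "submodule U R M \<and> N1 \<subseteq> U \<and> U \<subseteq> D"
    have "K1 \<subseteq> L1 \<inter> U" using U u1 K1s by blast
    then consider "L1 \<inter> U = K1" | "L1 \<inter> U = L1"
      using K1 submodule_Int[OF L1(1), of U] U by (auto simp: adjacent_def)
    then show "U = N1 \<or> U = D"
    proof cases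
      case 1
      have "U = (L2 <+>\<^bsub>M\<^esub> L1) \<inter> U"
        using U sum set_add_comm[OF submodule_subset[OF L1(1)] submodule_subset[OF L2(1)]] by auto
      also have "\<dots> = L2 <+>\<^bsub>M\<^esub> (L1 \<inter> U)" using U u1 by (intro modular_law L1 L2) auto
      also have "\<dots> = N1"
        unfolding 1 N1_def by (intro set_add_comm submodule_subset L2 K1s)
      finally show ?thesis by simp
    next
      case 2
      have "D \<subseteq> U" unfolding sum[symmetric] using U 2 u1 by (intro set_add_least) auto
      then show ?thesis using U by blast
    qed
  qed
  have adj2: "adjacent R M N2 D"
    unfolding adjacent_def
  proof (intro conjI allI impI N2s D)
    show "N2 \<subset> D" using N2D L2N2 K2s uD by blast
    fix U assume U: "submodule U R M \<and> N2 \<subseteq> U \<and> U \<subseteq> D"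
    have "K2 \<subseteq> L2 \<inter> U" using U u2 K2s by blast
    then consider "L2 \<inter> U = K2" | "L2 \<inter> U = L2"
      using K2 submodule_Int[OF L2(1), of U] U by (auto simp: adjacent_def)
    then show "U = N2 \<or> U = D"
    proof cases
      case 1
      have "U = (L1 <+>\<^bsub>M\<^esub> L2) \<inter> U" using U sum by auto
      also have "\<dots> = L1 <+>\<^bsub>M\<^esub> (L2 \<inter> U)" using U u2 by (intro modular_law L1 L2) auto
      also have "\<dots> = N2" unfolding 1 N2_def ..
      finally show ?thesis by simp
    next
      case 2
      have "D \<subseteq> U" unfolding sum[symmetric] using U 2 u2 by (intro set_add_least) auto
      then show ?thesis using U by blast
    qed
  qed
  interpret D: left_module R "restr M D" by (rule left_module_restr[OF D])
  have max_iff: "maximal_submodule N R (restr M D) \<longleftrightarrow> adjacent R M N D" for N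
    unfolding maximal_submodule_def adjacent_def submodule_restr[OF D] using D
    by (auto dest: submodule_subset)
  have max_Q: "Q \<subseteq> N" if N: "adjacent R M N D" for N
  proof -
    have Ns: "submodule N R M" "N \<subset> D" and mid: "\<And>U. submodule U R M \<Longrightarrow> N \<subseteq> U \<Longrightarrow> U \<subseteq> D \<Longrightarrow> U = N \<or> U = D"
      using N by (auto simp: adjacent_def)
    \<comment> \<open>If \<open>K\<close> were not in \<open>N\<close>, then
      \<open>K + N = D\<close>, and the modular law gives \<open>L = K + (N \<inter> L)\<close>. As
      \<open>K\<close> is the largest proper submodule of \<open>L\<close>, this forces
      \<open>L\<close>, and with it \<open>K\<close>, into \<open>N\<close>.\<close>
    have "K \<subseteq> N" if KL: "adjacent R M K L" and L: "submodule L R M" "uniserial_module R (restr M L)"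
      "L \<subseteq> D" for K L
    proof (rule ccontr)
      have K: "submodule K R M" "K \<subset> L" using KL by (auto simp: adjacent_def)
      assume notN: "\<not> K \<subseteq> N"
      let ?U = "K <+>\<^bsub>M\<^esub> N"
      note u = set_add_upper[OF K(1) Ns(1)]
      have "?U \<subseteq> D" using K L Ns by (intro set_add_least[OF D]) auto
      then have "?U = D" using mid[OF submodule_set_add[OF K(1) Ns(1)]] u notN by blast
      then have "L = ?U \<inter> L" using L by auto
      also have "\<dots> = K <+>\<^bsub>M\<^esub> (N \<inter> L)" using K by (intro modular_law Ns L) auto
      finally have L_eq: "L = K <+>\<^bsub>M\<^esub> (N \<inter> L)" .
      have "\<not> N \<inter> L \<subset> L"
      proof
        assume "N \<inter> L \<subset> L"
        then have "N \<inter> L \<subseteq> K" using L Ns by (intro below[OF KL]) (auto intro: submodule_Int)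
        then have "L \<subseteq> K" by (subst L_eq, intro set_add_least K) auto
        with K show False by blast
      qed
      then show False using notN K by blast
    qed
    then have "K1 \<subseteq> N" "K2 \<subseteq> N" using K1 K2 L1 L2 uD by blast+
    then show ?thesis unfolding Q_def by (intro set_add_least[OF Ns(1)])
  qed
  have \<rho>: "\<rho> = Q"
  proof
    show "\<rho> \<subseteq> Q" using adj1 adj2 NN unfolding \<rho>_def rad_module_def max_iff by auto
    show "Q \<subseteq> \<rho>" using max_Q QN N1D unfolding \<rho>_def rad_module_def max_iff by auto
  qed
  show \<rho>s: "submodule \<rho> R M" using Qs \<rho> by simp
  show "\<exists>N1 N2. adjacent R M N1 D \<and> adjacent R M N2 D \<and> \<rho> = N1 \<inter> N2"
    using adj1 adj2 NN \<rho> by blast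
  have L1\<rho>: "L1 \<inter> \<rho> = K1" using L1N1 QN uQ K1s unfolding \<rho> by blast
  have L2\<rho>: "L2 \<inter> \<rho> = K2" using L2N2 QN uQ K2s unfolding \<rho> by blast
  show "\<not> L1 \<subseteq> \<rho>" "\<not> L2 \<subseteq> \<rho>" using L1\<rho> L2\<rho> K1s K2s by blast+
  have \<rho>D: "submodule \<rho> R (restr M D)" using \<rho>s N1D QN \<rho> by (simp add: submodule_restr[OF D])
  let ?T = "top_module R (restr M D)"
  have T: "?T = quot_module (restr M D) \<rho>" by (simp add: top_module_def \<rho>_def)
  have cos: "\<rho> +>\<^bsub>restr M D\<^esub> x = \<rho> +>\<^bsub>M\<^esub> x" for x by (simp add: a_r_coset_def')
  let ?\<pi> = "\<lambda>x. \<rho> +>\<^bsub>M\<^esub> x"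
  interpret \<pi>: left_module_hom R "restr M D" ?T ?\<pi>
    using D.quot_left_module_hom[OF \<rho>D] by (simp add: T cos)
  have carT: "carrier ?T = ?\<pi> ` D" unfolding T D.carrier_quot by (simp add: cos)
  have zT: "\<zero>\<^bsub>?T\<^esub> = \<rho>" unfolding T D.quot_module_simps(1)[OF \<rho>D] ..
  have \<pi>_zero: "?\<pi> x = \<rho> \<longleftrightarrow> x \<in> \<rho>" if "x \<in> D" for x
    using D.coset_zero[OF \<rho>D, of x] that by (simp add: cos)
  have L1D: "submodule L1 R (restr M D)" and L2D: "submodule L2 R (restr M D)"
    using L1 L2 uD by (simp_all add: submodule_restr[OF D])
  have S1: "submodule S1 R ?T" and S2: "submodule S2 R ?T"
    unfolding S1_def S2_def by (intro \<pi>.submodule_image L1D L2D)+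
  show "internal_dsum R ?T S1 S2"
    unfolding internal_dsum_def
  proof (intro conjI S1 S2)
    have "S1 <+>\<^bsub>?T\<^esub> S2 = ?\<pi> ` (L1 <+>\<^bsub>restr M D\<^esub> L2)"
      unfolding S1_def S2_def using uD by (intro \<pi>.image_set_add[symmetric]) auto
    then show "S1 <+>\<^bsub>?T\<^esub> S2 = carrier ?T" using sum carT by (simp add: set_add_def')
    show "S1 \<inter> S2 = {\<zero>\<^bsub>?T\<^esub>}"
    proof
      show "S1 \<inter> S2 \<subseteq> {\<zero>\<^bsub>?T\<^esub>}"
      proof
        fix X assume "X \<in> S1 \<inter> S2"
        then obtain x y where xy: "x \<in> L1" "y \<in> L2" "X = ?\<pi> x" "?\<pi> x = ?\<pi> y" by (auto simp: S1_def S2_def)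
        have c: "x \<in> carrier M" "y \<in> carrier M" using xy submodule_carrier[OF L1(1)]
          submodule_carrier[OF L2(1)] by auto
        have "x \<ominus>\<^bsub>M\<^esub> y \<in> \<rho>" using xy(4) coset_eq_iff[OF \<rho>s c] by simp
        then have "x \<ominus>\<^bsub>M\<^esub> y \<in> N1" "y \<in> N1" using QN \<rho> u1 xy by auto
        then have "x \<in> N1" using submodule_diff_cancel[OF N1s c(1)] by blast
        then have "x \<in> \<rho>" using xy(1) L1N1 uQ \<rho> by blast
        then show "X \<in> {\<zero>\<^bsub>?T\<^esub>}" using xy \<pi>_zero[of x] uD zT by auto
      qed
      show "{\<zero>\<^bsub>?T\<^esub>} \<subseteq> S1 \<inter> S2" using \<pi>.N.submodule_zero[OF S1] \<pi>.N.submodule_zero[OF S2] by blast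
    qed
  qed
  have simple: "simple_module R (restr ?T (?\<pi> ` L))"
    if L: "submodule L R M" "L \<subseteq> D" and K: "adjacent R M K L" "L \<inter> \<rho> = K" for L K
  proof -
    have LD: "submodule L R (restr M D)" using L by (simp add: submodule_restr[OF D])
    have S: "submodule (?\<pi> ` L) R ?T" by (rule \<pi>.submodule_image[OF LD])
    interpret \<pi>': left_module_hom R "restr M L" "restr ?T (?\<pi> ` L)" ?\<pi>
      using module_hom_restr[OF \<pi>.hom, of L "?\<pi> ` L"] L(2)
      by (intro left_module_homI left_module_restr[OF L(1)] \<pi>.N.left_module_restr[OF S]) simp
    have "{x \<in> carrier (restr M L). ?\<pi> x = \<zero>\<^bsub>restr ?T (?\<pi> ` L)\<^esub>} = K"
      using K(2) \<pi>_zero L(2) zT by auto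
    then show ?thesis
      using \<pi>'.simple_iff_adjacent adjacent_restr[OF L(1) order.refl] K(1) by simp
  qed
  show "simple_module R (restr ?T S1)" unfolding S1_def using uD by (intro simple[OF L1(1) _ K1 L1\<rho>]) auto
  show "simple_module R (restr ?T S2)" unfolding S2_def using uD by (intro simple[OF L2(1) _ K2 L2\<rho>]) auto
qed

section \<open>What the conditions say about \<open>Ae\<close> and \<open>eA\<close>\<close>

locale quadri =
  fixes k :: "('k, 's) ring_scheme" and A :: "('a, 'r) ring_scheme" (structure) and \<phi> :: "'k \<Rightarrow> 'a"
  assumes quadri: "quadri_biserial_algebra k A \<phi>"
begin

lemma artin: "artin_algebra k A \<phi>"
  using quadri by (simp add: quadri_biserial_algebra_def biserial_algebra_def)

sublocale A: ring A using artin by (simp add: artin_algebra_def)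
sublocale op: ring "opposite_ring A" by (rule A.ring_opposite)

lemma ring_B: "B \<in> {A, opposite_ring A} \<Longrightarrow> ring B"
  using A.ring_axioms op.ring_axioms by auto

text \<open>The conditions on the algebra speak about modules of type \<open>cat_module\<close>; a
  copy of \<open>pmod B e\<close> makes them available.\<close>

lemma indecomposable_copy:
  assumes B: "B \<in> {A, opposite_ring A}" and e: "e \<in> carrier B" "e \<otimes>\<^bsub>B\<^esub> e = e"
    and ind: "indecomposable_module B (pmod B e)"
  obtains N :: "'a cat_module" and j where "fg_module B N" "projective_module B N"
    "indecomposable_module B N" "left_module_iso B (pmod B e) N j"
proof -
  interpret B: ring B by (rule ring_B[OF B])
  obtain N :: "'a cat_module" and j where N: "fg_module B N" "j \<in> module_hom B (pmod B e) N"
    "bij_betw j (carrier (pmod B e)) (carrier N)"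
    using fg_module_copy[OF B.fg_module_pmod[OF e]] by blast
  interpret j: left_module_iso B "pmod B e" N j
    using N fg_module_left_module[OF N(1)] B.left_module_pmod[OF e(1)]
    by (simp add: left_module_iso_def left_module_iso_axioms_def left_module_homI)
  show ?thesis
    by (rule that[OF N(1) j.projective_image[OF B.projective_module_pmod[OF e] N(1)]
        j.indecomposable_image[OF ind] j.left_module_iso_axioms])
qed

lemma quadri_conditions:
  fixes Q :: "'a cat_module"
  assumes "B \<in> {A, opposite_ring A}" "projective_module B Q" "indecomposable_module B Q"
  shows "\<exists>n\<le>4. has_length B Q n"
    and "internal_dsum B (top_module B (restr Q (rad_module B Q))) S1 S2 \<Longrightarrow>
      simple_module B (restr (top_module B (restr Q (rad_module B Q))) S1) \<Longrightarrow>
      simple_module B (restr (top_module B (restr Q (rad_module B Q))) S2) \<Longrightarrow>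
      injective_envelope_uniserial B (restr (top_module B (restr Q (rad_module B Q))) S1) \<or>
      injective_envelope_uniserial B (restr (top_module B (restr Q (rad_module B Q))) S2)"
    and "internal_dsum B (restr Q (rad_module B Q)) V U \<Longrightarrow> simple_module B (restr Q V) \<Longrightarrow>
      uniserial_module B (restr Q U) \<Longrightarrow> has_length B (restr Q U) 2 \<Longrightarrow>
      injective_envelope_uniserial B (restr Q V)"
proof -
  note q = bspec[OF conjunct2[OF quadri[unfolded quadri_biserial_algebra_def]] assms(1), rule_format, of
    Q,
      unfolded Let_def, OF conjI[OF assms(2,3)]]
  show "\<exists>n\<le>4. has_length B Q n" using q by (elim conjE)
  show "internal_dsum B (top_module B (restr Q (rad_module B Q))) S1 S2 \<Longrightarrow>
      simple_module B (restr (top_module B (restr Q (rad_module B Q))) S1) \<Longrightarrow>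
      simple_module B (restr (top_module B (restr Q (rad_module B Q))) S2) \<Longrightarrow>
      injective_envelope_uniserial B (restr (top_module B (restr Q (rad_module B Q))) S1) \<or>
      injective_envelope_uniserial B (restr (top_module B (restr Q (rad_module B Q))) S2)"
    using conjunct1[OF conjunct2[OF q]] by simp
  show "internal_dsum B (restr Q (rad_module B Q)) V U \<Longrightarrow> simple_module B (restr Q V) \<Longrightarrow>
      uniserial_module B (restr Q U) \<Longrightarrow> has_length B (restr Q U) 2 \<Longrightarrow>
      injective_envelope_uniserial B (restr Q V)"
    using conjunct2[OF conjunct2[OF q]] by simp
qed

lemma height_4:
  assumes B: "B \<in> {A, opposite_ring A}" and e: "e \<in> carrier B" "e \<otimes>\<^bsub>B\<^esub> e = e"
    and ind: "indecomposable_module B (pmod B e)"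
  shows "height_le B (pmod B e) 4"
proof -
  obtain N :: "'a cat_module" and j where N: "projective_module B N"
    "indecomposable_module B N" "left_module_iso B (pmod B e) N j"
    using indecomposable_copy[OF assms] by blast
  interpret j: left_module_iso B "pmod B e" N j by fact
  obtain n where n: "n \<le> 4" "has_length B N n"
    using quadri_conditions(1)[OF B N(1,2)] by blast
  have "height_le B N 4"
    using has_length_height[OF n(2)] n(1) unfolding height_le_def by (meson order_trans)
  then show ?thesis by (rule j.height_le_inj[OF j.inj])
qed

text \<open>The bound four on the length of indecomposable projectives provides the chain conditions
  of Fitting's lemma.\<close>

sublocale enough_primitives A
  by (rule enough_primitives_if_dcc[OF A.ring_axioms artin_algebra_dcc[OF artin]])
    (rule height_4; simp)

lemma primitive_B: "B \<in> {A, opposite_ring A} \<Longrightarrow> primitive A e \<Longrightarrow> primitive B e"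
  by auto

lemma jac_B: "B \<in> {A, opposite_ring A} \<Longrightarrow> jac B = jac A"
  by (auto simp: A.jac_opposite)

lemma primitive_copy:
  assumes B: "B \<in> {A, opposite_ring A}" and e: "primitive A e"
  obtains N :: "'a cat_module" and j where "fg_module B N" "projective_module B N"
    "indecomposable_module B N" "left_module_iso B (pmod B e) N j"
proof -
  interpret B: ring B by (rule ring_B[OF B])
  note pe = primitive_B[OF B e]
  show ?thesis
    using indecomposable_copy[OF B B.primitive_closed[OF pe] B.primitive_idem[OF pe]
      B.indecomposable_pmod[OF pe]] that
    by blast
qed

lemma primitive_height:
  assumes B: "B \<in> {A, opposite_ring A}" and e: "primitive A e"
  shows "height_le B (pmod B e) 4"
proof -
  interpret B: ring B by (rule ring_B[OF B])
  note pe = primitive_B[OF B e]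
  show ?thesis
    by (rule height_4[OF B B.primitive_closed[OF pe] B.primitive_idem[OF pe] B.indecomposable_pmod[OF
      pe]])
qed

text \<open>Submodules of the copy are images of submodules of \<open>pmod B e\<close>, and
  \<open>pmod_local\<close> puts the proper ones into the radical. The radical of \<open>A\<close>
  serves for both values of \<open>B\<close> because it is symmetric.\<close>

lemma copy_radical:
  assumes B: "B \<in> {A, opposite_ring A}" and e: "primitive A e" and j: "left_module_iso B (pmod B e) N j"
  defines "D \<equiv> j ` (ring.pid B e \<inter> jac A)"
  shows "submodule D B N" "D \<noteq> carrier N" "\<And>U. submodule U B N \<Longrightarrow> U \<noteq> carrier N \<Longrightarrow> U \<subseteq> D"
    "rad_module B N = D"
proof -
  interpret B: ring B by (rule ring_B[OF B])
  interpret j: left_module_iso B "pmod B e" N j by fact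
  note pe = primitive_B[OF B e]
  note ec = B.primitive_closed[OF pe] and ee = B.primitive_idem[OF pe]
  have sub: "submodule (B.pid e \<inter> jac A) B (pmod B e)"
    using B.jac_pid_submodule[OF ec] by (simp add: B.submodule_pmod[OF ec] jac_B[OF B])
  show D: "submodule D B N" unfolding D_def by (rule j.submodule_image[OF sub])
  have "e \<notin> jac A" using B.primitive_not_jac[OF pe] jac_B[OF B] by simp
  then have "B.pid e \<inter> jac A \<noteq> B.pid e" using B.pid_self[OF ec ee] by blast
  then show Dne: "D \<noteq> carrier N"
    unfolding D_def j.surj[symmetric] by (subst j.image_eq_iff) auto
  show largest: "U \<subseteq> D" if U: "submodule U B N" "U \<noteq> carrier N" for U
  proof -
    obtain V where V: "submodule V B (pmod B e)" "U = j ` V" using j.submodule_eq_image[OF U(1)] by blast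
    then have "submodule V B (reg B)" "V \<subseteq> B.pid e" "V \<noteq> B.pid e"
      using U(2) j.surj by (auto simp: B.submodule_pmod[OF ec])
    then have "V \<subseteq> jac A" using B.pmod_local[OF pe] jac_B[OF B] by simp
    then show ?thesis using V \<open>V \<subseteq> B.pid e\<close> by (auto simp: D_def)
  qed
  show "rad_module B N = D" by (rule j.N.rad_module_largest[OF D Dne largest])
qed

text \<open>A biserial module may also be the sum of its two uniserial submodules. Here both are
  proper, hence contained in the largest proper submodule, which leaves the other
  alternative.\<close>

lemma biserial_copy:
  fixes N :: "'a cat_module"
  assumes B: "B \<in> {A, opposite_ring A}" and e: "primitive A e" and nu: "\<not> uniserial_module B (pmod B e)"
    and j: "left_module_iso B (pmod B e) N j" and N: "projective_module B N" "indecomposable_module B N"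
  shows "\<exists>L1 L2. submodule L1 B N \<and> submodule L2 B N \<and> uniserial_module B (restr N L1) \<and>
    uniserial_module B (restr N L2) \<and> \<not> L1 \<subseteq> L2 \<and> \<not> L2 \<subseteq> L1 \<and> L1 <+>\<^bsub>N\<^esub> L2 = j ` (ring.pid B e \<inter> jac A)"
proof -
  interpret j: left_module_iso B "pmod B e" N j by fact
  interpret inv: left_module_hom B N "pmod B e" "the_inv_into (carrier (pmod B e)) j"
    by (intro left_module_homI j.M.left_module_axioms j.N.left_module_axioms j.inverse_hom j.bij)
  have "\<not> uniserial_module B N"
    using nu inv.uniserial_image the_inv_into_onto[OF j.inj] j.surj by auto
  then have "biserial_module B N"
    using bspec[OF conjunct2[OF conjunct1[OF quadri[unfolded quadri_biserial_algebra_def],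
          unfolded biserial_algebra_def]] B] N by simp
  then obtain L1 L2 where L: "submodule L1 B N" "submodule L2 B N" "uniserial_module B (restr N L1)"
    "uniserial_module B (restr N L2)" and inc: "\<not> L1 \<subseteq> L2" "\<not> L2 \<subseteq> L1"
    and sum: "L1 <+>\<^bsub>N\<^esub> L2 = carrier N \<or> (L1 <+>\<^bsub>N\<^esub> L2 \<noteq> carrier N \<and>
      (\<forall>U. submodule U B N \<and> U \<noteq> carrier N \<longrightarrow> U \<subseteq> L1 <+>\<^bsub>N\<^esub> L2))"
    unfolding biserial_module_def by (elim conjE exE) (rule that)
  note D = copy_radical[OF B e j]
  have "L1 \<noteq> carrier N" "L2 \<noteq> carrier N" using inc j.N.submodule_subset[OF L(1)] j.N.submodule_subset[OF
    L(2)] by auto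
  then have "L1 <+>\<^bsub>N\<^esub> L2 \<subseteq> j ` (ring.pid B e \<inter> jac A)"
    using D(3)[OF L(1)] D(3)[OF L(2)] by (intro j.N.set_add_least D(1))
  moreover from this have "L1 <+>\<^bsub>N\<^esub> L2 \<noteq> carrier N" using D(2) j.N.submodule_subset[OF D(1)] by blast
  ultimately have "L1 <+>\<^bsub>N\<^esub> L2 = j ` (ring.pid B e \<inter> jac A)" using sum D(1,2) by blast
  with L inc show ?thesis by blast
qed

text \<open>The same decomposition, pulled back from the copy to one-sided ideals.\<close>

lemma biserial_radical:
  assumes B: "B \<in> {A, opposite_ring A}" and e: "primitive A e" and nu: "\<not> uniserial_module B (pmod B e)"
  shows "\<exists>L1 L2. submodule L1 B (reg B) \<and> submodule L2 B (reg B) \<and> \<not> L1 \<subseteq> L2 \<and> \<not> L2 \<subseteq> L1 \<and>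
    L1 <+>\<^bsub>reg B\<^esub> L2 = ring.pid B e \<inter> jac A"
proof -
  interpret B: ring B by (rule ring_B[OF B])
  note pe = primitive_B[OF B e]
  note ec = B.primitive_closed[OF pe] and ee = B.primitive_idem[OF pe]
  obtain N :: "'a cat_module" and j where N: "projective_module B N" "indecomposable_module B N"
    and j: "left_module_iso B (pmod B e) N j"
    using primitive_copy[OF B e] by blast
  interpret j: left_module_iso B "pmod B e" N j by fact
  obtain L1 L2 where L: "submodule L1 B N" "submodule L2 B N" "\<not> L1 \<subseteq> L2" "\<not> L2 \<subseteq> L1"
    "L1 <+>\<^bsub>N\<^esub> L2 = j ` (ring.pid B e \<inter> jac A)"
    using biserial_copy[OF B e nu j N] by blast
  obtain K1 K2 where K: "submodule K1 B (pmod B e)" "L1 = j ` K1" "submodule K2 B (pmod B e)"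
    "L2 = j ` K2"
    using j.submodule_eq_image[OF L(1)] j.submodule_eq_image[OF L(2)] by blast
  note s = j.M.submodule_subset[OF K(1)] j.M.submodule_subset[OF K(3)]
  have "j ` (K1 <+>\<^bsub>pmod B e\<^esub> K2) = j ` (ring.pid B e \<inter> jac A)"
    using L(5) K j.image_set_add[OF s] by simp
  then have "K1 <+>\<^bsub>pmod B e\<^esub> K2 = ring.pid B e \<inter> jac A"
    using j.image_eq_iff[OF j.M.submodule_subset[OF j.M.submodule_set_add[OF K(1,3)]], of
      "ring.pid B e \<inter> jac A"]
    by simp
  then have "K1 <+>\<^bsub>reg B\<^esub> K2 = ring.pid B e \<inter> jac A" by (simp add: set_add_def')
  moreover have "submodule K1 B (reg B)" "submodule K2 B (reg B)"
    using K by (auto simp: B.submodule_pmod[OF ec])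
  moreover have "\<not> K1 \<subseteq> K2" "\<not> K2 \<subseteq> K1" using L(3,4) K(2,4) image_mono by metis+
  ultimately show ?thesis by blast
qed

text \<open>The simple summand of the top of the radical appears as a subquotient \<open>X / \<rho>\<close> of \<open>Ae\<close>.\<close>

lemma condition_b:
  assumes e: "primitive A e" and nu: "\<not> uniserial_module A (pmod A e)"
  shows "\<exists>\<rho> X (E :: 'a cat_module) \<theta>. submodule \<rho> A (reg A) \<and> submodule X A (reg A) \<and>
    X \<subseteq> A.pid e \<inter> jac A \<and>
    \<not> X \<subseteq> \<rho> \<and> (\<forall>a\<in>jac A. \<forall>x\<in>A.pid e \<inter> jac A. a \<otimes> x \<in> \<rho>) \<and>
    injective_module A E \<and> uniserial_module A E \<and> \<theta> \<in> module_hom A (restr (reg A) X) E \<and>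
    (\<forall>x\<in>X. \<theta> x = \<zero>\<^bsub>E\<^esub> \<longleftrightarrow> x \<in> \<rho>) \<and> (\<forall>a\<in>jac A. \<forall>x\<in>X. \<theta> (a \<otimes> x) = \<zero>\<^bsub>E\<^esub>)"
proof -
  have B: "A \<in> {A, opposite_ring A}" by simp
  note ec = A.primitive_closed[OF e] and ee = A.primitive_idem[OF e]
  obtain N :: "'a cat_module" and j where N: "fg_module A N" "projective_module A N"
    "indecomposable_module A N"
    and j: "left_module_iso A (pmod A e) N j"
    using primitive_copy[OF B e] by blast
  interpret j: left_module_iso A "pmod A e" N j by fact
  interpret N: ep_module A N by unfold_locales
  define P where "P = A.pid e \<inter> jac A"
  define D where "D = j ` P"
  note D = copy_radical[OF B e j, folded P_def, folded D_def]
  obtain L1 L2 where L1: "submodule L1 A N" "uniserial_module A (restr N L1)"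
    and L2: "submodule L2 A N" "uniserial_module A (restr N L2)"
    and inc: "\<not> L1 \<subseteq> L2" "\<not> L2 \<subseteq> L1" and sum: "L1 <+>\<^bsub>N\<^esub> L2 = D"
    using biserial_copy[OF B e nu j N(2,3)] unfolding D_def P_def by blast
  obtain n where n: "has_length A N n"
    using quadri_conditions(1)[OF B N(2,3)] by blast
  define \<rho> where "\<rho> = rad_module A (restr N D)"
  define T where "T = top_module A (restr N D)"
  note top = j.N.top_of_biserial_radical[OF has_length_height[OF n] D(1) L1 L2 sum inc, folded \<rho>_def
    T_def]
  have "injective_envelope_uniserial A (restr T ((\<lambda>x. \<rho> +>\<^bsub>N\<^esub> x) ` L1)) \<or>
    injective_envelope_uniserial A (restr T ((\<lambda>x. \<rho> +>\<^bsub>N\<^esub> x) ` L2))"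
    by (rule quadri_conditions(2)[OF B N(2,3), unfolded D(4), folded T_def, OF top(3,4,5)])
  \<comment> \<open>Whichever of \<open>L1\<close>, \<open>L2\<close> yields the summand with
    uniserial envelope is kept as \<open>L\<close>; pulled back to \<open>Ae\<close> it becomes
    \<open>X\<close>.\<close>
  then obtain L where L: "submodule L A N" "\<not> L \<subseteq> \<rho>" "L \<subseteq> D"
    and inj: "injective_envelope_uniserial A (restr T ((\<lambda>x. \<rho> +>\<^bsub>N\<^esub> x) ` L))"
    using top(6,7) L1 L2 j.N.set_add_upper[OF L1(1) L2(1)] sum by blast
  have \<rho>D: "\<rho> \<subseteq> D" by (auto simp: \<rho>_def rad_module_def)
  have J\<rho>: "a \<odot>\<^bsub>N\<^esub> x \<in> \<rho>" if a: "a \<in> jac A" and x: "x \<in> D" for a x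
    using top(2) N.jac_adjacent[OF _ a x] by blast
  obtain E :: "'a cat_module" and i where E: "injective_envelope A (restr T ((\<lambda>x. \<rho> +>\<^bsub>N\<^esub> x) ` L)) E i"
    "uniserial_module A E"
    using inj unfolding injective_envelope_uniserial_def by blast
  interpret D: left_module A "restr N D" by (rule j.N.left_module_restr[OF D(1)])
  have \<rho>s: "submodule \<rho> A (restr N D)" using top(1) \<rho>D by (simp add: j.N.submodule_restr[OF D(1)])
  have cos: "\<rho> +>\<^bsub>restr N D\<^esub> x = \<rho> +>\<^bsub>N\<^esub> x" for x by (simp add: a_r_coset_def')
  let ?\<pi> = "\<lambda>x. \<rho> +>\<^bsub>N\<^esub> x"
  have T: "T = quot_module (restr N D) \<rho>" by (simp add: T_def top_module_def \<rho>_def)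
  interpret \<pi>: left_module_hom A "restr N D" T ?\<pi>
    using D.quot_left_module_hom[OF \<rho>s] by (simp add: T cos)
  have \<pi>L: "?\<pi> \<in> module_hom A (restr N L) (restr T (?\<pi> ` L))"
    using module_hom_restr[OF \<pi>.hom, of L "?\<pi> ` L"] L(3) by simp
  have i: "i \<in> module_hom A (restr T (?\<pi> ` L)) E" "inj_on i (?\<pi> ` L)"
    using E by (auto simp: injective_envelope_def)
  have Einj: "injective_module A E" using E by (simp add: injective_envelope_def)
  have LD: "submodule L A (restr N D)" using L by (simp add: j.N.submodule_restr[OF D(1)])
  interpret i: left_module_hom A "restr T (?\<pi> ` L)" E i
    using Einj by (intro left_module_homI \<pi>.N.left_module_restr[OF \<pi>.submodule_image[OF LD]] i)
      (simp add: injective_module_def fg_module_def)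
  obtain \<rho>' X where \<rho>': "submodule \<rho>' A (pmod A e)" "\<rho> = j ` \<rho>'"
    and X: "submodule X A (pmod A e)" "L = j ` X"
    using j.submodule_eq_image[OF top(1)] j.submodule_eq_image[OF L(1)] by blast
  have \<rho>'s: "submodule \<rho>' A (reg A)" "\<rho>' \<subseteq> A.pid e" and Xs: "submodule X A (reg A)" "X \<subseteq> A.pid e"
    using \<rho>'(1) X(1) by (auto simp: A.submodule_pmod[OF ec])
  have XP: "X \<subseteq> P"
    using L(3) X(2) Xs(2) D_def j.image_mono_iff[of X P] P_def by simp
  have X\<rho>: "\<not> X \<subseteq> \<rho>'" using L(2) X(2) \<rho>'(2) by blast
  have mem: "j x \<in> \<rho> \<longleftrightarrow> x \<in> \<rho>'" if "x \<in> A.pid e" for x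
    using inj_on_image_mem_iff[OF j.inj, of x \<rho>'] that \<rho>'s(2) \<rho>'(2) by simp
  have jP: "j x \<in> D" "x \<in> A.pid e" "x \<in> carrier A" if "x \<in> P" for x
    using that by (auto simp: D_def P_def A.pid_def)
  have smult: "a \<otimes> x \<in> \<rho>'" if a: "a \<in> jac A" and x: "x \<in> P" for a x
  proof -
    have ac: "a \<in> carrier A" by (rule A.jac_closed[OF a])
    have "a \<otimes> x \<in> A.pid e" using ac jP[OF x] ec by (simp add: A.pid_def A.m_assoc)
    moreover have "j (a \<otimes> x) \<in> \<rho>"
      using J\<rho>[OF a jP(1)[OF x]] j.hom_smult[OF ac, of x] jP[OF x] by simp
    ultimately show ?thesis using mem by blast
  qed
  \<comment> \<open>The projection to the simple summand of the top followed by its envelope, so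
    that its kernel on \<open>X\<close> is \<open>X \<inter> \<rho>'\<close>.\<close>
  define \<theta> where "\<theta> x = i (?\<pi> (j x))" for x
  have "j \<in> module_hom A (restr (reg A) X) (restr N L)"
    using module_hom_restr[OF j.hom, of X L] Xs X by simp
  then have \<theta>: "\<theta> \<in> module_hom A (restr (reg A) X) E"
    unfolding \<theta>_def by (intro module_hom_compose[OF _ i(1)] module_hom_compose[OF _ \<pi>L])
  have \<theta>0: "\<theta> x = \<zero>\<^bsub>E\<^esub> \<longleftrightarrow> x \<in> \<rho>'" if x: "x \<in> X" for x
  proof -
    have jx: "j x \<in> L" using x X(2) by simp
    have z: "\<zero>\<^bsub>T\<^esub> \<in> ?\<pi> ` L" using \<pi>.N.submodule_zero[OF \<pi>.submodule_image[OF LD]] by simp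
    have "\<theta> x = i \<zero>\<^bsub>T\<^esub> \<longleftrightarrow> ?\<pi> (j x) = \<zero>\<^bsub>T\<^esub>"
      unfolding \<theta>_def using i(2) z jx by (auto dest: inj_onD)
    moreover have "i \<zero>\<^bsub>T\<^esub> = \<zero>\<^bsub>E\<^esub>" using i.hom_zero by simp
    moreover have "?\<pi> (j x) = \<zero>\<^bsub>T\<^esub> \<longleftrightarrow> j x \<in> \<rho>"
      using D.coset_zero[OF \<rho>s, of "j x"] jx L(3) D.quot_module_simps(1)[OF \<rho>s] by (auto simp: cos T)
    ultimately show ?thesis using mem x Xs(2) by auto
  qed
  have \<theta>J: "\<theta> (a \<otimes> x) = \<zero>\<^bsub>E\<^esub>" if "a \<in> jac A" "x \<in> X" for a x
  proof -
    interpret reg: left_module A "reg A" by (rule A.left_module_reg)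
    have "a \<otimes> x \<in> X" using reg.submodule_smult[OF Xs(1) A.jac_closed[OF that(1)] that(2)] by simp
    then show ?thesis using \<theta>0 smult[OF that(1)] XP that(2) by blast
  qed
  show ?thesis
    using smult \<theta>0 \<theta>J unfolding P_def
    by (intro exI[of _ \<rho>'] exI[of _ X] exI[of _ E] exI[of _ \<theta>] conjI ballI \<rho>'s(1) Xs(1) XP[unfolded
      P_def] X\<rho>
        Einj E(2) \<theta>) simp_all
qed

text \<open>The summands \<open>V\<close> and \<open>U\<close> of the radical are given as one-sided
  ideals and carried to a copy of the projective module, where (c) is available. The list of
  submodules of \<open>U\<close> expresses that \<open>U\<close> is uniserial of length two.\<close>

lemma condition_c:
  assumes B: "B \<in> {A, opposite_ring A}" and e: "primitive A e"
    and V: "adjacent B (reg B) {\<zero>} V" and Z: "adjacent B (reg B) {\<zero>} Z" and U: "adjacent B (reg B) Z U"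
    and uni: "\<And>W. submodule W B (reg B) \<Longrightarrow> W \<subseteq> U \<Longrightarrow> W = {\<zero>} \<or> W = Z \<or> W = U"
    and sum: "V <+>\<^bsub>reg B\<^esub> U = ring.pid B e \<inter> jac A" and int: "V \<inter> U = {\<zero>}"
  shows "\<exists>(E :: 'a cat_module) i. injective_module B E \<and> uniserial_module B E \<and>
    i \<in> module_hom B (restr (reg B) V) E \<and> inj_on i V"
proof -
  interpret B: ring B by (rule ring_B[OF B])
  interpret reg: left_module B "reg B" by (rule B.left_module_reg)
  have z: "\<zero>\<^bsub>B\<^esub> = \<zero>" using B by auto
  note pe = primitive_B[OF B e]
  note ec = B.primitive_closed[OF pe] and ee = B.primitive_idem[OF pe]
  obtain N :: "'a cat_module" and j where N: "projective_module B N" "indecomposable_module B N"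
    and j: "left_module_iso B (pmod B e) N j"
    using primitive_copy[OF B e] by blast
  interpret j: left_module_iso B "pmod B e" N j by fact
  define P where "P = B.pid e \<inter> jac A"
  define D where "D = j ` P"
  note D = copy_radical[OF B e j, folded P_def, folded D_def]
  have s: "submodule V B (reg B)" "submodule U B (reg B)" "submodule Z B (reg B)" "Z \<subseteq> U"
    using V U Z by (auto simp: adjacent_def)
  have VU: "V \<subseteq> P" "U \<subseteq> P" using reg.set_add_upper[OF s(1,2)] sum by (auto simp: P_def)
  have Pe: "P \<subseteq> B.pid e" by (auto simp: P_def)
  have ps: "submodule V B (pmod B e)" "submodule U B (pmod B e)" "submodule Z B (pmod B e)"
    using s VU Pe by (auto simp: B.submodule_pmod[OF ec])
  have adj: "adjacent B (pmod B e) Z' V'" if "adjacent B (reg B) Z' V'" "V' \<subseteq> P" for Z' V'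
    using reg.adjacent_restr[OF B.submodule_pid[OF ec], of V' Z'] that Pe by auto
  note jadj = j.adjacent_image[OF adj]
  have j0: "j ` {\<zero>} = {\<zero>\<^bsub>N\<^esub>}" using j.image_zero z by simp
  let ?R = "restr N D"
  have jV: "submodule (j ` V) B N" and jU: "submodule (j ` U) B N"
    using ps by (auto intro: j.submodule_image)
  have jD: "j ` V \<subseteq> D" "j ` U \<subseteq> D" using VU by (auto simp: D_def)
  have "internal_dsum B ?R (j ` V) (j ` U)"
    unfolding internal_dsum_def
  proof (intro conjI)
    show "submodule (j ` V) B ?R" "submodule (j ` U) B ?R"
      using jV jU jD by (simp_all add: j.N.submodule_restr[OF D(1)])
    have "j ` (V <+>\<^bsub>pmod B e\<^esub> U) = j ` V <+>\<^bsub>N\<^esub> j ` U"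
      using VU Pe by (intro j.image_set_add) auto
    then show "j ` V <+>\<^bsub>?R\<^esub> j ` U = carrier ?R" using sum by (simp add: set_add_def' D_def P_def)
    have "j ` V \<inter> j ` U = j ` (V \<inter> U)"
      using VU Pe by (intro inj_on_image_Int[OF j.inj, symmetric]) auto
    then show "j ` V \<inter> j ` U = {\<zero>\<^bsub>?R\<^esub>}" using int j0 by simp
  qed
  moreover have "simple_module B (restr N (j ` V))"
    using jadj[OF V VU(1)] j.N.simple_restr_iff[OF jV] j0 by simp
  moreover have "uniserial_module B (restr N (j ` U))"
  proof (rule j.N.uniserial_restrI[OF jU])
    have three: "W = {\<zero>\<^bsub>N\<^esub>} \<or> W = j ` Z \<or> W = j ` U" if W: "submodule W B N" "W \<subseteq> j ` U" for W
    proof -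
      obtain Y where Y: "submodule Y B (pmod B e)" "W = j ` Y" using j.submodule_eq_image[OF W(1)]
        by blast
      then have "Y \<subseteq> U"
        using W(2) j.image_mono_iff[OF j.M.submodule_subset[OF Y(1)] j.M.submodule_subset[OF ps(2)]]
          by simp
      then have "Y = {\<zero>} \<or> Y = Z \<or> Y = U" using Y(1) uni by (simp add: B.submodule_pmod[OF ec])
      then show ?thesis using Y(2) j0 by auto
    qed
    fix W W' assume W: "submodule W B N" "W \<subseteq> j ` U" and W': "submodule W' B N" "W' \<subseteq> j ` U"
    have "\<zero>\<^bsub>N\<^esub> \<in> W" "\<zero>\<^bsub>N\<^esub> \<in> W'" using W W' j.N.submodule_zero by auto
    then show "W \<subseteq> W' \<or> W' \<subseteq> W" using three[OF W] three[OF W'] s(4) by blast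
  qed
  moreover have "has_length B (restr N (j ` U)) 2"
    using jadj[OF Z] jadj[OF U VU(2)] s(4) VU(2) j0
    by (intro has_lengthI2[OF j.N.left_module_axioms, of "j ` Z"]) auto
  ultimately have "injective_envelope_uniserial B (restr N (j ` V))"
    by (rule quadri_conditions(3)[OF B N, unfolded D(4)])
  then obtain E :: "'a cat_module" and i where E: "injective_envelope B (restr N (j ` V)) E i"
    "uniserial_module B E"
    unfolding injective_envelope_uniserial_def by blast
  have i: "i \<in> module_hom B (restr N (j ` V)) E" "inj_on i (j ` V)" "injective_module B E"
    using E(1) by (auto simp: injective_envelope_def)
  have "j \<in> module_hom B (restr (reg B) V) (restr N (j ` V))"
    using module_hom_restr[OF j.hom, of V "j ` V"] VU Pe by auto
  from module_hom_compose[OF this i(1)] have "(\<lambda>x. i (j x)) \<in> module_hom B (restr (reg B) V) E" .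
  moreover have "inj_on (\<lambda>x. i (j x)) V"
    using comp_inj_on[OF inj_on_subset[OF j.inj], of V i] i(2) VU Pe by (auto simp: comp_def)
  ultimately show ?thesis using i(3) E(2) by blast
qed

end

section \<open>The injective module\<close>

lemma inj_on_subset_of_image_subset:
  assumes "inj_on f C" "X \<subseteq> C" "Y \<subseteq> C" "f ` X \<subseteq> f ` Y"
  shows "X \<subseteq> Y"
proof
  fix x assume "x \<in> X"
  then have "f x \<in> f ` Y" "x \<in> C" using assms by auto
  then show "x \<in> Y" using inj_on_image_mem_iff[OF assms(1) _ assms(3)] by simp
qed

lemma adjacentD:
  "adjacent A M Z V \<Longrightarrow> submodule U A M \<Longrightarrow> Z \<subseteq> U \<Longrightarrow> U \<subseteq> V \<Longrightarrow> U = Z \<or> U = V"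
  by (simp add: adjacent_def)

lemma adjacent_psubset: "adjacent A M Z V \<Longrightarrow> Z \<subset> V"
  by (simp add: adjacent_def)

text \<open>The surjection is conjugated with copies of \<open>X\<close> and \<open>Y\<close>, since
  projectivity is tested on modules of type \<open>cat_module\<close>.\<close>

lemma projective_lift:
  fixes A :: "('a, 'r) ring_scheme"
  assumes P: "projective_module A P" and X: "fg_module A X" and Y: "fg_module A Y"
    and q: "q \<in> module_hom A X Y" "q ` carrier X = carrier Y" and g: "g \<in> module_hom A P Y"
  shows "\<exists>h\<in>module_hom A P X. \<forall>z\<in>carrier P. q (h z) = g z"
proof -
  obtain X' :: "'a cat_module" and i where X': "fg_module A X'" "i \<in> module_hom A X X'"
    "bij_betw i (carrier X) (carrier X')"
    using fg_module_copy[OF X] by blast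
  obtain Y' :: "'a cat_module" and l where Y': "fg_module A Y'" "l \<in> module_hom A Y Y'"
    "bij_betw l (carrier Y) (carrier Y')"
    using fg_module_copy[OF Y] by blast
  interpret i: left_module_hom A X X' i
    by (intro left_module_homI fg_module_left_module X X')
  let ?i = "the_inv_into (carrier X) i"
  have i_inv: "?i \<in> module_hom A X' X" by (rule i.inverse_hom[OF X'(3)])
  have i_img: "?i ` carrier X' = carrier X"
    using X'(3) the_inv_into_onto[of i "carrier X"] by (auto simp: bij_betw_def)
  let ?q = "\<lambda>x. l (q (?i x))"
  have "?q \<in> module_hom A X' Y'" by (intro module_hom_compose[OF _ Y'(2)] module_hom_compose[OF i_inv
    q(1)])
  moreover have "?q ` carrier X' = carrier Y'"
  proof -
    have "?q ` carrier X' = l ` (q ` (?i ` carrier X'))" by (simp add: image_image)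
    then show ?thesis using i_img q(2) Y'(3) by (simp add: bij_betw_def)
  qed
  moreover have "(\<lambda>z. l (g z)) \<in> module_hom A P Y'" by (rule module_hom_compose[OF g Y'(2)])
  ultimately have "\<exists>h \<in> module_hom A P X'. \<forall>z\<in>carrier P. ?q (h z) = l (g z)"
    using conjunct2[OF P[unfolded projective_module_def], rule_format, of X' Y' ?q
      "\<lambda>z. l (g z)"] X'(1) Y'(1) by simp
  then obtain h where h: "h \<in> module_hom A P X'" "\<And>z. z \<in> carrier P \<Longrightarrow> ?q (h z) = l (g z)" by blast
  have "q (?i (h z)) = g z" if z: "z \<in> carrier P" for z
  proof -
    have "h z \<in> carrier X'" using h(1) z by (auto simp: module_hom_def)
    then have "?i (h z) \<in> carrier X" using i_img by blast
    then have "q (?i (h z)) \<in> carrier Y" "g z \<in> carrier Y" using q(2) g z by (auto simp: module_hom_def)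
    then show ?thesis using h(2)[OF z] Y'(3) by (auto simp: bij_betw_def dest: inj_onD)
  qed
  then show ?thesis using module_hom_compose[OF h(1) i_inv] by (intro bexI[of _ "\<lambda>z. ?i (h z)"]) auto
qed

text \<open>Since the cover \<open>P\<close> is projective, its map to \<open>S\<close> lifts
  through the map from \<open>Ae\<close> to \<open>S\<close>. The lift is onto because
  \<open>eAe\<close> is local, so \<open>Ae\<close> is a quotient of the uniserial module
  \<open>P\<close>.\<close>

lemma (in ring) uniserial_pmod_of_cover:
  assumes S: "simple_module R S" "fg_module R S" and cover: "projective_cover_uniserial R S"
    and e: "primitive R e" and x: "x \<in> carrier S" "e \<odot>\<^bsub>S\<^esub> x = x" "x \<noteq> \<zero>\<^bsub>S\<^esub>"
  shows "uniserial_module R (pmod R e)"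
proof -
  note ec = primitive_closed[OF e] and ee = primitive_idem[OF e]
  interpret S: left_module R S using S(1) by (simp add: simple_module_def)
  interpret reg: left_module R "reg R" by (rule left_module_reg)
  interpret Re: left_module R "pmod R e" by (rule left_module_pmod[OF ec])
  obtain P :: "'a cat_module" and p where "projective_cover R S P p" and P: "uniserial_module R P"
    using cover unfolding projective_cover_uniserial_def by blast
  then have P': "projective_module R P" and p: "p \<in> module_hom R P S" "p ` carrier P = carrier S"
    by (auto simp: projective_cover_def)
  interpret p: left_module_hom R P S p
    using P p by (intro left_module_homI S.left_module_axioms) (auto simp: uniserial_module_def)
  let ?q = "\<lambda>a. a \<odot>\<^bsub>S\<^esub> x"
  have q: "?q \<in> module_hom R (pmod R e) S"
    using x(1) by (intro module_homI) (auto simp: pid_def S.smult_closed S.smult_l_distr S.smult_assoc)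
  interpret q: left_module_hom R "pmod R e" S ?q
    by (intro left_module_homI q Re.left_module_axioms S.left_module_axioms)
  have "submodule (?q ` pid e) R S" using q.submodule_image[OF Re.submodule_UNIV] by simp
  moreover have "x \<in> ?q ` pid e" using x(2) pid_self[OF ec ee] by force
  ultimately have qs: "?q ` carrier (pmod R e) = carrier S"
    using S(1) x(3) unfolding simple_module_def by auto
  obtain \<alpha> where \<alpha>: "\<alpha> \<in> module_hom R P (pmod R e)" "\<And>z. z \<in> carrier P \<Longrightarrow> ?q (\<alpha> z) = p z"
    using projective_lift[OF P' fg_module_pmod[OF ec ee] S(2) q qs p(1)] by blast
  interpret \<alpha>: left_module_hom R P "pmod R e" \<alpha>
    by (intro left_module_homI \<alpha>(1) p.M.left_module_axioms Re.left_module_axioms)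
  obtain y where y: "y \<in> carrier P" "p y = x" using p(2) x(1) by (metis imageE)
  define u where "u = \<alpha> (e \<odot>\<^bsub>P\<^esub> y)"
  have eyc: "e \<odot>\<^bsub>P\<^esub> y \<in> carrier P" using p.M.smult_closed[OF ec y(1)] .
  have u: "u \<in> carrier R" "u \<otimes> e = u" using \<alpha>.hom_closed[OF eyc] by (auto simp: u_def pid_def)
  have "e \<odot>\<^bsub>P\<^esub> (e \<odot>\<^bsub>P\<^esub> y) = e \<odot>\<^bsub>P\<^esub> y" using p.M.smult_assoc[OF ec ec y(1)] ee by simp
  then have eu: "e \<otimes> u = u" using \<alpha>.hom_smult[OF ec eyc] by (simp add: u_def)
  have ux: "u \<odot>\<^bsub>S\<^esub> x = x"
    using \<alpha>(2)[OF eyc] p.hom_smult[OF ec y(1)] y(2) x(2) by (simp add: u_def)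
  \<comment> \<open>\<open>u\<close> fixes \<open>x\<close>, so \<open>e - u\<close> annihilates it,
    and \<open>u\<close> must be the invertible one of the two.\<close>
  have "\<not> unit_in R e (e \<ominus> u)"
  proof
    assume "unit_in R e (e \<ominus> u)"
    then obtain v where v: "v \<in> carrier R" "v \<otimes> (e \<ominus> u) = e" by (auto simp: unit_in_def)
    have "(e \<ominus> u) \<odot>\<^bsub>S\<^esub> x = \<zero>\<^bsub>S\<^esub>"
      using x u ec ux by (simp add: S.smult_diff_l S.diff_eq_zero)
    then have "v \<odot>\<^bsub>S\<^esub> ((e \<ominus> u) \<odot>\<^bsub>S\<^esub> x) = \<zero>\<^bsub>S\<^esub>" using v by simp
    then show False using v x u ec by (simp add: S.smult_assoc[symmetric])
  qed
  then obtain v where v: "v \<in> carrier R" "v \<otimes> u = e"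
    using e u eu by (auto simp: primitive_def unit_in_def)
  have "\<alpha> ` carrier P = carrier (pmod R e)"
  proof
    show "\<alpha> ` carrier P \<subseteq> carrier (pmod R e)" using \<alpha>.hom_closed by blast
    show "carrier (pmod R e) \<subseteq> \<alpha> ` carrier P"
    proof
      fix a assume "a \<in> carrier (pmod R e)"
      then have a: "a \<in> carrier R" "a = a \<otimes> e" by (auto simp: pid_def)
      have "\<alpha> ((a \<otimes> v) \<odot>\<^bsub>P\<^esub> (e \<odot>\<^bsub>P\<^esub> y)) = (a \<otimes> v) \<otimes> u"
        using \<alpha>.hom_smult[of "a \<otimes> v", OF _ eyc] a v by (simp add: u_def)
      also have "\<dots> = a" using a v u by (simp add: m_assoc)
      finally show "a \<in> \<alpha> ` carrier P"
        using p.M.smult_closed[of "a \<otimes> v", OF _ eyc] a v by (metis imageI m_closed)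
    qed
  qed
  then show ?thesis using \<alpha>.uniserial_image P by blast
qed

text \<open>Cut a coefficient \<open>a\<close> with \<open>y = a x\<close> down to
  \<open>f a e\<close>. Were it outside the radical, \<open>e\<close> would be a left multiple of it
  and \<open>x\<close> a multiple of \<open>y\<close>, hence in \<open>Z\<close>.\<close>

lemma (in ep_module) ex_radical_element:
  assumes e: "primitive R e" and f: "primitive R f" and x: "x \<in> carrier M" "e \<odot>\<^bsub>M\<^esub> x = x" "x \<notin> Z"
    and Z: "submodule Z R M" and y: "y \<in> Z" "y \<in> cyc x" "f \<odot>\<^bsub>M\<^esub> y = y"
  shows "\<exists>p\<in>jac R. f \<otimes> p = p \<and> p \<otimes> e = p \<and> p \<odot>\<^bsub>M\<^esub> x = y"
proof -
  note ec = R.primitive_closed[OF e] and ee = R.primitive_idem[OF e]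
  note fc = R.primitive_closed[OF f] and ff = R.primitive_idem[OF f]
  obtain a where a: "a \<in> carrier R" "y = a \<odot>\<^bsub>M\<^esub> x" using y(2) by (auto simp: cyc_def)
  let ?p = "f \<otimes> a \<otimes> e"
  have p: "?p \<in> carrier R" "f \<otimes> ?p = ?p" "?p \<otimes> e = ?p"
    using ec fc ee ff a by (simp_all add: R.m_assoc[symmetric]) (simp add: R.m_assoc)
  have px: "?p \<odot>\<^bsub>M\<^esub> x = y"
    using ec fc a x y(3) by (simp add: smult_assoc)
  have "?p \<in> jac R"
  proof (rule ccontr)
    assume "?p \<notin> jac R"
    then obtain b where b: "b \<in> carrier R" "b \<otimes> ?p = e" using R.not_jac_left[OF e p(1,3)] by blast
    have "x = b \<odot>\<^bsub>M\<^esub> (?p \<odot>\<^bsub>M\<^esub> x)" using b p(1) x by (simp add: smult_assoc[symmetric])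
    then show False using px submodule_smult[OF Z b(1) y(1)] x(3) by simp
  qed
  with p px show ?thesis by blast
qed

text \<open>The hypotheses of the theorem expressed in the submodule lattice of \<open>I\<close>.
  The projective cover of \<open>R / \<sigma>\<close> is replaced by \<open>Ae\<close> for each
  primitive \<open>e\<close> that fixes an element of \<open>R\<close> outside \<sigma>.\<close>

locale biserial_injective = quadri k A \<phi> + I: ep_module A I
  for k :: "('k, 's) ring_scheme" and A :: "('a, 'r) ring_scheme" (structure) and \<phi> :: "'k \<Rightarrow> 'a"
    and I :: "('a, 'i) module" +
  fixes \<sigma> M1 M2 R :: "'i set"
  assumes injective: "injective_module A I"
    and \<sigma>_min: "\<And>U. submodule U A I \<Longrightarrow> U \<noteq> {\<zero>\<^bsub>I\<^esub>} \<Longrightarrow> \<sigma> \<subseteq> U"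
    and adj_\<sigma>: "adjacent A I {\<zero>\<^bsub>I\<^esub>} \<sigma>"
    and adj_M1: "adjacent A I \<sigma> M1" and adj_R: "adjacent A I \<sigma> R" and adj_M2: "adjacent A I R M2"
    and chain_M2: "\<And>U. submodule U A I \<Longrightarrow> \<sigma> \<subseteq> U \<Longrightarrow> U \<subseteq> M2 \<Longrightarrow> U = \<sigma> \<or> U = R \<or> U = M2"
    and Int_M: "M1 \<inter> M2 = \<sigma>" and sum_M: "M1 <+>\<^bsub>I\<^esub> M2 = carrier I"
    and uniserial_S: "\<And>e r. primitive A e \<Longrightarrow> r \<in> R \<Longrightarrow> r \<notin> \<sigma> \<Longrightarrow> e \<odot>\<^bsub>I\<^esub> r = r \<Longrightarrow>
      uniserial_module A (pmod A e)"
begin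

abbreviation smul (infixr "\<cdot>" 75) where "a \<cdot> x \<equiv> a \<odot>\<^bsub>I\<^esub> x"

lemma sub: "submodule \<sigma> A I" "submodule M1 A I" "submodule R A I" "submodule M2 A I"
  using adj_\<sigma> adj_M1 adj_M2 by (auto simp: adjacent_def)

lemma le: "\<sigma> \<subseteq> M1" "\<sigma> \<subseteq> R" "R \<subseteq> M2" "\<sigma> \<subseteq> M2" "{\<zero>\<^bsub>I\<^esub>} \<noteq> \<sigma>" "\<sigma> \<noteq> M1" "\<sigma> \<noteq> R" "R \<noteq> M2"
  using adjacent_psubset[OF adj_\<sigma>] adjacent_psubset[OF adj_M1] adjacent_psubset[OF adj_R]
    adjacent_psubset[OF adj_M2]
  by (simp_all add: psubset_eq order.trans[of \<sigma> R M2])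

lemmas carr = I.submodule_carrier[OF sub(1)] I.submodule_carrier[OF sub(2)]
  I.submodule_carrier[OF sub(3)] I.submodule_carrier[OF sub(4)]

lemma Int_M1_R: "M1 \<inter> R = \<sigma>"
proof
  show "M1 \<inter> R \<subseteq> \<sigma>" unfolding Int_M[symmetric] using le(3) by (intro Int_mono order.refl)
  show "\<sigma> \<subseteq> M1 \<inter> R" using le(1,2) by (rule Int_greatest)
qed

lemma \<sigma>_in_cyc: "x \<in> carrier I \<Longrightarrow> x \<noteq> \<zero>\<^bsub>I\<^esub> \<Longrightarrow> \<sigma> \<subseteq> I.cyc x"
  using I.cyc_self[of x] by (intro \<sigma>_min I.submodule_cyc) auto

lemma cyc_M1: "x \<in> M1 \<Longrightarrow> x \<notin> \<sigma> \<Longrightarrow> I.cyc x = M1"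
  using adj_M1 I.submodule_cyc[of x] \<sigma>_in_cyc[of x] I.cyc_least[OF sub(2), of x] I.cyc_self[of x]
    carr(2)[of x]
    I.submodule_zero[OF sub(1)] unfolding adjacent_def by blast

lemma cyc_R: "x \<in> R \<Longrightarrow> x \<notin> \<sigma> \<Longrightarrow> I.cyc x = R"
  using adj_R I.submodule_cyc[of x] \<sigma>_in_cyc[of x] I.cyc_least[OF sub(3), of x] I.cyc_self[of x]
    carr(3)[of x]
    I.submodule_zero[OF sub(1)] unfolding adjacent_def by blast

lemma cyc_M2: "x \<in> M2 \<Longrightarrow> x \<notin> R \<Longrightarrow> I.cyc x = M2"
  using chain_M2[of "I.cyc x"] I.submodule_cyc[of x] \<sigma>_in_cyc[of x] I.cyc_least[OF sub(4), of x]
    I.cyc_self[of x] carr(4)[of x]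
    I.submodule_zero[OF sub(3)] le(2) by blast

lemma cyc_\<sigma>: "x \<in> \<sigma> \<Longrightarrow> x \<noteq> \<zero>\<^bsub>I\<^esub> \<Longrightarrow> I.cyc x = \<sigma>"
  using \<sigma>_in_cyc[of x] I.cyc_least[OF sub(1), of x] carr(1) by blast

lemma jac_smul: "a \<in> jac A \<Longrightarrow> x \<in> \<sigma> \<Longrightarrow> a \<cdot> x = \<zero>\<^bsub>I\<^esub>" "a \<in> jac A \<Longrightarrow> x \<in> M1 \<Longrightarrow> a \<cdot> x \<in> \<sigma>"
    "a \<in> jac A \<Longrightarrow> x \<in> R \<Longrightarrow> a \<cdot> x \<in> \<sigma>" "a \<in> jac A \<Longrightarrow> x \<in> M2 \<Longrightarrow> a \<cdot> x \<in> R"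
  using I.jac_adjacent[OF adj_\<sigma>] I.jac_adjacent[OF adj_M1] I.jac_adjacent[OF adj_R] I.jac_adjacent[OF
    adj_M2]
  by auto

lemma jac_smul_R: "a \<in> jac A \<Longrightarrow> x \<in> carrier I \<Longrightarrow> a \<cdot> x \<in> R"
proof -
  assume a: "a \<in> jac A" and "x \<in> carrier I"
  then obtain y z where yz: "y \<in> M1" "z \<in> M2" "x = y \<oplus>\<^bsub>I\<^esub> z" using I.set_add_iff[of x M1 M2] sum_M by auto
  then have "a \<cdot> x = a \<cdot> y \<oplus>\<^bsub>I\<^esub> a \<cdot> z" using carr(2,4) A.jac_closed[OF a] by (simp add: I.smult_r_distr)
  then show "a \<cdot> x \<in> R"
    using jac_smul(2)[OF a yz(1)] jac_smul(4)[OF a yz(2)] le(2) I.submodule_add[OF sub(3)] by auto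
qed

abbreviation L where "L \<equiv> M1 <+>\<^bsub>I\<^esub> R"

lemma sub_L: "submodule L A I" by (rule I.submodule_set_add[OF sub(2,3)])

lemma le_L: "M1 \<subseteq> L" "R \<subseteq> L" by (rule I.set_add_upper[OF sub(2,3)])+

text \<open>By the modular law \<open>X\<close> is \<open>M1 + (M2 \<inter> X)\<close>, and the
  second summand is one of \<sigma>, \<open>R\<close>, \<open>M2\<close>.\<close>

lemma above_M1:
  assumes X: "submodule X A I" "M1 \<subseteq> X"
  shows "X = M1 \<or> X = L \<or> X = carrier I"
proof -
  have "X = (M1 <+>\<^bsub>I\<^esub> M2) \<inter> X" using sum_M I.submodule_subset[OF X(1)] by auto
  also have "\<dots> = M1 <+>\<^bsub>I\<^esub> (M2 \<inter> X)" by (rule I.modular_law[OF sub(2,4) X])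
  finally have eq: "X = M1 <+>\<^bsub>I\<^esub> (M2 \<inter> X)" .
  have "M2 \<inter> X = \<sigma> \<or> M2 \<inter> X = R \<or> M2 \<inter> X = M2"
    using X le by (intro chain_M2 I.submodule_Int sub) auto
  moreover have "M1 <+>\<^bsub>I\<^esub> \<sigma> = M1"
    using I.set_add_least[OF sub(2) order.refl le(1)] I.set_add_upper[OF sub(2,1)] by blast
  ultimately show ?thesis using eq sum_M by auto
qed

lemma above_M1_comparable:
  assumes "submodule X A I" "M1 \<subseteq> X" "submodule Y A I" "M1 \<subseteq> Y"
  shows "X \<subseteq> Y \<or> Y \<subseteq> X"
  using above_M1[OF assms(1,2)] above_M1[OF assms(3,4)] I.submodule_subset[OF sub_L] le_L
    I.submodule_subset[OF assms(1)]
    I.submodule_subset[OF assms(3)] by auto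

lemma M2_Int_L: "M2 \<inter> L = R"
proof -
  have "(R <+>\<^bsub>I\<^esub> M1) \<inter> M2 = R <+>\<^bsub>I\<^esub> (M1 \<inter> M2)" by (rule I.modular_law[OF sub(3,2,4) le(3)])
  also have "\<dots> = R"
    unfolding Int_M using I.set_add_least[OF sub(3) order.refl le(2)] I.set_add_upper[OF sub(3,1)]
      by blast
  finally show ?thesis
    using I.set_add_comm[OF I.submodule_subset[OF sub(3)] I.submodule_subset[OF sub(2)]] by blast
qed

text \<open>A nonzero kernel would contain \<sigma>.\<close>

lemma inj_if_nonzero_on_\<sigma>:
  assumes g: "left_module_hom A I N g" and s: "s \<in> \<sigma>" "g s \<noteq> \<zero>\<^bsub>N\<^esub>"
  shows "inj_on g (carrier I)"
proof -
  interpret g: left_module_hom A I N g by fact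
  have "{x \<in> carrier I. g x = \<zero>\<^bsub>N\<^esub>} = {\<zero>\<^bsub>I\<^esub>}"
    using \<sigma>_min[OF g.submodule_kernel] s by blast
  then show ?thesis by (intro g.inj_onI_kernel) blast
qed

end

text \<open>Here \<open>q\<close>, \<open>p\<close>, \<open>g\<close> play the part of arrows of a
  quiver. The elements \<open>v\<close> and \<open>g\<close> with \<open>w = g v\<close> go one step
  further up in \<open>M2\<close>: they make \<open>p g\<close> nonzero, which supplies the fourth
  composition factor of the right ideal \<open>e0 A\<close>.\<close>

locale biserial_injective_elements = biserial_injective k A \<phi> I \<sigma> M1 M2 R
  for k :: "('k, 's) ring_scheme" and A :: "('a, 'r) ring_scheme" (structure) and \<phi> :: "'k \<Rightarrow> 'a"
    and I :: "('a, 'i) module" and \<sigma> M1 M2 R :: "'i set" +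
  fixes e0 e1 e2 e3 p q g :: 'a and s t w v :: 'i
  assumes e0: "primitive A e0" and e1: "primitive A e1" and e2: "primitive A e2" and e3: "primitive A e3"
    and s: "s \<in> \<sigma>" "s \<noteq> \<zero>\<^bsub>I\<^esub>" "e0 \<odot>\<^bsub>I\<^esub> s = s"
    and t: "t \<in> M1" "t \<notin> \<sigma>" "e1 \<odot>\<^bsub>I\<^esub> t = t"
    and w: "w \<in> R" "w \<notin> \<sigma>" "e2 \<odot>\<^bsub>I\<^esub> w = w"
    and v: "v \<in> M2" "v \<notin> R" "e3 \<odot>\<^bsub>I\<^esub> v = v"
    and q: "q \<in> jac A" "e0 \<otimes> q = q" "q \<otimes> e1 = q" "q \<odot>\<^bsub>I\<^esub> t = s"
    and p: "p \<in> jac A" "e0 \<otimes> p = p" "p \<otimes> e2 = p" "p \<odot>\<^bsub>I\<^esub> w = s"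
    and g: "g \<in> jac A" "e2 \<otimes> g = g" "g \<otimes> e3 = g" "g \<odot>\<^bsub>I\<^esub> v = w"

context biserial_injective
begin

lemma ex_elements: "\<exists>e0 e1 e2 e3 p q g s t w v. biserial_injective_elements k A \<phi> I \<sigma> M1 M2 R e0 e1 e2 e3 p q g s t w v"
proof -
  \<comment> \<open>An element of \<open>V\<close> outside \<open>Z\<close> stays outside after
    multiplication by a suitable primitive idempotent, which fixes the product.\<close>
  have pick: "\<exists>e x. primitive A e \<and> x \<in> V \<and> x \<notin> Z \<and> e \<cdot> x = x" if adj: "adjacent A I Z V" for Z V
  proof -
    have Z: "submodule Z A I" and V: "submodule V A I" using adj by (auto simp: adjacent_def)
    obtain x where x: "x \<in> V" "x \<notin> Z" using adj by (auto simp: adjacent_def)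
    have xc: "x \<in> carrier I" by (rule I.submodule_carrier[OF V x(1)])
    obtain e where e: "primitive A e" "e \<cdot> x \<notin> Z" using I.ex_primitive_smult[OF Z xc x(2)] by blast
    have "e \<cdot> (e \<cdot> x) = e \<cdot> x"
      using A.primitive_closed[OF e(1)] A.primitive_idem[OF e(1)] xc
        by (simp add: I.smult_assoc[symmetric])
    then show ?thesis using e I.submodule_smult[OF V A.primitive_closed[OF e(1)] x(1)] by blast
  qed
  obtain e0 s where s: "primitive A e0" "s \<in> \<sigma>" "s \<notin> {\<zero>\<^bsub>I\<^esub>}" "e0 \<cdot> s = s" using pick[OF adj_\<sigma>] by blast
  obtain e1 t where t: "primitive A e1" "t \<in> M1" "t \<notin> \<sigma>" "e1 \<cdot> t = t" using pick[OF adj_M1] by blast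
  obtain e3 v where v: "primitive A e3" "v \<in> M2" "v \<notin> R" "e3 \<cdot> v = v" using pick[OF adj_M2] by blast
  obtain e2 w where w: "primitive A e2" "w \<in> R" "w \<notin> \<sigma>" "e2 \<cdot> w = w" using pick[OF adj_R] by blast
  have st: "s \<in> I.cyc t" "s \<in> I.cyc w" "w \<in> I.cyc v"
    using cyc_M1[OF t(2,3)] cyc_R[OF w(2,3)] cyc_M2[OF v(2,3)] s(2) w(2) le by auto
  obtain q where q: "q \<in> jac A" "e0 \<otimes> q = q" "q \<otimes> e1 = q" "q \<cdot> t = s"
    using I.ex_radical_element[OF t(1) s(1) carr(2)[OF t(2)] t(4,3) sub(1) s(2) st(1) s(4)] by blast
  obtain p where p: "p \<in> jac A" "e0 \<otimes> p = p" "p \<otimes> e2 = p" "p \<cdot> w = s"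
    using I.ex_radical_element[OF w(1) s(1) carr(3)[OF w(2)] w(4,3) sub(1) s(2) st(2) s(4)] by blast
  obtain g where g: "g \<in> jac A" "e2 \<otimes> g = g" "g \<otimes> e3 = g" "g \<cdot> v = w"
    using I.ex_radical_element[OF v(1) w(1) carr(4)[OF v(2)] v(4,3) sub(3) w(2) st(3) w(4)] by blast
  have "biserial_injective_elements k A \<phi> I \<sigma> M1 M2 R e0 e1 e2 e3 p q g s t w v"
    by unfold_locales (use s t v w q p g in auto)
  then show ?thesis by blast
qed

end

section \<open>Multiplicative relations between the chosen elements\<close>

context biserial_injective_elements
begin

lemma cl [simp]: "e0 \<in> carrier A" "e1 \<in> carrier A" "e2 \<in> carrier A" "e3 \<in> carrier A" "p \<in> carrier A"
  "q \<in> carrier A"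
  "g \<in> carrier A" "s \<in> carrier I" "t \<in> carrier I" "w \<in> carrier I" "v \<in> carrier I"
  using e0 e1 e2 e3 p q g s t w v carr A.primitive_closed A.jac_closed by auto

lemma idem [simp]: "e0 \<otimes> e0 = e0" "e1 \<otimes> e1 = e1" "e2 \<otimes> e2 = e2" "e3 \<otimes> e3 = e3"
  using e0 e1 e2 e3 A.primitive_idem by auto

text \<open>The radical annihilates \<sigma>, so \<open>b e0\<close> is outside the radical and can
  be cancelled.\<close>

lemma s_unit:
  assumes "b \<in> carrier A" "b \<cdot> s \<noteq> \<zero>\<^bsub>I\<^esub>"
  shows "\<exists>c\<in>carrier A. c \<otimes> (b \<otimes> e0) = e0"
proof (rule A.not_jac_left[OF e0])
  have "(b \<otimes> e0) \<cdot> s = b \<cdot> s" using assms(1) s by (simp add: I.smult_assoc)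
  then show "b \<otimes> e0 \<notin> jac A" using jac_smul(1)[OF _ s(1)] assms(2) by auto
qed (use assms(1) in \<open>simp_all add: A.m_assoc\<close>)

sublocale reg: ep_module A "reg A"
  by (intro ep_module.intro A.left_module_reg enough_primitives_axioms)

sublocale ro: left_module "opposite_ring A" "reg (opposite_ring A)"
  by (rule op.left_module_reg)

text \<open>If \<open>b a = 0\<close> then \<open>b s = 0\<close>, since otherwise
  \<open>b e0\<close> could be cancelled and \<open>a = e0 a\<close> would vanish. So some map from
  \<open>A\<close> to \<open>I\<close> sends \<open>a\<close> to \<open>s\<close>, and the image
  \<open>x\<close> of the unit satisfies \<open>a x = s\<close>.\<close>

lemma faithful:
  assumes a: "a \<in> carrier A" "e0 \<otimes> a = a" "a \<noteq> \<zero>"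
  shows "\<exists>x\<in>carrier I. a \<cdot> x \<noteq> \<zero>\<^bsub>I\<^esub>"
proof -
  have "\<exists>h\<in>module_hom A (reg A) I. (\<forall>z\<in>{\<zero>\<^bsub>reg A\<^esub>}. h z = \<zero>\<^bsub>I\<^esub>) \<and> h a = s"
  proof (rule injective_extend[OF injective A.fg_module_reg reg.submodule_zero_set])
    fix b assume b: "b \<in> carrier A" and "b \<odot>\<^bsub>reg A\<^esub> a \<in> {\<zero>\<^bsub>reg A\<^esub>}"
    then have ba: "b \<otimes> a = \<zero>" by simp
    show "b \<cdot> s = \<zero>\<^bsub>I\<^esub>"
    proof (rule ccontr)
      assume "b \<cdot> s \<noteq> \<zero>\<^bsub>I\<^esub>"
      then obtain c where c: "c \<in> carrier A" "c \<otimes> (b \<otimes> e0) = e0" using s_unit[OF b] by blast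
      have "a = c \<otimes> (b \<otimes> e0) \<otimes> a" using a c by simp
      also have "\<dots> = c \<otimes> (b \<otimes> (e0 \<otimes> a))" using a(1) b c(1) by (simp add: A.m_assoc)
      also have "\<dots> = \<zero>" using a ba c by simp
      finally show False using a by simp
    qed
  qed (use a in auto)
  then obtain h where h: "h \<in> module_hom A (reg A) I" "h a = s" by blast
  interpret h: left_module_hom A "reg A" I h
    by (intro left_module_homI h A.left_module_reg I.left_module_axioms)
  have "h (a \<otimes> \<one>) = a \<cdot> h \<one>" using h.hom_smult[of a \<one>] a by simp
  then show ?thesis using h.hom_closed[of \<one>] h(2) a s(2) by (intro bexI[of _ "h \<one>"]) auto
qed

text \<open>\<open>x\<close> acts on \<open>y\<close>, while all products of two radical elements
  kill \<open>y\<close>. If \<open>b\<close> were not in \<open>A x\<close>, then for some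
  \<open>f\<close> neither is \<open>f b\<close>; uniseriality gives \<open>x = d b\<close> with
  \<open>d\<close> in \<open>e0 A f\<close>, and \<open>d\<close> is not in the radical. Cancelling
  \<open>d\<close> puts \<open>f b\<close> into \<open>A x\<close>, a contradiction.\<close>

lemma cyclic_radical:
  assumes e: "primitive A e" and uni: "uniserial_module A (pmod A e)"
    and x: "x \<in> jac A" "e0 \<otimes> x = x" "x \<otimes> e = x"
    and y: "y \<in> carrier I" "x \<cdot> y \<noteq> \<zero>\<^bsub>I\<^esub>" "\<And>a b. a \<in> jac A \<Longrightarrow> b \<in> jac A \<Longrightarrow> a \<cdot> (b \<cdot> y) = \<zero>\<^bsub>I\<^esub>"
    and b: "b \<in> jac A" "b \<otimes> e = b"
  shows "\<exists>c\<in>carrier A. b = c \<otimes> x"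
proof (rule ccontr)
  note ec = A.primitive_closed[OF e] and xc = A.jac_closed[OF x(1)] and bc = A.jac_closed[OF b(1)]
  assume "\<not> ?thesis"
  then have "b \<notin> reg.cyc x" by (auto simp: reg.cyc_def)
  then obtain f where f: "primitive A f" "f \<otimes> b \<notin> reg.cyc x"
    using reg.ex_primitive_smult[OF reg.submodule_cyc[of x], of b] xc bc by auto
  note fc = A.primitive_closed[OF f(1)] and ff = A.primitive_idem[OF f(1)]
  have "submodule (reg.cyc x) A (pmod A e)" "submodule (reg.cyc (f \<otimes> b)) A (pmod A e)"
    unfolding A.submodule_pmod[OF ec] using xc bc fc ec b x reg.submodule_cyc[of x] reg.submodule_cyc[of
      "f \<otimes> b"]
    by (auto simp: reg.cyc_def A.pid_def A.m_assoc)
  then have "reg.cyc x \<subseteq> reg.cyc (f \<otimes> b) \<or> reg.cyc (f \<otimes> b) \<subseteq> reg.cyc x"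
    using uni unfolding uniserial_module_def by blast
  then have "x \<in> reg.cyc (f \<otimes> b)" using reg.cyc_self[of x] reg.cyc_self[of "f \<otimes> b"] f(2) xc bc fc by auto
  then obtain c where c: "c \<in> carrier A" "x = c \<otimes> (f \<otimes> b)" by (auto simp: reg.cyc_def)
  let ?d = "e0 \<otimes> (c \<otimes> f)"
  have db: "?d \<otimes> b = x" using c(1) fc bc x(2) unfolding c(2) by (simp add: A.m_assoc)
  have d: "?d \<in> carrier A" "?d \<otimes> f = ?d" using c fc ff by (simp_all add: A.m_assoc)
  have "?d \<notin> jac A"
  proof
    assume "?d \<in> jac A"
    from y(3)[OF this b(1)] have "x \<cdot> y = \<zero>\<^bsub>I\<^esub>" using d bc y(1) db by (simp add: I.smult_assoc[symmetric])
    with y(2) show False by simp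
  qed
  then obtain z where z: "z \<in> carrier A" "z \<otimes> ?d = f" using A.not_jac_left[OF f(1) d] by blast
  have "f \<otimes> b = z \<otimes> x" using z d bc db by (metis A.m_assoc)
  then have "f \<otimes> b \<in> reg.cyc x" using z(1) by (auto simp: reg.cyc_def)
  with f(2) show False by blast
qed

lemma jac_e2: "b \<in> jac A \<Longrightarrow> b \<otimes> e2 = b \<Longrightarrow> \<exists>c\<in>carrier A. b = c \<otimes> p"
  using cyclic_radical[OF e2 uniserial_S[OF e2 w] p(1-3), of w b] p(4) s(2) jac_smul(1)[OF _
    jac_smul(3)[OF _ w(1)]]
  by auto

text \<open>
  Otherwise \<open>M1\<close> and \<open>R\<close> are isomorphic quotients of \<open>P\<^sub>S\<close>, and an isomorphism extends to an injective
  endomorphism of \<open>I\<close> that maps \<open>R\<close> to \<open>M1\<close>; but the submodules containing \<open>M1\<close> form a chain.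
\<close>

lemma e2_M1:
  assumes m: "m \<in> M1"
  shows "e2 \<cdot> m \<in> \<sigma>"
proof (rule ccontr)
  define m' where "m' = e2 \<cdot> m"
  assume "e2 \<cdot> m \<notin> \<sigma>"
  then have m': "m' \<in> M1" "m' \<notin> \<sigma>" "e2 \<cdot> m' = m'"
    using m I.submodule_smult[OF sub(2)] carr(2)[OF m] by (auto simp: m'_def I.smult_assoc[symmetric])
  note mc = carr(2)[OF m'(1)]
  define K where "K x = {a \<in> A.pid e2. a \<cdot> x = \<zero>\<^bsub>I\<^esub>}" for x
  have K: "submodule (K x) A (pmod A e2)" if x: "x \<in> carrier I" for x
    unfolding A.submodule_pmod[OF cl(3)] K_def using x
    by (intro conjI reg.submoduleI) (auto simp: A.pid_def A.l_distr A.m_assoc I.smult_l_distr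
      I.smult_assoc)
  have comp: "K m' \<subseteq> K w \<or> K w \<subseteq> K m'"
    using uniserial_S[OF e2 w] K[OF mc] K[of w] unfolding uniserial_module_def by simp
  \<comment> \<open>The annihilators of \<open>m'\<close> and \<open>w\<close> in
    \<open>A e2\<close> are comparable. If some \<open>a\<close> killed \<open>w\<close> but not
    \<open>m'\<close>, then \<open>p m' = c a m'\<close> for some \<open>c\<close>; so
    \<open>p - c a\<close> kills \<open>m'\<close>, hence \<open>w\<close>, contradicting
    \<open>p w = s\<close>.\<close>
  have ann: "a \<cdot> m' = \<zero>\<^bsub>I\<^esub>" if a: "a \<in> A.pid e2" "a \<cdot> w = \<zero>\<^bsub>I\<^esub>" for a
  proof (rule ccontr)
    have ac: "a \<in> carrier A" "a \<otimes> e2 = a" using a by (auto simp: A.pid_def)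
    assume am: "a \<cdot> m' \<noteq> \<zero>\<^bsub>I\<^esub>"
    then have le: "K m' \<subseteq> K w" using comp a by (auto simp: K_def)
    have "p \<cdot> m' \<in> I.cyc (a \<cdot> m')"
      using \<sigma>_in_cyc[of "a \<cdot> m'"] am jac_smul(2)[OF p(1) m'(1)] I.smult_closed[OF ac(1) mc] by auto
    then obtain c where c: "c \<in> carrier A" "p \<cdot> m' = c \<cdot> (a \<cdot> m')" by (auto simp: I.cyc_def)
    have "p \<ominus> c \<otimes> a \<in> K m'"
      using c ac p(3) mc by (simp add: K_def A.pid_def A.minus_eq A.l_distr A.l_minus A.m_assoc)
        (simp add: A.minus_eq[symmetric] I.smult_diff_l I.smult_assoc I.diff_eq_zero I.smult_closed)
    then have "(p \<ominus> c \<otimes> a) \<cdot> w = \<zero>\<^bsub>I\<^esub>" using le by (auto simp: K_def)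
    then have "p \<cdot> w = c \<cdot> (a \<cdot> w)" using c ac by (simp add: I.smult_diff_l I.smult_assoc I.diff_eq_zero
      I.smult_closed)
    then show False using a(2) c p(4) s(2) by simp
  qed
  have "\<exists>h\<in>module_hom A I I. (\<forall>z\<in>{\<zero>\<^bsub>I\<^esub>}. h z = \<zero>\<^bsub>I\<^esub>) \<and> h w = m'"
  proof (rule injective_extend[OF injective _ I.submodule_zero_set cl(10) mc])
    show "fg_module A I" using injective by (simp add: injective_module_def)
    fix a assume a: "a \<in> carrier A" and "a \<cdot> w \<in> {\<zero>\<^bsub>I\<^esub>}"
    then have "(a \<otimes> e2) \<cdot> m' = \<zero>\<^bsub>I\<^esub>" using w by (intro ann) (auto simp: A.pid_def A.m_assoc I.smult_assoc)
    then show "a \<cdot> m' = \<zero>\<^bsub>I\<^esub>" using a mc m' by (simp add: I.smult_assoc)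
  qed
  then obtain h where h: "h \<in> module_hom A I I" "h w = m'" by blast
  interpret h: left_module_hom A I I h by (intro left_module_homI h I.left_module_axioms)
  have hs: "h s = p \<cdot> m'" using h.hom_smult[of p w] h(2) p(4) by simp
  \<comment> \<open>\<open>s = b m'\<close> for some \<open>b\<close>, and \<open>b e2\<close> lies
    in the radical, hence in \<open>A p\<close>; so \<open>s\<close> is a multiple of
    \<open>p m' = h s\<close>.\<close>
  have "h s \<noteq> \<zero>\<^bsub>I\<^esub>"
  proof
    assume 0: "h s = \<zero>\<^bsub>I\<^esub>"
    have "m' \<noteq> \<zero>\<^bsub>I\<^esub>" using m' I.submodule_zero[OF sub(1)] by auto
    then have "s \<in> I.cyc m'" using \<sigma>_in_cyc[OF mc] s(1) by blast
    then obtain b where b: "b \<in> carrier A" "s = b \<cdot> m'" by (auto simp: I.cyc_def)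
    have "b \<otimes> e2 \<in> jac A"
    proof (rule ccontr)
      assume "b \<otimes> e2 \<notin> jac A"
      then obtain c where c: "c \<in> carrier A" "c \<otimes> (b \<otimes> e2) = e2"
        using A.not_jac_left[OF e2, of "b \<otimes> e2"] b by (auto simp: A.m_assoc)
      have "m' = (c \<otimes> (b \<otimes> e2)) \<cdot> m'" using c m' by simp
      also have "\<dots> = c \<cdot> s" using b c(1) mc m'(3) by (simp add: I.smult_assoc)
      finally have "m' \<in> \<sigma>" using I.submodule_smult[OF sub(1) c(1) s(1)] by simp
      with m' show False by blast
    qed
    then obtain c where c: "c \<in> carrier A" "b \<otimes> e2 = c \<otimes> p" using jac_e2[of "b \<otimes> e2"] b
      by (auto simp: A.m_assoc)
    have "s = (b \<otimes> e2) \<cdot> m'" using b mc m'(3) by (simp add: I.smult_assoc)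
    also have "\<dots> = c \<cdot> (p \<cdot> m')" using c mc by (simp add: I.smult_assoc)
    also have "\<dots> = \<zero>\<^bsub>I\<^esub>" using 0 hs c by simp
    finally show False using s(2) by simp
  qed
  then have inj: "inj_on h (carrier I)" by (rule inj_if_nonzero_on_\<sigma>[OF h.left_module_hom_axioms s(1)])
  have above: "M1 \<subseteq> h ` X" if X: "submodule X A I" "R \<subseteq> X" for X
  proof -
    have "m' \<in> h ` X" using X(2) w(1) h(2) by blast
    then show ?thesis using I.cyc_least[OF h.submodule_image[OF X(1)]] cyc_M1[OF m'(1,2)] by blast
  qed
  \<comment> \<open>Both images contain \<open>M1\<close> because both modules contain
    \<open>R\<close>, so they are comparable; by injectivity so are \<open>M2\<close> and
    \<open>L\<close>, which is impossible.\<close>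
  have "h ` M2 \<subseteq> h ` L \<or> h ` L \<subseteq> h ` M2"
    by (intro above_M1_comparable h.submodule_image sub sub_L above le(3) le_L(2))
  then have "M2 \<subseteq> L \<or> L \<subseteq> M2"
    using inj_onD[OF inj] I.submodule_subset[OF sub(4)] I.submodule_subset[OF sub_L] by blast
  then show False using M2_Int_L Int_M le le_L by blast
qed

text \<open>An equation \<open>a x = e1\<close> would put \<open>t = a e2 x t\<close> into \<sigma>
  by \<open>e2_M1\<close>. So \<open>A e1\<close> and \<open>A e2\<close> have non-isomorphic
  tops.\<close>

lemma e1_e2_jac:
  assumes a: "a \<in> carrier A" "e1 \<otimes> a = a" "a \<otimes> e2 = a"
  shows "a \<in> jac A"
proof (rule ccontr)
  assume "a \<notin> jac A"
  then obtain x where x: "x \<in> carrier A" "a \<otimes> x = e1" using A.not_jac_right[OF e1 a(1,2)] by blast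
  have "t = (a \<otimes> e2 \<otimes> x) \<cdot> t" using a x t by simp
  also have "\<dots> = a \<cdot> (e2 \<cdot> (x \<cdot> t))" using a(1) x(1) by (simp add: I.smult_assoc I.smult_closed)
  also have "\<dots> \<in> \<sigma>" by (intro I.submodule_smult[OF sub(1)] e2_M1 I.submodule_smult[OF sub(2)] a x t)
  finally show False using t by simp
qed

lemma e2_e1_jac:
  assumes a: "a \<in> carrier A" "e2 \<otimes> a = a" "a \<otimes> e1 = a"
  shows "a \<in> jac A"
proof (rule ccontr)
  assume "a \<notin> jac A"
  then obtain x where x: "x \<in> carrier A" "x \<otimes> a = e1" using A.not_jac_left[OF e1 a(1,3)] by blast
  have "t = (x \<otimes> (e2 \<otimes> a)) \<cdot> t" using a x t by simp
  also have "\<dots> = x \<cdot> (e2 \<cdot> (a \<cdot> t))" using a(1) x(1) by (simp add: I.smult_assoc I.smult_closed)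
  also have "\<dots> \<in> \<sigma>" by (intro I.submodule_smult[OF sub(1)] e2_M1 I.submodule_smult[OF sub(2)] a x t)
  finally show False using t by simp
qed

text \<open>\<open>R\<close> is generated by \<open>w = e2 w\<close>, and \<open>e1 A e2\<close>
  lies in the radical.\<close>

lemma e1_R: "r \<in> R \<Longrightarrow> e1 \<cdot> r \<in> \<sigma>"
proof -
  assume "r \<in> R"
  then obtain b where b: "b \<in> carrier A" "r = b \<cdot> w" using cyc_R[OF w(1,2)] by (auto simp: I.cyc_def)
  have "e1 \<otimes> b \<otimes> e2 \<in> jac A"
    using b by (intro e1_e2_jac) (simp_all add: A.m_assoc[symmetric], simp add: A.m_assoc)
  from jac_smul(3)[OF this w(1)] show ?thesis using b w(3) by (simp add: I.smult_assoc)
qed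

text \<open>The radical maps \<open>I\<close> into \<open>R\<close>, \<open>e1\<close> maps
  \<open>R\<close> into \<sigma>, and \<open>q = q e1\<close> kills \<sigma>. So \<open>q j\<close>
  annihilates \<open>I\<close>, and \<open>faithful\<close> makes it zero.\<close>

lemma q_jac:
  assumes j: "j \<in> jac A" shows "q \<otimes> j = \<zero>"
proof (rule ccontr)
  note jc = A.jac_closed[OF j]
  assume "q \<otimes> j \<noteq> \<zero>"
  then obtain x where x: "x \<in> carrier I" "(q \<otimes> j) \<cdot> x \<noteq> \<zero>\<^bsub>I\<^esub>"
    using faithful[of "q \<otimes> j"] jc q(2) by (auto simp: A.m_assoc[symmetric])
  have "e1 \<cdot> (j \<cdot> x) \<in> \<sigma>" by (intro e1_R jac_smul_R j x)
  then have "q \<cdot> (e1 \<cdot> (j \<cdot> x)) = \<zero>\<^bsub>I\<^esub>" by (rule jac_smul(1)[OF q(1)])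
  then have "(q \<otimes> e1) \<cdot> (j \<cdot> x) = \<zero>\<^bsub>I\<^esub>" using jc x by (simp add: I.smult_assoc I.smult_closed)
  then show False using x jc q(3) by (simp add: I.smult_assoc)
qed

text \<open>Otherwise \<open>e1 z\<close> would be in the radical, which \<open>q\<close>
  annihilates from the left.\<close>

lemma q_mult_unit:
  assumes z: "z \<in> carrier A" "q \<otimes> z \<noteq> \<zero>"
  shows "\<exists>c\<in>carrier A. e1 \<otimes> z \<otimes> c = e1"
proof (rule A.not_jac_right[OF e1])
  have "q \<otimes> (e1 \<otimes> z) = q \<otimes> z" using z(1) q(3) by (simp add: A.m_assoc[symmetric])
  then show "e1 \<otimes> z \<notin> jac A" using q_jac z(2) by auto
qed (use z in \<open>simp_all add: A.m_assoc[symmetric]\<close>)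

section \<open>The right ideal \<open>e0 A\<close> and its submodules \<open>q A\<close> and
  \<open>p A\<close>\<close>

abbreviation rc where "rc \<equiv> ro.cyc"

lemma rc_iff: "y \<in> rc x \<longleftrightarrow> (\<exists>a\<in>carrier A. y = x \<otimes> a)"
  by (auto simp: ro.cyc_def)

lemma sub_rc: "x \<in> carrier A \<Longrightarrow> submodule (rc x) (opposite_ring A) (reg (opposite_ring A))"
  using ro.submodule_cyc[of x] by simp

lemma rc_least: "submodule N (opposite_ring A) (reg (opposite_ring A)) \<Longrightarrow> x \<in> N \<Longrightarrow> rc x \<subseteq> N"
  by (rule ro.cyc_least)

lemma rc_self: "x \<in> carrier A \<Longrightarrow> x \<in> rc x"
  using ro.cyc_self[of x] by simp

lemma op_pid: "op.pid e = {a \<in> carrier A. e \<otimes> a = a}"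
  by (simp add: op.pid_def)

lemma rc_pid: "e \<in> carrier A \<Longrightarrow> x \<in> carrier A \<Longrightarrow> e \<otimes> x = x \<Longrightarrow> rc x \<subseteq> op.pid e"
  by (auto simp: op_pid rc_iff A.m_assoc[symmetric])

lemma right_adjacent:
  assumes e: "primitive A e" and X: "submodule X0 (opposite_ring A) (reg (opposite_ring A))"
    "submodule X1 (opposite_ring A) (reg (opposite_ring A))"
      "submodule X2 (opposite_ring A) (reg (opposite_ring A))"
    "submodule X3 (opposite_ring A) (reg (opposite_ring A))" "X0 \<subset> X1" "X1 \<subset> X2" "X2 \<subset> X3" "X3 \<subset> op.pid e"
  defines "adj \<equiv> adjacent (opposite_ring A) (reg (opposite_ring A))"
  shows "adj X0 X1" "adj X1 X2" "adj X2 X3" "adj X3 (op.pid e)"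
proof -
  have ec: "e \<in> carrier (opposite_ring A)" using A.primitive_closed[OF e] by simp
  note P = op.submodule_pid[OF ec]
  have P': "submodule (op.pid e) (opposite_ring A) (pmod (opposite_ring A) e)"
    using P by (simp add: op.submodule_pmod[OF ec])
  have h: "height_le (opposite_ring A) (pmod (opposite_ring A) e) 4"
    by (rule primitive_height[OF _ e]) simp
  have s: "submodule X0 (opposite_ring A) (pmod (opposite_ring A) e)"
    "submodule X1 (opposite_ring A) (pmod (opposite_ring A) e)"
    "submodule X2 (opposite_ring A) (pmod (opposite_ring A) e)"
      "submodule X3 (opposite_ring A) (pmod (opposite_ring A) e)"
    using X unfolding op.submodule_pmod[OF ec] by auto
  have le: "X1 \<subseteq> op.pid e" "X2 \<subseteq> op.pid e" "X3 \<subseteq> op.pid e" using X by auto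
  note a = height_le_4_chain[OF h s P' X(5-8)]
  show "adj X0 X1" "adj X1 X2" "adj X2 X3" "adj X3 (op.pid e)"
    unfolding adj_def using a le by (simp_all add: ro.adjacent_restr[OF P])
qed

lemma pw_zero: "j \<in> jac A \<Longrightarrow> i \<in> jac A \<Longrightarrow> (i \<otimes> j) \<cdot> w = \<zero>\<^bsub>I\<^esub>" "j \<in> jac A \<Longrightarrow> i \<in> jac A \<Longrightarrow> (i \<otimes> j) \<cdot> t = \<zero>\<^bsub>I\<^esub>"
  using jac_smul(1)[OF _ jac_smul(3)[OF _ w(1)]] jac_smul(1)[OF _ jac_smul(2)[OF _ t(1)]]
  by (simp_all add: I.smult_assoc A.jac_closed)

definition rsum where "rsum = rc q <+>\<^bsub>reg (opposite_ring A)\<^esub> rc p"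

text \<open>Strictness is tested on \<open>I\<close>: \<open>p g v = s\<close>, products of two
  radical elements kill \<open>w\<close> and \<open>t\<close>, and \<open>e2 A e1\<close> lies in
  the radical, which keeps \<open>q\<close> out of \<open>p A\<close>. Four strict steps exhaust the
  length bound.\<close>

lemma right_structure:
  defines "adj \<equiv> adjacent (opposite_ring A) (reg (opposite_ring A))"
  shows "adj {\<zero>} (rc (p \<otimes> g))" "adj (rc (p \<otimes> g)) (rc p)" "adj (rc p) rsum" "adj rsum (op.pid e0)"
proof -
  have sub: "submodule {\<zero>} (opposite_ring A) (reg (opposite_ring A))"
    "submodule (rc (p \<otimes> g)) (opposite_ring A) (reg (opposite_ring A))"
      "submodule (rc p) (opposite_ring A) (reg (opposite_ring A))"
    "submodule rsum (opposite_ring A) (reg (opposite_ring A))"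
    using ro.submodule_zero_set sub_rc ro.submodule_set_add[OF sub_rc[of q] sub_rc[of p]]
      by (auto simp: rsum_def)
  note up = ro.set_add_upper[OF sub_rc[of q] sub_rc[of p], folded rsum_def]
  have "(p \<otimes> g) \<cdot> v = s" using g(4) p(4) by (simp add: I.smult_assoc)
  then have "p \<otimes> g \<noteq> \<zero>" using s(2) by auto
  then have 1: "{\<zero>} \<subset> rc (p \<otimes> g)" using rc_self[of "p \<otimes> g"] ro.submodule_zero[OF sub(2)] by auto
  have "p \<notin> rc (p \<otimes> g)"
  proof
    assume "p \<in> rc (p \<otimes> g)"
    then obtain a where a: "a \<in> carrier A" "p = p \<otimes> (g \<otimes> a)" by (auto simp: rc_iff A.m_assoc)
    have "(p \<otimes> (g \<otimes> a)) \<cdot> w = \<zero>\<^bsub>I\<^esub>" using a(1) by (intro pw_zero p A.jac_rmult g)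
    then show False using a(2) p(4) s(2) by simp
  qed
  moreover have "rc (p \<otimes> g) \<subseteq> rc p" by (intro rc_least sub) (auto simp: rc_iff)
  ultimately have 2: "rc (p \<otimes> g) \<subset> rc p" using rc_self[of p] by auto
  have "q \<notin> rc p"
  proof
    assume "q \<in> rc p"
    then obtain a where a: "a \<in> carrier A" "q = p \<otimes> a" by (auto simp: rc_iff)
    have "q = p \<otimes> (e2 \<otimes> a \<otimes> e1)"
    proof -
      have "q = (p \<otimes> e2) \<otimes> a \<otimes> e1" using a(2) p(3) q(3) by simp
      then show ?thesis using a(1) by (simp add: A.m_assoc)
    qed
    moreover have "e2 \<otimes> a \<otimes> e1 \<in> jac A"
      using a(1) by (intro e2_e1_jac) (simp_all add: A.m_assoc[symmetric], simp add: A.m_assoc)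
    ultimately have "q \<cdot> t = \<zero>\<^bsub>I\<^esub>" using pw_zero(2)[OF _ p(1)] by metis
    then show False using q(4) s(2) by simp
  qed
  then have 3: "rc p \<subset> rsum" using up rc_self[of q] by auto
  have "rsum \<subseteq> op.pid e0"
    unfolding rsum_def using q(2) p(2) op.submodule_pid[of e0] by (intro ro.set_add_least rc_pid) auto
  moreover have "rsum \<subseteq> jac A"
    unfolding rsum_def using A.jac_rmult[OF q(1)] A.jac_rmult[OF p(1)] A.jac_add
    by (auto simp: set_add_def' rc_iff)
  moreover have "e0 \<in> op.pid e0" by (simp add: op_pid)
  ultimately have 4: "rsum \<subset> op.pid e0" using A.primitive_not_jac[OF e0] by blast
  show "adj {\<zero>} (rc (p \<otimes> g))" "adj (rc (p \<otimes> g)) (rc p)" "adj (rc p) rsum" "adj rsum (op.pid e0)"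
    unfolding adj_def using right_adjacent[OF e0 sub 1 2 3 4] by blast+
qed

text \<open>The radical part lies between \<open>rsum\<close> and \<open>e0 A\<close>, which are
  adjacent, and it misses \<open>e0\<close>.\<close>

lemma right_radical: "op.pid e0 \<inter> jac A = rsum"
proof -
  have P: "submodule (op.pid e0 \<inter> jac A) (opposite_ring A) (reg (opposite_ring A))"
    using op.jac_pid_submodule[of e0] by (simp add: A.jac_opposite)
  note adj = right_structure(4)
  have "rsum \<subseteq> op.pid e0" using adj by (auto simp: adjacent_def)
  moreover have "rsum \<subseteq> jac A"
    unfolding rsum_def using A.jac_rmult[OF q(1)] A.jac_rmult[OF p(1)] A.jac_add
    by (auto simp: set_add_def' rc_iff)
  ultimately have "op.pid e0 \<inter> jac A = rsum \<or> op.pid e0 \<inter> jac A = op.pid e0"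
    using adj P unfolding adjacent_def by blast
  moreover have "e0 \<in> op.pid e0" by (simp add: op_pid)
  ultimately show ?thesis using A.primitive_not_jac[OF e0] by blast
qed

lemma right_radicalE:
  assumes "a \<in> jac A" "e0 \<otimes> a = a"
  obtains x y where "x \<in> carrier A" "y \<in> carrier A" "a = q \<otimes> x \<oplus> p \<otimes> y"
proof -
  have "a \<in> rsum" using assms A.jac_closed unfolding right_radical[symmetric] by (auto simp: op_pid)
  then obtain y z where "y \<in> rc q" "z \<in> rc p" "a = y \<oplus> z"
    unfolding rsum_def ro.set_add_iff by auto
  then show ?thesis using that unfolding rc_iff by blast
qed

text \<open>Decompose \<open>e0 y p\<close> in \<open>q A + p A\<close>. Since it ends in
  \<open>e2\<close>, its part in \<open>q A\<close> may be taken in \<open>q e1 A e2\<close>, and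
  this is zero by \<open>q_jac\<close>. Hence \<open>e0 A p W\<close> stays inside
  \<open>p W\<close> for every module \<open>W\<close>, as the sequence starting at
  \<open>M1\<close> requires.\<close>

lemma e0_p:
  assumes y: "y \<in> carrier A"
  shows "\<exists>z\<in>carrier A. e0 \<otimes> y \<otimes> p = p \<otimes> z"
proof -
  let ?a = "e0 \<otimes> y \<otimes> p"
  have a: "?a \<in> jac A" "e0 \<otimes> ?a = ?a" using y p(1) by (simp_all add: A.jac_lmult A.m_assoc[symmetric])
  obtain x z where xz: "x \<in> carrier A" "z \<in> carrier A" "?a = q \<otimes> x \<oplus> p \<otimes> z" by (rule right_radicalE[OF a])
  have "e1 \<otimes> x \<otimes> e2 \<in> jac A"
    using xz by (intro e1_e2_jac) (simp_all add: A.m_assoc[symmetric], simp add: A.m_assoc)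
  then have "q \<otimes> (e1 \<otimes> x \<otimes> e2) = \<zero>" by (rule q_jac)
  moreover have "q \<otimes> (e1 \<otimes> x \<otimes> e2) = (q \<otimes> e1) \<otimes> x \<otimes> e2" using xz by (simp add: A.m_assoc)
  ultimately have "q \<otimes> x \<otimes> e2 = \<zero>" using q(3) by simp
  moreover have "?a = ?a \<otimes> e2" using y p(3) by (simp add: A.m_assoc)
  then have "?a = q \<otimes> x \<otimes> e2 \<oplus> p \<otimes> (z \<otimes> e2)" using xz by (simp add: A.l_distr A.m_assoc)
  ultimately have "?a = p \<otimes> (z \<otimes> e2)" using xz by simp
  then show ?thesis using xz(2) by (intro bexI[of _ "z \<otimes> e2"]) auto
qed

text \<open>Condition (c) for the opposite algebra and the projective right module \<open>e0A\<close>.\<close>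

lemma ex_right_injective:
  "\<exists>(E :: 'a cat_module) \<tau>. injective_module (opposite_ring A) E \<and> uniserial_module (opposite_ring A) E \<and>
     \<tau> \<in> carrier E \<and> \<tau> \<noteq> \<zero>\<^bsub>E\<^esub> \<and> (\<forall>b\<in>carrier A. q \<otimes> b = \<zero> \<longrightarrow> b \<odot>\<^bsub>E\<^esub> \<tau> = \<zero>\<^bsub>E\<^esub>)"
proof -
  let ?adj = "adjacent (opposite_ring A) (reg (opposite_ring A))"
  let ?sub = "\<lambda>W. submodule W (opposite_ring A) (reg (opposite_ring A))"
  have q0: "q \<noteq> \<zero>" using q(4) s(2) by auto
  \<comment> \<open>\<open>q A\<close> is simple since a nonzero \<open>q z\<close> can be
    multiplied back to \<open>q\<close>.\<close>
  have V: "?adj {\<zero>} (rc q)"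
    unfolding adjacent_def
  proof (intro conjI allI impI)
    show "?sub {\<zero>}" "?sub (rc q)" using ro.submodule_zero_set sub_rc by auto
    then show "{\<zero>} \<subset> rc q" using q0 rc_self[of q] ro.submodule_zero[of "rc q"] by auto
    fix W assume W: "?sub W \<and> {\<zero>} \<subseteq> W \<and> W \<subseteq> rc q"
    show "W = {\<zero>} \<or> W = rc q"
    proof (cases "W = {\<zero>}")
      case False
      then obtain y where y: "y \<in> W" "y \<noteq> \<zero>" using W by blast
      then have "y \<in> rc q" using W by blast
      then obtain z where z: "z \<in> carrier A" "y = q \<otimes> z" unfolding rc_iff by blast
      then obtain c where c: "c \<in> carrier A" "e1 \<otimes> z \<otimes> c = e1" using q_mult_unit y(2) by blast
      have "y \<otimes> c = (q \<otimes> e1) \<otimes> z \<otimes> c" using z q(3) by simp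
      also have "\<dots> = q \<otimes> (e1 \<otimes> z \<otimes> c)" using z c(1) by (simp add: A.m_assoc)
      also have "\<dots> = q" using c(2) q(3) by simp
      finally have "q \<in> W" using ro.submodule_smult[of W c y] W y c by auto
      then show ?thesis using W rc_least by blast
    qed simp
  qed
  have U: "W = {\<zero>} \<or> W = rc (p \<otimes> g) \<or> W = rc p" if W: "?sub W" "W \<subseteq> rc p" for W
  proof (cases "p \<in> W")
    case True
    then show ?thesis using rc_least[OF W(1)] W(2) by blast
  next
    case False
    \<comment> \<open>\<open>p J\<close> contains every proper submodule of \<open>p A\<close>, and
      it coincides with \<open>p g A\<close> because nothing lies between \<open>p g A\<close> and
      \<open>p A\<close>.\<close>
    let ?P = "{p \<otimes> j | j. j \<in> jac A}"
    have P: "?sub ?P"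
      using ro.submodule_smult_image[of p "jac A"] A.jac_closed A.jac_zero A.jac_add A.jac_rmult
      by (auto simp: subset_iff)
    have "p \<notin> ?P"
    proof
      assume "p \<in> ?P"
      then obtain j where j: "j \<in> jac A" "p = p \<otimes> j" by blast
      then have "p \<cdot> w = \<zero>\<^bsub>I\<^esub>" using pw_zero(1)[OF j(1) p(1)] by simp
      then show False using p(4) s(2) by simp
    qed
    moreover have "rc (p \<otimes> g) \<subseteq> ?P"
    proof
      fix y assume "y \<in> rc (p \<otimes> g)"
      then obtain a where "a \<in> carrier A" "y = p \<otimes> (g \<otimes> a)" by (auto simp: rc_iff A.m_assoc)
      then show "y \<in> ?P" using A.jac_rmult[OF g(1)] by blast
    qed
    moreover have "?P \<subseteq> rc p" using A.jac_closed unfolding subset_iff rc_iff by blast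
    ultimately have PZ: "?P = rc (p \<otimes> g)"
    proof -
      assume pP: "p \<notin> ?P" and le: "rc (p \<otimes> g) \<subseteq> ?P" "?P \<subseteq> rc p"
      have "?P \<noteq> rc p"
      proof
        assume "?P = rc p"
        then show False using pP rc_self[OF cl(5)] by simp
      qed
      then show ?thesis using adjacentD[OF right_structure(2) P le] by simp
    qed
    have "W \<subseteq> ?P"
    proof
      fix y assume y: "y \<in> W"
      then have "y \<in> rc p" using W(2) by blast
      then obtain z where z: "z \<in> carrier A" "y = p \<otimes> z" unfolding rc_iff by blast
      have y2: "y = p \<otimes> (e2 \<otimes> z)" using z p(3) by (simp add: A.m_assoc[symmetric])
      have "e2 \<otimes> z \<in> jac A"
      proof (rule ccontr)
        assume "e2 \<otimes> z \<notin> jac A"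
        then obtain c where c: "c \<in> carrier A" "e2 \<otimes> z \<otimes> c = e2"
          using A.not_jac_right[OF e2, of "e2 \<otimes> z"] z by (auto simp: A.m_assoc[symmetric])
        have "y \<otimes> c = p \<otimes> (e2 \<otimes> z \<otimes> c)" using y2 z c(1) by (simp add: A.m_assoc)
        then have "y \<otimes> c = p" using c p(3) by simp
        then show False using ro.submodule_smult[OF W(1), of c y] y c False by auto
      qed
      with y2 show "y \<in> ?P" by blast
    qed
    then show ?thesis
      using right_structure(1) W(1) ro.submodule_zero[OF W(1)] unfolding PZ adjacent_def by auto
  qed
  have "q \<notin> rc p"
  proof
    assume "q \<in> rc p"
    then have "rc q \<subseteq> rc p" using sub_rc[of p] by (intro rc_least) auto
    then have "rsum \<subseteq> rc p" unfolding rsum_def using sub_rc[of p] by (intro ro.set_add_least) auto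
    then show False using right_structure(3) by (auto simp: adjacent_def)
  qed
  then have "rc q \<inter> rc p \<noteq> rc q" using rc_self[of q] by auto
  moreover have "?sub (rc q \<inter> rc p)" by (intro ro.submodule_Int sub_rc) auto
  ultimately have int: "rc q \<inter> rc p = {\<zero>}"
    using V ro.submodule_zero[of "rc q \<inter> rc p"] unfolding adjacent_def by auto
  have "\<exists>(E :: 'a cat_module) i. injective_module (opposite_ring A) E \<and>
    uniserial_module (opposite_ring A) E \<and>
    i \<in> module_hom (opposite_ring A) (restr (reg (opposite_ring A)) (rc q)) E \<and> inj_on i (rc q)"
    by (rule condition_c[OF _ e0 V right_structure(1,2) U _ int])
      (simp_all add: right_radical, simp add: rsum_def)
  then obtain E :: "'a cat_module" and i where E: "injective_module (opposite_ring A) E"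
    "uniserial_module (opposite_ring A) E"
    and i: "i \<in> module_hom (opposite_ring A) (restr (reg (opposite_ring A)) (rc q)) E" "inj_on i (rc q)"
      by blast
  have sq: "?sub (rc q)" using sub_rc by simp
  interpret i: left_module_hom "opposite_ring A" "restr (reg (opposite_ring A)) (rc q)" E i
    using E(2) by (intro left_module_homI i(1) ro.left_module_restr[OF sq]) (simp add:
      uniserial_module_def)
  have qq: "q \<in> rc q" using rc_self by simp
  have zq: "\<zero> \<in> rc q" using ro.submodule_zero[OF sq] by simp
  have i0: "i \<zero> = \<zero>\<^bsub>E\<^esub>" using i.hom_zero by simp
  show ?thesis
  proof (intro exI[of _ E] exI[of _ "i q"] conjI E ballI impI)
    show "i q \<in> carrier E" using i.hom_closed[of q] qq by simp
    show "i q \<noteq> \<zero>\<^bsub>E\<^esub>" using inj_onD[OF i(2), of q \<zero>] qq zq q0 i0 by auto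
    show "b \<odot>\<^bsub>E\<^esub> i q = \<zero>\<^bsub>E\<^esub>" if "b \<in> carrier A" "q \<otimes> b = \<zero>" for b
      using i.hom_smult[of b q] qq that i0 by simp
  qed
qed

text \<open>An injective envelope of the socle of \<open>I\<close> contains \<open>I\<close>, which is not uniserial.\<close>

lemma no_socle_in_uniserial_injective:
  fixes E :: "'a cat_module"
  assumes E: "injective_module A E" "uniserial_module A E"
    and X: "submodule X A (reg A)" and \<theta>: "\<theta> \<in> module_hom A (restr (reg A) X) E"
    and J: "\<And>a x. a \<in> jac A \<Longrightarrow> x \<in> X \<Longrightarrow> \<theta> (a \<otimes> x) = \<zero>\<^bsub>E\<^esub>" and x: "x \<in> X"
  shows "\<theta> (e0 \<otimes> x) = \<zero>\<^bsub>E\<^esub>"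
proof (rule ccontr)
  have Em: "left_module A E" using E by (simp add: uniserial_module_def)
  interpret E: left_module A E by fact
  interpret \<theta>: left_module_hom A "restr (reg A) X" E \<theta>
    by (intro left_module_homI \<theta> Em reg.left_module_restr[OF X])
  have xc: "x \<in> carrier A" using reg.submodule_carrier[OF X x] by simp
  have bX: "e0 \<otimes> x \<in> X" using reg.submodule_smult[OF X _ x, of e0] by simp
  let ?z = "\<theta> (e0 \<otimes> x)"
  have zc: "?z \<in> carrier E" using \<theta>.hom_closed bX by simp
  assume nz: "?z \<noteq> \<zero>\<^bsub>E\<^esub>"
  \<comment> \<open>\<open>a s = 0\<close> puts \<open>a e0\<close> into the radical, whose
    multiples \<theta> kills; so \<open>s\<close> can be sent to \<open>?z\<close>. The resulting
    map is injective and carries \<open>I\<close> into the uniserial module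
    \<open>E\<close>.\<close>
  have "\<exists>h\<in>module_hom A I E. (\<forall>y\<in>{\<zero>\<^bsub>I\<^esub>}. h y = \<zero>\<^bsub>E\<^esub>) \<and> h s = ?z"
  proof (rule injective_extend[OF E(1) _ I.submodule_zero_set _ zc])
    show "fg_module A I" using injective by (simp add: injective_module_def)
    fix a assume a: "a \<in> carrier A" and "a \<cdot> s \<in> {\<zero>\<^bsub>I\<^esub>}"
    then have as: "a \<cdot> s = \<zero>\<^bsub>I\<^esub>" by simp
    have "a \<otimes> e0 \<in> jac A"
    proof (rule ccontr)
      assume "a \<otimes> e0 \<notin> jac A"
      then obtain c where c: "c \<in> carrier A" "c \<otimes> (a \<otimes> e0) = e0"
        using A.not_jac_left[OF e0, of "a \<otimes> e0"] a by (auto simp: A.m_assoc)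
      have "s = (c \<otimes> (a \<otimes> e0)) \<cdot> s" using c s by simp
      also have "\<dots> = \<zero>\<^bsub>I\<^esub>" using c(1) a as s by (simp add: I.smult_assoc)
      finally show False using s by simp
    qed
    from J[OF this x] have "\<theta> (a \<otimes> (e0 \<otimes> x)) = \<zero>\<^bsub>E\<^esub>" using a xc by (simp add: A.m_assoc)
    then show "a \<odot>\<^bsub>E\<^esub> ?z = \<zero>\<^bsub>E\<^esub>" using \<theta>.hom_smult[OF a, of "e0 \<otimes> x"] bX by simp
  qed simp
  then obtain h where h: "h \<in> module_hom A I E" "h s = ?z" by blast
  interpret h: left_module_hom A I E h by (intro left_module_homI h Em I.left_module_axioms)
  have inj: "inj_on h (carrier I)" using h nz by (intro inj_if_nonzero_on_\<sigma>[OF h.left_module_hom_axioms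
    s(1)]) simp
  have "h ` M1 \<subseteq> h ` M2 \<or> h ` M2 \<subseteq> h ` M1"
    using E(2) h.submodule_image[OF sub(2)] h.submodule_image[OF sub(4)] unfolding uniserial_module_def
      by blast
  then have "M1 \<subseteq> M2 \<or> M2 \<subseteq> M1"
    using inj_on_subset_of_image_subset[OF inj] I.submodule_subset[OF sub(2)] I.submodule_subset[OF
      sub(4)] by metis
  then have "M1 = \<sigma> \<or> M2 = \<sigma>" using Int_M by blast
  then show False using le by blast
qed

text \<open>Otherwise (b) provides an element \<open>a = f a\<close> of \<open>J e1\<close> outside
  \<rho>, where \<rho> contains \<open>J J e1\<close> and \<open>f\<close> is inequivalent to
  \<open>e0\<close>. Two-sided ideals \<open>K1\<close> and \<open>K2\<close> separate
  \<open>q\<close> from \<open>a\<close>. Sending either of them to \<tau> and killing the ideal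
  that contains the other gives two maps from the right module \<open>A\<close> to the uniserial
  injective module \<open>E\<close>, and comparing the images of the unit yields
  \<open>\<tau> = 0\<close>.\<close>

lemma uniserial_e1: "uniserial_module A (pmod A e1)"
proof (rule ccontr)
  assume "\<not> uniserial_module A (pmod A e1)"
  from condition_b[OF e1 this] obtain \<rho> X and E' :: "'a cat_module" and \<theta>
    where \<rho>: "submodule \<rho> A (reg A)" and X: "submodule X A (reg A)" "X \<subseteq> A.pid e1 \<inter> jac A" "\<not> X \<subseteq> \<rho>"
      and J\<rho>: "\<forall>a\<in>jac A. \<forall>x\<in>A.pid e1 \<inter> jac A. a \<otimes> x \<in> \<rho>"
      and E': "injective_module A E'" "uniserial_module A E'" "\<theta> \<in> module_hom A (restr (reg A) X) E'"
      and \<theta>0: "\<forall>x\<in>X. \<theta> x = \<zero>\<^bsub>E'\<^esub> \<longleftrightarrow> x \<in> \<rho>" and \<theta>J: "\<forall>a\<in>jac A. \<forall>x\<in>X. \<theta> (a \<otimes> x) = \<zero>\<^bsub>E'\<^esub>"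
    by (elim exE conjE) (rule that)
  have X_smult: "a \<otimes> x \<in> X" if "a \<in> carrier A" "x \<in> X" for a x
    using reg.submodule_smult[OF X(1) that] by simp
  have \<rho>_smult: "a \<otimes> x \<in> \<rho>" if "a \<in> carrier A" "x \<in> \<rho>" for a x
    using reg.submodule_smult[OF \<rho> that] by simp
  have \<rho>_add: "x \<oplus> y \<in> \<rho>" if "x \<in> \<rho>" "y \<in> \<rho>" for x y
    using reg.submodule_add[OF \<rho> that] by simp
  have \<rho>_zero: "\<zero> \<in> \<rho>" using reg.submodule_zero[OF \<rho>] by simp
  \<comment> \<open>The simple module provided by (b) cannot be isomorphic to the socle of
    \<open>I\<close>, as its envelope is uniserial.\<close>
  have e0X: "e0 \<otimes> x \<in> \<rho>" if x: "x \<in> X" for x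
  proof -
    have "\<theta> (e0 \<otimes> x) = \<zero>\<^bsub>E'\<^esub>"
      by (rule no_socle_in_uniserial_injective[OF E'(1,2) X(1) E'(3) _ x]) (use \<theta>J in simp)
    then show ?thesis using \<theta>0 X_smult[OF cl(1) x] by simp
  qed
  obtain a0 where a0: "a0 \<in> X" "a0 \<notin> \<rho>" using X(3) by blast
  then have a0c: "a0 \<in> carrier A" using reg.submodule_carrier[OF X(1)] by simp
  obtain f where f: "primitive A f" "f \<otimes> a0 \<notin> \<rho>"
    using reg.ex_primitive_smult[OF \<rho>, of a0] a0 a0c by auto
  note fc [simp] = A.primitive_closed[OF f(1)] and ff = A.primitive_idem[OF f(1)]
  define a where "a = f \<otimes> a0"
  have a: "a \<in> X" "a \<notin> \<rho>" "f \<otimes> a = a"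
    using f a0 a0c X_smult ff by (auto simp: a_def A.m_assoc[symmetric])
  have aJ: "a \<in> jac A" and ae: "a \<otimes> e1 = a" and ac [simp]: "a \<in> carrier A"
    using a(1) X(2) by (auto simp: A.pid_def)
  \<comment> \<open>An element between \<open>f\<close> and \<open>e0\<close> outside the radical
    would write \<open>a\<close> as a multiple of an element of \<open>e0 X\<close>, which lies in
    \<rho>.\<close>
  have fe0: "f \<otimes> y \<otimes> e0 \<in> jac A" if y: "y \<in> carrier A" for y
  proof (rule ccontr)
    assume "f \<otimes> y \<otimes> e0 \<notin> jac A"
    then obtain c where c: "c \<in> carrier A" "f \<otimes> y \<otimes> e0 \<otimes> c = f"
      using A.not_jac_right[OF f(1), of "f \<otimes> y \<otimes> e0"] y ff by (auto simp: A.m_assoc[symmetric])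
    have "a = f \<otimes> y \<otimes> e0 \<otimes> c \<otimes> a" using a(3) c by simp
    also have "\<dots> = (f \<otimes> y) \<otimes> (e0 \<otimes> (c \<otimes> a))" using y c(1) by (simp add: A.m_assoc)
    also have "\<dots> \<in> \<rho>" using y c(1) by (intro \<rho>_smult e0X X_smult a) auto
    finally show False using a by simp
  qed
  have e0f: "e0 \<otimes> y \<otimes> f \<in> jac A" if y: "y \<in> carrier A" for y
  proof (rule ccontr)
    assume "e0 \<otimes> y \<otimes> f \<notin> jac A"
    then obtain c where c: "c \<in> carrier A" "c \<otimes> (e0 \<otimes> y \<otimes> f) = f"
      using A.not_jac_left[OF f(1), of "e0 \<otimes> y \<otimes> f"] y ff by (auto simp: A.m_assoc)
    have "a = c \<otimes> (e0 \<otimes> y \<otimes> f) \<otimes> a" using a(3) c by simp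
    also have "\<dots> = c \<otimes> (e0 \<otimes> (y \<otimes> (f \<otimes> a)))" using y c(1) by (simp add: A.m_assoc)
    also have "\<dots> \<in> \<rho>" using y c(1) a(3) by (intro \<rho>_smult e0X X_smult) (auto intro: a)
    finally show False using a by simp
  qed
  \<comment> \<open>Both are two-sided ideals: \<open>K1\<close> contains \<open>q\<close> but not
    \<open>a\<close>, and \<open>K2\<close> contains \<open>a\<close> but not
    \<open>q\<close>.\<close>
  define K1 where "K1 = {x \<in> carrier A. \<forall>y\<in>carrier A. \<forall>z\<in>carrier A. f \<otimes> y \<otimes> x \<otimes> z \<otimes> e1 \<in> \<rho>}"
  define K2 where "K2 = {x \<in> carrier A. \<forall>y\<in>carrier A. \<forall>m\<in>M1. (e0 \<otimes> y \<otimes> x) \<cdot> m = \<zero>\<^bsub>I\<^esub>}"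
  have K1: "submodule K1 (opposite_ring A) (reg (opposite_ring A))"
  proof (rule ro.submoduleI)
    show "x \<oplus>\<^bsub>reg (opposite_ring A)\<^esub> x' \<in> K1" if "x \<in> K1" "x' \<in> K1" for x x'
      using that \<rho>_add by (auto simp: K1_def A.l_distr A.r_distr)
    fix b x assume b: "b \<in> carrier (opposite_ring A)" and x: "x \<in> K1"
    have "f \<otimes> y \<otimes> (x \<otimes> b) \<otimes> z \<otimes> e1 = f \<otimes> y \<otimes> x \<otimes> (b \<otimes> z) \<otimes> e1" if "y \<in> carrier A" "z \<in> carrier A" for y z
      using that b x by (simp add: A.m_assoc K1_def)
    then show "b \<odot>\<^bsub>reg (opposite_ring A)\<^esub> x \<in> K1" using b x by (auto simp: K1_def)
  qed (auto simp: K1_def \<rho>_zero)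
  have M1_smult: "b \<cdot> m \<in> M1" "m \<in> carrier I" if "b \<in> carrier A" "m \<in> M1" for b m
    using I.submodule_smult[OF sub(2) that] carr(2) that by auto
  have K2: "submodule K2 (opposite_ring A) (reg (opposite_ring A))"
  proof (rule ro.submoduleI)
    show "x \<oplus>\<^bsub>reg (opposite_ring A)\<^esub> x' \<in> K2" if "x \<in> K2" "x' \<in> K2" for x x'
      using that M1_smult by (auto simp: K2_def A.l_distr A.r_distr I.smult_l_distr)
    fix b x assume b: "b \<in> carrier (opposite_ring A)" and x: "x \<in> K2"
    have "(e0 \<otimes> y \<otimes> (x \<otimes> b)) \<cdot> m = (e0 \<otimes> y \<otimes> x) \<cdot> (b \<cdot> m)" if "y \<in> carrier A" "m \<in> M1" for y m
      using that b x M1_smult by (simp add: A.m_assoc I.smult_assoc I.smult_closed K2_def)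
    then show "b \<odot>\<^bsub>reg (opposite_ring A)\<^esub> x \<in> K2" using b x M1_smult by (auto simp: K2_def)
  qed (auto simp: K2_def carr)
  have K1_left: "b \<otimes> x \<in> K1" if "b \<in> carrier A" "x \<in> K1" for b x
  proof -
    have "f \<otimes> y \<otimes> (b \<otimes> x) \<otimes> z \<otimes> e1 = f \<otimes> (y \<otimes> b) \<otimes> x \<otimes> z \<otimes> e1" if "y \<in> carrier A" "z \<in> carrier A" for y z
      using that \<open>b \<in> carrier A\<close> \<open>x \<in> K1\<close> by (simp add: A.m_assoc K1_def)
    then show ?thesis using that by (auto simp: K1_def)
  qed
  have K2_left: "b \<otimes> x \<in> K2" if "b \<in> carrier A" "x \<in> K2" for b x
  proof -
    have "e0 \<otimes> y \<otimes> (b \<otimes> x) = e0 \<otimes> (y \<otimes> b) \<otimes> x" if "y \<in> carrier A" for y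
      using that \<open>b \<in> carrier A\<close> \<open>x \<in> K2\<close> by (simp add: A.m_assoc K2_def)
    then show ?thesis using that by (auto simp: K2_def)
  qed
  have qK1: "q \<in> K1"
  proof -
    have "f \<otimes> y \<otimes> q \<otimes> z \<otimes> e1 \<in> \<rho>" if yz: "y \<in> carrier A" "z \<in> carrier A" for y z
    proof -
      have "f \<otimes> y \<otimes> q \<otimes> z \<otimes> e1 = f \<otimes> y \<otimes> (e0 \<otimes> q) \<otimes> z \<otimes> e1" using q(2) by simp
      also have "\<dots> = (f \<otimes> y \<otimes> e0) \<otimes> (q \<otimes> z \<otimes> e1)" using yz by (simp add: A.m_assoc)
      also have "\<dots> \<in> \<rho>"
        using fe0[OF yz(1)] J\<rho> A.jac_rmult[OF A.jac_rmult[OF q(1) yz(2)], of e1] yz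
        by (auto simp: A.pid_def A.m_assoc)
      finally show ?thesis .
    qed
    then show ?thesis by (simp add: K1_def)
  qed
  have aK1: "a \<notin> K1"
  proof
    assume "a \<in> K1"
    then have "f \<otimes> \<one> \<otimes> a \<otimes> \<one> \<otimes> e1 \<in> \<rho>" unfolding K1_def by blast
    then show False using a(2,3) ae by simp
  qed
  have aK2: "a \<in> K2"
  proof -
    have "(e0 \<otimes> y \<otimes> a) \<cdot> m = \<zero>\<^bsub>I\<^esub>" if y: "y \<in> carrier A" and m: "m \<in> M1" for y m
    proof -
      have "e0 \<otimes> y \<otimes> a = (e0 \<otimes> y \<otimes> f) \<otimes> a" using y a(3) by (simp add: A.m_assoc)
      then have "(e0 \<otimes> y \<otimes> a) \<cdot> m = (e0 \<otimes> y \<otimes> f) \<cdot> (a \<cdot> m)" using y carr(2)[OF m]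
        by (simp add: I.smult_assoc)
      then show ?thesis using jac_smul(1)[OF e0f[OF y] jac_smul(2)[OF aJ m]] by simp
    qed
    then show ?thesis by (simp add: K2_def)
  qed
  have qK2: "q \<notin> K2"
  proof
    assume "q \<in> K2"
    then have "(e0 \<otimes> \<one> \<otimes> q) \<cdot> t = \<zero>\<^bsub>I\<^esub>" using t(1) unfolding K2_def by blast
    then show False using q(2,4) s(2) by simp
  qed
  obtain E :: "'a cat_module" and \<tau> where E: "injective_module (opposite_ring A) E"
    "uniserial_module (opposite_ring A) E"
    and \<tau>: "\<tau> \<in> carrier E" "\<tau> \<noteq> \<zero>\<^bsub>E\<^esub>" "\<And>b. b \<in> carrier A \<Longrightarrow> q \<otimes> b = \<zero> \<Longrightarrow> b \<odot>\<^bsub>E\<^esub> \<tau> = \<zero>\<^bsub>E\<^esub>"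
    using ex_right_injective by (elim exE conjE) (rule that, auto)
  have Em: "left_module (opposite_ring A) E" using E by (simp add: uniserial_module_def)
  interpret E: left_module "opposite_ring A" E by fact
  \<comment> \<open>An element \<open>l = l e1\<close> outside \<open>K\<close> may be sent to
    \<tau>: if \<open>l b\<close> is in \<open>K\<close> then \<open>q b = 0\<close>, as otherwise
    \<open>e1 b c = e1\<close> for some \<open>c\<close> and \<open>l\<close> itself would be in
    \<open>K\<close>.\<close>
  have ex: "\<exists>h\<in>module_hom (opposite_ring A) (reg (opposite_ring A)) E. (\<forall>z\<in>K. h z = \<zero>\<^bsub>E\<^esub>) \<and> h l = \<tau>"
    if K: "submodule K (opposite_ring A) (reg (opposite_ring A))"
      and l: "l \<in> carrier A" "l \<otimes> e1 = l" "l \<notin> K" for K l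
  proof (rule injective_extend[OF E(1) op.fg_module_reg K _ \<tau>(1)])
    fix b assume "b \<in> carrier (opposite_ring A)" and lb: "b \<odot>\<^bsub>reg (opposite_ring A)\<^esub> l \<in> K"
    then have b: "b \<in> carrier A" by simp
    show "b \<odot>\<^bsub>E\<^esub> \<tau> = \<zero>\<^bsub>E\<^esub>"
    proof (cases "q \<otimes> b = \<zero>")
      case False
      then obtain c where c: "c \<in> carrier A" "e1 \<otimes> b \<otimes> c = e1" using q_mult_unit[OF b] by blast
      have "l \<otimes> b \<otimes> c = l \<otimes> e1 \<otimes> b \<otimes> c" using l by simp
      also have "\<dots> = l \<otimes> (e1 \<otimes> b \<otimes> c)" using l(1) b c(1) by (simp add: A.m_assoc)
      also have "\<dots> = l" using c l by simp
      finally have "l \<in> K" using ro.submodule_smult[OF K, of c "l \<otimes> b"] c lb by simp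
      with l show ?thesis by blast
    qed (use \<tau>(3) b in simp)
  qed (use l in simp)
  obtain g1 where g1: "g1 \<in> module_hom (opposite_ring A) (reg (opposite_ring A)) E"
    "\<And>z. z \<in> K2 \<Longrightarrow> g1 z = \<zero>\<^bsub>E\<^esub>" "g1 q = \<tau>"
    using ex[OF K2, of q] qK2 q(3) by auto
  obtain g2 where g2: "g2 \<in> module_hom (opposite_ring A) (reg (opposite_ring A)) E"
    "\<And>z. z \<in> K1 \<Longrightarrow> g2 z = \<zero>\<^bsub>E\<^esub>" "g2 a = \<tau>"
    using ex[OF K1, of a] aK1 ae by auto
  interpret g1: left_module_hom "opposite_ring A" "reg (opposite_ring A)" E g1
    by (intro left_module_homI g1 Em op.left_module_reg)
  interpret g2: left_module_hom "opposite_ring A" "reg (opposite_ring A)" E g2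
    by (intro left_module_homI g2 Em op.left_module_reg)
  have c: "g1 \<one> \<in> carrier E" "g2 \<one> \<in> carrier E" using g1.hom_closed[of \<one>] g2.hom_closed[of \<one>] by auto
  have ev: "g1 y = y \<odot>\<^bsub>E\<^esub> g1 \<one>" "g2 y = y \<odot>\<^bsub>E\<^esub> g2 \<one>" if "y \<in> carrier A" for y
    using g1.hom_smult[of y \<one>] g2.hom_smult[of y \<one>] that by simp_all
  \<comment> \<open>If, say, the image of the unit under \<open>g1\<close> is \<open>b\<close> times
    the one under \<open>g2\<close>, then \<tau> is the value of \<open>g2\<close> at
    \<open>b q\<close>, which lies in \<open>K1\<close>.\<close>
  have "E.cyc (g1 \<one>) \<subseteq> E.cyc (g2 \<one>) \<or> E.cyc (g2 \<one>) \<subseteq> E.cyc (g1 \<one>)"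
    using E(2) E.submodule_cyc[OF c(1)] E.submodule_cyc[OF c(2)] unfolding uniserial_module_def by blast
  then show False
  proof
    assume "E.cyc (g1 \<one>) \<subseteq> E.cyc (g2 \<one>)"
    then have "g1 \<one> \<in> E.cyc (g2 \<one>)" using E.cyc_self[OF c(1)] by blast
    then obtain b where b: "b \<in> carrier A" "g1 \<one> = b \<odot>\<^bsub>E\<^esub> g2 \<one>" by (auto simp: E.cyc_def)
    have "\<tau> = q \<odot>\<^bsub>E\<^esub> (b \<odot>\<^bsub>E\<^esub> g2 \<one>)" using g1(3) ev(1)[of q] b by simp
    also have "\<dots> = g2 (b \<otimes> q)" using ev(2)[of "b \<otimes> q"] b(1) c(2) E.smult_assoc[of q b "g2 \<one>"] by simp
    also have "\<dots> = \<zero>\<^bsub>E\<^esub>" by (intro g2 K1_left b qK1)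
    finally show False using \<tau>(2) by simp
  next
    assume "E.cyc (g2 \<one>) \<subseteq> E.cyc (g1 \<one>)"
    then have "g2 \<one> \<in> E.cyc (g1 \<one>)" using E.cyc_self[OF c(2)] by blast
    then obtain b where b: "b \<in> carrier A" "g2 \<one> = b \<odot>\<^bsub>E\<^esub> g1 \<one>" by (auto simp: E.cyc_def)
    have "\<tau> = a \<odot>\<^bsub>E\<^esub> (b \<odot>\<^bsub>E\<^esub> g1 \<one>)" using g2(3) ev(2)[of a] b by simp
    also have "\<dots> = g1 (b \<otimes> a)" using ev(1)[of "b \<otimes> a"] b(1) c(1) E.smult_assoc[of a b "g1 \<one>"] by simp
    also have "\<dots> = \<zero>\<^bsub>E\<^esub>" by (intro g1 K2_left b aK2)
    finally show False using \<tau>(2) by simp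
  qed
qed

lemma jac_e1: "b \<in> jac A \<Longrightarrow> b \<otimes> e1 = b \<Longrightarrow> \<exists>c\<in>carrier A. b = c \<otimes> q"
  using cyclic_radical[OF e1 uniserial_e1 q(1-3), of t b] q(4) s(2) jac_smul(1)[OF _ jac_smul(2)[OF _
    t(1)]]
  by auto

text \<open>
  The kernel of the projective cover \<open>Ae1 + Ae2 \<rightarrow> M1 + R\<close> is generated by \<open>(q, -p)\<close>. Otherwise the right
  module \<open>fA\<close>, for a suitable \<open>f\<close> with a suitable \<open>r\<close> in \<open>fJ\<close>, has length four and radical \<open>rA\<close>, which is
  not uniserial as it contains the incomparable submodules \<open>rqA\<close> and \<open>rpA\<close>.
\<close>

lemma separate:
  assumes r0: "r0 \<in> jac A"
  shows "\<exists>a\<in>carrier A. a \<otimes> q = r0 \<otimes> q \<and> a \<otimes> p = \<zero>"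
proof (rule ccontr)
  assume neg: "\<not> ?thesis"
  \<comment> \<open>\<open>V = J q\<close>, and \<open>N\<close> collects the \<open>a q\<close>
    with \<open>a p = 0\<close>. By assumption \<open>r0 q\<close> is in \<open>V\<close> but not in
    \<open>N\<close>, so there is a maximal submodule \<open>Z\<close> of \<open>V\<close> above
    \<open>N \<inter> V\<close>, and some \<open>r\<close> in \<open>f J e0\<close> will have
    \<open>r q\<close> outside \<open>Z\<close>.\<close>
  define V where "V = {j \<otimes> q | j. j \<in> jac A}"
  define N where "N = {a \<otimes> q | a. a \<in> {a \<in> carrier A. a \<otimes> p = \<zero>}}"
  have V: "submodule V A (reg A)"
    using reg.submodule_smult_image[of q "jac A"] A.jac_closed A.jac_zero A.jac_add A.jac_lmult
    by (auto simp: V_def subset_iff)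
  have N: "submodule N A (reg A)"
    using reg.submodule_smult_image[of q "{a \<in> carrier A. a \<otimes> p = \<zero>}"]
    by (auto simp: N_def A.l_distr A.m_assoc)
  have Vpid: "V \<subseteq> A.pid e1" using q(3) A.jac_closed by (auto simp: V_def A.pid_def A.m_assoc)
  note P = A.submodule_pid[OF cl(2)]
  have NV: "submodule (N \<inter> V) A (pmod A e1)" and V': "submodule V A (pmod A e1)"
    using reg.submodule_Int[OF N V] V Vpid by (auto simp: A.submodule_pmod)
  have "r0 \<otimes> q \<in> V" using r0 by (auto simp: V_def)
  moreover have "r0 \<otimes> q \<notin> N"
  proof
    assume "r0 \<otimes> q \<in> N"
    then obtain a where "a \<in> carrier A" "a \<otimes> p = \<zero>" "a \<otimes> q = r0 \<otimes> q" by (auto simp: N_def)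
    with neg show False by blast
  qed
  ultimately have "N \<inter> V \<subset> V" by blast
  then obtain Z where Z: "N \<inter> V \<subseteq> Z" "adjacent A (pmod A e1) Z V"
    using height_le_adjacent[OF primitive_height[OF _ e1] NV V'] by auto
  then have adjZ: "adjacent A (reg A) Z V" using reg.adjacent_restr[OF P Vpid] by simp
  then have Zs: "submodule Z A (reg A)" and ZV: "Z \<subset> V" by (auto simp: adjacent_def)
  obtain x where x: "x \<in> V" "x \<notin> Z" using ZV by blast
  obtain f where f: "primitive A f" "f \<otimes> x \<notin> Z"
    using reg.ex_primitive_smult[OF Zs, of x] x reg.submodule_carrier[OF V x(1)] by auto
  note fc [simp] = A.primitive_closed[OF f(1)] and ff = A.primitive_idem[OF f(1)]
  obtain j where j: "j \<in> jac A" "x = j \<otimes> q" using x(1) by (auto simp: V_def)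
  have jc: "j \<in> carrier A" by (rule A.jac_closed[OF j(1)])
  define r where "r = f \<otimes> j \<otimes> e0"
  have rJ: "r \<in> jac A" unfolding r_def using j by (intro A.jac_rmult A.jac_lmult) auto
  have rc' [simp]: "r \<in> carrier A" by (rule A.jac_closed[OF rJ])
  have fr: "f \<otimes> r = r" "r \<otimes> e0 = r"
    using ff jc by (simp_all add: r_def A.m_assoc[symmetric]) (simp add: A.m_assoc)
  have "r \<otimes> q = f \<otimes> j \<otimes> (e0 \<otimes> q)" using jc by (simp add: r_def A.m_assoc)
  then have rq: "r \<otimes> q \<notin> Z" using f(2) j(2) q(2) jc by (simp add: A.m_assoc)
  \<comment> \<open>\<open>r\<close> is in the radical and acts as zero on the simple factor
    \<open>V / Z\<close>.\<close>
  have kill: "r \<otimes> (i \<otimes> q) \<in> Z" if "i \<in> jac A" for i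
    using reg.jac_adjacent[OF adjZ rJ, of "i \<otimes> q"] that by (auto simp: V_def)
  have in_Z: "b \<otimes> q \<in> Z" if "b \<in> jac A" "b \<otimes> p = \<zero>" for b
    using Z(1) that A.jac_closed[OF that(1)] by (auto simp: N_def V_def)
  have rp0: "r \<otimes> p \<noteq> \<zero>" using in_Z[OF rJ] rq by blast
  \<comment> \<open>Otherwise \<open>r q = r p z\<close> with \<open>z\<close> in
    \<open>e2 A e1\<close>; this \<open>z\<close> lies in \<open>J e1 = A q\<close>, so
    \<open>r q\<close> lies in \<open>r J q\<close>, hence in \<open>Z\<close>.\<close>
  have rq_rp: "r \<otimes> q \<notin> rc (r \<otimes> p)"
  proof
    assume "r \<otimes> q \<in> rc (r \<otimes> p)"
    then obtain z where z: "z \<in> carrier A" "r \<otimes> q = r \<otimes> p \<otimes> z" by (auto simp: rc_iff)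
    let ?z = "e2 \<otimes> z \<otimes> e1"
    have zJ: "?z \<in> jac A" using z(1) by (intro e2_e1_jac) (simp_all add: A.m_assoc[symmetric], simp add:
      A.m_assoc)
    then obtain d where d: "d \<in> carrier A" "?z = d \<otimes> q" using jac_e1[of ?z] z(1) by (auto simp: A.m_assoc)
    have "r \<otimes> q = r \<otimes> (p \<otimes> e2) \<otimes> z \<otimes> e1" using z q(3) p(3) by (metis A.m_assoc cl(2,6) rc')
    also have "\<dots> = r \<otimes> (p \<otimes> ?z)" using z(1) by (simp add: A.m_assoc)
    also have "\<dots> = r \<otimes> ((p \<otimes> d) \<otimes> q)" using d by (simp add: A.m_assoc)
    also have "\<dots> \<in> Z" by (intro kill A.jac_rmult p d)
    finally show False using rq by blast
  qed
  \<comment> \<open>Otherwise \<open>r p = r q d p\<close> for some \<open>d\<close>; then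
    \<open>r - r q d\<close> kills \<open>p\<close> and its product with \<open>q\<close> lies in
    \<open>Z\<close>, which forces \<open>r q\<close> into \<open>Z\<close>.\<close>
  have rp_rq: "r \<otimes> p \<notin> rc (r \<otimes> q)"
  proof
    assume "r \<otimes> p \<in> rc (r \<otimes> q)"
    then obtain z where z: "z \<in> carrier A" "r \<otimes> p = r \<otimes> q \<otimes> z" by (auto simp: rc_iff)
    let ?z = "e1 \<otimes> z \<otimes> e2"
    have zJ: "?z \<in> jac A" using z(1) by (intro e1_e2_jac) (simp_all add: A.m_assoc[symmetric], simp add:
      A.m_assoc)
    then obtain d where d: "d \<in> carrier A" "?z = d \<otimes> p" using jac_e2[of ?z] z(1) by (auto simp: A.m_assoc)
    have "r \<otimes> p = r \<otimes> (q \<otimes> e1) \<otimes> z \<otimes> e2" using z q(3) p(3) by (metis A.m_assoc cl(3,5) rc')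
    also have "\<dots> = r \<otimes> (q \<otimes> ?z)" using z(1) by (simp add: A.m_assoc)
    also have "\<dots> = (r \<otimes> q \<otimes> d) \<otimes> p" using d by (simp add: A.m_assoc)
    finally have eq: "r \<otimes> p = (r \<otimes> q \<otimes> d) \<otimes> p" .
    let ?b = "r \<ominus> r \<otimes> q \<otimes> d"
    have "?b \<otimes> p = r \<otimes> p \<ominus> (r \<otimes> q \<otimes> d) \<otimes> p" using d by (simp add: A.minus_eq A.l_distr A.l_minus)
    then have "?b \<otimes> p = \<zero>" using eq[symmetric] A.right_minus_eq[of "r \<otimes> p" "r \<otimes> p"] by simp
    moreover have "?b \<in> jac A" using d by (intro A.jac_diff rJ A.jac_rmult) auto
    ultimately have "?b \<otimes> q \<in> Z" by (intro in_Z)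
    moreover have "?b \<otimes> q = r \<otimes> q \<ominus> r \<otimes> ((q \<otimes> d) \<otimes> q)"
      using d by (simp add: A.minus_eq A.l_distr A.l_minus A.m_assoc)
    ultimately have "r \<otimes> q \<ominus> r \<otimes> ((q \<otimes> d) \<otimes> q) \<in> Z" by simp
    moreover have "r \<otimes> ((q \<otimes> d) \<otimes> q) \<in> Z" by (intro kill A.jac_rmult q d)
    ultimately show False using reg.submodule_diff_cancel[OF Zs, of "r \<otimes> q" "r \<otimes> ((q \<otimes> d) \<otimes> q)"] rq
      by simp
  qed
  have r_not: "r \<noteq> r \<otimes> i" if "i \<in> jac A" for i
  proof
    assume "r = r \<otimes> i"
    then have "r \<otimes> q = r \<otimes> (i \<otimes> q)" using A.jac_closed[OF that] by (metis A.m_assoc cl(6) rc')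
    then show False using kill[OF that] rq by simp
  qed
  let ?sum = "rc (r \<otimes> p) <+>\<^bsub>reg (opposite_ring A)\<^esub> rc (r \<otimes> q)"
  have sub: "submodule {\<zero>} (opposite_ring A) (reg (opposite_ring A))"
    "submodule (rc (r \<otimes> p)) (opposite_ring A) (reg (opposite_ring A))"
    "submodule ?sum (opposite_ring A) (reg (opposite_ring A))"
      "submodule (rc r) (opposite_ring A) (reg (opposite_ring A))"
    using ro.submodule_zero_set sub_rc ro.submodule_set_add[OF sub_rc sub_rc, of "r \<otimes> p" "r \<otimes> q"] by auto
  have sq: "submodule (rc (r \<otimes> q)) (opposite_ring A) (reg (opposite_ring A))" using sub_rc by simp
  note up = ro.set_add_upper[OF sub(2) sq]
  have 1: "{\<zero>} \<subset> rc (r \<otimes> p)" using rp0 rc_self[of "r \<otimes> p"] ro.submodule_zero[OF sub(2)] by auto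
  have 2: "rc (r \<otimes> p) \<subset> ?sum" using up rq_rp rc_self[of "r \<otimes> q"] by auto
  have "r \<notin> ?sum"
  proof
    assume "r \<in> ?sum"
    then obtain y z where yz: "y \<in> carrier A" "z \<in> carrier A" "r = r \<otimes> p \<otimes> y \<oplus> r \<otimes> q \<otimes> z"
      by (auto simp: ro.set_add_iff rc_iff)
    then have "r = r \<otimes> (p \<otimes> y \<oplus> q \<otimes> z)" by (simp add: A.r_distr A.m_assoc)
    moreover have "p \<otimes> y \<oplus> q \<otimes> z \<in> jac A" using yz by (intro A.jac_add A.jac_rmult p q)
    ultimately show False using r_not by blast
  qed
  moreover have "?sum \<subseteq> rc r" by (intro ro.set_add_least sub rc_least) (auto simp: rc_iff)
  ultimately have 3: "?sum \<subset> rc r" using rc_self[of r] by auto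
  have rcJ: "rc r \<subseteq> jac A" using A.jac_rmult[OF rJ] by (auto simp: rc_iff)
  have f_pid: "f \<in> op.pid f" using ff by (simp add: op_pid)
  have 4: "rc r \<subset> op.pid f"
    using rc_pid[OF fc rc' fr(1)] rcJ f_pid A.primitive_not_jac[OF f(1)] by blast
  have Pf: "submodule (op.pid f \<inter> jac A) (opposite_ring A) (reg (opposite_ring A))"
    using op.jac_pid_submodule[of f] by (simp add: A.jac_opposite)
  have jac_f: "op.pid f \<inter> jac A = rc r"
    using right_adjacent(4)[OF f(1) sub 1 2 3 4] Pf rcJ f_pid A.primitive_not_jac[OF f(1)] 4
    unfolding adjacent_def by blast
  have nu: "\<not> uniserial_module (opposite_ring A) (pmod (opposite_ring A) f)"
  proof
    assume u: "uniserial_module (opposite_ring A) (pmod (opposite_ring A) f)"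
    have "submodule (rc (r \<otimes> p)) (opposite_ring A) (pmod (opposite_ring A) f)"
      "submodule (rc (r \<otimes> q)) (opposite_ring A) (pmod (opposite_ring A) f)"
      using sub(2) sq 4 3 up by (auto simp: op.submodule_pmod)
    then have "rc (r \<otimes> p) \<subseteq> rc (r \<otimes> q) \<or> rc (r \<otimes> q) \<subseteq> rc (r \<otimes> p)"
      using u unfolding uniserial_module_def by blast
    then show False using rq_rp rp_rq rc_self[of "r \<otimes> p"] rc_self[of "r \<otimes> q"] by auto
  qed
  obtain L1 L2 where L: "submodule L1 (opposite_ring A) (reg (opposite_ring A))"
    "submodule L2 (opposite_ring A) (reg (opposite_ring A))" "\<not> L1 \<subseteq> L2" "\<not> L2 \<subseteq> L1"
    "L1 <+>\<^bsub>reg (opposite_ring A)\<^esub> L2 = rc r"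
    using biserial_radical[OF _ f(1) nu] jac_f by auto
  have Lr: "L1 \<subseteq> rc r" "L2 \<subseteq> rc r" using ro.set_add_upper[OF L(1,2)] L(5) by auto
  \<comment> \<open>Proper submodules of \<open>r A\<close> lie in \<open>r J\<close>, so
    \<open>r A\<close> is not a sum of two of them; but biseriality writes it as such a sum.\<close>
  have loc: "\<exists>i\<in>jac A. l = r \<otimes> i" if l: "l \<in> L'" and L':
    "submodule L' (opposite_ring A) (reg (opposite_ring A))" "L' \<subseteq> rc r" "L' \<noteq> rc r" for l L'
  proof -
    have "l \<in> rc r" using l L' by blast
    then obtain y where y: "y \<in> carrier A" "l = r \<otimes> y" unfolding rc_iff by blast
    have l2: "l = r \<otimes> (e0 \<otimes> y)" using y fr(2) by (simp add: A.m_assoc[symmetric])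
    have "e0 \<otimes> y \<in> jac A"
    proof (rule ccontr)
      assume "e0 \<otimes> y \<notin> jac A"
      then obtain c where c: "c \<in> carrier A" "e0 \<otimes> y \<otimes> c = e0"
        using A.not_jac_right[OF e0, of "e0 \<otimes> y"] y by (auto simp: A.m_assoc[symmetric])
      have "l \<otimes> c = r \<otimes> (e0 \<otimes> y \<otimes> c)" using l2 y c(1) by (simp add: A.m_assoc)
      then have "r \<in> L'" using ro.submodule_smult[OF L'(1), of c l] c l fr(2) by simp
      then show False using rc_least[OF L'(1)] L' by blast
    qed
    with l2 show ?thesis by blast
  qed
  have "r \<in> L1 <+>\<^bsub>reg (opposite_ring A)\<^esub> L2" using L(5) rc_self[of r] by simp
  then obtain l1 l2 where l: "l1 \<in> L1" "l2 \<in> L2" "r = l1 \<oplus> l2" by (auto simp: ro.set_add_iff)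
  obtain i1 where i1: "i1 \<in> jac A" "l1 = r \<otimes> i1" using loc[OF l(1) L(1) Lr(1)] L(4) Lr by blast
  obtain i2 where i2: "i2 \<in> jac A" "l2 = r \<otimes> i2" using loc[OF l(2) L(2) Lr(2)] L(3) Lr by blast
  have "l1 \<oplus> l2 = r \<otimes> (i1 \<oplus> i2)" using i1 i2 A.jac_closed by (simp add: A.r_distr)
  with l(3) have "r = r \<otimes> (i1 \<oplus> i2)" by (rule trans)
  then show False using r_not[OF A.jac_add[OF i1(1) i2(1)]] by blast
qed

text \<open>Subtract the element provided by \<open>separate\<close> from \<open>r\<close>.\<close>

lemma separate':
  assumes r: "r \<in> jac A"
  shows "\<exists>a\<in>carrier A. a \<otimes> q = \<zero> \<and> a \<otimes> p = r \<otimes> p"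
proof -
  obtain a where a: "a \<in> carrier A" "a \<otimes> q = r \<otimes> q" "a \<otimes> p = \<zero>" using separate[OF r] by blast
  have rc: "r \<in> carrier A" by (rule A.jac_closed[OF r])
  have "(r \<ominus> a) \<otimes> q = r \<otimes> q \<ominus> a \<otimes> q" "(r \<ominus> a) \<otimes> p = r \<otimes> p \<ominus> a \<otimes> p"
    using a rc by (simp_all add: A.minus_eq A.l_distr A.l_minus)
  then have "(r \<ominus> a) \<otimes> q = \<zero>" "(r \<ominus> a) \<otimes> p = r \<otimes> p"
    using a rc A.right_minus_eq[of "r \<otimes> q" "r \<otimes> q"] reg.diff_zero_right[of "r \<otimes> p"] by simp_all
  then show ?thesis using a rc by (intro bexI[of _ "r \<ominus> a"]) auto
qed

end

section \<open>The two almost split sequences\<close>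

context biserial_injective_elements
begin

lemma restr_modules: "left_module A (restr I \<sigma>)" "left_module A (restr I M1)" "left_module A (restr I R)"
    "left_module A (restr I L)"
  by (intro I.left_module_restr sub sub_L)+

lemma L_carr: "x \<in> L \<Longrightarrow> x \<in> carrier I"
  by (rule I.submodule_carrier[OF sub_L])

text \<open>\<open>L\<close> is the pushout of \<open>M1\<close> and \<open>R\<close> over
  \<open>\<sigma> = M1 \<inter> R\<close>: the sum map from the direct sum onto \<open>L\<close> has
  the antidiagonal copy of \<sigma> as its kernel.\<close>

lemma glue:
  assumes W: "left_module A W" and \<alpha>: "\<alpha> \<in> module_hom A (restr I M1) W"
    and \<beta>: "\<beta> \<in> module_hom A (restr I R) W"
    and agree: "\<And>x. x \<in> \<sigma> \<Longrightarrow> \<alpha> x = \<beta> x"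
  shows "\<exists>k\<in>module_hom A (restr I L) W. (\<forall>m\<in>M1. k m = \<alpha> m) \<and> (\<forall>r\<in>R. k r = \<beta> r)"
proof -
  interpret W: left_module A W by fact
  interpret \<alpha>: left_module_hom A "restr I M1" W \<alpha> by (intro left_module_homI \<alpha> W restr_modules)
  interpret \<beta>: left_module_hom A "restr I R" W \<beta> by (intro left_module_homI \<beta> W restr_modules)
  let ?D = "dsum (restr I M1) (restr I R)"
  have D: "left_module A ?D" by (intro left_module_dsum restr_modules)
  let ?\<theta> = "\<lambda>x. \<alpha> (fst x) \<oplus>\<^bsub>W\<^esub> \<beta> (snd x)" and ?p = "\<lambda>x. fst x \<oplus>\<^bsub>I\<^esub> snd x"
  have \<theta>: "?\<theta> \<in> module_hom A ?D W"
    by (intro module_hom_add W module_hom_compose[OF _ \<alpha>] module_hom_compose[OF _ \<beta>] dsum_homs)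
  interpret \<theta>: left_module_hom A ?D W ?\<theta> by (intro left_module_homI \<theta> W D)
  have fstI: "fst \<in> module_hom A ?D I" and sndI: "snd \<in> module_hom A ?D I"
    using carr by (auto intro!: module_homI)
  have "?p \<in> module_hom A ?D I" by (intro module_hom_add I.left_module_axioms fstI sndI)
  then have p: "?p \<in> module_hom A ?D (restr I L)"
    by (auto simp: module_hom_def Pi_iff I.set_add_iff)
  have p_im: "?p ` carrier ?D = carrier (restr I L)" by (force simp: I.set_add_iff)
  have "?\<theta> x = \<zero>\<^bsub>W\<^esub>" if x: "x \<in> carrier ?D" "?p x = \<zero>\<^bsub>restr I L\<^esub>" for x
  proof -
    obtain m r where mr: "x = (m, r)" "m \<in> M1" "r \<in> R" using x(1) by auto
    have c: "m \<in> carrier I" "r \<in> carrier I" using mr carr by auto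
    have m: "m = \<ominus>\<^bsub>I\<^esub> r" using x(2) mr c by (simp add: I.M.minus_equality)
    then have mR: "m \<in> R" using I.submodule_neg[OF sub(3) mr(3)] by simp
    then have m\<sigma>: "m \<in> \<sigma>" using Int_M1_R mr(2) by blast
    have "\<beta> (m \<oplus>\<^bsub>restr I R\<^esub> r) = \<beta> m \<oplus>\<^bsub>W\<^esub> \<beta> r" using mR mr by (intro \<beta>.hom_add) simp_all
    moreover have "m \<oplus>\<^bsub>restr I R\<^esub> r = \<zero>\<^bsub>restr I R\<^esub>" using x(2) mr by simp
    ultimately show ?thesis using agree[OF m\<sigma>] mr \<beta>.hom_zero by simp
  qed
  from \<theta>.factor_hom[OF restr_modules(4) p p_im this]
  obtain k where k: "k \<in> module_hom A (restr I L) W" "\<And>x. x \<in> carrier ?D \<Longrightarrow> k (?p x) = ?\<theta> x" by blast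
  have z: "\<zero>\<^bsub>I\<^esub> \<in> M1" "\<zero>\<^bsub>I\<^esub> \<in> R" using I.submodule_zero[OF sub(2)] I.submodule_zero[OF sub(3)] by auto
  have a0: "\<alpha> \<zero>\<^bsub>I\<^esub> = \<zero>\<^bsub>W\<^esub>" "\<beta> \<zero>\<^bsub>I\<^esub> = \<zero>\<^bsub>W\<^esub>" using \<alpha>.hom_zero \<beta>.hom_zero by simp_all
  have "k m = \<alpha> m" if "m \<in> M1" for m
    using k(2)[of "(m, \<zero>\<^bsub>I\<^esub>)"] that z a0 carr(2)[OF that] \<alpha>.hom_closed[of m] by simp
  moreover have "k r = \<beta> r" if "r \<in> R" for r
    using k(2)[of "(\<zero>\<^bsub>I\<^esub>, r)"] that z a0 carr(3)[OF that] \<beta>.hom_closed[of r] by simp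
  ultimately show ?thesis using k(1) by blast
qed

lemma annihilator_s:
  assumes c: "c \<in> carrier A" "c \<cdot> s = \<zero>\<^bsub>I\<^esub>"
  shows "c \<otimes> e0 \<in> jac A"
proof (rule ccontr)
  assume "c \<otimes> e0 \<notin> jac A"
  then obtain d where d: "d \<in> carrier A" "d \<otimes> (c \<otimes> e0) = e0"
    using A.not_jac_left[OF e0, of "c \<otimes> e0"] c by (auto simp: A.m_assoc)
  have "s = (d \<otimes> (c \<otimes> e0)) \<cdot> s" using d s by simp
  also have "\<dots> = \<zero>\<^bsub>I\<^esub>" using d(1) c s by (simp add: I.smult_assoc)
  finally show False using s by simp
qed

text \<open>The annihilator of \<open>y\<close> in \<open>Ae\<close> is \<open>J x\<close>: an
  element \<open>b e\<close> killing \<open>y\<close> lies in the radical, so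
  \<open>b e = c x\<close>, and \<open>c s = 0\<close> forces \<open>c e0\<close> into the radical.
  So \<open>y\<close> can be sent to any \<open>y' = e y'\<close> with
  \<open>J x y' = 0\<close>.\<close>

lemma hom_from_cyclic:
  assumes e: "primitive A e" and x: "x \<in> carrier A" "e0 \<otimes> x = x" "x \<otimes> e = x"
    and gen: "\<And>b. b \<in> jac A \<Longrightarrow> b \<otimes> e = b \<Longrightarrow> \<exists>c\<in>carrier A. b = c \<otimes> x"
    and y: "y \<in> carrier I" "e \<cdot> y = y" "y \<noteq> \<zero>\<^bsub>I\<^esub>" "x \<cdot> y = s" and X: "submodule X A I" "I.cyc y = X"
    and W: "left_module A W" and y': "y' \<in> carrier W" "e \<odot>\<^bsub>W\<^esub> y' = y'"
    and rad: "\<And>r. r \<in> jac A \<Longrightarrow> r \<odot>\<^bsub>W\<^esub> (x \<odot>\<^bsub>W\<^esub> y') = \<zero>\<^bsub>W\<^esub>"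
  shows "\<exists>\<alpha>\<in>module_hom A (restr I X) W. \<alpha> y = y'"
proof (rule cyclic_hom[OF I.left_module_restr[OF X(1)] W])
  interpret W: left_module A W by fact
  note ec = A.primitive_closed[OF e]
  show "y \<in> carrier (restr I X)" using X(2) I.cyc_self[OF y(1)] by simp
  show "\<exists>a\<in>carrier A. z = a \<odot>\<^bsub>restr I X\<^esub> y" if "z \<in> carrier (restr I X)" for z
    using that X(2) by (auto simp: I.cyc_def)
  fix b assume b: "b \<in> carrier A" and "b \<odot>\<^bsub>restr I X\<^esub> y = \<zero>\<^bsub>restr I X\<^esub>"
  then have by0: "b \<cdot> y = \<zero>\<^bsub>I\<^esub>" by simp
  have be: "b \<otimes> e \<otimes> e = b \<otimes> e" using b ec A.primitive_idem[OF e] by (simp add: A.m_assoc)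
  have bey: "(b \<otimes> e) \<cdot> y = \<zero>\<^bsub>I\<^esub>" using by0 b ec y by (simp add: I.smult_assoc)
  have "b \<otimes> e \<in> jac A"
  proof (rule ccontr)
    assume "b \<otimes> e \<notin> jac A"
    then obtain d where d: "d \<in> carrier A" "d \<otimes> (b \<otimes> e) = e"
      using A.not_jac_left[OF e _ be] b ec by auto
    have "y = (d \<otimes> (b \<otimes> e)) \<cdot> y" using d y by simp
    also have "\<dots> = d \<cdot> ((b \<otimes> e) \<cdot> y)" using d(1) b ec y by (simp add: I.smult_assoc)
    also have "\<dots> = \<zero>\<^bsub>I\<^esub>" using bey d by simp
    finally show False using y by simp
  qed
  then obtain c where c: "c \<in> carrier A" "b \<otimes> e = c \<otimes> x" using gen be by blast
  have "c \<cdot> s = (c \<otimes> x) \<cdot> y" using c x y by (simp add: I.smult_assoc)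
  then have "c \<cdot> s = \<zero>\<^bsub>I\<^esub>" using bey c(2) by simp
  then have ce: "c \<otimes> e0 \<in> jac A" by (rule annihilator_s[OF c(1)])
  have "b \<odot>\<^bsub>W\<^esub> y' = (b \<otimes> e) \<odot>\<^bsub>W\<^esub> y'" using b ec y' by (simp add: W.smult_assoc)
  also have "\<dots> = ((c \<otimes> e0) \<otimes> x) \<odot>\<^bsub>W\<^esub> y'" using c x by (simp add: A.m_assoc)
  also have "\<dots> = (c \<otimes> e0) \<odot>\<^bsub>W\<^esub> (x \<odot>\<^bsub>W\<^esub> y')" using c x y' by (intro W.smult_assoc) auto
  also have "\<dots> = \<zero>\<^bsub>W\<^esub>" by (rule rad[OF ce])
  finally show "b \<odot>\<^bsub>W\<^esub> y' = \<zero>\<^bsub>W\<^esub>" .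
qed (rule y')

lemma nonzero: "t \<noteq> \<zero>\<^bsub>I\<^esub>" "w \<noteq> \<zero>\<^bsub>I\<^esub>"
  using t w I.submodule_zero[OF sub(1)] by auto

lemma hom_from_M1:
  assumes W: "left_module A W" and t': "t' \<in> carrier W" "e1 \<odot>\<^bsub>W\<^esub> t' = t'"
    and rad: "\<And>r. r \<in> jac A \<Longrightarrow> r \<odot>\<^bsub>W\<^esub> (q \<odot>\<^bsub>W\<^esub> t') = \<zero>\<^bsub>W\<^esub>"
  shows "\<exists>\<alpha>\<in>module_hom A (restr I M1) W. \<alpha> t = t' \<and> \<alpha> s = q \<odot>\<^bsub>W\<^esub> t'"
proof -
  obtain \<alpha> where \<alpha>: "\<alpha> \<in> module_hom A (restr I M1) W" "\<alpha> t = t'"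
    using hom_from_cyclic[OF e1 cl(6) q(2,3) jac_e1 cl(9) t(3) nonzero(1) q(4) sub(2) cyc_M1[OF t(1,2)]
      W t' rad] by blast
  interpret \<alpha>: left_module_hom A "restr I M1" W \<alpha> by (intro left_module_homI \<alpha> W restr_modules)
  show ?thesis using \<alpha> \<alpha>.hom_smult[of q t] t q(4) by (intro bexI[of _ \<alpha>]) auto
qed

lemma hom_from_R:
  assumes W: "left_module A W" and w': "w' \<in> carrier W" "e2 \<odot>\<^bsub>W\<^esub> w' = w'"
    and rad: "\<And>r. r \<in> jac A \<Longrightarrow> r \<odot>\<^bsub>W\<^esub> (p \<odot>\<^bsub>W\<^esub> w') = \<zero>\<^bsub>W\<^esub>"
  shows "\<exists>\<beta>\<in>module_hom A (restr I R) W. \<beta> w = w' \<and> \<beta> s = p \<odot>\<^bsub>W\<^esub> w'"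
proof -
  obtain \<beta> where \<beta>: "\<beta> \<in> module_hom A (restr I R) W" "\<beta> w = w'"
    using hom_from_cyclic[OF e2 cl(5) p(2,3) jac_e2 cl(10) w(3) nonzero(2) p(4) sub(3) cyc_R[OF w(1,2)]
      W w' rad] by blast
  interpret \<beta>: left_module_hom A "restr I R" W \<beta> by (intro left_module_homI \<beta> W restr_modules)
  show ?thesis using \<beta> \<beta>.hom_smult[of p w] w p(4) by (intro bexI[of _ \<beta>]) auto
qed

text \<open>Let \<open>K\<close> be the largest submodule with \<open>e0 K\<close> inside
  \<open>G\<close>; it misses \<open>s'\<close>. If \<open>a s'\<close> is in \<open>K\<close>, then
  \<open>a s = 0\<close>, since otherwise \<open>a e0\<close> could be cancelled and
  \<open>s'\<close> would be in \<open>K\<close>. So some map kills \<open>K\<close> and sends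
  \<open>s'\<close> to \<open>s\<close>. Below, \<open>G\<close> is the set of values
  \<open>p x\<close> or \<open>q x + p y\<close> among which \<open>s'\<close> does not
  occur.\<close>

lemma ex_hom_to_I:
  assumes W: "fg_module A W" and s': "s' \<in> carrier W" "e0 \<odot>\<^bsub>W\<^esub> s' = s'"
    and G: "G \<subseteq> carrier W" "\<zero>\<^bsub>W\<^esub> \<in> G" "\<And>x y. x \<in> G \<Longrightarrow> y \<in> G \<Longrightarrow> x \<oplus>\<^bsub>W\<^esub> y \<in> G" "s' \<notin> G"
  shows "\<exists>h\<in>module_hom A W I. h s' = s \<and>
    (\<forall>x\<in>carrier W. (\<forall>y\<in>carrier A. (e0 \<otimes> y) \<odot>\<^bsub>W\<^esub> x \<in> G) \<longrightarrow> h x = \<zero>\<^bsub>I\<^esub>)"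
proof -
  interpret W: left_module A W using W by (rule fg_module_left_module)
  define K where "K = {x \<in> carrier W. \<forall>y\<in>carrier A. (e0 \<otimes> y) \<odot>\<^bsub>W\<^esub> x \<in> G}"
  have K: "submodule K A W"
  proof (rule W.submoduleI)
    fix a x assume a: "a \<in> carrier A" and x: "x \<in> K"
    have "(e0 \<otimes> y) \<odot>\<^bsub>W\<^esub> (a \<odot>\<^bsub>W\<^esub> x) = (e0 \<otimes> (y \<otimes> a)) \<odot>\<^bsub>W\<^esub> x" if "y \<in> carrier A" for y
      using that a x by (simp add: K_def W.smult_assoc[symmetric] A.m_assoc)
    then show "a \<odot>\<^bsub>W\<^esub> x \<in> K" using a x by (auto simp: K_def W.smult_closed)
  qed (use G in \<open>auto simp: K_def W.smult_r_distr\<close>)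
  have "s' \<notin> K"
  proof
    assume "s' \<in> K"
    then have "(e0 \<otimes> \<one>) \<odot>\<^bsub>W\<^esub> s' \<in> G" unfolding K_def by blast
    then show False using s' G by simp
  qed
  have "\<exists>h\<in>module_hom A W I. (\<forall>z\<in>K. h z = \<zero>\<^bsub>I\<^esub>) \<and> h s' = s"
  proof (rule injective_extend[OF injective W K s'(1) cl(8)])
    fix a assume a: "a \<in> carrier A" "a \<odot>\<^bsub>W\<^esub> s' \<in> K"
    show "a \<cdot> s = \<zero>\<^bsub>I\<^esub>"
    proof (rule ccontr)
      assume "a \<cdot> s \<noteq> \<zero>\<^bsub>I\<^esub>"
      then obtain c where c: "c \<in> carrier A" "c \<otimes> (a \<otimes> e0) = e0" using s_unit[OF a(1)] by blast
      have "s' = (c \<otimes> (a \<otimes> e0)) \<odot>\<^bsub>W\<^esub> s'" using c s' by simp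
      also have "\<dots> = c \<odot>\<^bsub>W\<^esub> (a \<odot>\<^bsub>W\<^esub> s')" using c(1) a(1) s' by (simp add: W.smult_assoc)
      also have "\<dots> \<in> K" by (rule W.submodule_smult[OF K c(1) a(2)])
      finally show False using \<open>s' \<notin> K\<close> by blast
    qed
  qed
  then show ?thesis unfolding K_def by blast
qed

text \<open>If \<open>x\<close> were outside \<sigma>, so would be some \<open>f x\<close>, and
  \<open>s = a f x\<close> because \<sigma> is the least nonzero submodule. As the radical kills
  \<open>x\<close>, \<open>a f\<close> is outside the radical; cancelling it gives
  \<open>f x\<close> in \<open>A s\<close>.\<close>

lemma killed_by_jac:
  assumes x: "x \<in> carrier I" and J: "\<And>a. a \<in> jac A \<Longrightarrow> a \<cdot> x = \<zero>\<^bsub>I\<^esub>"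
  shows "x \<in> \<sigma>"
proof (rule ccontr)
  assume "x \<notin> \<sigma>"
  then obtain f where f: "primitive A f" "f \<cdot> x \<notin> \<sigma>" using I.ex_primitive_smult[OF sub(1) x] by blast
  note fc = A.primitive_closed[OF f(1)] and ff = A.primitive_idem[OF f(1)]
  have fx: "f \<cdot> x \<in> carrier I" by (rule I.smult_closed[OF fc x])
  have "f \<cdot> x \<noteq> \<zero>\<^bsub>I\<^esub>" using f(2) I.submodule_zero[OF sub(1)] by metis
  then have "s \<in> I.cyc (f \<cdot> x)" using \<sigma>_in_cyc[OF fx] s(1) by blast
  then obtain a where a: "a \<in> carrier A" "s = (a \<otimes> f) \<cdot> x" using fc x
    by (auto simp: I.cyc_def I.smult_assoc)
  then have "a \<otimes> f \<notin> jac A" using J s(2) by auto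
  then obtain c where c: "c \<in> carrier A" "c \<otimes> (a \<otimes> f) = f"
    using A.not_jac_left[OF f(1), of "a \<otimes> f"] a(1) fc ff by (auto simp: A.m_assoc)
  have "f \<cdot> x = (c \<otimes> (a \<otimes> f)) \<cdot> x" using c by simp
  also have "\<dots> = c \<cdot> s" using c(1) a fc x by (simp add: I.smult_assoc)
  finally show False using f(2) I.submodule_smult[OF sub(1) c(1) s(1)] by simp
qed

lemma \<sigma>_elem: "x \<in> \<sigma> \<Longrightarrow> \<exists>a\<in>carrier A. x = a \<cdot> s"
  using cyc_\<sigma>[OF s(1,2)] by (auto simp: I.cyc_def)

lemma M1_elem: "x \<in> M1 \<Longrightarrow> \<exists>a\<in>carrier A. x = a \<cdot> t"
  using cyc_M1[OF t(1,2)] by (auto simp: I.cyc_def)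

lemma R_elem: "x \<in> R \<Longrightarrow> \<exists>a\<in>carrier A. x = a \<cdot> w"
  using cyc_R[OF w(1,2)] by (auto simp: I.cyc_def)

lemma homs_agree_on_\<sigma>:
  assumes W: "left_module A W" and h: "h \<in> module_hom A (restr I \<sigma>) W" "l \<in> module_hom A (restr I \<sigma>) W"
    and eq: "h s = l s" and x: "x \<in> \<sigma>"
  shows "h x = l x"
  using \<sigma>_elem[OF x] s(1) h eq by (auto simp: module_hom_def)

lemma restrict_to_\<sigma>:
  "h \<in> module_hom A (restr I M1) W \<Longrightarrow> h \<in> module_hom A (restr I \<sigma>) W"
  "h \<in> module_hom A (restr I R) W \<Longrightarrow> h \<in> module_hom A (restr I \<sigma>) W"
  using le(1,2) by (auto simp: module_hom_def Pi_iff subset_iff)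

lemma fg_parts: "fg_module A (restr I \<sigma>)" "fg_module A (restr I M1)" "fg_module A (restr I R)"
  "fg_module A (restr I L)"
proof -
  show "fg_module A (restr I \<sigma>)"
    using \<sigma>_elem s(1) by (intro left_module.fg_module_cyclic[OF restr_modules(1), of s]) auto
  show "fg_module A (restr I M1)"
    using M1_elem t(1) by (intro left_module.fg_module_cyclic[OF restr_modules(2), of t]) auto
  show "fg_module A (restr I R)"
    using R_elem w(1) by (intro left_module.fg_module_cyclic[OF restr_modules(3), of w]) auto
  show "fg_module A (restr I L)"
    unfolding left_module.fg_iff[OF restr_modules(4)]
  proof (intro exI[of _ "{t, w}"] conjI allI impI)
    show "{t, w} \<subseteq> carrier (restr I L)" using t(1) w(1) le_L by auto
    fix N assume "submodule N A (restr I L) \<and> {t, w} \<subseteq> N"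
    then have N: "submodule N A I" "N \<subseteq> L" "t \<in> N" "w \<in> N" by (auto simp: I.submodule_restr[OF sub_L])
    then have "L \<subseteq> N"
      using I.cyc_least[OF N(1) N(3)] I.cyc_least[OF N(1) N(4)] cyc_M1[OF t(1,2)] cyc_R[OF w(1,2)]
      by (intro I.set_add_least) auto
    then show "N = carrier (restr I L)" using N(2) by auto
  qed simp
qed

lemma fg_dsum: "fg_module A (dsum (restr I M1) (restr I R))"
proof -
  let ?D = "dsum (restr I M1) (restr I R)"
  interpret D: left_module A ?D by (intro left_module_dsum restr_modules)
  show ?thesis
    unfolding D.fg_iff
  proof (intro exI[of _ "{(t, \<zero>\<^bsub>I\<^esub>), (\<zero>\<^bsub>I\<^esub>, w)}"] conjI allI impI)
    show "{(t, \<zero>\<^bsub>I\<^esub>), (\<zero>\<^bsub>I\<^esub>, w)} \<subseteq> carrier ?D"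
      using t(1) w(1) I.submodule_zero[OF sub(2)] I.submodule_zero[OF sub(3)] by simp
    fix N assume *: "submodule N A ?D \<and> {(t, \<zero>\<^bsub>I\<^esub>), (\<zero>\<^bsub>I\<^esub>, w)} \<subseteq> N"
    then have N: "submodule N A ?D" by blast
    have "(x, y) \<in> N" if xy: "x \<in> M1" "y \<in> R" for x y
    proof -
      obtain a b where ab: "a \<in> carrier A" "x = a \<cdot> t" "b \<in> carrier A" "y = b \<cdot> w"
        using M1_elem[OF xy(1)] R_elem[OF xy(2)] by blast
      have "a \<odot>\<^bsub>?D\<^esub> (t, \<zero>\<^bsub>I\<^esub>) \<oplus>\<^bsub>?D\<^esub> b \<odot>\<^bsub>?D\<^esub> (\<zero>\<^bsub>I\<^esub>, w) \<in> N"
        using * ab by (intro D.submodule_add[OF N] D.submodule_smult[OF N]) auto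
      then show ?thesis using ab by (simp add: I.smult_closed)
    qed
    then show "N = carrier ?D" using D.submodule_subset[OF N] by auto
  qed simp
qed

text \<open>An endomorphism killing \<open>s\<close> kills \<sigma>; then the images of
  \<open>t\<close> and \<open>w\<close> are annihilated by the radical, so the whole image lies in
  \<sigma> and the square is zero. Otherwise it is injective, and \<open>e1\<close>,
  \<open>e2\<close> keep the images of \<open>t\<close> and \<open>w\<close> in \<open>M1\<close>
  and \<open>R\<close> but outside \<sigma>, so they generate \<open>L\<close>.\<close>

lemma endomorphism_L:
  assumes \<chi>: "\<chi> \<in> module_hom A (restr I L) (restr I L)"
  shows "bij_betw \<chi> (carrier (restr I L)) (carrier (restr I L)) \<or>
    (\<forall>z\<in>carrier (restr I L). \<chi> (\<chi> z) = \<zero>\<^bsub>restr I L\<^esub>)"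
proof -
  interpret \<chi>: left_module_hom A "restr I L" "restr I L" \<chi> by (intro left_module_homI \<chi> restr_modules)
  have in_L: "s \<in> L" "t \<in> L" "w \<in> L" using s(1) t(1) w(1) le le_L by blast+
  have smult: "\<chi> (a \<cdot> x) = a \<cdot> \<chi> x" if "a \<in> carrier A" "x \<in> L" for a x
    using \<chi>.hom_smult[OF that(1), of x] that(2) by simp
  have cL: "\<chi> x \<in> L" "\<chi> x \<in> carrier I" if "x \<in> L" for x using \<chi>.hom_closed[of x] that L_carr by simp_all
  show ?thesis
  proof (cases "\<chi> s = \<zero>\<^bsub>I\<^esub>")
    case True
    have zero: "\<chi> x = \<zero>\<^bsub>I\<^esub>" if "x \<in> \<sigma>" for x
      using \<sigma>_elem[OF that] smult[OF _ in_L(1)] True by auto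
    have "\<chi> t \<in> \<sigma>"
      using zero jac_smul(2)[OF _ t(1)] smult[OF A.jac_closed in_L(2)]
        by (intro killed_by_jac cL in_L) metis
    moreover have "\<chi> w \<in> \<sigma>"
      using zero jac_smul(3)[OF _ w(1)] smult[OF A.jac_closed in_L(3)]
        by (intro killed_by_jac cL in_L) metis
    ultimately have "\<chi> x \<in> \<sigma>" if xL: "x \<in> L" for x
    proof -
      obtain m r where mr: "m \<in> M1" "r \<in> R" "x = m \<oplus>\<^bsub>I\<^esub> r" using xL by (auto simp: I.set_add_iff)
      obtain a b where ab: "a \<in> carrier A" "m = a \<cdot> t" "b \<in> carrier A" "r = b \<cdot> w"
        using M1_elem[OF mr(1)] R_elem[OF mr(2)] by blast
      have "\<chi> x = \<chi> m \<oplus>\<^bsub>I\<^esub> \<chi> r" using \<chi>.hom_add[of m r] mr le_L by auto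
      also have "\<dots> = a \<cdot> \<chi> t \<oplus>\<^bsub>I\<^esub> b \<cdot> \<chi> w" using smult ab in_L by simp
      finally show ?thesis
        using \<open>\<chi> t \<in> \<sigma>\<close> \<open>\<chi> w \<in> \<sigma>\<close> ab I.submodule_add[OF sub(1)] I.submodule_smult[OF sub(1)] by simp
    qed
    then show ?thesis using zero by simp
  next
    case False
    have "inj_on \<chi> (carrier (restr I L))"
    proof (rule \<chi>.inj_onI_kernel)
      have "submodule {x \<in> L. \<chi> x = \<zero>\<^bsub>I\<^esub>} A I"
        using \<chi>.submodule_kernel by (simp add: I.submodule_restr[OF sub_L])
      moreover have "s \<notin> {x \<in> L. \<chi> x = \<zero>\<^bsub>I\<^esub>}" using False by simp
      ultimately have "{x \<in> L. \<chi> x = \<zero>\<^bsub>I\<^esub>} = {\<zero>\<^bsub>I\<^esub>}" using \<sigma>_min s(1) by blast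
      then show "x = \<zero>\<^bsub>restr I L\<^esub>" if "x \<in> carrier (restr I L)" "\<chi> x = \<zero>\<^bsub>restr I L\<^esub>" for x
        using that by auto
    qed
    moreover have im: "submodule (\<chi> ` L) A I"
      using \<chi>.submodule_image[OF \<chi>.M.submodule_UNIV] by (simp add: I.submodule_restr[OF sub_L])
    have "\<chi> t \<in> M1 \<and> \<chi> t \<notin> \<sigma>"
    proof
      obtain m r where mr: "m \<in> M1" "r \<in> R" "\<chi> t = m \<oplus>\<^bsub>I\<^esub> r" using cL(1)[OF in_L(2)]
        by (auto simp: I.set_add_iff)
      have "\<chi> t = e1 \<cdot> \<chi> t" using smult[of e1 t] in_L t by simp
      also have "\<dots> = e1 \<cdot> m \<oplus>\<^bsub>I\<^esub> e1 \<cdot> r" unfolding mr(3) using mr carr by (intro I.smult_r_distr) auto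
      also have "\<dots> \<in> M1" using e1_R[OF mr(2)] le(1) mr(1) I.submodule_smult[OF sub(2) cl(2)]
        by (intro I.submodule_add[OF sub(2)]) auto
      finally show "\<chi> t \<in> M1" .
      show "\<chi> t \<notin> \<sigma>"
      proof
        assume "\<chi> t \<in> \<sigma>"
        then have "q \<cdot> \<chi> t = \<zero>\<^bsub>I\<^esub>" by (rule jac_smul(1)[OF q(1)])
        then show False using smult[of q t] in_L q(4) False by simp
      qed
    qed
    moreover have "\<chi> w \<in> R \<and> \<chi> w \<notin> \<sigma>"
    proof
      obtain m r where mr: "m \<in> M1" "r \<in> R" "\<chi> w = m \<oplus>\<^bsub>I\<^esub> r" using cL(1)[OF in_L(3)]
        by (auto simp: I.set_add_iff)
      have "\<chi> w = e2 \<cdot> \<chi> w" using smult[of e2 w] in_L w by simp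
      also have "\<dots> = e2 \<cdot> m \<oplus>\<^bsub>I\<^esub> e2 \<cdot> r" unfolding mr(3) using mr carr by (intro I.smult_r_distr) auto
      also have "\<dots> \<in> R" using e2_M1[OF mr(1)] le(2) mr(2) I.submodule_smult[OF sub(3) cl(3)]
        by (intro I.submodule_add[OF sub(3)]) auto
      finally show "\<chi> w \<in> R" .
      show "\<chi> w \<notin> \<sigma>"
      proof
        assume "\<chi> w \<in> \<sigma>"
        then have "p \<cdot> \<chi> w = \<zero>\<^bsub>I\<^esub>" by (rule jac_smul(1)[OF p(1)])
        then show False using smult[of p w] in_L p(4) False by simp
      qed
    qed
    ultimately have "M1 \<subseteq> \<chi> ` L" "R \<subseteq> \<chi> ` L"
      using cyc_M1[of "\<chi> t"] cyc_R[of "\<chi> w"] I.cyc_least[OF im, of "\<chi> t"] I.cyc_least[OF im, of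
        "\<chi> w"] in_L by auto
    then have "L \<subseteq> \<chi> ` L" by (intro I.set_add_least im)
    then have "\<chi> ` carrier (restr I L) = carrier (restr I L)" using cL by auto
    with \<open>inj_on \<chi> (carrier (restr I L))\<close> show ?thesis by (simp add: bij_betw_def)
  qed
qed

text \<open>If \<open>s' = q t' + p w'\<close>, maps sending \<open>t\<close> to \<open>t'\<close>
  and \<open>w\<close> to \<open>w'\<close> exist thanks to \<open>separate\<close>, and their sum
  extends \<open>h\<close>. If there is no such equation, \<open>G = q W + p W\<close> contains
  \<open>e0 J W\<close>, so the map to \<open>I\<close> kills \<open>J W\<close> and has its image
  in \<sigma>: it is a retraction.\<close>

lemma left_almost_split_dsum:
  "left_almost_split A (restr I \<sigma>) (dsum (restr I M1) (restr I R)) (\<lambda>x. (x, x))"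
  unfolding left_almost_split_def
proof (intro conjI allI impI)
  let ?D = "dsum (restr I M1) (restr I R)"
  show f: "(\<lambda>x. (x, x)) \<in> module_hom A (restr I \<sigma>) ?D"
    using le(1,2) by (auto intro!: module_homI)
  show "\<not> split_mono A (restr I \<sigma>) ?D (\<lambda>x. (x, x))"
  proof
    assume "split_mono A (restr I \<sigma>) ?D (\<lambda>x. (x, x))"
    then obtain r where r: "r \<in> module_hom A ?D (restr I \<sigma>)" "r (s, s) = s" using s(1)
      by (auto simp: split_mono_def)
    interpret r: left_module_hom A ?D "restr I \<sigma>" r
      by (intro left_module_homI r left_module_dsum restr_modules)
    have z: "(t, \<zero>\<^bsub>I\<^esub>) \<in> carrier ?D" "(\<zero>\<^bsub>I\<^esub>, w) \<in> carrier ?D" "(s, \<zero>\<^bsub>I\<^esub>) \<in> carrier ?D"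
      "(\<zero>\<^bsub>I\<^esub>, s) \<in> carrier ?D"
      using s(1) t(1) w(1) le I.submodule_zero[OF sub(2)] I.submodule_zero[OF sub(3)] by auto
    \<comment> \<open>A retraction maps \<open>(t, 0)\<close> and \<open>(0, w)\<close> into
      \<sigma>, where \<open>q\<close> and \<open>p\<close> act as zero.\<close>
    have "r (s, \<zero>\<^bsub>I\<^esub>) = q \<cdot> r (t, \<zero>\<^bsub>I\<^esub>)" using r.hom_smult[OF cl(6) z(1)] q(4) by simp
    then have 1: "r (s, \<zero>\<^bsub>I\<^esub>) = \<zero>\<^bsub>I\<^esub>" using jac_smul(1)[OF q(1)] r.hom_closed[OF z(1)] by simp
    have "r (\<zero>\<^bsub>I\<^esub>, s) = p \<cdot> r (\<zero>\<^bsub>I\<^esub>, w)" using r.hom_smult[OF cl(5) z(2)] p(4) by simp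
    then have 2: "r (\<zero>\<^bsub>I\<^esub>, s) = \<zero>\<^bsub>I\<^esub>" using jac_smul(1)[OF p(1)] r.hom_closed[OF z(2)] by simp
    have "r (s, s) = r (s, \<zero>\<^bsub>I\<^esub>) \<oplus>\<^bsub>I\<^esub> r (\<zero>\<^bsub>I\<^esub>, s)" using r.hom_add[OF z(3,4)] by simp
    then show False using 1 2 r(2) s(2) by simp
  qed
  fix W :: "'a cat_module" and h
  assume "fg_module A W \<and> h \<in> module_hom A (restr I \<sigma>) W \<and> \<not> split_mono A (restr I \<sigma>) W h"
  then have W: "fg_module A W" and h: "h \<in> module_hom A (restr I \<sigma>) W"
    and ns: "\<not> split_mono A (restr I \<sigma>) W h" by auto
  note Wm = fg_module_left_module[OF W]
  interpret W: left_module A W by (rule Wm)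
  interpret h: left_module_hom A "restr I \<sigma>" W h by (intro left_module_homI h Wm restr_modules)
  define s' where "s' = h s"
  have s': "s' \<in> carrier W" using h.hom_closed s(1) by (simp add: s'_def)
  have hs: "h (a \<cdot> s) = a \<odot>\<^bsub>W\<^esub> s'" if "a \<in> carrier A" for a
    using h.hom_smult[OF that, of s] s(1) by (simp add: s'_def)
  have e0s': "e0 \<odot>\<^bsub>W\<^esub> s' = s'" using hs[of e0] s(3) by (simp add: s'_def)
  define G where "G = {q \<odot>\<^bsub>W\<^esub> x \<oplus>\<^bsub>W\<^esub> p \<odot>\<^bsub>W\<^esub> y | x y. x \<in> carrier W \<and> y \<in> carrier W}"
  have G: "G \<subseteq> carrier W" "\<zero>\<^bsub>W\<^esub> \<in> G"
    by (auto simp: G_def W.smult_closed intro!: exI[of _ "\<zero>\<^bsub>W\<^esub>"])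
  have G_add: "x \<oplus>\<^bsub>W\<^esub> y \<in> G" if xy: "x \<in> G" "y \<in> G" for x y
  proof -
    obtain x1 x2 y1 y2 where c: "x1 \<in> carrier W" "x2 \<in> carrier W" "y1 \<in> carrier W" "y2 \<in> carrier W"
      and eq: "x = q \<odot>\<^bsub>W\<^esub> x1 \<oplus>\<^bsub>W\<^esub> p \<odot>\<^bsub>W\<^esub> x2" "y = q \<odot>\<^bsub>W\<^esub> y1 \<oplus>\<^bsub>W\<^esub> p \<odot>\<^bsub>W\<^esub> y2"
      using xy unfolding G_def by blast
    have "x \<oplus>\<^bsub>W\<^esub> y = q \<odot>\<^bsub>W\<^esub> (x1 \<oplus>\<^bsub>W\<^esub> y1) \<oplus>\<^bsub>W\<^esub> p \<odot>\<^bsub>W\<^esub> (x2 \<oplus>\<^bsub>W\<^esub> y2)"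
      unfolding eq using c by (simp add: W.smult_r_distr W.smult_closed W.M.a_ac)
    then show ?thesis unfolding G_def using c W.M.a_closed by blast
  qed
  show "\<exists>k\<in>module_hom A ?D W. \<forall>x\<in>carrier (restr I \<sigma>). k (x, x) = h x"
  proof (cases "s' \<in> G")
    case True
    then obtain t0 w0 where tw: "t0 \<in> carrier W" "w0 \<in> carrier W" "s' = q \<odot>\<^bsub>W\<^esub> t0 \<oplus>\<^bsub>W\<^esub> p \<odot>\<^bsub>W\<^esub> w0"
      unfolding G_def by blast
    define t' where "t' = e1 \<odot>\<^bsub>W\<^esub> t0"
    define w' where "w' = e2 \<odot>\<^bsub>W\<^esub> w0"
    have t': "t' \<in> carrier W" "e1 \<odot>\<^bsub>W\<^esub> t' = t'" "q \<odot>\<^bsub>W\<^esub> t0 = q \<odot>\<^bsub>W\<^esub> t'"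
      using tw q(3) by (simp_all add: t'_def W.smult_closed W.smult_assoc[symmetric])
    have w': "w' \<in> carrier W" "e2 \<odot>\<^bsub>W\<^esub> w' = w'" "p \<odot>\<^bsub>W\<^esub> w0 = p \<odot>\<^bsub>W\<^esub> w'"
      using tw p(3) by (simp_all add: w'_def W.smult_closed W.smult_assoc[symmetric])
    have s'_eq: "s' = q \<odot>\<^bsub>W\<^esub> t' \<oplus>\<^bsub>W\<^esub> p \<odot>\<^bsub>W\<^esub> w'" using tw t' w' by simp
    have as': "a \<odot>\<^bsub>W\<^esub> s' = (a \<otimes> q) \<odot>\<^bsub>W\<^esub> t' \<oplus>\<^bsub>W\<^esub> (a \<otimes> p) \<odot>\<^bsub>W\<^esub> w'" if "a \<in> carrier A" for a
      unfolding s'_eq using that t' w' by (simp add: W.smult_r_distr W.smult_closed W.smult_assoc)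
    have zero: "a \<odot>\<^bsub>W\<^esub> s' = \<zero>\<^bsub>W\<^esub>" if "a \<in> carrier A" "a \<cdot> s = \<zero>\<^bsub>I\<^esub>" for a
      using hs[OF that(1)] that(2) h.hom_zero by simp
    \<comment> \<open>Take \<open>a\<close> with \<open>a q = r q\<close> and
      \<open>a p = 0\<close>: it kills \<open>s = p w\<close>, hence \<open>s'\<close>, and
      \<open>a s' = r q t'\<close>.\<close>
    have "r \<odot>\<^bsub>W\<^esub> (q \<odot>\<^bsub>W\<^esub> t') = \<zero>\<^bsub>W\<^esub>" if r: "r \<in> jac A" for r
    proof -
      obtain a where a: "a \<in> carrier A" "a \<otimes> q = r \<otimes> q" "a \<otimes> p = \<zero>" using separate[OF r] by blast
      have "a \<cdot> s = (a \<otimes> p) \<cdot> w" using a(1) p(4) by (simp add: I.smult_assoc)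
      then have "a \<odot>\<^bsub>W\<^esub> s' = \<zero>\<^bsub>W\<^esub>" using a by (intro zero) auto
      then have "(r \<otimes> q) \<odot>\<^bsub>W\<^esub> t' = \<zero>\<^bsub>W\<^esub>" using as'[OF a(1)] a t' w' A.jac_closed[OF r]
        by (simp add: W.smult_closed)
      then show ?thesis using t' A.jac_closed[OF r] by (simp add: W.smult_assoc)
    qed
    from hom_from_M1[OF Wm t'(1,2) this]
    obtain \<alpha> where \<alpha>: "\<alpha> \<in> module_hom A (restr I M1) W" "\<alpha> s = q \<odot>\<^bsub>W\<^esub> t'" by blast
    have "r \<odot>\<^bsub>W\<^esub> (p \<odot>\<^bsub>W\<^esub> w') = \<zero>\<^bsub>W\<^esub>" if r: "r \<in> jac A" for r
    proof -
      obtain a where a: "a \<in> carrier A" "a \<otimes> q = \<zero>" "a \<otimes> p = r \<otimes> p" using separate'[OF r] by blast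
      have "a \<cdot> s = (a \<otimes> q) \<cdot> t" using a(1) q(4) by (simp add: I.smult_assoc)
      then have "a \<odot>\<^bsub>W\<^esub> s' = \<zero>\<^bsub>W\<^esub>" using a by (intro zero) auto
      then have "(r \<otimes> p) \<odot>\<^bsub>W\<^esub> w' = \<zero>\<^bsub>W\<^esub>" using as'[OF a(1)] a t' w' A.jac_closed[OF r]
        by (simp add: W.smult_closed)
      then show ?thesis using w' A.jac_closed[OF r] by (simp add: W.smult_assoc)
    qed
    from hom_from_R[OF Wm w'(1,2) this]
    obtain \<beta> where \<beta>: "\<beta> \<in> module_hom A (restr I R) W" "\<beta> s = p \<odot>\<^bsub>W\<^esub> w'" by blast
    let ?k = "\<lambda>x. \<alpha> (fst x) \<oplus>\<^bsub>W\<^esub> \<beta> (snd x)"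
    have "?k \<in> module_hom A ?D W"
      by (intro module_hom_add Wm module_hom_compose[OF _ \<alpha>(1)] module_hom_compose[OF _ \<beta>(1)] dsum_homs)
    moreover have "?k (x, x) = h x" if x: "x \<in> \<sigma>" for x
    proof -
      have "(\<lambda>x. \<alpha> x \<oplus>\<^bsub>W\<^esub> \<beta> x) \<in> module_hom A (restr I \<sigma>) W"
        by (intro module_hom_add Wm restrict_to_\<sigma> \<alpha> \<beta>)
      from homs_agree_on_\<sigma>[OF Wm this h _ x] show ?thesis
        using \<alpha>(2) \<beta>(2) s'_eq by (simp add: s'_def)
    qed
    ultimately show ?thesis by (intro bexI[of _ ?k]) auto
  next
    case False
    obtain g' where g': "g' \<in> module_hom A W I" "g' s' = s"
      "\<And>x. x \<in> carrier W \<Longrightarrow> (\<And>y. y \<in> carrier A \<Longrightarrow> (e0 \<otimes> y) \<odot>\<^bsub>W\<^esub> x \<in> G) \<Longrightarrow> g' x = \<zero>\<^bsub>I\<^esub>"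
      using ex_hom_to_I[OF W s' e0s' G G_add False] by blast
    interpret g': left_module_hom A W I g' by (intro left_module_homI g' Wm I.left_module_axioms)
    have "g' x \<in> \<sigma>" if x: "x \<in> carrier W" for x
    proof (rule killed_by_jac[OF g'.hom_closed[OF x]])
      fix a assume a: "a \<in> jac A"
      note ac = A.jac_closed[OF a]
      have "g' (a \<odot>\<^bsub>W\<^esub> x) = \<zero>\<^bsub>I\<^esub>"
      proof (rule g'(3)[OF W.smult_closed[OF ac x]])
        fix y assume y: "y \<in> carrier A"
        have b: "e0 \<otimes> y \<otimes> a \<in> jac A" "e0 \<otimes> (e0 \<otimes> y \<otimes> a) = e0 \<otimes> y \<otimes> a"
          using y a ac by (simp_all add: A.jac_lmult A.m_assoc[symmetric])
        obtain c d where cd: "c \<in> carrier A" "d \<in> carrier A" "e0 \<otimes> y \<otimes> a = q \<otimes> c \<oplus> p \<otimes> d"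
          by (rule right_radicalE[OF b])
        have "(e0 \<otimes> y) \<odot>\<^bsub>W\<^esub> (a \<odot>\<^bsub>W\<^esub> x) = (e0 \<otimes> y \<otimes> a) \<odot>\<^bsub>W\<^esub> x" using y ac x
          by (simp add: W.smult_assoc[symmetric])
        also have "\<dots> = q \<odot>\<^bsub>W\<^esub> (c \<odot>\<^bsub>W\<^esub> x) \<oplus>\<^bsub>W\<^esub> p \<odot>\<^bsub>W\<^esub> (d \<odot>\<^bsub>W\<^esub> x)"
          unfolding cd(3) using cd x by (simp add: W.smult_l_distr W.smult_assoc)
        finally show "(e0 \<otimes> y) \<odot>\<^bsub>W\<^esub> (a \<odot>\<^bsub>W\<^esub> x) \<in> G"
          unfolding G_def using W.smult_closed[OF cd(1) x] W.smult_closed[OF cd(2) x] by blast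
      qed
      then show "a \<cdot> g' x = \<zero>\<^bsub>I\<^esub>" using g'.hom_smult[OF ac x] by simp
    qed
    then have "g' \<in> module_hom A W (restr I \<sigma>)" using g'(1) by (auto simp: module_hom_def)
    moreover have "g' (h x) = x" if x: "x \<in> \<sigma>" for x
    proof -
      obtain a where a: "a \<in> carrier A" "x = a \<cdot> s" using \<sigma>_elem[OF x] by blast
      then show ?thesis using hs[OF a(1)] g'.hom_smult[OF a(1) s'] g'(2) by simp
    qed
    ultimately have "split_mono A (restr I \<sigma>) W h" using h by (auto simp: split_mono_def)
    with ns show ?thesis by blast
  qed
qed

text \<open>The minus sign matches the diagonal embedding: the difference vanishes exactly on the
  diagonal copy of \<open>M1 \<inter> R = \<sigma>\<close>.\<close>

lemma almost_split_dsum: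
  "almost_split_sequence A (restr I \<sigma>) (dsum (restr I M1) (restr I R)) (restr I L)
     (\<lambda>x. (x, x)) (\<lambda>x. fst x \<ominus>\<^bsub>I\<^esub> snd x)"
proof -
  let ?D = "dsum (restr I M1) (restr I R)"
  let ?g = "\<lambda>x. fst x \<ominus>\<^bsub>I\<^esub> snd x"
  have fstI: "fst \<in> module_hom A ?D I" and sndI: "snd \<in> module_hom A ?D I"
    using carr by (auto intro!: module_homI)
  have gI: "?g \<in> module_hom A ?D I" by (intro module_hom_diff I.left_module_axioms fstI sndI)
  have gL: "?g x \<in> L" if "x \<in> carrier ?D" for x
    using that le_L I.submodule_diff[OF sub_L] by (auto simp: subset_iff)
  have g: "?g \<in> module_hom A ?D (restr I L)" using gI gL by (auto simp: module_hom_def)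
  have se: "short_exact A (restr I \<sigma>) ?D (restr I L) (\<lambda>x. (x, x)) ?g"
    unfolding short_exact_def
  proof (intro conjI g)
    show "(\<lambda>x. (x, x)) \<in> module_hom A (restr I \<sigma>) ?D"
      using le(1,2) by (auto intro!: module_homI)
    show "inj_on (\<lambda>x. (x, x)) (carrier (restr I \<sigma>))" by (auto intro: inj_onI)
    show "(\<lambda>x. (x, x)) ` carrier (restr I \<sigma>) = a_kernel ?D (restr I L) ?g"
      using Int_M1_R carr(2,3) le(1,2) by (auto simp: a_kernel_def' I.diff_eq_zero)
    show "?g ` carrier ?D = carrier (restr I L)"
    proof
      show "?g ` carrier ?D \<subseteq> carrier (restr I L)" using gL by auto
      show "carrier (restr I L) \<subseteq> ?g ` carrier ?D"
      proof
        fix x assume "x \<in> carrier (restr I L)"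
        then obtain m r where mr: "m \<in> M1" "r \<in> R" "x = m \<oplus>\<^bsub>I\<^esub> r" by (auto simp: I.set_add_iff)
        then have "x = ?g (m, \<ominus>\<^bsub>I\<^esub> r)" using carr by (simp add: I.M.minus_eq)
        moreover have "(m, \<ominus>\<^bsub>I\<^esub> r) \<in> carrier ?D" using mr I.submodule_neg[OF sub(3)] by simp
        ultimately show "x \<in> ?g ` carrier ?D" by blast
      qed
    qed
  qed
  show ?thesis
    unfolding almost_split_sequence_def
    using fg_parts(1,4) fg_dsum se left_almost_split_dsum
      right_almost_split_from_left[OF fg_parts(1) fg_dsum restr_modules(4) se left_almost_split_dsum
        endomorphism_L]
    by blast
qed

text \<open>If \<open>s' = p w'\<close>, \<open>h\<close> is glued with the map from
  \<open>R\<close> sending \<open>w\<close> to \<open>w'\<close>. If not, some \<open>g'\<close>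
  from \<open>W\<close> to \<open>I\<close> sends \<open>s'\<close> to \<open>s\<close> and has an
  image killed by \<open>p\<close>; such an image lies in \<open>M1\<close>, and \<open>g' h\<close>
  is an automorphism of \<open>M1\<close>, which yields the retraction.\<close>

lemma left_almost_split_M1: "left_almost_split A (restr I M1) (restr I L) (\<lambda>x. x)"
  unfolding left_almost_split_def
proof (intro conjI allI impI)
  show "(\<lambda>x. x) \<in> module_hom A (restr I M1) (restr I L)"
    using le_L(1) by (auto intro!: module_homI)
  show "\<not> split_mono A (restr I M1) (restr I L) (\<lambda>x. x)"
  proof
    assume "split_mono A (restr I M1) (restr I L) (\<lambda>x. x)"
    then obtain r where r: "r \<in> module_hom A (restr I L) (restr I M1)" "\<And>x. x \<in> M1 \<Longrightarrow> r x = x"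
      by (auto simp: split_mono_def)
    interpret r: left_module_hom A "restr I L" "restr I M1" r by (intro left_module_homI r restr_modules)
    have wL: "w \<in> L" using w(1) le_L(2) by blast
    have rw: "r w \<in> M1" using r.hom_closed[of w] wL by simp
    have "s = r (p \<cdot> w)" using p(4) r(2)[of s] s(1) le(1) by auto
    also have "\<dots> = p \<cdot> r w" using r.hom_smult[of p w] wL by simp
    also have "\<dots> = (p \<otimes> e2) \<cdot> r w" using p(3) by simp
    also have "\<dots> = p \<cdot> (e2 \<cdot> r w)" using carr(2)[OF rw] by (intro I.smult_assoc) auto
    also have "\<dots> = \<zero>\<^bsub>I\<^esub>" by (rule jac_smul(1)[OF p(1) e2_M1[OF rw]])
    finally show False using s(2) by simp
  qed
  fix W :: "'a cat_module" and h
  assume "fg_module A W \<and> h \<in> module_hom A (restr I M1) W \<and> \<not> split_mono A (restr I M1) W h"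
  then have W: "fg_module A W" and h: "h \<in> module_hom A (restr I M1) W"
    and ns: "\<not> split_mono A (restr I M1) W h" by auto
  note Wm = fg_module_left_module[OF W]
  interpret W: left_module A W by (rule Wm)
  interpret h: left_module_hom A "restr I M1" W h by (intro left_module_homI h Wm restr_modules)
  define s' where "s' = h s"
  have sM: "s \<in> M1" using s(1) le(1) by blast
  have s': "s' \<in> carrier W" using h.hom_closed sM by (simp add: s'_def)
  have hs: "h (a \<cdot> s) = a \<odot>\<^bsub>W\<^esub> s'" if "a \<in> carrier A" for a
    using h.hom_smult[OF that, of s] sM by (simp add: s'_def)
  have e0s': "e0 \<odot>\<^bsub>W\<^esub> s' = s'" using hs[of e0] s(3) by (simp add: s'_def)
  have J: "a \<odot>\<^bsub>W\<^esub> s' = \<zero>\<^bsub>W\<^esub>" if "a \<in> jac A" for a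
    using hs[OF A.jac_closed[OF that]] jac_smul(1)[OF that s(1)] h.hom_zero by simp
  define G where "G = {p \<odot>\<^bsub>W\<^esub> y | y. y \<in> carrier W}"
  have G: "G \<subseteq> carrier W" "\<zero>\<^bsub>W\<^esub> \<in> G"
    by (auto simp: G_def W.smult_closed intro!: exI[of _ "\<zero>\<^bsub>W\<^esub>"])
  have G_add: "x \<oplus>\<^bsub>W\<^esub> y \<in> G" if xy: "x \<in> G" "y \<in> G" for x y
  proof -
    obtain x1 y1 where c: "x1 \<in> carrier W" "y1 \<in> carrier W" and eq: "x = p \<odot>\<^bsub>W\<^esub> x1" "y = p \<odot>\<^bsub>W\<^esub> y1"
      using xy unfolding G_def by blast
    have "x \<oplus>\<^bsub>W\<^esub> y = p \<odot>\<^bsub>W\<^esub> (x1 \<oplus>\<^bsub>W\<^esub> y1)"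
      unfolding eq using c by (simp add: W.smult_r_distr)
    then show ?thesis unfolding G_def using c W.M.a_closed by blast
  qed
  show "\<exists>k\<in>module_hom A (restr I L) W. \<forall>x\<in>carrier (restr I M1). k x = h x"
  proof (cases "s' \<in> G")
    case True
    then obtain w0 where w0: "w0 \<in> carrier W" "s' = p \<odot>\<^bsub>W\<^esub> w0" unfolding G_def by blast
    define w' where "w' = e2 \<odot>\<^bsub>W\<^esub> w0"
    have w': "w' \<in> carrier W" "e2 \<odot>\<^bsub>W\<^esub> w' = w'" "p \<odot>\<^bsub>W\<^esub> w' = s'"
      using w0 p(3) by (simp_all add: w'_def W.smult_closed W.smult_assoc[symmetric])
    obtain \<beta> where \<beta>: "\<beta> \<in> module_hom A (restr I R) W" "\<beta> s = s'"
      using hom_from_R[OF Wm w'(1,2)] J w'(3) by auto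
    have "h x = \<beta> x" if "x \<in> \<sigma>" for x
      using homs_agree_on_\<sigma>[OF Wm restrict_to_\<sigma>(1)[OF h] restrict_to_\<sigma>(2)[OF \<beta>(1)] _ that] \<beta>(2)
      by (simp add: s'_def)
    from glue[OF Wm h \<beta>(1) this] show ?thesis by auto
  next
    case False
    obtain g' where g': "g' \<in> module_hom A W I" "g' s' = s"
      "\<And>x. x \<in> carrier W \<Longrightarrow> (\<And>y. y \<in> carrier A \<Longrightarrow> (e0 \<otimes> y) \<odot>\<^bsub>W\<^esub> x \<in> G) \<Longrightarrow> g' x = \<zero>\<^bsub>I\<^esub>"
      using ex_hom_to_I[OF W s' e0s' G G_add False] by blast
    interpret g': left_module_hom A W I g' by (intro left_module_homI g' Wm I.left_module_axioms)
    \<comment> \<open>\<open>e0 A p\<close> is contained in \<open>p A\<close>, so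
      \<open>e0 A p W\<close> stays in \<open>G = p W\<close> and \<open>g'\<close> kills
      \<open>p W\<close>.\<close>
    have pg': "p \<cdot> g' x = \<zero>\<^bsub>I\<^esub>" if x: "x \<in> carrier W" for x
    proof -
      have "g' (p \<odot>\<^bsub>W\<^esub> x) = \<zero>\<^bsub>I\<^esub>"
      proof (rule g'(3)[OF W.smult_closed[OF cl(5) x]])
        fix y assume y: "y \<in> carrier A"
        obtain z where z: "z \<in> carrier A" "e0 \<otimes> y \<otimes> p = p \<otimes> z" using e0_p[OF y] by blast
        have "(e0 \<otimes> y) \<odot>\<^bsub>W\<^esub> (p \<odot>\<^bsub>W\<^esub> x) = (e0 \<otimes> y \<otimes> p) \<odot>\<^bsub>W\<^esub> x" using y x
          by (simp add: W.smult_assoc[symmetric])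
        also have "\<dots> = p \<odot>\<^bsub>W\<^esub> (z \<odot>\<^bsub>W\<^esub> x)" unfolding z(2) using z x by (simp add: W.smult_assoc)
        finally show "(e0 \<otimes> y) \<odot>\<^bsub>W\<^esub> (p \<odot>\<^bsub>W\<^esub> x) \<in> G"
          unfolding G_def using W.smult_closed[OF z(1) x] by blast
      qed
      then show ?thesis using g'.hom_smult[OF cl(5) x] by simp
    qed
    define N where "N = g' ` carrier W"
    have N: "submodule N A I" unfolding N_def by (rule g'.submodule_image[OF W.submodule_UNIV])
    \<comment> \<open>A submodule outside \<open>M1\<close> reaches \<open>w\<close> together with
      \<open>M1\<close>. But \<open>p\<close> kills \<open>N\<close>, and also \<open>M1\<close>
      since \<open>p = p e2\<close> and \<open>e2\<close> maps \<open>M1\<close> into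
      \<sigma>.\<close>
    have NM1: "N \<subseteq> M1"
    proof (rule ccontr)
      assume "\<not> N \<subseteq> M1"
      note u = I.set_add_upper[OF sub(2) N]
      have "M1 <+>\<^bsub>I\<^esub> N \<noteq> M1" using u \<open>\<not> N \<subseteq> M1\<close> by blast
      then have "L \<subseteq> M1 <+>\<^bsub>I\<^esub> N"
        using above_M1[OF I.submodule_set_add[OF sub(2) N] u(1)] I.submodule_subset[OF sub_L] by auto
      then have "w \<in> M1 <+>\<^bsub>I\<^esub> N" using w(1) le_L by blast
      then obtain m n where mn: "m \<in> M1" "n \<in> N" "w = m \<oplus>\<^bsub>I\<^esub> n" by (auto simp: I.set_add_iff)
      note c = carr(2)[OF mn(1)] I.submodule_carrier[OF N mn(2)]
      have "p \<cdot> m = (p \<otimes> e2) \<cdot> m" using p(3) by simp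
      also have "\<dots> = p \<cdot> (e2 \<cdot> m)" using c by (intro I.smult_assoc) auto
      also have "\<dots> = \<zero>\<^bsub>I\<^esub>" by (rule jac_smul(1)[OF p(1) e2_M1[OF mn(1)]])
      finally have "p \<cdot> m = \<zero>\<^bsub>I\<^esub>" .
      moreover have "p \<cdot> n = \<zero>\<^bsub>I\<^esub>" using mn(2) pg' by (auto simp: N_def)
      moreover have "p \<cdot> w = p \<cdot> m \<oplus>\<^bsub>I\<^esub> p \<cdot> n" unfolding mn(3) using c by (simp add: I.smult_r_distr)
      ultimately show False using p(4) s(2) by simp
    qed
    have g'M1: "g' \<in> module_hom A W (restr I M1)" using g'(1) NM1 by (auto simp: module_hom_def N_def)
    let ?\<psi> = "\<lambda>x. g' (h x)"
    have \<psi>: "?\<psi> \<in> module_hom A (restr I M1) (restr I M1)" by (rule module_hom_compose[OF h g'M1])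
    interpret \<psi>: left_module_hom A "restr I M1" "restr I M1" ?\<psi>
      by (intro left_module_homI \<psi> restr_modules)
    have \<psi>s: "?\<psi> s = s" using g'(2) by (simp add: s'_def)
    have "inj_on ?\<psi> (carrier (restr I M1))"
    proof (rule \<psi>.inj_onI_kernel)
      have "submodule {x \<in> M1. ?\<psi> x = \<zero>\<^bsub>I\<^esub>} A I"
        using \<psi>.submodule_kernel by (simp add: I.submodule_restr[OF sub(2)])
      moreover have "s \<notin> {x \<in> M1. ?\<psi> x = \<zero>\<^bsub>I\<^esub>}" using \<psi>s s(2) by simp
      ultimately have "{x \<in> M1. ?\<psi> x = \<zero>\<^bsub>I\<^esub>} = {\<zero>\<^bsub>I\<^esub>}" using \<sigma>_min s(1) by blast
      then show "x = \<zero>\<^bsub>restr I M1\<^esub>" if "x \<in> carrier (restr I M1)" "?\<psi> x = \<zero>\<^bsub>restr I M1\<^esub>" for x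
        using that by auto
    qed
    moreover have "?\<psi> ` carrier (restr I M1) = carrier (restr I M1)"
    proof -
      have im: "submodule (?\<psi> ` M1) A I" "?\<psi> ` M1 \<subseteq> M1"
        using \<psi>.submodule_image[OF h.M.submodule_UNIV] by (simp_all add: I.submodule_restr[OF sub(2)])
      have \<psi>t: "?\<psi> t \<in> M1" using \<psi>.hom_closed[of t] t(1) by simp
      have "?\<psi> t \<notin> \<sigma>"
      proof
        assume "?\<psi> t \<in> \<sigma>"
        then have "q \<cdot> ?\<psi> t = \<zero>\<^bsub>I\<^esub>" by (rule jac_smul(1)[OF q(1)])
        then show False using \<psi>.hom_smult[of q t] t(1) q(4) \<psi>s s(2) by simp
      qed
      then have "M1 \<subseteq> ?\<psi> ` M1" using cyc_M1[OF \<psi>t] I.cyc_least[OF im(1), of "?\<psi> t"] t(1) by blast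
      with im(2) show ?thesis by simp
    qed
    ultimately have bij: "bij_betw ?\<psi> (carrier (restr I M1)) (carrier (restr I M1))"
      by (simp add: bij_betw_def)
    let ?i = "the_inv_into (carrier (restr I M1)) ?\<psi>"
    have "(\<lambda>x. ?i (g' x)) \<in> module_hom A W (restr I M1)"
      by (rule module_hom_compose[OF g'M1 \<psi>.inverse_hom[OF bij]])
    moreover have "?i (g' (h x)) = x" if "x \<in> carrier (restr I M1)" for x
      using the_inv_into_f_f[of ?\<psi> "carrier (restr I M1)" x] bij that by (simp add: bij_betw_def)
    ultimately have "split_mono A (restr I M1) W h"
      unfolding split_mono_def by (intro conjI h bexI[of _ "\<lambda>x. ?i (g' x)"]) simp_all
    with ns show ?thesis by (rule notE)
  qed
qed

text \<open>The second map is glued from zero on \<open>M1\<close> and \<pi> on \<open>R\<close>.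
  \<open>S\<close> is left abstract because in the theorem it is the socle of a quotient of
  \<open>M2\<close>, with elements of another type.\<close>

lemma almost_split_M1:
  assumes S: "simple_module A S" and \<pi>: "\<pi> \<in> module_hom A (restr I R) S" "\<pi> ` R = carrier S"
    and ker: "\<And>r. r \<in> R \<Longrightarrow> \<pi> r = \<zero>\<^bsub>S\<^esub> \<longleftrightarrow> r \<in> \<sigma>"
  shows "\<exists>g. almost_split_sequence A (restr I M1) (restr I L) S (\<lambda>x. x) g"
proof -
  have Sm: "left_module A S" using S by (simp add: simple_module_def)
  interpret S: left_module A S by fact
  interpret \<pi>: left_module_hom A "restr I R" S \<pi> by (intro left_module_homI \<pi> Sm restr_modules)
  have "\<zero>\<^bsub>S\<^esub> = \<pi> x" if "x \<in> \<sigma>" for x using ker[of x] that le(2) by auto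
  from glue[OF Sm module_hom_zero[OF Sm] \<pi>(1) this]
  obtain g where g: "g \<in> module_hom A (restr I L) S" "\<And>m. m \<in> M1 \<Longrightarrow> g m = \<zero>\<^bsub>S\<^esub>" "\<And>r. r \<in> R \<Longrightarrow> g r = \<pi> r"
    by blast
  interpret g: left_module_hom A "restr I L" S g by (intro left_module_homI g Sm restr_modules)
  have gsum: "g (m \<oplus>\<^bsub>I\<^esub> r) = \<pi> r" if "m \<in> M1" "r \<in> R" for m r
    using g.hom_add[of m r] g(2,3) that le_L \<pi>.hom_closed[of r] by (simp add: subset_iff)
  have gR: "g ` L = carrier S"
  proof
    show "g ` L \<subseteq> carrier S" using g.hom_closed by auto
    show "carrier S \<subseteq> g ` L" unfolding \<pi>(2)[symmetric] using g(3) le_L(2) by force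
  qed
  have se: "short_exact A (restr I M1) (restr I L) S (\<lambda>x. x) g"
    unfolding short_exact_def
  proof (intro conjI g(1))
    show "(\<lambda>x. x) \<in> module_hom A (restr I M1) (restr I L)"
      using le_L(1) by (auto intro!: module_homI)
    show "(\<lambda>x. x) ` carrier (restr I M1) = a_kernel (restr I L) S g"
    proof
      show "(\<lambda>x. x) ` carrier (restr I M1) \<subseteq> a_kernel (restr I L) S g"
        using g(2) le_L(1) by (auto simp: a_kernel_def')
      show "a_kernel (restr I L) S g \<subseteq> (\<lambda>x. x) ` carrier (restr I M1)"
      proof
        fix x assume "x \<in> a_kernel (restr I L) S g"
        then have x: "x \<in> L" "g x = \<zero>\<^bsub>S\<^esub>" by (auto simp: a_kernel_def')
        then obtain m r where mr: "m \<in> M1" "r \<in> R" "x = m \<oplus>\<^bsub>I\<^esub> r" by (auto simp: I.set_add_iff)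
        then have "r \<in> \<sigma>" using gsum x ker by simp
        then show "x \<in> (\<lambda>x. x) ` carrier (restr I M1)" using mr le(1) I.submodule_add[OF sub(2)] by auto
      qed
    qed
    show "g ` carrier (restr I L) = carrier S" using gR by simp
  qed simp
  \<comment> \<open>Schur's lemma: an endomorphism of a simple module is bijective or zero.\<close>
  have endo: "bij_betw \<chi> (carrier S) (carrier S) \<or> (\<forall>z\<in>carrier S. \<chi> (\<chi> z) = \<zero>\<^bsub>S\<^esub>)"
    if \<chi>: "\<chi> \<in> module_hom A S S" for \<chi>
  proof -
    interpret \<chi>: left_module_hom A S S \<chi> by (intro left_module_homI \<chi> Sm)
    let ?K = "{x \<in> carrier S. \<chi> x = \<zero>\<^bsub>S\<^esub>}"
    consider "?K = {\<zero>\<^bsub>S\<^esub>}" | "?K = carrier S"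
      using S \<chi>.submodule_kernel by (auto simp: simple_module_def)
    then show ?thesis
    proof cases
      case 1
      then have inj: "inj_on \<chi> (carrier S)" by (intro \<chi>.inj_onI_kernel) blast
      consider "\<chi> ` carrier S = {\<zero>\<^bsub>S\<^esub>}" | "\<chi> ` carrier S = carrier S"
        using S \<chi>.submodule_image[OF S.submodule_UNIV] by (auto simp: simple_module_def)
      then show ?thesis
      proof cases
        case a: 1
        then have "carrier S \<subseteq> ?K" by blast
        with 1 S S.submodule_zero[OF S.submodule_UNIV] have "carrier S = {\<zero>\<^bsub>S\<^esub>}" by blast
        then show ?thesis using S by (simp add: simple_module_def)
      qed (use inj in \<open>simp add: bij_betw_def\<close>)
    next
      case 2
      then have "\<chi> z = \<zero>\<^bsub>S\<^esub>" if "z \<in> carrier S" for z using that by blast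
      then show ?thesis using \<chi>.hom_closed by blast
    qed
  qed
  have fgS: "fg_module A S" by (rule g.fg_module_image[OF fg_parts(4)]) (simp add: gR)
  show ?thesis
    unfolding almost_split_sequence_def
    using fg_parts(2,4) fgS se left_almost_split_M1
      right_almost_split_from_left[OF fg_parts(2,4) Sm se left_almost_split_M1 endo]
    by blast
qed

text \<open>If the component of \<open>x\<close> in \<open>M2\<close> were outside \<open>R\<close>,
  some multiple of it by \<open>b\<close> would be \<open>v\<close>; then \<open>g b\<close> carries
  \<open>x\<close> to \<open>w\<close> modulo \<sigma>, while the radical maps \<open>X\<close> into
  \<sigma>. This bounds the second socle of \<open>I\<close> by \<open>L\<close>.\<close>

lemma adjacent_\<sigma>_in_L:
  assumes X: "adjacent A I \<sigma> X"
  shows "X \<subseteq> L"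
proof
  fix x assume x: "x \<in> X"
  have "x \<in> carrier I" using X x I.submodule_carrier by (auto simp: adjacent_def)
  then obtain m1 m2 where m: "m1 \<in> M1" "m2 \<in> M2" "x = m1 \<oplus>\<^bsub>I\<^esub> m2" using I.set_add_iff[of x M1 M2] sum_M
    by auto
  note c = carr(2)[OF m(1)] carr(4)[OF m(2)]
  have "m2 \<in> R"
  proof (rule ccontr)
    assume "m2 \<notin> R"
    then have "v \<in> I.cyc m2" using cyc_M2[OF m(2)] v(1) by simp
    then obtain b where b: "b \<in> carrier A" "v = b \<cdot> m2" by (auto simp: I.cyc_def)
    have gb: "g \<otimes> b \<in> jac A" by (intro A.jac_rmult g b)
    have "(g \<otimes> b) \<cdot> x = (g \<otimes> b) \<cdot> m1 \<oplus>\<^bsub>I\<^esub> (g \<otimes> b) \<cdot> m2" unfolding m(3) using b c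
      by (simp add: I.smult_r_distr)
    also have "(g \<otimes> b) \<cdot> m2 = w" using b c g(4) by (simp add: I.smult_assoc)
    finally have "w \<oplus>\<^bsub>I\<^esub> (g \<otimes> b) \<cdot> m1 \<in> \<sigma>"
      using I.jac_adjacent[OF X gb x] b c by (simp add: I.M.a_comm I.smult_closed)
    then have "w \<in> \<sigma>" using I.submodule_add_cancel[OF sub(1) cl(10) jac_smul(2)[OF gb m(1)]] by simp
    with w show False by simp
  qed
  then show "x \<in> L" using m by (auto simp: I.set_add_iff)
qed

end

section \<open>Socles and preimages of simple factors\<close>

lemma (in left_module) submodule_Inter:
  assumes "F \<noteq> {}" "\<And>N. N \<in> F \<Longrightarrow> submodule N R M"
  shows "submodule (\<Inter>F) R M"
proof (rule submoduleI)
  show "\<Inter>F \<subseteq> carrier M" using assms submodule_subset by blast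
  show "\<zero>\<^bsub>M\<^esub> \<in> \<Inter>F" using assms(2) submodule_zero by blast
  show "x \<oplus>\<^bsub>M\<^esub> y \<in> \<Inter>F" if "x \<in> \<Inter>F" "y \<in> \<Inter>F" for x y
    using that submodule_add[OF assms(2)] by blast
  show "a \<odot>\<^bsub>M\<^esub> x \<in> \<Inter>F" if "a \<in> carrier R" "x \<in> \<Inter>F" for a x
    using that submodule_smult[OF assms(2)] by blast
qed

lemma (in left_module) submodule_soc: "submodule (soc_module R M) R M"
proof -
  let ?F = "{N. submodule N R M \<and> (\<forall>S. submodule S R M \<and> simple_module R (restr M S) \<longrightarrow> S \<subseteq> N)}"
  have "carrier M \<in> ?F" using submodule_UNIV submodule_subset by blast
  then show ?thesis
    unfolding soc_module_def by (intro submodule_Inter) auto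
qed

text \<open>A least nonzero submodule is contained in every simple one, hence is the only simple
  one.\<close>

lemma (in left_module) soc_eq_minimal:
  assumes Z: "submodule Z R M" "Z \<noteq> {\<zero>\<^bsub>M\<^esub>}" and min: "\<And>U. submodule U R M \<Longrightarrow> U \<noteq> {\<zero>\<^bsub>M\<^esub>} \<Longrightarrow> Z \<subseteq> U"
  shows "soc_module R M = Z" "adjacent R M {\<zero>\<^bsub>M\<^esub>} Z"
proof -
  show a: "adjacent R M {\<zero>\<^bsub>M\<^esub>} Z"
    unfolding adjacent_def using Z min submodule_zero_set submodule_zero[OF Z(1)] by blast
  have simple: "S = Z" if S: "submodule S R M" "simple_module R (restr M S)" for S
  proof -
    have "S \<noteq> {\<zero>\<^bsub>M\<^esub>}" using S(2) by (auto simp: simple_module_def)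
    moreover have "adjacent R M {\<zero>\<^bsub>M\<^esub>} S" using S simple_restr_iff by blast
    ultimately show ?thesis
      using min[OF S(1)] adjacentD[of R M "{\<zero>\<^bsub>M\<^esub>}" S Z] Z submodule_zero[OF Z(1)] by blast
  qed
  have "simple_module R (restr M Z)" using a simple_restr_iff[OF Z(1)] by blast
  then show "soc_module R M = Z" using simple Z(1) unfolding soc_module_def by blast
qed

text \<open>A submodule above the preimage of \<open>Z\<close> contains the kernel, so it is the
  preimage of its image.\<close>

lemma (in left_module_hom) adjacent_preimage:
  assumes surj: "f ` carrier M = carrier N" and a: "adjacent A N Z V"
  shows "adjacent A M {x \<in> carrier M. f x \<in> Z} {x \<in> carrier M. f x \<in> V}" (is "adjacent A M ?Z ?V")
proof -
  have Z: "submodule Z A N" and V: "submodule V A N" and ZV: "Z \<subset> V" using a by (auto simp: adjacent_def)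
  have strict: "?Z \<subset> ?V"
  proof
    show "?Z \<subseteq> ?V" using ZV by blast
    show "?Z \<noteq> ?V"
    proof
      assume "?Z = ?V"
      then have "f ` ?Z = f ` ?V" by (rule arg_cong)
      then show False using ZV unfolding image_preimage[OF surj Z] image_preimage[OF surj V] by simp
    qed
  qed
  have "U = ?Z \<or> U = ?V" if U: "submodule U A M" "?Z \<subseteq> U" "U \<subseteq> ?V" for U
  proof -
    have preim: "{x \<in> carrier M. f x \<in> f ` U} = U"
    proof
      show "{x \<in> carrier M. f x \<in> f ` U} \<subseteq> U"
      proof
        fix x assume "x \<in> {x \<in> carrier M. f x \<in> f ` U}"
        then obtain u where u: "x \<in> carrier M" "u \<in> U" "f x = f u" by blast
        have uc: "u \<in> carrier M" by (rule M.submodule_carrier[OF U(1) u(2)])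
        have "f (x \<ominus>\<^bsub>M\<^esub> u) = \<zero>\<^bsub>N\<^esub>" using u uc by (simp add: hom_diff N.diff_eq_zero hom_closed)
        then have "x \<ominus>\<^bsub>M\<^esub> u \<in> ?Z" using u uc N.submodule_zero[OF Z] by simp
        then show "x \<in> U" using U(2) M.submodule_diff_cancel[OF U(1) u(1,2)] by blast
      qed
      show "U \<subseteq> {x \<in> carrier M. f x \<in> f ` U}" using M.submodule_carrier[OF U(1)] by blast
    qed
    have "Z \<subseteq> f ` U" using image_preimage[OF surj Z] U(2) by blast
    moreover have "f ` U \<subseteq> V" using U(3) by blast
    ultimately have "f ` U = Z \<or> f ` U = V" by (intro adjacentD[OF a submodule_image[OF U(1)]])
    then show ?thesis using preim by auto
  qed
  then show ?thesis
    unfolding adjacent_def using strict submodule_preimage[OF Z] submodule_preimage[OF V] by blast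
qed

theorem proposition4p4p2:
  fixes k :: "('k, 's) ring_scheme" and A :: "('a, 'r) ring_scheme" and \<phi> :: "'k \<Rightarrow> 'a"
    and I :: "('a, 'i) module" and M\<^sub>1 M\<^sub>2 :: "'i set"
  defines "socI \<equiv> soc_module A I"
  defines "N\<^sub>1 \<equiv> quot_module (restr I M\<^sub>1) socI"
    and "N\<^sub>2 \<equiv> quot_module (restr I M\<^sub>2) socI"
  defines "S \<equiv> restr N\<^sub>2 (soc_module A N\<^sub>2)"
  assumes "quadri_biserial_algebra k A \<phi>"
    and "injective_module A I" and "biserial_module A I"
    and "submodule M\<^sub>1 A I" and "socI \<subseteq> M\<^sub>1"
    and "submodule M\<^sub>2 A I" and "socI \<subseteq> M\<^sub>2"
    and "internal_dsum A (quot_module I socI) (carrier N\<^sub>1) (carrier N\<^sub>2)"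
    and "simple_module A N\<^sub>1"
    and "uniserial_module A N\<^sub>2" and "has_length A N\<^sub>2 2"
    and "projective_cover_uniserial A S"
  shows "(\<exists>f g. almost_split_sequence A (restr I M\<^sub>1) (restr I (soc2_module A I)) S f g) \<and>
    (\<exists>f g. almost_split_sequence A (restr I socI)
       (dsum (restr I M\<^sub>1) (restr I (rad_module A (restr I M\<^sub>2))))
       (restr I (soc2_module A I)) f g)"
proof -
  note quadri = assms(5) and injective = assms(6) and biserial = assms(7)
    and M1 = assms(8,9) and M2 = assms(10,11) and dsum = assms(12) and simple1 = assms(13)
    and uni2 = assms(14) and len2 = assms(15) and cover = assms(16)
  interpret quadri k A \<phi> by (rule quadri.intro[OF quadri])
  have "left_module A I" using injective by (simp add: injective_module_def fg_module_def)
  then interpret I: ep_module A I by (intro ep_module.intro enough_primitives_axioms)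
  interpret M1: left_module A "restr I M\<^sub>1" by (rule I.left_module_restr[OF M1(1)])
  interpret M2: left_module A "restr I M\<^sub>2" by (rule I.left_module_restr[OF M2(1)])
  have soc: "submodule socI A I" unfolding socI_def by (rule I.submodule_soc)
  have soc1: "submodule socI A (restr I M\<^sub>1)" and soc2: "submodule socI A (restr I M\<^sub>2)"
    using soc M1 M2 by (simp_all add: I.submodule_restr)
  have cos: "socI +>\<^bsub>restr I X\<^esub> x = socI +>\<^bsub>I\<^esub> x" for X x by (simp add: a_r_coset_def')
  let ?c = "\<lambda>x. socI +>\<^bsub>I\<^esub> x"
  have N1: "carrier N\<^sub>1 = ?c ` M\<^sub>1" and N2: "carrier N\<^sub>2 = ?c ` M\<^sub>2"
    unfolding N\<^sub>1_def N\<^sub>2_def M1.carrier_quot M2.carrier_quot by (simp_all add: cos)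
  interpret Q: left_module_hom A I "quot_module I socI" ?c by (rule I.quot_left_module_hom[OF soc])
  interpret N2: left_module_hom A "restr I M\<^sub>2" N\<^sub>2 ?c
    using M2.quot_left_module_hom[OF soc2] by (simp add: N\<^sub>2_def cos)
  have c0: "?c x = \<zero>\<^bsub>quot_module I socI\<^esub> \<longleftrightarrow> x \<in> socI" if "x \<in> carrier I" for x
    using I.coset_zero[OF soc that] by (simp add: I.quot_module_simps[OF soc])
  have N2_zero: "\<zero>\<^bsub>N\<^sub>2\<^esub> = socI" by (simp add: N\<^sub>2_def M2.quot_module_simps[OF soc2])
  have c0': "?c x = \<zero>\<^bsub>N\<^sub>2\<^esub> \<longleftrightarrow> x \<in> socI" if "x \<in> M\<^sub>2" for x
    using I.coset_zero[OF soc I.submodule_carrier[OF M2(1) that]] by (simp add: N2_zero)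
  have sum_M: "M\<^sub>1 <+>\<^bsub>I\<^esub> M\<^sub>2 = carrier I"
  proof
    show "M\<^sub>1 <+>\<^bsub>I\<^esub> M\<^sub>2 \<subseteq> carrier I" by (rule I.submodule_subset[OF I.submodule_set_add[OF M1(1) M2(1)]])
    show "carrier I \<subseteq> M\<^sub>1 <+>\<^bsub>I\<^esub> M\<^sub>2"
    proof
      fix x assume x: "x \<in> carrier I"
      have "?c ` M\<^sub>1 <+>\<^bsub>quot_module I socI\<^esub> ?c ` M\<^sub>2 = carrier (quot_module I socI)"
        using dsum unfolding internal_dsum_def N1 N2 by blast
      then have "?c ` (M\<^sub>1 <+>\<^bsub>I\<^esub> M\<^sub>2) = carrier (quot_module I socI)"
        using Q.image_set_add[OF I.submodule_subset[OF M1(1)] I.submodule_subset[OF M2(1)]] by simp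
      then have "?c x \<in> ?c ` (M\<^sub>1 <+>\<^bsub>I\<^esub> M\<^sub>2)" using Q.hom_closed[OF x] by simp
      then obtain y where y: "y \<in> M\<^sub>1 <+>\<^bsub>I\<^esub> M\<^sub>2" "?c x = ?c y" by blast
      note s = I.submodule_set_add[OF M1(1) M2(1)]
      have "x \<ominus>\<^bsub>I\<^esub> y \<in> socI" using y(2) I.coset_eq_iff[OF soc x I.submodule_carrier[OF s y(1)]] by simp
      then have "x \<ominus>\<^bsub>I\<^esub> y \<in> M\<^sub>1 <+>\<^bsub>I\<^esub> M\<^sub>2" using M1(2) I.set_add_upper(1)[OF M1(1) M2(1)] by blast
      then show "x \<in> M\<^sub>1 <+>\<^bsub>I\<^esub> M\<^sub>2" by (rule I.submodule_diff_cancel[OF s x y(1)])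
    qed
  qed
  have Int_M: "M\<^sub>1 \<inter> M\<^sub>2 = socI"
  proof
    show "socI \<subseteq> M\<^sub>1 \<inter> M\<^sub>2" using M1 M2 by blast
    show "M\<^sub>1 \<inter> M\<^sub>2 \<subseteq> socI"
    proof
      fix x assume x: "x \<in> M\<^sub>1 \<inter> M\<^sub>2"
      have "carrier N\<^sub>1 \<inter> carrier N\<^sub>2 = {\<zero>\<^bsub>quot_module I socI\<^esub>}" using dsum
        by (simp add: internal_dsum_def)
      moreover have "?c x \<in> carrier N\<^sub>1 \<inter> carrier N\<^sub>2" using x unfolding N1 N2 by blast
      ultimately show "x \<in> socI" using c0[of x] x I.submodule_carrier[OF M1(1)] by blast
    qed
  qed
  have adj1: "adjacent A I socI M\<^sub>1"
    using simple1 I.simple_quot_restr_iff[OF soc M1] by (simp add: N\<^sub>1_def)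
  obtain C where C: "C 0 = {\<zero>\<^bsub>N\<^sub>2\<^esub>}" "C 2 = carrier N\<^sub>2" "\<And>i. i \<le> 2 \<Longrightarrow> submodule (C i) A N\<^sub>2"
    "\<And>i. i < 2 \<Longrightarrow> C i \<subseteq> C (Suc i) \<and> simple_module A (quot_module (restr N\<^sub>2 (C (Suc i))) (C i))"
    using len2 unfolding has_length_def by blast
  have adjC: "adjacent A N\<^sub>2 (C i) (C (Suc i))" if "i < 2" for i
    using N2.N.simple_quot_restr_iff[OF C(3) C(3), of i "Suc i"] C(4)[OF that] that by simp
  have C1: "adjacent A N\<^sub>2 {\<zero>\<^bsub>N\<^sub>2\<^esub>} (C 1)" and C2: "adjacent A N\<^sub>2 (C 1) (carrier N\<^sub>2)"
    using adjC[of 0] adjC[of 1] C(1,2) by (simp_all add: numeral_2_eq_2)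
  \<comment> \<open>The preimage in \<open>M\<^sub>2\<close> of the middle term of a composition
    series of \<open>N\<^sub>2\<close>; it will turn out to be the radical of
    \<open>M\<^sub>2\<close>.\<close>
  define R where "R = {x \<in> M\<^sub>2. ?c x \<in> C 1}"
  have N2_surj: "?c ` carrier (restr I M\<^sub>2) = carrier N\<^sub>2" by (simp add: N2)
  have "{x \<in> carrier (restr I M\<^sub>2). ?c x \<in> {\<zero>\<^bsub>N\<^sub>2\<^esub>}} = socI" using c0' M2(2) by auto
  then have "adjacent A (restr I M\<^sub>2) socI R"
    using N2.adjacent_preimage[OF N2_surj C1] by (simp add: R_def)
  then have adjR: "adjacent A I socI R"
    using I.adjacent_restr[OF M2(1), of R] by (simp add: R_def)
  have "{x \<in> carrier (restr I M\<^sub>2). ?c x \<in> carrier N\<^sub>2} = M\<^sub>2" unfolding N2 by auto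
  then have "adjacent A (restr I M\<^sub>2) R M\<^sub>2"
    using N2.adjacent_preimage[OF N2_surj C2] by (simp add: R_def)
  then have adj2: "adjacent A I R M\<^sub>2" using I.adjacent_restr[OF M2(1) order.refl] by simp
  have Rs: "submodule R A I" "socI \<subset> R" "R \<subset> M\<^sub>2" using adjR adj2 by (auto simp: adjacent_def)
  have chain: "U = socI \<or> U = R \<or> U = M\<^sub>2" if U: "submodule U A I" "socI \<subseteq> U" "U \<subseteq> M\<^sub>2" for U
  proof -
    have Us: "submodule U A (restr I M\<^sub>2)" using U by (simp add: I.submodule_restr[OF M2(1)])
    have "?c ` U \<subseteq> C 1 \<or> C 1 \<subseteq> ?c ` U"
      using uni2 N2.submodule_image[OF Us] C(3)[of 1] unfolding uniserial_module_def by simp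
    then show ?thesis
    proof
      assume "?c ` U \<subseteq> C 1"
      then have "U \<subseteq> R" using U(3) by (auto simp: R_def)
      then show ?thesis using adjacentD[OF adjR U(1,2)] by blast
    next
      assume C1U: "C 1 \<subseteq> ?c ` U"
      have "R \<subseteq> U"
      proof
        fix x assume "x \<in> R"
        then obtain u where u: "u \<in> U" "?c x = ?c u" "x \<in> M\<^sub>2" using C1U by (auto simp: R_def)
        have xc: "x \<in> carrier I" by (rule I.submodule_carrier[OF M2(1) u(3)])
        have "x \<ominus>\<^bsub>I\<^esub> u \<in> socI" using u(2) I.coset_eq_iff[OF soc xc I.submodule_carrier[OF U(1) u(1)]]
          by simp
        then show "x \<in> U" using U(2) I.submodule_diff_cancel[OF U(1) xc u(1)] by blast
      qed
      then show ?thesis using adjacentD[OF adj2 U(1) _ U(3)] by blast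
    qed
  qed
  \<comment> \<open>The two uniserial submodules that make \<open>I\<close> biserial must sum to
    \<open>I\<close>: a largest proper submodule would contain \<open>M\<^sub>1\<close> and
    \<open>M\<^sub>2\<close>, whose sum is \<open>I\<close>. Then indecomposability excludes a zero
    intersection, so the intersection is the least nonzero submodule.\<close>
  have minimal: "\<exists>Z. submodule Z A I \<and> Z \<noteq> {\<zero>\<^bsub>I\<^esub>} \<and> (\<forall>U. submodule U A I \<and> U \<noteq> {\<zero>\<^bsub>I\<^esub>} \<longrightarrow> Z \<subseteq> U)"
  proof -
    have ind: "indecomposable_module A I" using biserial by (simp add: biserial_module_def)
    obtain X1 X2 where X: "submodule X1 A I" "submodule X2 A I" "\<not> X1 \<subseteq> X2" "\<not> X2 \<subseteq> X1"
      and sum: "X1 <+>\<^bsub>I\<^esub> X2 = carrier I \<or> (X1 <+>\<^bsub>I\<^esub> X2 \<noteq> carrier I \<and>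
        (\<forall>N. submodule N A I \<and> N \<noteq> carrier I \<longrightarrow> N \<subseteq> X1 <+>\<^bsub>I\<^esub> X2))"
      and int: "X1 \<inter> X2 = {\<zero>\<^bsub>I\<^esub>} \<or> (X1 \<inter> X2 \<noteq> {\<zero>\<^bsub>I\<^esub>} \<and>
        (\<forall>N. submodule N A I \<and> N \<noteq> {\<zero>\<^bsub>I\<^esub>} \<longrightarrow> X1 \<inter> X2 \<subseteq> N))"
      using biserial unfolding biserial_module_def by (elim conjE exE) (rule that)
    have "M\<^sub>1 \<noteq> carrier I"
    proof
      assume "M\<^sub>1 = carrier I"
      then have "M\<^sub>2 = socI" using Int_M I.submodule_subset[OF M2(1)] by blast
      then show False using Rs by blast
    qed
    moreover have "M\<^sub>2 \<noteq> carrier I"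
    proof
      assume "M\<^sub>2 = carrier I"
      then have "M\<^sub>1 = socI" using Int_M I.submodule_subset[OF M1(1)] by blast
      then show False using adjacent_psubset[OF adj1] by blast
    qed
    ultimately have full: "X1 <+>\<^bsub>I\<^esub> X2 = carrier I"
      using sum sum_M M1(1) M2(1) I.set_add_least[OF I.submodule_set_add[OF X(1,2)], of "M\<^sub>1" "M\<^sub>2"]
        I.submodule_subset[OF I.submodule_set_add[OF X(1,2)]] by auto
    have "X1 \<inter> X2 \<noteq> {\<zero>\<^bsub>I\<^esub>}"
    proof
      assume "X1 \<inter> X2 = {\<zero>\<^bsub>I\<^esub>}"
      then have "X1 = {\<zero>\<^bsub>I\<^esub>} \<or> X2 = {\<zero>\<^bsub>I\<^esub>}"
        using ind X full unfolding indecomposable_module_def internal_dsum_def by blast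
      then show False using X I.submodule_zero[OF X(1)] I.submodule_zero[OF X(2)] by blast
    qed
    then show ?thesis using int I.submodule_Int[OF X(1,2)] by blast
  qed
  have socle: "adjacent A I {\<zero>\<^bsub>I\<^esub>} socI" "\<And>U. submodule U A I \<Longrightarrow> U \<noteq> {\<zero>\<^bsub>I\<^esub>} \<Longrightarrow> socI \<subseteq> U"
    using minimal I.soc_eq_minimal unfolding socI_def by metis+
  have C1s: "submodule (C 1) A N\<^sub>2" using C(3)[of 1] by simp
  \<comment> \<open>Comparability with every submodule makes the simple module \<open>C 1\<close>
    the least nonzero one, so it is the socle of \<open>N\<^sub>2\<close>.\<close>
  have "C 1 \<subseteq> U" if U: "submodule U A N\<^sub>2" "U \<noteq> {\<zero>\<^bsub>N\<^sub>2\<^esub>}" for U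
  proof -
    have "C 1 \<subseteq> U \<or> U \<subseteq> C 1" using uni2 U(1) C1s unfolding uniserial_module_def by blast
    then show ?thesis using adjacentD[OF C1 U(1)] N2.N.submodule_zero[OF U(1)] U(2) by auto
  qed
  from N2.N.soc_eq_minimal(1)[OF C1s _ this] have socN2: "soc_module A N\<^sub>2 = C 1"
    using adjacent_psubset[OF C1] by blast
  have S: "S = restr N\<^sub>2 (C 1)" by (simp add: S_def socN2)
  have S_simple: "simple_module A S"
    unfolding S using N2.N.simple_restr_iff[OF C1s] C1 by simp
  have Sm: "left_module A S" using S_simple by (simp add: simple_module_def)
  have \<pi>R: "?c ` R = carrier S"
    unfolding S using N2.image_preimage[OF N2_surj C1s] by (simp add: R_def)
  have \<pi>: "?c \<in> module_hom A (restr I R) S"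
    unfolding S using module_hom_restr[OF N2.hom, of R "C 1"] by (auto simp: R_def)
  interpret \<pi>: left_module_hom A "restr I R" S ?c
    by (intro left_module_homI \<pi> Sm I.left_module_restr Rs)
  have \<pi>0: "?c r = \<zero>\<^bsub>S\<^esub> \<longleftrightarrow> r \<in> socI" if "r \<in> R" for r
    using c0'[of r] that Rs(3) unfolding S by auto
  have fgS: "fg_module A S"
  proof -
    obtain x where x: "x \<in> carrier S" "x \<noteq> \<zero>\<^bsub>S\<^esub>"
      using S_simple \<pi>.N.submodule_zero[OF \<pi>.N.submodule_UNIV] unfolding simple_module_def by blast
    have "\<pi>.N.cyc x = carrier S"
      using S_simple \<pi>.N.submodule_cyc[OF x(1)] \<pi>.N.cyc_self[OF x(1)] x(2) unfolding simple_module_def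
        by blast
    then show ?thesis by (intro \<pi>.N.fg_module_cyclic[OF x(1)]) (auto simp: \<pi>.N.cyc_def)
  qed
  have uniserial_S: "uniserial_module A (pmod A e)"
    if e: "primitive A e" and r: "r \<in> R" "r \<notin> socI" "e \<odot>\<^bsub>I\<^esub> r = r" for e r
  proof (rule A.uniserial_pmod_of_cover[OF S_simple fgS cover e])
    show "?c r \<in> carrier S" using \<pi>R r(1) by blast
    show "e \<odot>\<^bsub>S\<^esub> ?c r = ?c r" using \<pi>.hom_smult[OF A.primitive_closed[OF e], of r] r by simp
    show "?c r \<noteq> \<zero>\<^bsub>S\<^esub>" using \<pi>0 r by blast
  qed
  interpret biserial_injective k A \<phi> I socI "M\<^sub>1" "M\<^sub>2" R
    by unfold_locales (fact injective socle adj1 adjR adj2 chain Int_M sum_M uniserial_S)+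
  obtain e0 e1 e2 e3 p q g s t w v
    where "biserial_injective_elements k A \<phi> I socI M\<^sub>1 M\<^sub>2 R e0 e1 e2 e3 p q g s t w v"
    using ex_elements by blast
  then interpret biserial_injective_elements k A \<phi> I socI "M\<^sub>1" "M\<^sub>2" R e0 e1 e2 e3 p q g s t w v .
  have rad: "rad_module A (restr I M\<^sub>2) = R"
  proof (rule M2.rad_module_largest)
    show "submodule R A (restr I M\<^sub>2)" "R \<noteq> carrier (restr I M\<^sub>2)" using Rs
      by (auto simp: I.submodule_restr[OF M2(1)])
    fix U assume "submodule U A (restr I M\<^sub>2)" "U \<noteq> carrier (restr I M\<^sub>2)"
    then have U: "submodule U A I" "U \<subseteq> M\<^sub>2" "U \<noteq> M\<^sub>2" by (auto simp: I.submodule_restr[OF M2(1)])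
    show "U \<subseteq> R"
    proof (cases "U = {\<zero>\<^bsub>I\<^esub>}")
      case True
      then show ?thesis using I.submodule_zero[OF Rs(1)] by simp
    next
      case False
      then show ?thesis using chain[OF U(1) socle(2)[OF U(1)] U(2)] U(3) Rs(2) by blast
    qed
  qed
  have Q_surj: "?c ` carrier I = carrier (quot_module I socI)" by (simp add: I.carrier_quot)
  have preim: "{x \<in> carrier I. ?c x \<in> ?c ` U} = U" if U: "submodule U A I" "socI \<subseteq> U" for U
  proof
    show "U \<subseteq> {x \<in> carrier I. ?c x \<in> ?c ` U}" using I.submodule_carrier[OF U(1)] by blast
    show "{x \<in> carrier I. ?c x \<in> ?c ` U} \<subseteq> U"
    proof
      fix x assume "x \<in> {x \<in> carrier I. ?c x \<in> ?c ` U}"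
      then obtain u where u: "x \<in> carrier I" "u \<in> U" "?c x = ?c u" by blast
      have "x \<ominus>\<^bsub>I\<^esub> u \<in> socI" using u(3) I.coset_eq_iff[OF soc u(1) I.submodule_carrier[OF U(1) u(2)]]
        by simp
      then show "x \<in> U" using U(2) I.submodule_diff_cancel[OF U(1) u(1,2)] by blast
    qed
  qed
  \<comment> \<open>Simple submodules of the quotient correspond to submodules adjacent to the
    socle. All of these lie in \<open>L\<close>, and \<open>M\<^sub>1\<close> and \<open>R\<close>,
    which span \<open>L\<close>, are among them.\<close>
  have socQ: "soc_module A (quot_module I socI) = ?c ` L"
  proof
    have "\<forall>X. submodule X A (quot_module I socI) \<and> simple_module A (restr (quot_module I socI) X) \<longrightarrow>
      X \<subseteq> ?c ` L"
    proof (intro allI impI)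
      fix X assume X: "submodule X A (quot_module I socI) \<and>
        simple_module A (restr (quot_module I socI) X)"
      then have "adjacent A (quot_module I socI) {\<zero>\<^bsub>quot_module I socI\<^esub>} X" using Q.N.simple_restr_iff
        by blast
      from Q.adjacent_preimage[OF Q_surj this]
      have "adjacent A I {x \<in> carrier I. ?c x \<in> {\<zero>\<^bsub>quot_module I socI\<^esub>}} {x \<in> carrier I. ?c x \<in> X}" .
      moreover have "{x \<in> carrier I. ?c x \<in> {\<zero>\<^bsub>quot_module I socI\<^esub>}} = socI"
        using c0 I.submodule_carrier[OF soc] by blast
      ultimately have "{x \<in> carrier I. ?c x \<in> X} \<subseteq> L" using adjacent_\<sigma>_in_L by simp
      then have "?c ` {x \<in> carrier I. ?c x \<in> X} \<subseteq> ?c ` L" by (rule image_mono)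
      then show "X \<subseteq> ?c ` L" using Q.image_preimage[OF Q_surj] X by simp
    qed
    then show "soc_module A (quot_module I socI) \<subseteq> ?c ` L"
      unfolding soc_module_def using Q.submodule_image[OF sub_L] by blast
    have sQ: "submodule (soc_module A (quot_module I socI)) A (quot_module I socI)"
      by (rule Q.N.submodule_soc)
    have part: "?c ` U \<subseteq> soc_module A (quot_module I socI)" if U: "adjacent A I socI U" for U
    proof -
      have Us: "submodule U A I" "socI \<subseteq> U" using U by (auto simp: adjacent_def)
      interpret U: left_module_hom A "restr I U" "restr (quot_module I socI) (?c ` U)" ?c
        using I.submodule_subset[OF Us(1)]
        by (intro left_module_homI I.left_module_restr Us Q.N.left_module_restr Q.submodule_image
          module_hom_restr[OF Q.hom]) auto
      have "{x \<in> carrier (restr I U). ?c x = \<zero>\<^bsub>restr (quot_module I socI) (?c ` U)\<^esub>} = socI"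
        using c0 I.submodule_carrier[OF Us(1)] Us(2) by auto
      then have "simple_module A (restr (quot_module I socI) (?c ` U))"
        using U.simple_iff_adjacent I.adjacent_restr[OF Us(1) order.refl] U by simp
      then show ?thesis unfolding soc_module_def using Q.submodule_image[OF Us(1)] by blast
    qed
    have "?c ` L = ?c ` M\<^sub>1 <+>\<^bsub>quot_module I socI\<^esub> ?c ` R"
      by (intro Q.image_set_add I.submodule_subset M1 Rs)
    also have "\<dots> \<subseteq> soc_module A (quot_module I socI)"
      by (intro Q.N.set_add_least sQ part adj1 adjR)
    finally show "?c ` L \<subseteq> soc_module A (quot_module I socI)" .
  qed
  have soc2: "soc2_module A I = L"
  proof -
    have "soc2_module A I = \<Union>(?c ` L)" unfolding soc2_module_def using socQ by (simp add: socI_def)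
    also have "\<dots> = L"
    proof
      show "\<Union>(?c ` L) \<subseteq> L"
      proof
        fix y assume "y \<in> \<Union>(?c ` L)"
        then obtain x where x: "x \<in> L" "y \<in> ?c x" by blast
        then have y: "y \<in> carrier I" "y \<ominus>\<^bsub>I\<^esub> x \<in> socI" using I.coset_iff[OF soc L_carr[OF x(1)]] by auto
        then have "y \<ominus>\<^bsub>I\<^esub> x \<in> L" using M1(2) le_L(1) by blast
        then show "y \<in> L" by (rule I.submodule_diff_cancel[OF sub_L y(1) x(1)])
      qed
      show "L \<subseteq> \<Union>(?c ` L)"
      proof
        fix x assume x: "x \<in> L"
        note xc = L_carr[OF x]
        have "x \<in> ?c x" using I.coset_iff[OF soc xc, of x] xc I.submodule_zero[OF soc] I.diff_eq_zero[OF
          xc xc] by simp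
        then show "x \<in> \<Union>(?c ` L)" using x by blast
      qed
    qed
    finally show ?thesis .
  qed
  have "\<exists>g. almost_split_sequence A (restr I M\<^sub>1) (restr I L) S (\<lambda>x. x) g"
    by (rule almost_split_M1[OF S_simple \<pi> \<pi>R \<pi>0])
  then show ?thesis unfolding soc2 rad using almost_split_dsum by blast
qed

end
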